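(* Let $n\ge 1$, $\Lambda=(\lambda_1,\dots,\lambda_n)\in\mathbb{C}^n$, $R\in(0,1/2]$, and let $$H(x,y,\eta,t)=h(x,y,\eta)+f(x,y,t),\qquad h(x,y,\eta)=\eta+\sum_{l=1}^n\lambda_l x_l y_l ,$$ where $f(\cdot,\cdot,t)\in\mathfrak{C}(\mathcal{Q}_R)$ for every $t\in\mathbb{R}^+=[0,+\infty)$. Assume that $f$ is at least quadratic in $x$ and at least linear in $y$ (property ($QxLy$)), and that there exist $M_f\in[1,+\infty)$ and $a\in[0,1)$ such that $\|f(\cdot,\cdot,t)\|_R\le M_f e^{-at}$ for all $t\in\mathbb{R}^+$. Suppose that one of the following two conditions is satisfied: I. (Time decay) $a>0$. II. (Linearity in $y$ and non-resonance) $a=0$, the perturbation is linear in $y$, i.e. of the form $f(x,y,t)=y\cdot g(x,t)$, and $\Lambda$ satisfies the non-resonance condition $$\max_{l=1,\dots,n}\big|\Re\big((\alpha-e_l)\cdot\Lambda\big)\big|^{-1}\le\gamma|\alpha|^{\tau}\qquad\text{for all }\alpha\in\mathbb{N}^n\text{ with }|\alpha|\ge 2,$$ for some $\gamma>0$ and $\tau\ge n$, where $e_l$ is the $l$-th vector of the canonical basis of $\mathbb{R}^n$. Then it is possible to determine $R_*,R_0$ with $0<R_*<R_0\le R^{16}$ and a family (parametrised by $t\in\mathbb{R}^+$) of canonical transformations $(x,y,\eta)=\mathcal{M}(x^{(\infty)},y^{(\infty)},\eta^{(\infty)})$, $\mathcal{M}:\mathcal{D}_{R_*}\to\mathcal{D}_{R_0}$,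 analytic on $\mathcal{D}_{R_*}$ for all $t\in\mathbb{R}^+$, casting $H$ into the strong normal form $$H^{(\infty)}(x^{(\infty)},y^{(\infty)},\eta^{(\infty)})=h(x^{(\infty)},y^{(\infty)},\eta^{(\infty)}).$$
   Context: $\mathbb{N}=\{0,1,2,\dots\}$; for $\alpha\in\mathbb{N}^n$, $|\alpha|=\sum_l\alpha_l$, and $x^\alpha y^\beta=x_1^{\alpha_1}\cdots x_n^{\alpha_n}y_1^{\beta_1}\cdots y_n^{\beta_n}$. For $\rho>0$: $\mathcal{Q}_\rho=\{(x,y)\in\mathbb{C}^{2n}:|x|,|y|\le\rho\}$ with $|x|=\max_l|x_l|$, $\mathcal{S}_\rho=\{\eta\in\mathbb{C}:|\Im\eta|\le\rho\}$, $\mathcal{D}_\rho=\mathcal{Q}_\rho\times\mathcal{S}_\rho$. $\mathfrak{C}(\mathcal{Q}_\rho)$ is the space of real-analytic functions on the interior of $\mathcal{Q}_\rho$ that are continuous on the boundary. For $G(x,y,t)=\sum_{\alpha,\beta\in\mathbb{N}^n}g_{\alpha,\beta}(t)x^\alpha y^\beta$ the Taylor norm is $\|G(\cdot,\cdot,t)\|_\rho=\sum_{\alpha,\beta}|g_{\alpha,\beta}(t)|\rho^{|\alpha+\beta|}$ (a function of $t$). Property ($QxLy$) for $f=\sum f_{\alpha,\beta}(t)x^\alpha y^\beta$: $f_{\alpha,\beta}(t)=0$ for all $t\in\mathbb{R}^+$ unless $|\alpha|\ge2$ and $|\beta|\ge1$. $H$ is the autonomous equivalent of the time-dependent Hamiltonian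 $\sum_l\lambda_lx_ly_l+f(x,y,t)$, $\eta$ being the variable conjugate to $t$. $H^{(\infty)}$ denotes $H$ expressed in the new variables $(x^{(\infty)},y^{(\infty)},\eta^{(\infty)})$; the transformation leaves $t$ unchanged.
   Formalization: The formal theorem also assumes that f has a continuous partial derivative in t inside Q_R; without differentiability in t the claim fails, e.g. f = x²y g(t) with g discontinuous admits no such canonical family in the extended phase space. *)

theory Defs
  imports "HOL-Analysis.Analysis"
begin

text \<open>Multi-indices in \<open>\<nat>\<^sup>n\<close> are functions \<open>'n \<Rightarrow> nat\<close> on a finite index type with \<open>n = CARD('n)\<close>.\<close>

definition mdeg :: "('n::finite \<Rightarrow> nat) \<Rightarrow> nat" where
  "mdeg \<alpha> = (\<Sum>l\<in>UNIV. \<alpha> l)"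

definition mpow :: "(complex ^ 'n) \<Rightarrow> ('n::finite \<Rightarrow> nat) \<Rightarrow> complex" where
  "mpow x \<alpha> = (\<Prod>l\<in>UNIV. (x $ l) ^ \<alpha> l)"

definition max_norm :: "(complex ^ 'n::finite) \<Rightarrow> real" where
  "max_norm x = (MAX l\<in>UNIV. norm (x $ l))"

definition Qdom :: "real \<Rightarrow> ((complex ^ 'n::finite) \<times> (complex ^ 'n)) set" where
  "Qdom \<rho> = {(x, y). max_norm x \<le> \<rho> \<and> max_norm y \<le> \<rho>}"

definition Sdom :: "real \<Rightarrow> complex set" where
  "Sdom \<rho> = {\<eta>. \<bar>Im \<eta>\<bar> \<le> \<rho>}"

definition Ddom :: "real \<Rightarrow> ((complex ^ 'n::finite) \<times> (complex ^ 'n) \<times> complex) set" where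
  "Ddom \<rho> = {(x, y, \<eta>). (x, y) \<in> Qdom \<rho> \<and> \<eta> \<in> Sdom \<rho>}"

text \<open>Analyticity at a point: local expansion in a convergent power series in the complex
  coordinates. No reality condition is imposed, since \<open>\<Lambda>\<close> (hence the Hamiltonian) is complex.
  The \<open>has_sum\<close> is over all multi-indices, so convergence is unconditional (absolute).\<close>

definition analytic_at_Q ::
  "((complex ^ 'n::finite) \<Rightarrow> (complex ^ 'n) \<Rightarrow> complex) \<Rightarrow> (complex ^ 'n) \<Rightarrow> (complex ^ 'n) \<Rightarrow> bool" where
  "analytic_at_Q G x0 y0 \<longleftrightarrow>
     (\<exists>r>0. \<exists>c. \<forall>x y. max_norm (x - x0) < r \<and> max_norm (y - y0) < r \<longrightarrow>
        ((\<lambda>(\<alpha>, \<beta>). c \<alpha> \<beta> * mpow (x - x0) \<alpha> * mpow (y - y0) \<beta>) has_sum G x y) UNIV)"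

definition analytic_at_D ::
  "((complex ^ 'n::finite) \<times> (complex ^ 'n) \<times> complex \<Rightarrow> complex) \<Rightarrow>
     (complex ^ 'n) \<times> (complex ^ 'n) \<times> complex \<Rightarrow> bool" where
  "analytic_at_D F = (\<lambda>(x0, y0, \<eta>0).
     \<exists>r>0. \<exists>c. \<forall>x y \<eta>. max_norm (x - x0) < r \<and> max_norm (y - y0) < r \<and> norm (\<eta> - \<eta>0) < r \<longrightarrow>
        ((\<lambda>(\<alpha>, \<beta>, k). c \<alpha> \<beta> k * mpow (x - x0) \<alpha> * mpow (y - y0) \<beta> * (\<eta> - \<eta>0) ^ k)
           has_sum F (x, y, \<eta>)) UNIV)"

text \<open>As for the library's \<open>analytic_on\<close>, analyticity on a (closed) set means analyticity at each of
  its points, i.e. on a neighbourhood of the set.\<close>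

definition analytic_map_on_D ::
  "((complex ^ 'n::finite) \<times> (complex ^ 'n) \<times> complex) set \<Rightarrow>
   ((complex ^ 'n) \<times> (complex ^ 'n) \<times> complex \<Rightarrow> (complex ^ 'n) \<times> (complex ^ 'n) \<times> complex) \<Rightarrow> bool" where
  "analytic_map_on_D A F \<longleftrightarrow>
     (\<forall>p\<in>A. (\<forall>l. analytic_at_D (\<lambda>q. fst (F q) $ l) p) \<and>
            (\<forall>l. analytic_at_D (\<lambda>q. fst (snd (F q)) $ l) p) \<and>
            analytic_at_D (\<lambda>q. snd (snd (F q))) p)"

definition C_space :: "real \<Rightarrow> ((complex ^ 'n::finite) \<Rightarrow> (complex ^ 'n) \<Rightarrow> complex) set" where
  "C_space \<rho> = {G. (\<forall>(x, y)\<in>interior (Qdom \<rho>). analytic_at_Q G x y) \<and>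
                   continuous_on (Qdom \<rho>) (\<lambda>(x, y). G x y)}"

text \<open>\<open>G(x,y) = \<Sum> g\<^sub>\<alpha>\<^sub>\<beta> x\<^sup>\<alpha> y\<^sup>\<beta>\<close> inside the polydisc; this determines \<open>g\<close> uniquely when \<open>\<rho> > 0\<close>.\<close>

definition has_taylor_coeffs ::
  "real \<Rightarrow> ((complex ^ 'n::finite) \<Rightarrow> (complex ^ 'n) \<Rightarrow> complex) \<Rightarrow>
     (('n \<Rightarrow> nat) \<Rightarrow> ('n \<Rightarrow> nat) \<Rightarrow> complex) \<Rightarrow> bool" where
  "has_taylor_coeffs \<rho> G g \<longleftrightarrow>
     (\<forall>(x, y)\<in>interior (Qdom \<rho>).
        ((\<lambda>(\<alpha>, \<beta>). g \<alpha> \<beta> * mpow x \<alpha> * mpow y \<beta>) has_sum G x y) UNIV)"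

text \<open>Valued in \<open>[0,\<infinity>]\<close>, so that a finite bound includes convergence of the series.\<close>

definition taylor_norm :: "real \<Rightarrow> (('n::finite \<Rightarrow> nat) \<Rightarrow> ('n \<Rightarrow> nat) \<Rightarrow> complex) \<Rightarrow> ennreal" where
  "taylor_norm \<rho> g = (\<Sum>\<^sub>\<infinity>(\<alpha>, \<beta>)\<in>UNIV. ennreal (norm (g \<alpha> \<beta>) * \<rho> ^ (mdeg \<alpha> + mdeg \<beta>)))"

definition QxLy :: "(('n::finite \<Rightarrow> nat) \<Rightarrow> ('n \<Rightarrow> nat) \<Rightarrow> real \<Rightarrow> complex) \<Rightarrow> bool" where
  "QxLy g \<longleftrightarrow> (\<forall>\<alpha> \<beta>. \<not> (mdeg \<alpha> \<ge> 2 \<and> mdeg \<beta> \<ge> 1) \<longrightarrow> (\<forall>t\<ge>0. g \<alpha> \<beta> t = 0))"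

text \<open>Standing regularity in time: \<open>t\<close> is a coordinate of the extended phase space on which
  \<open>H = h + f\<close> is an (autonomous) Hamiltonian, with \<open>\<eta>' = - \<partial>f/\<partial>t\<close>; so \<open>\<partial>f/\<partial>t\<close> has to exist
  (one-sided at \<open>t = 0\<close>) and be continuous. No bound on it is imposed.\<close>

definition C1_in_time :: "real \<Rightarrow> ((complex ^ 'n::finite) \<Rightarrow> (complex ^ 'n) \<Rightarrow> real \<Rightarrow> complex) \<Rightarrow> bool" where
  "C1_in_time \<rho> f \<longleftrightarrow>
     (\<exists>ft. (\<forall>(x, y)\<in>interior (Qdom \<rho>). \<forall>t\<ge>0.
              ((\<lambda>s. f x y s) has_vector_derivative ft x y t) (at t within {0..})) \<and>
           continuous_on (interior (Qdom \<rho>) \<times> {0..}) (\<lambda>((x, y), t). ft x y t))"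

definition linear_in_y :: "real \<Rightarrow> ((complex ^ 'n::finite) \<Rightarrow> (complex ^ 'n) \<Rightarrow> real \<Rightarrow> complex) \<Rightarrow> bool" where
  "linear_in_y \<rho> f \<longleftrightarrow>
     (\<exists>g :: (complex ^ 'n) \<Rightarrow> real \<Rightarrow> (complex ^ 'n).
        \<forall>(x, y)\<in>Qdom \<rho>. \<forall>t\<ge>0. f x y t = (\<Sum>l\<in>UNIV. y $ l * g x t $ l))"

text \<open>The requirement \<open>\<noteq> 0\<close> is explicit because \<open>inverse 0 = 0\<close>.\<close>

definition nonresonant :: "(complex ^ 'n::finite) \<Rightarrow> real \<Rightarrow> real \<Rightarrow> bool" where
  "nonresonant \<Lambda> \<gamma> \<tau> \<longleftrightarrow>
     (\<forall>\<alpha> :: 'n \<Rightarrow> nat. mdeg \<alpha> \<ge> 2 \<longrightarrow>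
        (\<forall>l. let d = Re (\<Sum>k\<in>UNIV. (of_nat (\<alpha> k) - axis l 1 $ k) * \<Lambda> $ k)
             in d \<noteq> 0 \<and> inverse \<bar>d\<bar> \<le> \<gamma> * real (mdeg \<alpha>) powr \<tau>))"

definition ham_h :: "(complex ^ 'n::finite) \<Rightarrow> (complex ^ 'n) \<times> (complex ^ 'n) \<times> complex \<Rightarrow> complex" where
  "ham_h \<Lambda> = (\<lambda>(x, y, \<eta>). \<eta> + (\<Sum>l\<in>UNIV. \<Lambda> $ l * x $ l * y $ l))"

definition ham_H :: "(complex ^ 'n::finite) \<Rightarrow> ((complex ^ 'n) \<Rightarrow> (complex ^ 'n) \<Rightarrow> real \<Rightarrow> complex) \<Rightarrow>
    (complex ^ 'n) \<times> (complex ^ 'n) \<times> complex \<Rightarrow> real \<Rightarrow> complex" where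
  "ham_H \<Lambda> f = (\<lambda>(x, y, \<eta>) t. ham_h \<Lambda> (x, y, \<eta>) + f x y t)"

text \<open>The symplectic form \<open>\<Sum>\<^sub>l dx\<^sub>l \<and> dy\<^sub>l + dt \<and> d\<eta>\<close> of the extended phase space, whose points are
  written \<open>(x, y, \<eta>, t)\<close>; the conjugate pairs are \<open>(x\<^sub>l, y\<^sub>l)\<close> and \<open>(t, \<eta>)\<close>.\<close>

definition symp_form ::
  "(complex ^ 'n::finite) \<times> (complex ^ 'n) \<times> complex \<times> real \<Rightarrow>
   (complex ^ 'n) \<times> (complex ^ 'n) \<times> complex \<times> real \<Rightarrow> complex" where
  "symp_form = (\<lambda>(x, y, \<eta>, t) (x', y', \<eta>', t').
     (\<Sum>l\<in>UNIV. x $ l * y' $ l - y $ l * x' $ l) + (of_real t * \<eta>' - \<eta> * of_real t'))"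

definition extended_map ::
  "(real \<Rightarrow> (complex ^ 'n::finite) \<times> (complex ^ 'n) \<times> complex \<Rightarrow> (complex ^ 'n) \<times> (complex ^ 'n) \<times> complex) \<Rightarrow>
   (complex ^ 'n) \<times> (complex ^ 'n) \<times> complex \<times> real \<Rightarrow> (complex ^ 'n) \<times> (complex ^ 'n) \<times> complex \<times> real" where
  "extended_map M = (\<lambda>(x, y, \<eta>, t). case M t (x, y, \<eta>) of (x', y', \<eta>') \<Rightarrow> (x', y', \<eta>', t))"

text \<open>A family of transformations, one for each \<open>t \<ge> 0\<close> and leaving \<open>t\<close> unchanged, is canonical if
  each is injective (a change of variables) and the map they form on the extended phase space
  preserves the symplectic form. The derivative is a real one, as \<open>t\<close> is real; it includes the
  derivative in \<open>t\<close>, which is what ties the transformation of \<open>\<eta>\<close> to that of \<open>(x, y)\<close>.\<close>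

definition canonical_family_on ::
  "((complex ^ 'n::finite) \<times> (complex ^ 'n) \<times> complex) set \<Rightarrow>
   (real \<Rightarrow> (complex ^ 'n) \<times> (complex ^ 'n) \<times> complex \<Rightarrow> (complex ^ 'n) \<times> (complex ^ 'n) \<times> complex) \<Rightarrow> bool" where
  "canonical_family_on A M \<longleftrightarrow>
     (\<forall>t\<ge>0. inj_on (M t) A) \<and>
     (let E = {(x, y, \<eta>, t). (x, y, \<eta>) \<in> A \<and> t \<ge> 0} in
      \<forall>p\<in>E. \<exists>L. (extended_map M has_derivative L) (at p within E) \<and>
                (\<forall>u v. symp_form (L u) (L v) = symp_form u v))"

end

theory Submission
  imports Defs "HOL-Library.Function_Algebras"
begin

text \<open>Write \<open>z = (x, y)\<close>, \<open>\<nu> = (\<Lambda>, -\<Lambda>)\<close>, and let \<open>F\<close> be the Hamiltonian vector field of \<open>f\<close>. The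
  transformation is found at once, without an iteration over shrinking domains: a map \<open>Z \<mapsto> Z + u(Z, t)\<close>
  with \<open>u\<close> of order at least two carries the linear flow to the full one iff its coefficients satisfy
  \<open>u\<^sub>i\<^sub>p' = -\<mu> u\<^sub>i\<^sub>p + [F\<^sub>i(Z + u)]\<^sub>p\<close> with \<open>\<mu> = \<nu>\<cdot>p - \<nu>\<^sub>i\<close>, a triangular system. Integrating from
  \<open>0\<close> if \<open>Re \<mu> > 0\<close> and from \<open>\<infinity>\<close> otherwise multiplies bounds by \<open>D = 1/a\<close> or by \<open>D = 1/\<bar>Re \<mu>\<bar>\<close>. In the
  second case linearity in \<open>y\<close> is inherited by all the modes that occur, \<open>Re \<mu>\<close> of such a mode is one of the
  numbers bounded by the non-resonance condition, and so is the difference of two of them; Siegel's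
  argument then bounds the products of small divisors geometrically, and a majorant series converges.

  The Lagrange brackets of the solution minus their constant values satisfy homogeneous linear equations
  \<open>W' = -\<mu> W\<close>, and the choice of the integration limits leaves only \<open>W = 0\<close>. Hence the map is symplectic
  for each \<open>t\<close>. Finally \<open>\<eta>\<close> is shifted by the amount that makes \<open>H \<circ> M = h\<close>, and the brackets with \<open>t\<close> and
  \<open>\<eta>\<close> are correct because the flow equation is Hamiltonian.\<close>

section \<open>Formal power series in finitely many variables\<close>

text \<open>Composition multiplies divisors along every nested product of coefficients, so bounding
  a single divisor does not bound the solution. The estimate is therefore split in two: weights
  \<open>\<delta>\<close> collect the worst product of divisors belonging to a mode and do not
  involve \<open>F\<close>, while \<open>\<sigma>\<close> solves a majorant equation without
  divisors. The coefficients obey \<open>norm (u i p t) \<le> \<delta> i p * \<sigma> p\<close>, and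
  for the modes that occur both factors grow at most geometrically with the degree. Under decay the
  loss per mode is 1/a whatever \<open>Re \<mu>\<close> is: the forcing inherits
  \<open>exp (- a * t)\<close> from \<open>F\<close> even where \<open>u\<close> is merely bounded,
  so no decay rate is used up from one degree to the next. In the other case the divisor of
  \<open>(i, p)\<close> minus that of \<open>(j, q)\<close>, with \<open>q \<le> p\<close>, is the
  divisor of \<open>(i, p - q + unit_index j)\<close>, whose degree depends only on the gap between
  the two degrees; two nested divisors are thus both small only across a large gap. The number
  \<open>R ^ 16\<close> is simply taken as the outer radius \<open>R0\<close>; the inner radius
  comes from the convergence of the series and the size of the energy shift.\<close>

lemma finite_le_index: "finite {q :: 'k::finite \<Rightarrow> nat. q \<le> p}"
proof -
  have "{q. q \<le> p} \<subseteq> (\<Pi>\<^sub>E k\<in>UNIV. {..p k})"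
    by (auto simp: le_fun_def PiE_UNIV_domain)
  then show ?thesis by (rule finite_subset) (auto intro: finite_PiE)
qed

lemma mdeg_zero [simp]: "mdeg 0 = 0"
  by (simp add: mdeg_def)

lemma mdeg_add [simp]: "mdeg (p + q) = mdeg p + mdeg q"
  by (simp add: mdeg_def sum.distrib)

lemma mdeg_mono: "p \<le> q \<Longrightarrow> mdeg p \<le> mdeg q"
  by (simp add: mdeg_def le_fun_def sum_mono)

lemma mdeg_diff: "q \<le> p \<Longrightarrow> mdeg (p - q) = mdeg p - mdeg q"
  by (simp add: mdeg_def le_fun_def sum_subtractf_nat)

lemma mdeg_eq_0_iff [simp]: "mdeg p = 0 \<longleftrightarrow> p = 0"
  by (auto simp: mdeg_def fun_eq_iff)

lemma index_le_mdeg: "p k \<le> mdeg p"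
  unfolding mdeg_def by (rule member_le_sum) auto

lemma finite_mdeg_le: "finite {m :: 'k::finite \<Rightarrow> nat. mdeg m \<le> N}"
proof -
  have "{m :: 'k \<Rightarrow> nat. mdeg m \<le> N} \<subseteq> {q. q \<le> (\<lambda>_. N)}"
    using index_le_mdeg by (auto simp: le_fun_def intro: order_trans)
  then show ?thesis using finite_le_index finite_subset by blast
qed

lemma index_le_add [simp]: "(q :: 'k \<Rightarrow> nat) \<le> q + r" "r \<le> q + r"
  by (auto simp: le_fun_def)

lemma index_add_diff [simp]: "(q :: 'k \<Rightarrow> nat) + r - r = q"
  by (auto simp: fun_eq_iff)

lemma index_diff_add: "(q :: 'k \<Rightarrow> nat) \<le> p \<Longrightarrow> q + (p - q) = p" "q \<le> p \<Longrightarrow> p - q + q = p"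
  by (auto simp: fun_eq_iff le_fun_def)

lemma index_diff_le [simp]: "(p :: 'k \<Rightarrow> nat) - q \<le> p"
  by (auto simp: le_fun_def)

definition unit_index :: "'k \<Rightarrow> 'k \<Rightarrow> nat" where
  "unit_index k = (\<lambda>j. if j = k then 1 else 0)"

lemma mdeg_unit [simp]: "mdeg (unit_index k) = 1"
  by (simp add: mdeg_def unit_index_def)

lemma unit_index_same [simp]: "unit_index k k = 1"
  by (simp add: unit_index_def)

lemma unit_index_neq_0 [simp]: "unit_index k \<noteq> 0"
  by (metis unit_index_same zero_fun_apply zero_neq_one)

lemma unit_index_inj [simp]: "unit_index k = unit_index j \<longleftrightarrow> k = j"
  by (auto simp: unit_index_def fun_eq_iff split: if_splits)

lemma unit_index_le_iff: "unit_index k \<le> p \<longleftrightarrow> p k \<ge> 1"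
  by (auto simp: unit_index_def le_fun_def)

lemma index_split_unit: "p k \<ge> 1 \<Longrightarrow> p = (p - unit_index k) + unit_index k"
  by (simp add: index_diff_add unit_index_le_iff)

lemma nonzero_index_split:
  assumes "p \<noteq> 0" obtains k p' where "p = p' + unit_index k"
proof -
  from assms obtain k where "p k \<ge> 1" by (auto simp: fun_eq_iff Suc_le_eq)
  then show thesis using that index_split_unit by metis
qed

text \<open>Taking one unit off the index is taking one factor off a monomial; statements about
  powers of series are proved this way.\<close>

lemma multi_index_induct [case_names zero add]:
  fixes m :: "'k::finite \<Rightarrow> nat"
  assumes "P 0" and "\<And>m k. P m \<Longrightarrow> P (m + unit_index k)"
  shows "P m"
proof (induction "mdeg m" arbitrary: m)
  case 0
  then have "m = 0" by (metis mdeg_eq_0_iff)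
  then show ?case using assms(1) by metis
next
  case (Suc d)
  then have "m \<noteq> 0" by auto
  then obtain k p' where "m = p' + unit_index k" by (rule nonzero_index_split)
  with Suc assms(2) show ?case by auto
qed

section \<open>The ring of formal power series and monomials in it\<close>

text \<open>Functions on multi-indices already carry the pointwise algebra, which is the one wanted
  for the indices themselves; a separate type leaves room for the convolution product of
  coefficients.\<close>

typedef ('k, 'a) mps = "UNIV :: (('k \<Rightarrow> nat) \<Rightarrow> 'a) set"
  morphisms mcoeff Mps by simp

lemma mcoeff_Mps [simp]: "mcoeff (Mps f) = f"
  by (simp add: Mps_inverse)

lemma mps_eqI: "(\<And>p. mcoeff a p = mcoeff b p) \<Longrightarrow> a = b"
  by (metis ext mcoeff_inject)

instantiation mps :: (finite, comm_semiring_1) comm_semiring_1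
begin

definition "0 = Mps (\<lambda>_. 0)"
definition "1 = Mps (\<lambda>p. if p = 0 then 1 else 0)"
definition "a + b = Mps (\<lambda>p. mcoeff a p + mcoeff b p)"
definition "a * b = Mps (\<lambda>p. \<Sum>q\<in>{q. q \<le> p}. mcoeff a q * mcoeff b (p - q))"

instance
proof
  fix a b c :: "('a, 'b) mps"
  show "a * b * c = a * (b * c)"
  proof (rule mps_eqI)
    fix p :: "'a \<Rightarrow> nat"
    have "mcoeff (a * b * c) p =
      (\<Sum>(q, q')\<in>(SIGMA q:{q. q \<le> p}. {q'. q' \<le> q}). mcoeff a q' * mcoeff b (q - q') * mcoeff c (p - q))"
      by (simp add: times_mps_def sum.Sigma[symmetric] finite_le_index sum_distrib_right)
    \<comment> \<open>Both sides sum over splittings of \<open>p\<close> into three parts; the pair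
      (first part plus second, first) is exchanged for the pair (first, second).\<close>
    also have "\<dots> = (\<Sum>(q, q')\<in>(SIGMA q:{q. q \<le> p}. {q'. q' \<le> p - q}). mcoeff a q * (mcoeff b q' * mcoeff c (p - q - q')))"
    proof (rule sum.reindex_bij_witness[where i = "\<lambda>(q, r). (q + r, q)" and j = "\<lambda>(q, r). (r, q - r)"])
      show "(case x of (q, r) \<Rightarrow> (q + r, q)) \<in> (SIGMA q:{q. q \<le> p}. {q'. q' \<le> q})"
        if "x \<in> (SIGMA q:{q. q \<le> p}. {q'. q' \<le> p - q})" for x
      proof -
        obtain q r where x: "x = (q, r)" by fastforce
        have "q k + r k \<le> p k" for k
        proof -
          have "q k \<le> p k" "r k \<le> p k - q k" using that x by (auto simp: le_fun_def)
          then show ?thesis by linarith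
        qed
        then show ?thesis by (simp add: x le_fun_def)
      qed
      show "(case x of (q, r) \<Rightarrow> (r, q - r)) \<in> (SIGMA q:{q. q \<le> p}. {q'. q' \<le> p - q})"
        if "x \<in> (SIGMA q:{q. q \<le> p}. {q'. q' \<le> q})" for x
      proof -
        obtain q r where x: "x = (q, r)" by fastforce
        have "r k \<le> p k \<and> q k - r k \<le> p k - r k" for k
        proof -
          have "q k \<le> p k" "r k \<le> q k" using that x by (auto simp: le_fun_def)
          then show ?thesis by linarith
        qed
        then show ?thesis by (simp add: x le_fun_def)
      qed
      show "(case (case x of (q, r) \<Rightarrow> (r, q - r)) of (q, q') \<Rightarrow>
           mcoeff a q * (mcoeff b q' * mcoeff c (p - q - q'))) =
           (case x of (q, q') \<Rightarrow> mcoeff a q' * mcoeff b (q - q') * mcoeff c (p - q))"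
        if x: "x \<in> (SIGMA q:{q. q \<le> p}. {q'. q' \<le> q})" for x
      proof -
        obtain q r where [simp]: "x = (q, r)" and "r \<le> q" using x by auto
        then have "p - r - (q - r) = p - q" by (auto simp: fun_eq_iff le_fun_def)
        then show ?thesis by (simp add: mult.assoc)
      qed
    qed (auto simp: index_diff_add)
    also have "\<dots> = mcoeff (a * (b * c)) p"
      by (simp add: times_mps_def sum.Sigma[symmetric] finite_le_index sum_distrib_left)
    finally show "mcoeff (a * b * c) p = mcoeff (a * (b * c)) p" .
  qed
  show "a * b = b * a"
  proof (rule mps_eqI)
    fix p :: "'a \<Rightarrow> nat"
    have pd: "p - (p - q) = q" if "q \<le> p" for q
      using that by (auto simp: fun_eq_iff le_fun_def)
    show "mcoeff (a * b) p = mcoeff (b * a) p"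
      unfolding times_mps_def mcoeff_Mps
      by (rule sum.reindex_bij_witness[where i = "\<lambda>q. p - q" and j = "\<lambda>q. p - q"])
         (auto simp: pd mult.commute)
  qed
  show "1 * a = a"
  proof (rule mps_eqI)
    fix p :: "'a \<Rightarrow> nat"
    have "mcoeff (1 * a) p = (\<Sum>q\<in>{0}. mcoeff a (p - q))"
      unfolding times_mps_def one_mps_def mcoeff_Mps
      by (rule sum.mono_neutral_cong_right) (auto simp: finite_le_index)
    then show "mcoeff (1 * a) p = mcoeff a p"
      by (simp add: fun_diff_def)
  qed
  show "(a + b) * c = a * c + b * c"
    by (rule mps_eqI) (simp add: times_mps_def plus_mps_def distrib_right sum.distrib)
  show "(0 :: ('a, 'b) mps) \<noteq> 1"
  proof
    assume "(0 :: ('a, 'b) mps) = 1"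
    then have "mcoeff (0 :: ('a, 'b) mps) 0 = mcoeff 1 0" by simp
    then show False by (simp add: zero_mps_def one_mps_def)
  qed
qed (auto intro!: mps_eqI simp: zero_mps_def plus_mps_def times_mps_def add_ac)

end

instantiation mps :: (finite, comm_ring_1) comm_ring_1
begin

definition "- a = Mps (\<lambda>p. - mcoeff a p)"
definition "a - b = Mps (\<lambda>p. mcoeff a p - mcoeff b p)"

instance
  by standard (auto intro!: mps_eqI simp: uminus_mps_def minus_mps_def plus_mps_def zero_mps_def)

end

lemma mcoeff_zero [simp]: "mcoeff 0 p = 0"
  by (simp add: zero_mps_def)

lemma mcoeff_one: "mcoeff 1 p = (if p = 0 then 1 else 0)"
  by (simp add: one_mps_def)

lemma mcoeff_add [simp]: "mcoeff (a + b) p = mcoeff a p + mcoeff b p"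
  by (simp add: plus_mps_def)

lemma mcoeff_minus [simp]: "mcoeff (a - b) p = mcoeff a p - mcoeff b p"
  by (simp add: minus_mps_def)

lemma mcoeff_uminus [simp]: "mcoeff (- a) p = - mcoeff a p"
  by (simp add: uminus_mps_def)

lemma mcoeff_mult: "mcoeff (a * b) p = (\<Sum>q\<in>{q. q \<le> p}. mcoeff a q * mcoeff b (p - q))"
  by (simp add: times_mps_def)

lemma mcoeff_sum [simp]: "mcoeff (\<Sum>x\<in>A. f x) p = (\<Sum>x\<in>A. mcoeff (f x) p)"
  by (induction A rule: infinite_finite_induct) auto

definition mconst :: "'a::comm_semiring_1 \<Rightarrow> ('k::finite, 'a) mps" where
  "mconst c = Mps (\<lambda>p. if p = 0 then c else 0)"

definition mvar :: "'k::finite \<Rightarrow> ('k, 'a::comm_semiring_1) mps" where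
  "mvar k = Mps (\<lambda>p. if p = unit_index k then 1 else 0)"

lemma mcoeff_mvar: "mcoeff (mvar k) p = (if p = unit_index k then 1 else 0)"
  by (simp add: mvar_def)

lemma mcoeff_mconst: "mcoeff (mconst c) p = (if p = 0 then c else 0)"
  by (simp add: mconst_def)

lemma mcoeff_mconst_mult [simp]: "mcoeff (mconst c * a) p = c * mcoeff a p"
proof -
  have "mcoeff (mconst c * a) p = (\<Sum>q\<in>{0}. c * mcoeff a (p - q))"
    unfolding mcoeff_mult mconst_def mcoeff_Mps
    by (rule sum.mono_neutral_cong_right) (auto simp: finite_le_index)
  then show ?thesis by (simp add: fun_diff_def)
qed

lemma mconst_zero [simp]: "mconst 0 = 0"
  by (rule mps_eqI) (simp add: mcoeff_mconst)

lemma mconst_one: "mconst 1 = 1"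
  by (rule mps_eqI) (simp add: mcoeff_mconst mcoeff_one)

lemma mconst_add: "mconst (a + b) = mconst a + mconst b"
  by (rule mps_eqI) (simp add: mcoeff_mconst)

lemma mconst_uminus: "mconst (- a) = - mconst a"
  by (rule mps_eqI) (simp add: mcoeff_mconst)

lemma mconst_mult: "mconst (a * b) = mconst a * mconst b"
  by (rule mps_eqI) (simp add: mcoeff_mconst)

lemma mconst_of_nat: "mconst (of_nat n) = of_nat n"
  by (induction n) (simp_all add: mconst_add mconst_one)

lemma mcoeff_mult_0 [simp]: "mcoeff (a * b) 0 = mcoeff a 0 * mcoeff b 0"
  by (simp add: mcoeff_mult)

definition wpow :: "('k::finite \<Rightarrow> ('j::finite, 'a::comm_semiring_1) mps) \<Rightarrow> ('k \<Rightarrow> nat) \<Rightarrow> ('j, 'a) mps" where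
  "wpow w m = (\<Prod>k\<in>UNIV. w k ^ m k)"

lemma wpow_zero [simp]: "wpow w 0 = 1"
  by (simp add: wpow_def)

lemma wpow_add: "wpow w (m + m') = wpow w m * wpow w m'"
  by (simp add: wpow_def power_add prod.distrib)

lemma wpow_unit [simp]: "wpow w (unit_index k) = w k"
proof -
  have "wpow w (unit_index k) = (\<Prod>j\<in>UNIV. if j = k then w j else 1)"
    unfolding wpow_def unit_index_def by (rule prod.cong) auto
  then show ?thesis by simp
qed

lemma mcoeff_mult_low_degree:
  assumes "\<And>q. mdeg q < m \<Longrightarrow> mcoeff a q = 0" "\<And>q. mdeg q < n \<Longrightarrow> mcoeff b q = 0" "mdeg p < m + n"
  shows "mcoeff (a * b) p = 0"
  unfolding mcoeff_mult
proof (rule sum.neutral, safe)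
  fix q assume "q \<le> p"
  then have "mdeg q + mdeg (p - q) = mdeg p"
    by (metis index_diff_add(1) mdeg_add)
  then have "mdeg q < m \<or> mdeg (p - q) < n" using assms(3) by linarith
  then show "mcoeff a q * mcoeff b (p - q) = 0" using assms by auto
qed

text \<open>Each factor without constant term raises the order by one. This makes a composition a
  finite sum in every degree.\<close>

lemma mcoeff_wpow_low_degree:
  assumes "\<And>k. mcoeff (w k) 0 = 0" "mdeg p < mdeg m"
  shows "mcoeff (wpow w m) p = 0"
proof -
  have "\<forall>p. mdeg p < mdeg m \<longrightarrow> mcoeff (wpow w m) p = 0"
  proof (rule multi_index_induct[of "\<lambda>m. \<forall>p. mdeg p < mdeg m \<longrightarrow> mcoeff (wpow w m) p = 0" m])
    fix m k assume IH: "\<forall>p. mdeg p < mdeg m \<longrightarrow> mcoeff (wpow w m) p = 0"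
    show "\<forall>p. mdeg p < mdeg (m + unit_index k) \<longrightarrow> mcoeff (wpow w (m + unit_index k)) p = 0"
      unfolding wpow_add wpow_unit mdeg_add mdeg_unit
      using IH assms(1) by (intro allI impI mcoeff_mult_low_degree[of "mdeg m" _ 1]) auto
  qed simp
  then show ?thesis using assms(2) by blast
qed

text \<open>An error of order \<open>m\<close> in one factor is multiplied by a series of order
  \<open>j\<close>, so it first shows in degree \<open>m + j\<close>; symmetrically for
  \<open>n + i\<close>.\<close>

lemma mcoeff_mult_agree:
  assumes "\<And>q. mdeg q < m \<Longrightarrow> mcoeff a q = mcoeff a' q" "\<And>q. mdeg q < n \<Longrightarrow> mcoeff b q = mcoeff b' q"
    and "\<And>q. mdeg q < i \<Longrightarrow> mcoeff a q = 0 \<and> mcoeff a' q = 0"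
    and "\<And>q. mdeg q < j \<Longrightarrow> mcoeff b q = 0 \<and> mcoeff b' q = 0"
    and "mdeg p < m + j" "mdeg p < n + i"
  shows "mcoeff (a * b) p = mcoeff (a' * b') p"
  unfolding mcoeff_mult
proof (rule sum.cong, safe)
  fix q assume "q \<le> p"
  then have *: "mdeg q + mdeg (p - q) = mdeg p"
    by (metis index_diff_add(1) mdeg_add)
  consider "mdeg q < m" "mdeg (p - q) < n" | "mdeg q \<ge> m" | "mdeg (p - q) \<ge> n" by linarith
  then show "mcoeff a q * mcoeff b (p - q) = mcoeff a' q * mcoeff b' (p - q)"
  proof cases
    case 2 then have "mdeg (p - q) < j" using * assms(5) by linarith
    then show ?thesis using assms(4) by simp
  next
    case 3 then have "mdeg q < i" using * assms(6) by linarith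
    then show ?thesis using assms(3) by simp
  qed (use assms in auto)
qed

text \<open>An error of order \<open>d\<close> in one factor meets \<open>mdeg m - 1\<close> other
  factors of order one. For \<open>mdeg m \<ge> 2\<close> and \<open>d = mdeg p\<close> the
  coefficient at \<open>p\<close> sees \<open>w\<close> only below degree \<open>mdeg p\<close>:
  this is why substitution into a nonlinearity without linear terms is triangular.\<close>

lemma mcoeff_wpow_agree:
  assumes agree: "\<And>k q. mdeg q < d \<Longrightarrow> mcoeff (w k) q = mcoeff (w' k) q"
    and zero: "\<And>k. mcoeff (w k) 0 = 0" "\<And>k. mcoeff (w' k) 0 = 0"
    and "mdeg p < d + mdeg m - 1"
  shows "mcoeff (wpow w m) p = mcoeff (wpow w' m) p"
proof -
  let ?P = "\<lambda>m. \<forall>p. mdeg p < d + mdeg m - 1 \<longrightarrow> mcoeff (wpow w m) p = mcoeff (wpow w' m) p"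
  have "?P m"
  proof (rule multi_index_induct[of ?P m])
    fix m k assume IH: "?P m"
    show "?P (m + unit_index k)"
    proof (cases "m = 0")
      case True
      then have "m + unit_index k = unit_index k" by (simp only: add_0)
      then show ?thesis using agree by (simp del: plus_fun_apply)
    next
      case False
      then have "mdeg m > 0" using mdeg_eq_0_iff[of m] by linarith
      have "mcoeff (wpow w m * w k) p = mcoeff (wpow w' m * w' k) p" if "mdeg p < d + mdeg m" for p
      proof (rule mcoeff_mult_agree[where m = "d + mdeg m - 1" and n = d and i = "mdeg m" and j = 1])
        show "mcoeff (wpow w m) q = 0 \<and> mcoeff (wpow w' m) q = 0" if "mdeg q < mdeg m" for q
          using that zero by (simp add: mcoeff_wpow_low_degree)
      qed (use that IH agree zero \<open>mdeg m > 0\<close> in auto)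
      then show ?thesis by (auto simp: wpow_add)
    qed
  qed simp
  then show ?thesis using assms(4) by blast
qed

section \<open>Substitution, differentiation and the Euler field\<close>

text \<open>The cut at \<open>mdeg m \<le> mdeg p\<close> makes the sum finite for every
  \<open>w\<close>. It is genuine substitution when the series in \<open>w\<close> have no constant
  term, since the omitted terms then vanish.\<close>

definition mcomp :: "('k::finite, 'a::comm_semiring_1) mps \<Rightarrow> ('k \<Rightarrow> ('j::finite, 'a) mps) \<Rightarrow> ('j, 'a) mps" where
  "mcomp F w = Mps (\<lambda>p. \<Sum>m\<in>{m. mdeg m \<le> mdeg p}. mcoeff F m * mcoeff (wpow w m) p)"

lemma mcoeff_mcomp:
  "mcoeff (mcomp F w) p = (\<Sum>m\<in>{m. mdeg m \<le> mdeg p}. mcoeff F m * mcoeff (wpow w m) p)"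
  by (simp add: mcomp_def)

text \<open>With any larger cut the value is the same, so several coefficients can share one
  summation range.\<close>

lemma mcoeff_mcomp_upto:
  assumes "\<And>k. mcoeff (w k) 0 = 0" "mdeg p \<le> N"
  shows "mcoeff (mcomp F w) p = (\<Sum>m\<in>{m. mdeg m \<le> N}. mcoeff F m * mcoeff (wpow w m) p)"
  unfolding mcoeff_mcomp
proof (rule sum.mono_neutral_left)
  show "\<forall>m\<in>{m. mdeg m \<le> N} - {m. mdeg m \<le> mdeg p}. mcoeff F m * mcoeff (wpow w m) p = 0"
    using mcoeff_wpow_low_degree[of w p] assms(1) by simp
qed (use assms(2) in \<open>auto simp: finite_mdeg_le\<close>)

definition mderiv :: "'k::finite \<Rightarrow> ('k, 'a::comm_semiring_1) mps \<Rightarrow> ('k, 'a) mps" where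
  "mderiv k a = Mps (\<lambda>p. of_nat (p k + 1) * mcoeff a (p + unit_index k))"

lemma mcoeff_mderiv: "mcoeff (mderiv k a) p = of_nat (p k + 1) * mcoeff a (p + unit_index k)"
  by (simp add: mderiv_def)

lemma mderiv_add: "mderiv k (a + b) = mderiv k a + mderiv k b"
  by (rule mps_eqI) (simp add: mcoeff_mderiv algebra_simps)

lemma mderiv_zero [simp]: "mderiv k 0 = 0"
  by (rule mps_eqI) (simp add: mcoeff_mderiv)

lemma add_unit_index_neq_0 [simp]: "p + unit_index k \<noteq> 0"
  by (metis add_is_0 one_neq_zero plus_fun_apply unit_index_same zero_fun_apply)

lemma mderiv_one [simp]: "mderiv k 1 = 0"
  by (rule mps_eqI) (simp only: mcoeff_mderiv mcoeff_one add_unit_index_neq_0 if_False mult_zero_right mcoeff_zero)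

lemma mderiv_mconst_mult: "mderiv k (mconst c * a) = mconst c * mderiv k a"
  by (rule mps_eqI) (simp only: mcoeff_mderiv mcoeff_mconst_mult mult.left_commute)

lemma mderiv_mvar: "mderiv k (mvar j) = (if k = j then 1 else 0)"
proof (rule mps_eqI)
  fix p
  show "mcoeff (mderiv k (mvar j)) p = mcoeff (if k = j then 1 else (0 :: ('a, 'b) mps)) p"
  proof (cases "p = 0")
    case False
    then have "mdeg (p + unit_index k) \<noteq> mdeg (unit_index j)" by simp
    then have "p + unit_index k \<noteq> unit_index j" by metis
    then show ?thesis using False by (simp add: mcoeff_mderiv mcoeff_mvar mcoeff_one)
  qed (simp add: mcoeff_mderiv mcoeff_mvar mcoeff_one)
qed

lemma mderiv_commute: "mderiv k (mderiv j a) = mderiv j (mderiv k a)"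
proof (cases "k = j")
  case False
  then show ?thesis
    by (intro mps_eqI) (simp add: mcoeff_mderiv unit_index_def add_ac mult_ac)
qed simp

text \<open>In a Leibniz sum the terms with \<open>q k = 0\<close> carry the factor
  \<open>q k\<close> and drop out; what remains is a translate of the box below
  \<open>p\<close>.\<close>

lemma sum_le_shift:
  fixes p :: "'k::finite \<Rightarrow> nat" and g :: "('k \<Rightarrow> nat) \<Rightarrow> 'a::comm_monoid_add"
  assumes "\<And>q. q \<le> p + unit_index k \<Longrightarrow> q k = 0 \<Longrightarrow> g q = 0"
  shows "(\<Sum>q | q \<le> p + unit_index k. g q) = (\<Sum>q | q \<le> p. g (q + unit_index k))"
proof -
  have "(\<Sum>q | q \<le> p. g (q + unit_index k)) = sum g ((\<lambda>q. q + unit_index k) ` {q. q \<le> p})"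
    by (subst sum.reindex) (auto simp: inj_on_def)
  also have "\<dots> = (\<Sum>q | q \<le> p + unit_index k. g q)"
  proof (rule sum.mono_neutral_left)
    show "\<forall>q\<in>{q. q \<le> p + unit_index k} - (\<lambda>q. q + unit_index k) ` {q. q \<le> p}. g q = 0"
    proof
      fix q assume q: "q \<in> {q. q \<le> p + unit_index k} - (\<lambda>q. q + unit_index k) ` {q. q \<le> p}"
      have "q k = 0"
      proof (rule ccontr)
        assume "q k \<noteq> 0"
        then have "q = (q - unit_index k) + unit_index k" by (intro index_split_unit) auto
        moreover have "q - unit_index k \<le> p"
          using q by (auto simp: le_fun_def fun_diff_def le_diff_conv)
        ultimately show False using q by blast
      qed
      then show "g q = 0" using assms q by auto
    qed
  qed (use finite_le_index in \<open>auto simp: le_fun_def\<close>)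
  finally show ?thesis by simp
qed

text \<open>The factor \<open>(p + ?e) k\<close> from differentiation splits as
  \<open>q k + (p + ?e - q) k\<close> in each summand; the two halves are the two terms of the
  product rule.\<close>

lemma mderiv_mult: "mderiv k (a * b) = mderiv k a * b + a * mderiv k b"
proof (rule mps_eqI)
  fix p :: "'a \<Rightarrow> nat"
  let ?e = "unit_index k"
  let ?A = "mcoeff a" and ?B = "mcoeff b"
  have "of_nat ((p + ?e) k) * (?A q * ?B (p + ?e - q)) =
    of_nat (q k) * (?A q * ?B (p + ?e - q)) + of_nat ((p + ?e - q) k) * (?A q * ?B (p + ?e - q))"
    if "q \<le> p + ?e" for q
  proof -
    have "q k \<le> (p + ?e) k" using that by (simp only: le_fun_def)
    then have "(p + ?e) k = q k + (p + ?e - q) k" by simp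
    then show ?thesis by (metis distrib_right of_nat_add)
  qed
  then have "mcoeff (mderiv k (a * b)) p =
      (\<Sum>q | q \<le> p + ?e. of_nat (q k) * (?A q * ?B (p + ?e - q))) +
      (\<Sum>q | q \<le> p + ?e. of_nat ((p + ?e - q) k) * (?A q * ?B (p + ?e - q)))"
    by (simp add: mcoeff_mderiv mcoeff_mult sum_distrib_left flip: sum.distrib)
  moreover have "(\<Sum>q | q \<le> p + ?e. of_nat (q k) * (?A q * ?B (p + ?e - q))) = mcoeff (mderiv k a * b) p"
  proof (subst sum_le_shift)
    have "p + ?e - (q + ?e) = p - q" for q by (simp add: fun_eq_iff)
    then show "(\<Sum>q | q \<le> p. of_nat ((q + ?e) k) * (?A (q + ?e) * ?B (p + ?e - (q + ?e)))) = mcoeff (mderiv k a * b) p"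
      by (simp add: mcoeff_mult mcoeff_mderiv mult.assoc)
  qed auto
  moreover have "(\<Sum>q | q \<le> p + ?e. of_nat ((p + ?e - q) k) * (?A q * ?B (p + ?e - q))) = mcoeff (a * mderiv k b) p"
  proof -
    have "(\<Sum>q | q \<le> p + ?e. of_nat ((p + ?e - q) k) * (?A q * ?B (p + ?e - q))) =
          (\<Sum>q | q \<le> p + ?e. of_nat (q k) * (?A (p + ?e - q) * ?B q))"
      by (rule sum.reindex_bij_witness[where i = "\<lambda>q. p + ?e - q" and j = "\<lambda>q. p + ?e - q"])
         (auto simp: le_fun_def fun_eq_iff fun_diff_def)
    also have "\<dots> = (\<Sum>q | q \<le> p. of_nat ((q + ?e) k) * (?A (p + ?e - (q + ?e)) * ?B (q + ?e)))"
      by (rule sum_le_shift) auto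
    also have "\<dots> = (\<Sum>q | q \<le> p. of_nat (q k + 1) * (?A (p - q) * ?B (q + ?e)))"
    proof -
      have "p + ?e - (q + ?e) = p - q" for q by (simp add: fun_eq_iff)
      then show ?thesis by simp
    qed
    also have "\<dots> = mcoeff (mderiv k b * a) p"
      unfolding mcoeff_mult mcoeff_mderiv by (intro sum.cong) (simp_all add: mult_ac)
    finally show ?thesis by (subst mult.commute)
  qed
  ultimately show "mcoeff (mderiv k (a * b)) p = mcoeff (mderiv k a * b + a * mderiv k b) p"
    by simp
qed

text \<open>The subtraction in \<open>m - unit_index k\<close> is truncated; where that matters the
  factor \<open>of_nat (m k)\<close> is zero.\<close>

lemma mderiv_wpow:
  "mderiv a (wpow w m) = (\<Sum>k\<in>UNIV. of_nat (m k) * wpow w (m - unit_index k) * mderiv a (w k))"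
proof (rule multi_index_induct[of "\<lambda>m. mderiv a (wpow w m) =
      (\<Sum>k\<in>UNIV. of_nat (m k) * wpow w (m - unit_index k) * mderiv a (w k))" m])
  fix m j
  assume IH: "mderiv a (wpow w m) =
    (\<Sum>k\<in>UNIV. of_nat (m k) * wpow w (m - unit_index k) * mderiv a (w k))"
  have *: "of_nat ((m + unit_index j) k) * wpow w (m + unit_index j - unit_index k) * mderiv a (w k) =
     of_nat (m k) * wpow w (m - unit_index k) * mderiv a (w k) * w j +
       (if k = j then wpow w m * mderiv a (w j) else 0)" for k
  proof (cases "k = j")
    case True
    then show ?thesis
    proof (cases "m j = 0")
      case False
      then have "wpow w m = wpow w (m - unit_index j) * w j"
        using index_split_unit[of m j] by (metis wpow_add wpow_unit One_nat_def Suc_le_eq neq0_conv)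
      then show ?thesis using True by (simp add: algebra_simps)
    qed simp
  next
    case neq: False
    show ?thesis
    proof (cases "m k = 0")
      case True
      then show ?thesis using neq by (simp add: unit_index_def)
    next
      case False
      have "m + unit_index j - unit_index k = (m - unit_index k) + unit_index j"
        using False neq by (auto simp: fun_eq_iff unit_index_def)
      moreover have "(m + unit_index j) k = m k" using neq by (simp add: unit_index_def)
      ultimately show ?thesis using neq by (simp add: wpow_add algebra_simps)
    qed
  qed
  show "mderiv a (wpow w (m + unit_index j)) =
    (\<Sum>k\<in>UNIV. of_nat ((m + unit_index j) k) * wpow w (m + unit_index j - unit_index k) * mderiv a (w k))"
    unfolding * sum.distrib wpow_add wpow_unit mderiv_mult IH
    by (simp add: sum_distrib_right)
qed simp

lemma mderiv_mcomp:
  fixes F :: "('k::finite, 'a::comm_semiring_1) mps" and w :: "'k \<Rightarrow> ('j::finite, 'a) mps"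
  assumes w0: "\<And>k. mcoeff (w k) 0 = 0"
  shows "mderiv a (mcomp F w) = (\<Sum>k\<in>UNIV. mcomp (mderiv k F) w * mderiv a (w k))"
proof (rule mps_eqI)
  fix p :: "'j \<Rightarrow> nat"
  define N where "N = mdeg p"
  let ?S = "{m. mdeg m \<le> N}" and ?S' = "{m. mdeg m \<le> Suc N}"
  \<comment> \<open>The derivative reads a coefficient one degree above \<open>p\<close>, hence the
    cut at \<open>Suc N\<close>.\<close>
  have "mcoeff (mderiv a (mcomp F w)) p = (\<Sum>m\<in>?S'. mcoeff F m * mcoeff (mderiv a (wpow w m)) p)"
    by (subst mcoeff_mderiv, subst mcoeff_mcomp_upto[OF w0, of _ "Suc N"])
       (auto simp: N_def mcoeff_mderiv sum_distrib_left mult_ac)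
  also have "\<dots> = (\<Sum>k\<in>UNIV. \<Sum>m\<in>?S'. of_nat (m k) * mcoeff F m * mcoeff (wpow w (m - unit_index k) * mderiv a (w k)) p)"
    by (subst sum.swap)
       (simp add: mderiv_wpow sum_distrib_left mult_ac flip: mconst_of_nat)
  also have "\<dots> = (\<Sum>k\<in>UNIV. mcoeff (mcomp (mderiv k F) w * mderiv a (w k)) p)"
  proof (rule sum.cong)
    fix k :: 'k
    let ?g = "\<lambda>m. of_nat (m k) * mcoeff F m * mcoeff (wpow w (m - unit_index k) * mderiv a (w k)) p"
    \<comment> \<open>Indices with \<open>m k = 0\<close> have weight zero; the others are
      translates by \<open>unit_index k\<close> of indices one degree lower, which restores the cut
      at \<open>N\<close>.\<close>
    have "sum ?g ?S' = sum ?g ((\<lambda>m. m + unit_index k) ` ?S)"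
    proof (rule sum.mono_neutral_right)
      show "\<forall>m\<in>?S' - (\<lambda>m. m + unit_index k) ` ?S. ?g m = 0"
      proof
        fix m assume m: "m \<in> ?S' - (\<lambda>m. m + unit_index k) ` ?S"
        have "m k = 0"
        proof (rule ccontr)
          assume "m k \<noteq> 0"
          then have eq: "m = (m - unit_index k) + unit_index k" by (intro index_split_unit) auto
          then have "mdeg m = mdeg (m - unit_index k) + 1" by (metis mdeg_add mdeg_unit)
          then have "m - unit_index k \<in> ?S" using m by auto
          then show False using m eq by blast
        qed
        then show "?g m = 0" by simp
      qed
    qed (auto simp: finite_mdeg_le)
    also have "\<dots> = (\<Sum>m\<in>?S. mcoeff (mderiv k F) m * mcoeff (wpow w m * mderiv a (w k)) p)"
      by (subst sum.reindex) (auto simp: inj_on_def mcoeff_mderiv)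
    also have "\<dots> = (\<Sum>m\<in>?S. \<Sum>q | q \<le> p. mcoeff (mderiv k F) m * mcoeff (wpow w m) q * mcoeff (mderiv a (w k)) (p - q))"
      by (simp add: mcoeff_mult sum_distrib_left mult_ac)
    also have "\<dots> = (\<Sum>q | q \<le> p. (\<Sum>m\<in>?S. mcoeff (mderiv k F) m * mcoeff (wpow w m) q) * mcoeff (mderiv a (w k)) (p - q))"
      by (subst sum.swap) (simp add: sum_distrib_right)
    also have "\<dots> = mcoeff (mcomp (mderiv k F) w * mderiv a (w k)) p"
      unfolding mcoeff_mult
    proof (rule sum.cong)
      fix q assume "q \<in> {q. q \<le> p}"
      then have "mdeg q \<le> N" by (simp add: N_def mdeg_mono)
      then show "(\<Sum>m\<in>?S. mcoeff (mderiv k F) m * mcoeff (wpow w m) q) * mcoeff (mderiv a (w k)) (p - q) =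
        mcoeff (mcomp (mderiv k F) w) q * mcoeff (mderiv a (w k)) (p - q)"
        by (simp add: mcoeff_mcomp_upto[OF w0])
    qed simp
    finally show "sum ?g ?S' = mcoeff (mcomp (mderiv k F) w * mderiv a (w k)) p" .
  qed simp
  finally show "mcoeff (mderiv a (mcomp F w)) p = mcoeff (\<Sum>k\<in>UNIV. mcomp (mderiv k F) w * mderiv a (w k)) p"
    by simp
qed

text \<open>Stated over a semiring because it is used with complex frequencies, where it yields the
  divisors, and with natural weights, where it grades the modes.\<close>

definition idot :: "('k::finite \<Rightarrow> 'a::comm_semiring_1) \<Rightarrow> ('k \<Rightarrow> nat) \<Rightarrow> 'a" where
  "idot \<nu> p = (\<Sum>k\<in>UNIV. \<nu> k * of_nat (p k))"

lemma idot_zero [simp]: "idot \<nu> 0 = 0"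
  by (simp add: idot_def)

lemma idot_add: "idot \<nu> (p + q) = idot \<nu> p + idot \<nu> q"
  by (simp add: idot_def distrib_left sum.distrib)

lemma idot_unit [simp]: "idot \<nu> (unit_index k) = \<nu> k"
proof -
  have "idot \<nu> (unit_index k) = (\<Sum>j\<in>UNIV. if j = k then \<nu> j else 0)"
    unfolding idot_def unit_index_def by (rule sum.cong) auto
  then show ?thesis by simp
qed

text \<open>The derivative along the linear field with components \<open>\<nu> k * z k\<close>.
  Monomials are its eigenvectors, and this diagonal form is taken as the definition; the
  differential operator is recovered in \<open>weighted_euler_eq_sum\<close>.\<close>

definition weighted_euler :: "('k::finite \<Rightarrow> 'a::comm_semiring_1) \<Rightarrow> ('k, 'a) mps \<Rightarrow> ('k, 'a) mps" where
  "weighted_euler \<nu> a = Mps (\<lambda>p. idot \<nu> p * mcoeff a p)"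

lemma mcoeff_weighted_euler: "mcoeff (weighted_euler \<nu> a) p = idot \<nu> p * mcoeff a p"
  by (simp add: weighted_euler_def)

lemma weighted_euler_mult:
  "weighted_euler \<nu> (a * b) = weighted_euler \<nu> a * b + a * weighted_euler \<nu> b"
proof (rule mps_eqI)
  fix p
  have "idot \<nu> p * (mcoeff a q * mcoeff b (p - q)) =
    idot \<nu> q * mcoeff a q * mcoeff b (p - q) + mcoeff a q * (idot \<nu> (p - q) * mcoeff b (p - q))"
    if "q \<le> p" for q
  proof -
    have "idot \<nu> p = idot \<nu> q + idot \<nu> (p - q)"
      using that by (metis idot_add index_diff_add(1))
    then show ?thesis by (simp add: algebra_simps)
  qed
  then show "mcoeff (weighted_euler \<nu> (a * b)) p = mcoeff (weighted_euler \<nu> a * b + a * weighted_euler \<nu> b) p"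
    by (simp add: mcoeff_mult mcoeff_weighted_euler sum_distrib_left flip: sum.distrib)
qed

lemma weighted_euler_eq_sum: "weighted_euler \<nu> a = (\<Sum>k\<in>UNIV. mconst (\<nu> k) * (mvar k * mderiv k a))"
proof (rule mps_eqI)
  fix p
  have "mcoeff (mvar k * mderiv k a) p = of_nat (p k) * mcoeff a p" for k
  proof (cases "p k = 0")
    case True
    then have "mcoeff (mvar k * mderiv k a) p = (\<Sum>q | q \<le> p. 0)"
      unfolding mcoeff_mult
      by (intro sum.cong) (auto simp: mcoeff_mvar unit_index_le_iff)
    then show ?thesis using True by simp
  next
    case False
    then have *: "p = (p - unit_index k) + unit_index k" by (intro index_split_unit) auto
    have "mcoeff (mvar k * mderiv k a) p = (\<Sum>q\<in>{unit_index k}. mcoeff (mderiv k a) (p - q))"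
      unfolding mcoeff_mult
      by (rule sum.mono_neutral_cong_right)
         (use False in \<open>auto simp: mcoeff_mvar finite_le_index unit_index_le_iff\<close>)
    then show ?thesis using * False by (simp add: mcoeff_mderiv del: of_nat_add)
  qed
  then show "mcoeff (weighted_euler \<nu> a) p = mcoeff (\<Sum>k\<in>UNIV. mconst (\<nu> k) * (mvar k * mderiv k a)) p"
    by (simp add: mcoeff_weighted_euler idot_def sum_distrib_right mult.assoc
          mult.left_commute[of "mvar _" "mconst _"] mult.left_commute[of "\<nu> _"])
qed

text \<open>The n-th iterate is final in all degrees below n, whatever the starting value; reading
  degree d from iterate d + 1 gives the fixed point.\<close>

lemma degree_recursion:
  fixes T :: "('i \<Rightarrow> ('k::finite \<Rightarrow> nat) \<Rightarrow> 'v) \<Rightarrow> 'i \<Rightarrow> ('k \<Rightarrow> nat) \<Rightarrow> 'v"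
  assumes "\<And>u v i p. (\<And>j q. mdeg q < mdeg p \<Longrightarrow> u j q = v j q) \<Longrightarrow> T u i p = T v i p"
  shows "\<exists>u. T u = u"
proof -
  define U where "U n = (T ^^ n) (\<lambda>_ _. undefined)" for n
  have U_agree: "U m i p = U n i p" if "mdeg p < n" "n \<le> m" for m n i p
    using that
  proof (induction n arbitrary: m i p)
    case (Suc n)
    then obtain m' where m: "m = Suc m'" by (cases m) auto
    have "T (U m') i p = T (U n) i p"
    proof (rule assms)
      fix j and q :: "'k \<Rightarrow> nat" assume "mdeg q < mdeg p"
      then show "U m' j q = U n j q"
        by (intro Suc.IH) (use Suc.prems m \<open>mdeg q < mdeg p\<close> in auto)
    qed
    then show ?case by (simp add: m U_def)
  qed simp
  define u where "u i p = U (Suc (mdeg p)) i p" for i p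
  have "T u i p = u i p" for i p
  proof -
    have "T u i p = T (U (mdeg p)) i p"
    proof (rule assms)
      fix j and q :: "'k \<Rightarrow> nat" assume "mdeg q < mdeg p"
      then show "u j q = U (mdeg p) j q"
        unfolding u_def by (intro U_agree[symmetric]) auto
    qed
    then show ?thesis by (simp add: u_def U_def)
  qed
  then have "T u = u" by (intro ext)
  then show ?thesis by blast
qed

section \<open>Small divisors\<close>

text \<open>The product of successive drops of a decreasing list. In the chain lemma a 0 is
  appended, so that the last degree itself counts as a drop.\<close>

fun gaps :: "nat list \<Rightarrow> nat" where
  "gaps [] = 1"
| "gaps [x] = 1"
| "gaps (x # y # zs) = (x - y) * gaps (y # zs)"

lemma gaps_append: "gaps (as @ a # bs) = gaps (as @ [a]) * gaps (a # bs)"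
proof (induction as)
  case Nil then show ?case by simp
next
  case (Cons x as)
  then show ?case by (cases as) auto
qed

text \<open>The minimum times the maximum is \<open>u * v\<close>, and \<open>u + v\<close> is at
  most twice the maximum. This 2 is the origin of \<open>2 ^ T\<close> in the chain lemma.\<close>

lemma min_mult_add_le: "min u v * (u + v) \<le> 2 * (u * v)" for u v :: nat
proof (cases "u \<le> v")
  case True
  then have "u * u \<le> u * v" by simp
  then show ?thesis using True by (simp add: min_def distrib_left)
next
  case False
  then have "v * v \<le> u * v" by simp
  then show ?thesis using False by (simp add: min_def distrib_left mult.commute)
qed

text \<open>Siegel's lemma on small divisors. Removing an element with the smallest \<open>d\<close> merges two gaps
  \<open>u\<close>, \<open>v\<close> into \<open>u + v\<close>, and costs a factor \<open>d \<le> N * min u v ^ T\<close>.\<close>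

lemma siegel_chain:
  fixes xs :: "(nat \<times> real) list" and N :: real
  assumes "N \<ge> 1"
    and "\<And>x. x \<in> set xs \<Longrightarrow> 0 \<le> snd x \<and> snd x \<le> N * real (fst x) ^ T \<and> 0 < fst x"
    and "sorted_wrt (\<lambda>x y. fst y < fst x \<and> min (snd x) (snd y) \<le> N * real (fst x - fst y) ^ T) xs"
  shows "prod_list (map snd xs) \<le> (2 ^ T * N) ^ length xs * real (gaps (map fst xs @ [0])) ^ T"
  using assms(2,3)
proof (induction "length xs" arbitrary: xs)
  case 0 then show ?case by simp
next
  case (Suc n)
  from Suc.hyps(2) have "set xs \<noteq> {}" by auto
  then obtain x where x: "x \<in> set xs" "\<And>y. y \<in> set xs \<Longrightarrow> snd x \<le> snd y"
    by (metis (no_types, lifting) List.finite_set arg_min_if_finite(1) arg_min_least)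
  obtain as bs where xs: "xs = as @ x # bs" using x(1) by (meson split_list)
  \<comment> \<open>\<open>b\<close> is the degree following \<open>x\<close>, or the final 0 if
    \<open>x\<close> is last, so a gap below \<open>x\<close> is always available.\<close>
  define b rest where "b = hd (map fst bs @ [0])" and "rest = tl (map fst bs @ [0])"
  have brest: "map fst bs @ [0] = b # rest"
    unfolding b_def rest_def by (cases bs) auto
  have nonneg: "0 \<le> snd x" using Suc.prems(1) x by blast
  \<comment> \<open>Since \<open>snd x\<close> is least, its minimum with the value of a neighbour
    is \<open>snd x\<close> itself.\<close>
  have xb: "snd x \<le> N * real (fst x - b) ^ T \<and> b < fst x"
  proof (cases bs)
    case Nil then show ?thesis using Suc.prems(1)[of x] x by (simp add: b_def)
  next
    case (Cons y bs')
    then have "fst y < fst x \<and> min (snd x) (snd y) \<le> N * real (fst x - fst y) ^ T"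
      using Suc.prems(2) by (simp add: xs sorted_wrt_append del: of_nat_diff)
    moreover have "snd x \<le> snd y" using x(2)[of y] xs Cons by simp
    ultimately show ?thesis by (simp add: b_def Cons min_def del: of_nat_diff)
  qed
  have IH: "prod_list (map snd (as @ bs)) \<le> (2 ^ T * N) ^ n * real (gaps (map fst (as @ bs) @ [0])) ^ T"
  proof -
    have "sorted_wrt (\<lambda>x y. fst y < fst x \<and> min (snd x) (snd y) \<le> N * real (fst x - fst y) ^ T) (as @ bs)"
      using Suc.prems(2) by (simp add: xs sorted_wrt_append)
    moreover have "n = length (as @ bs)" using Suc.hyps(2) xs by simp
    ultimately show ?thesis
      using Suc.hyps(1)[of "as @ bs"] Suc.prems(1) xs by auto
  qed
  have key: "snd x * real (gaps (map fst (as @ bs) @ [0])) ^ T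
      \<le> 2 ^ T * N * real (gaps (map fst (as @ x # bs) @ [0])) ^ T"
  proof (cases as rule: rev_cases)
    case Nil
    have "snd x * real (gaps (b # rest)) ^ T \<le> N * real (fst x - b) ^ T * real (gaps (b # rest)) ^ T"
      using xb by (intro mult_right_mono) auto
    also have "\<dots> \<le> 2 ^ T * (N * real (fst x - b) ^ T * real (gaps (b # rest)) ^ T)"
      using mult_right_mono[of 1 "2 ^ T" "N * real (fst x - b) ^ T * real (gaps (b # rest)) ^ T"] assms(1) by simp
    finally show ?thesis
      using Nil brest by (simp add: power_mult_distrib mult_ac)
  next
    \<comment> \<open>Now there are gaps both above and below \<open>x\<close>, and each of them
      bounds \<open>snd x\<close>. At the head of the list removal merely deletes the gap below;
      here the two gaps merge.\<close>
    case (snoc as' y)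
    have "fst x < fst y \<and> min (snd y) (snd x) \<le> N * real (fst y - fst x) ^ T"
      using Suc.prems(2) by (simp add: xs snoc sorted_wrt_append del: of_nat_diff)
    moreover have "snd x \<le> snd y" using x(2)[of y] xs snoc by simp
    ultimately have xa: "snd x \<le> N * real (fst y - fst x) ^ T" "fst x < fst y"
      by (auto simp: min_def simp del: of_nat_diff split: if_splits)
    define u v where "u = fst y - fst x" and "v = fst x - b"
    have "snd x \<le> N * real (min u v) ^ T"
      using xb xa by (simp add: u_def v_def min_def del: of_nat_diff)
    then have "snd x * real (u + v) ^ T \<le> N * real (min u v) ^ T * real (u + v) ^ T"
      by (intro mult_right_mono) auto
    also have "\<dots> = N * real (min u v * (u + v)) ^ T"
      by (simp add: power_mult_distrib)
    also have "\<dots> \<le> N * real (2 * (u * v)) ^ T"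
      using assms(1) min_mult_add_le[of u v] by (intro mult_left_mono power_mono of_nat_mono) auto
    also have "\<dots> = 2 ^ T * N * real (u * v) ^ T"
      by (simp add: power_mult_distrib)
    finally have uv: "snd x * real (u + v) ^ T \<le> 2 ^ T * N * real (u * v) ^ T" .
    define g where "g = gaps (map fst as' @ [fst y]) * gaps (b # rest)"
    have "fst y - b = u + v" using xa xb by (simp add: u_def v_def)
    then have g1: "gaps (map fst (as @ bs) @ [0]) = (u + v) * g"
      using brest by (simp add: snoc gaps_append[of "map fst as'" "fst y" "b # rest"] g_def)
    have g2: "gaps (map fst (as @ x # bs) @ [0]) = (u * v) * g"
      using brest by (simp add: snoc gaps_append[of "map fst as'" "fst y" "fst x # b # rest"] g_def u_def v_def)
    have "snd x * real (u + v) ^ T * real g ^ T \<le> 2 ^ T * N * real (u * v) ^ T * real g ^ T"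
      using uv by (rule mult_right_mono) simp
    then show ?thesis unfolding g1 g2 by (simp add: power_mult_distrib mult_ac)
  qed
  have "prod_list (map snd xs) = snd x * prod_list (map snd (as @ bs))"
    by (simp add: xs)
  also have "\<dots> \<le> snd x * ((2 ^ T * N) ^ n * real (gaps (map fst (as @ bs) @ [0])) ^ T)"
    using IH nonneg by (rule mult_left_mono)
  also have "\<dots> = (2 ^ T * N) ^ n * (snd x * real (gaps (map fst (as @ bs) @ [0])) ^ T)"
    by simp
  also have "\<dots> \<le> (2 ^ T * N) ^ n * (2 ^ T * N * real (gaps (map fst (as @ x # bs) @ [0])) ^ T)"
    using key assms(1) by (intro mult_left_mono) auto
  also have "\<dots> = (2 ^ T * N) ^ length xs * real (gaps (map fst xs @ [0])) ^ T"
    using Suc.hyps(2)[symmetric] by (simp add: xs)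
  finally show ?case .
qed

section \<open>Inequalities between sums and products of degrees\<close>

text \<open>For numbers at least 1 the sum of two is at most twice their product; each element
  contributes one such factor 2.\<close>

lemma sum_list_le_prod_list_double:
  assumes "\<And>s. s \<in> set ss \<Longrightarrow> 1 \<le> (s::nat)"
  shows "sum_list ss \<le> 2 ^ length ss * prod_list ss" "1 \<le> prod_list ss"
proof -
  have "sum_list ss \<le> 2 ^ length ss * prod_list ss \<and> 1 \<le> prod_list ss"
    using assms
  proof (induction ss)
    case (Cons s ss)
    let ?P = "2 ^ length ss * prod_list ss"
    have IH: "sum_list ss \<le> ?P" "1 \<le> prod_list ss" "1 \<le> s" using Cons by auto
    then have P: "1 \<le> ?P" using mult_le_mono[of 1 "2 ^ length ss" 1 "prod_list ss"] by simp
    have "s \<le> s * ?P" "?P \<le> s * ?P" using P IH by auto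
    then have "s + sum_list ss \<le> 2 * (s * ?P)" using IH by linarith
    then show ?case using IH by (simp add: mult_ac one_le_mult_iff)
  qed simp
  then show "sum_list ss \<le> 2 ^ length ss * prod_list ss" "1 \<le> prod_list ss" by auto
qed

text \<open>Appending \<open>s\<close> adds \<open>2 * s * S + s * (s - h)\<close> to
  \<open>S * (S - h)\<close>, and the second term is not positive. The gain is quadratic growth:
  once the sum exceeds the cap \<open>h\<close> on single parts by a fixed proportion, the product
  controls the square of the sum.\<close>

lemma sum_list_quadratic_le_prod_list:
  assumes "\<And>s. s \<in> set ss \<Longrightarrow> 1 \<le> (s::nat) \<and> real s \<le> h"
  shows "real (sum_list ss) * (real (sum_list ss) - h) \<le> 4 ^ length ss * real (prod_list ss)"
  using assms
proof (induction ss)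
  case (Cons s ss)
  define P where "P = 4 ^ length ss * real (prod_list ss)"
  define S where "S = real (sum_list ss)"
  have s: "1 \<le> real s" "real s \<le> h" using Cons.prems[of s] by auto
  have S0: "S \<ge> 0" by (simp add: S_def)
  have IH: "S * (S - h) \<le> P" using Cons by (simp add: S_def P_def)
  have "S \<le> real (2 ^ length ss * prod_list ss)"
    unfolding S_def using sum_list_le_prod_list_double(1)[of ss] Cons.prems
    by (intro of_nat_mono) auto
  also have "\<dots> \<le> P"
  proof -
    have "(2::real) ^ length ss \<le> 4 ^ length ss" by (intro power_mono) auto
    then show ?thesis by (simp add: P_def mult_right_mono)
  qed
  finally have SP: "S \<le> P" .
  have "(real s + S) * (real s + S - h) = S * (S - h) + 2 * real s * S + real s * (real s - h)"
    by (simp add: algebra_simps)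
  also have "real s * (real s - h) \<le> 0" using s by (simp add: mult_nonneg_nonpos)
  also have "2 * real s * S \<le> 2 * real s * P" using SP s by (simp add: mult_left_mono)
  also have "S * (S - h) + 2 * real s * P + 0 \<le> 4 * real s * P"
  proof -
    have "P \<le> real s * P" using s SP S0 by (simp add: mult_le_cancel_right1)
    moreover have "0 \<le> P" using SP S0 by linarith
    ultimately show ?thesis using IH by linarith
  qed
  finally show ?case by (simp add: P_def S_def mult_ac)
qed simp

text \<open>In the application \<open>q\<close> is the degree at the end of a chain starting in
  degree \<open>k\<close>, \<open>ss\<close> the degrees of the factors found there,
  \<open>r\<close> the number of links and \<open>G\<close> the product of the drops. About three
  powers of \<open>k\<close> have to be paid for, either by the parts in \<open>ss\<close> alone or
  by these together with the drop from \<open>k\<close> to \<open>q\<close>.\<close>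

lemma siegel_endgame:
  fixes G k q r :: nat and ss :: "nat list"
  assumes ss: "\<And>s. s \<in> set ss \<Longrightarrow> 1 \<le> s \<and> 2 * s \<le> k" "2 \<le> length ss" "sum_list ss = q"
    and "k < 2 * q" "q \<le> k" "1 \<le> G" "k \<le> q + 2 ^ r * G" "r = 0 \<Longrightarrow> k = q"
  shows "real q * real k ^ 2 * 4 ^ r \<le> 256 ^ (length ss + 2 * r) * real (prod_list ss) ^ 2 * real G"
proof -
  define P where "P = real (prod_list ss)"
  define m where "m = length ss"
  have k1: "real k \<ge> 1" using assms(4,5) by linarith
  have P1: "P \<ge> 1" using sum_list_le_prod_list_double(2)[of ss] ss(1) by (simp add: P_def)
  have qk: "real q * real k ^ 2 \<le> real k ^ 3"
  proof -
    have "real q * real k ^ 2 \<le> real k * real k ^ 2" using assms(5) by (intro mult_right_mono) auto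
    then show ?thesis by (simp add: power3_eq_cube power2_eq_square)
  qed
  have e: "(256::real) ^ (m + 2 * r) = 256 ^ m * 65536 ^ r"
    by (simp add: power_add power_mult)
  show ?thesis
  proof (cases "4 * q \<ge> 3 * k")
    \<comment> \<open>Parts of size at most \<open>k / 2\<close> with sum at least
      \<open>3 * k / 4\<close> have a product of order \<open>k ^ 2\<close>, whose square covers
      \<open>k ^ 3\<close>.\<close>
    case True
    have "real q * (real q - real k / 2) \<le> 4 ^ m * P"
      using sum_list_quadratic_le_prod_list[of ss "real k / 2"] ss(1,3) by (fastforce simp: m_def P_def)
    moreover have "(3 * real k / 4) * (real k / 4) \<le> real q * (real q - real k / 2)"
      using True by (intro mult_mono) auto
    ultimately have "3 * real k ^ 2 \<le> 16 * (4 ^ m * P)"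
      by (simp add: power2_eq_square)
    then have "(3 * real k ^ 2) ^ 2 \<le> (16 * (4 ^ m * P)) ^ 2"
      by (intro power_mono) auto
    then have "9 * real k ^ 4 \<le> 256 * (16 ^ m * P ^ 2)"
    proof -
      have "(16::real) ^ m = 4 ^ m * 4 ^ m" by (simp flip: power_mult_distrib)
      moreover have "real k ^ 4 = real k ^ 2 * real k ^ 2" by (simp flip: power_add)
      ultimately show ?thesis
        using \<open>(3 * real k ^ 2) ^ 2 \<le> (16 * (4 ^ m * P)) ^ 2\<close>
        by (simp add: power2_eq_square mult_ac)
    qed
    moreover have "(256::real) \<le> 16 ^ m"
    proof -
      have "(16::real) ^ 2 \<le> 16 ^ m" using ss(2) by (intro power_increasing) (auto simp: m_def)
      then show ?thesis by simp
    qed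
    then have "256 * (16 ^ m * P ^ 2) \<le> 16 ^ m * (16 ^ m * P ^ 2)"
      by (intro mult_right_mono) auto
    moreover have "(16::real) ^ m * 16 ^ m = 256 ^ m"
      by (simp flip: power_mult_distrib)
    moreover have "real k ^ 3 \<le> 9 * real k ^ 4"
    proof -
      have "real k ^ 3 * 1 \<le> real k ^ 3 * (9 * real k)" using k1 by (intro mult_left_mono) auto
      then show ?thesis by (simp add: numeral_eq_Suc)
    qed
    ultimately have main: "real q * real k ^ 2 \<le> 256 ^ m * P ^ 2"
      using qk by (simp flip: mult.assoc)
    have "real q * real k ^ 2 * 4 ^ r \<le> (256 ^ m * P ^ 2) * 65536 ^ r"
      using main by (rule mult_mono) (auto intro: power_mono)
    also have "\<dots> \<le> (256 ^ m * P ^ 2) * 65536 ^ r * real G"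
      using mult_left_mono[of 1 "real G" "(256 ^ m * P ^ 2) * 65536 ^ r"] assms(6) by simp
    finally show ?thesis using e by (simp add: m_def P_def mult_ac)
  next
    \<comment> \<open>Here the product of the parts is only of order \<open>k\<close> and its square
      of order \<open>k ^ 2\<close>. The missing power comes from \<open>k - q > k / 4\<close>,
      which forces \<open>2 ^ r * G\<close> to be of order \<open>k\<close>.\<close>
    case False
    have P2: "real k / 2 \<le> 2 ^ m * P"
    proof -
      have "real (sum_list ss) \<le> real (2 ^ length ss * prod_list ss)"
        using sum_list_le_prod_list_double(1)[of ss] ss(1) by (intro of_nat_mono) auto
      then show ?thesis using assms(4) ss(3) by (simp add: m_def P_def)
    qed
    have G: "real k / 4 \<le> 2 ^ r * real G"
    proof -
      have "real k \<le> real (q + 2 ^ r * G)" using assms(7) by (intro of_nat_mono)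
      then show ?thesis using False by (simp add: not_le)
    qed
    have "(real k / 2) ^ 2 * (real k / 4) \<le> (2 ^ m * P) ^ 2 * (2 ^ r * real G)"
      using P2 G by (intro mult_mono power_mono) auto
    then have "real k ^ 3 \<le> 16 * (4 ^ m * P ^ 2 * (2 ^ r * real G))"
      by (simp add: power2_eq_square power3_eq_cube field_simps flip: power_mult_distrib)
    then have "real k ^ 3 * 4 ^ r \<le> 16 * (4 ^ m * P ^ 2 * (2 ^ r * real G)) * 4 ^ r"
      by (rule mult_right_mono) simp
    also have "\<dots> = (16 * 4 ^ m) * (P ^ 2 * real G) * 8 ^ r"
      by (simp add: mult_ac flip: power_mult_distrib)
    also have "\<dots> \<le> 256 ^ m * (P ^ 2 * real G) * 65536 ^ r"
    proof (intro mult_mono power_mono)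
      have "(4::real) ^ 2 \<le> 4 ^ m" using ss(2) by (intro power_increasing) (auto simp: m_def)
      then have "(16::real) * 4 ^ m \<le> 4 ^ m * 4 ^ m" by simp
      also have "\<dots> = 16 ^ m" by (simp flip: power_mult_distrib)
      also have "\<dots> \<le> 256 ^ m" by (intro power_mono) auto
      finally show "(16::real) * 4 ^ m \<le> 256 ^ m" .
    qed (use P1 in auto)
    finally have "real k ^ 3 * 4 ^ r \<le> 256 ^ m * (P ^ 2 * real G) * 65536 ^ r" .
    moreover have "real q * real k ^ 2 * 4 ^ r \<le> real k ^ 3 * 4 ^ r"
      using qk by (rule mult_right_mono) simp
    ultimately have "real q * real k ^ 2 * 4 ^ r \<le> 256 ^ m * (P ^ 2 * real G) * 65536 ^ r"
      by linarith
    then show ?thesis using e by (simp add: m_def P_def mult_ac)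
  qed
qed

section \<open>Decompositions of modes and the weights that collect their divisors\<close>

lemma mdeg_sum_list:
  fixes ps :: "('k::finite \<Rightarrow> nat) list"
  shows "mdeg (sum_list ps) = sum_list (map mdeg ps)"
proof (induction ps)
  case Nil
  have "mdeg (sum_list [] :: 'k \<Rightarrow> nat) = mdeg (0 :: 'k \<Rightarrow> nat)" by (simp only: sum_list.Nil)
  then show ?case by (simp only: mdeg_zero list.map sum_list.Nil)
qed (simp del: plus_fun_apply)

lemma prod_list_map_mono:
  assumes "\<And>x. x \<in> set xs \<Longrightarrow> f x \<le> g x" "\<And>x. x \<in> set xs \<Longrightarrow> (0::real) \<le> f x"
  shows "(\<Prod>x\<leftarrow>xs. f x) \<le> (\<Prod>x\<leftarrow>xs. g x)"
  using assms by (induction xs) (auto intro!: mult_mono' prod_list_nonneg)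

text \<open>The weight \<open>wt\<close> encodes which modes can occur: it is \<open>0\<close> under time decay, where all of them do, and
  the degree in \<open>y\<close> in the linear case.\<close>

definition good_mode :: "('k::finite \<Rightarrow> nat) \<Rightarrow> 'k \<Rightarrow> ('k \<Rightarrow> nat) \<Rightarrow> bool" where
  "good_mode wt i p \<longleftrightarrow> idot wt p = wt i"

text \<open>The index patterns of products of series coefficients entering the coefficient
  \<open>p\<close> of a composition. There are at least two factors because the nonlinearity starts
  with quadratic terms; the factors are listed in order because powers are expanded one factor at a
  time.\<close>

definition decomps :: "('k::finite \<Rightarrow> nat) \<Rightarrow> ('k \<Rightarrow> nat) \<Rightarrow> ('k \<times> ('k \<Rightarrow> nat)) list set" where
  "decomps wt p = {ds. 2 \<le> length ds \<and> (\<forall>(j, q)\<in>set ds. q \<noteq> 0 \<and> good_mode wt j q) \<and> sum_list (map snd ds) = p}"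

text \<open>As there are at least two nonzero parts, each has strictly smaller degree; this is what
  makes recursion over decompositions end.\<close>

lemma decomps_degree:
  assumes "ds \<in> decomps wt p"
  shows "(\<Sum>x\<leftarrow>ds. mdeg (snd x)) = mdeg p"
    and "x \<in> set ds \<Longrightarrow> 1 \<le> mdeg (snd x)" and "x \<in> set ds \<Longrightarrow> mdeg (snd x) < mdeg p"
    and "length ds \<le> mdeg p"
proof -
  show sum: "(\<Sum>x\<leftarrow>ds. mdeg (snd x)) = mdeg p"
    using assms by (auto simp: decomps_def mdeg_sum_list comp_def)
  show pos: "1 \<le> mdeg (snd x)" if "x \<in> set ds" for x
    using assms that mdeg_eq_0_iff[of "snd x"] by (fastforce simp: decomps_def)
  have len: "length es \<le> (\<Sum>x\<leftarrow>es. mdeg (snd x))" if "set es \<subseteq> set ds" for es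
    using that
  proof (induction es)
    case (Cons x es) then show ?case using pos[of x] by simp
  qed simp
  show "length ds \<le> mdeg p" using len[of ds] sum by simp
  show "mdeg (snd x) < mdeg p" if x: "x \<in> set ds" for x
  proof -
    obtain as bs where ds: "ds = as @ x # bs" using split_list[OF x] by blast
    have "length (as @ bs) \<le> (\<Sum>x\<leftarrow>as @ bs. mdeg (snd x))" by (rule len) (auto simp: ds)
    moreover have "length (as @ bs) \<ge> 1" using assms by (auto simp: decomps_def ds)
    ultimately show ?thesis using sum by (simp add: ds)
  qed
qed

lemma finite_decomps: "finite (decomps wt p)"
proof -
  have "decomps wt p \<subseteq> {ds. set ds \<subseteq> UNIV \<times> {q. mdeg q \<le> mdeg p} \<and> length ds \<le> mdeg p}"
    using decomps_degree(3,4) by (fastforce intro: less_imp_le)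
  then show ?thesis
    by (rule finite_subset) (intro finite_lists_length_le finite_cartesian_product, auto simp: finite_mdeg_le)
qed

text \<open>\<open>D i p\<close> is the factor by which solving the mode \<open>(i, p)\<close> may
  enlarge its forcing. \<open>D_min\<close> is the separation property behind Siegel's argument: for
  nested modes both factors can be large only if the degrees are far apart.\<close>

locale small_divisors =
  fixes wt :: "'k::finite \<Rightarrow> nat" and D :: "'k \<Rightarrow> ('k \<Rightarrow> nat) \<Rightarrow> real" and N :: real and T :: nat
  assumes D_nonneg: "D i p \<ge> 0" and N_ge_1: "N \<ge> 1"
    and D_le: "good_mode wt i p \<Longrightarrow> 2 \<le> mdeg p \<Longrightarrow> D i p \<le> N * real (mdeg p) ^ T"
    and D_min: "good_mode wt i p \<Longrightarrow> good_mode wt j q \<Longrightarrow> q \<le> p \<Longrightarrow> q \<noteq> p \<Longrightarrow> 2 \<le> mdeg q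
      \<Longrightarrow> min (D i p) (D j q) \<le> N * real (mdeg p - mdeg q) ^ T"
begin

text \<open>\<open>2 ^ T * N\<close> is the price of one element in the chain lemma. The number
  65536 is \<open>256 ^ 2\<close>: the power \<open>256 ^ (m + 2 * r)\<close> of the final
  inequality is at most \<open>256 ^ (2 * (m - 1 + r))\<close> when
  \<open>m \<ge> 2\<close>.\<close>

definition C :: real where "C = 2 ^ T * N * 65536 ^ T"

lemma C_ge: "C \<ge> 1" "C \<ge> 4 ^ T" "C \<ge> 2 ^ T * N * 65536 ^ T"
proof -
  have 1: "(4::real) ^ T \<le> 65536 ^ T" by (intro power_mono) auto
  have "1 * 1 \<le> 2 ^ T * N" using N_ge_1 by (intro mult_mono) auto
  then have "1 * 65536 ^ T \<le> 2 ^ T * N * 65536 ^ T" by (intro mult_right_mono) auto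
  then show "C \<ge> 4 ^ T" using 1 unfolding C_def by linarith
  then show "C \<ge> 1" using one_le_power[of "4::real" T] by linarith
qed (simp add: C_def)

text \<open>The polynomial denominator absorbs the product of gaps produced by the chain lemma; this is what
  closes the induction on the degree.\<close>

definition bnd :: "nat \<Rightarrow> real" where "bnd k = C ^ k / (C * real k ^ (2 * T))"

lemma bnd_nonneg: "bnd k \<ge> 0"
  using C_ge(1) by (simp add: bnd_def)

lemma prod_list_bnd:
  "(\<Prod>s\<leftarrow>ss. bnd s) = C ^ sum_list ss / (C ^ length ss * real (prod_list ss) ^ (2 * T))"
  by (induction ss) (simp_all add: bnd_def power_add power_mult_distrib)

text \<open>A group of factors is charged like one factor of the total degree, at the extra rate
  \<open>4 ^ T / C \<le> 1\<close>. That total degree will be the drop in one link of the chain, so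
  its power in the denominator supplies the square of the gap.\<close>

lemma prod_list_bnd_le:
  assumes "\<And>s. s \<in> set ss \<Longrightarrow> 1 \<le> s" "ss \<noteq> []"
  shows "(\<Prod>s\<leftarrow>ss. bnd s) \<le> C ^ sum_list ss * (4 ^ T / C) / real (sum_list ss) ^ (2 * T)"
proof -
  let ?S = "real (sum_list ss)" and ?P = "real (prod_list ss)" and ?m = "length ss"
  have "sum_list ss \<ge> 1" using assms by (cases ss) (auto simp: add_increasing2)
  then have S: "?S \<ge> 1" by linarith
  have P: "?P \<ge> 1" using sum_list_le_prod_list_double(2)[OF assms(1)] by (simp add: Suc_le_eq)
  have "?S \<le> real (2 ^ ?m * prod_list ss)"
    using sum_list_le_prod_list_double(1)[OF assms(1)] by (rule of_nat_mono)
  then have "?S ^ (2 * T) \<le> (2 ^ ?m * ?P) ^ (2 * T)" by (intro power_mono) auto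
  also have "\<dots> = (4 ^ T) ^ ?m * ?P ^ (2 * T)"
  proof -
    have "((2::real) ^ ?m) ^ (2 * T) = (4 ^ T) ^ ?m"
    proof -
      have "(4::real) = 2 ^ 2" by simp
      then show ?thesis by (simp only: power_mult[symmetric] mult_ac)
    qed
    then show ?thesis by (simp add: power_mult_distrib)
  qed
  finally have SP: "?S ^ (2 * T) \<le> (4 ^ T) ^ ?m * ?P ^ (2 * T)" .
  have quot: "4 ^ T / C \<le> 1" "0 \<le> 4 ^ T / C" using C_ge by auto
  have "(4 ^ T / C) ^ ?m \<le> (4 ^ T / C) ^ 1"
    using quot assms(2) by (intro power_decreasing) (auto simp: Suc_le_eq)
  then have m: "(4 ^ T) ^ ?m / C ^ ?m \<le> 4 ^ T / C" by (simp add: power_divide)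
  have "(\<Prod>s\<leftarrow>ss. bnd s) * ?S ^ (2 * T) \<le> (\<Prod>s\<leftarrow>ss. bnd s) * ((4 ^ T) ^ ?m * ?P ^ (2 * T))"
    using SP C_ge(1) by (intro mult_left_mono) (auto simp: prod_list_bnd)
  also have "\<dots> = C ^ sum_list ss * ((4 ^ T) ^ ?m / C ^ ?m)"
    using P by (simp add: prod_list_bnd)
  also have "\<dots> \<le> C ^ sum_list ss * (4 ^ T / C)"
    using m C_ge(1) by (intro mult_left_mono) auto
  finally have "(\<Prod>s\<leftarrow>ss. bnd s) * ?S ^ (2 * T) \<le> C ^ sum_list ss * (4 ^ T / C)" .
  moreover have "0 < ?S ^ (2 * T)" using S by simp
  ultimately show ?thesis by (simp only: pos_le_divide_eq)
qed

text \<open>At most one factor of a decomposition has degree above half of \<open>k\<close>. Following that factor gives the chain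
  to which Siegel's lemma applies, and the induction hypothesis covers the factors left aside.\<close>

lemma chain_exists:
  fixes \<delta> :: "'k \<Rightarrow> ('k \<Rightarrow> nat) \<Rightarrow> real"
  assumes nonneg: "\<And>i p. \<delta> i p \<ge> 0"
    and step: "\<And>i p. good_mode wt i p \<Longrightarrow> 2 \<le> mdeg p \<Longrightarrow> \<delta> i p \<noteq> 0 \<Longrightarrow>
        \<exists>ds\<in>decomps wt p. \<delta> i p = D i p * (\<Prod>x\<leftarrow>ds. \<delta> (fst x) (snd x))"
    and IH: "\<And>i p. good_mode wt i p \<Longrightarrow> 1 \<le> mdeg p \<Longrightarrow> mdeg p < k \<Longrightarrow> \<delta> i p \<le> bnd (mdeg p)"
    and k: "2 \<le> k"
    and p: "good_mode wt i p" "mdeg p \<le> k" "k < 2 * mdeg p" "\<delta> i p \<noteq> 0"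
  shows "\<exists>ms ss. ms \<noteq> [] \<and> hd ms = (i, p) \<and>
     (\<forall>x\<in>set ms. good_mode wt (fst x) (snd x) \<and> k < 2 * mdeg (snd x) \<and> snd x \<le> p) \<and>
     sorted_wrt (\<lambda>x y. snd y \<le> snd x \<and> snd y \<noteq> snd x) ms \<and>
     (\<forall>s\<in>set ss. 1 \<le> s \<and> 2 * s \<le> k) \<and> 2 \<le> length ss \<and> sum_list ss = mdeg (snd (last ms)) \<and>
     1 \<le> gaps (map (mdeg \<circ> snd) ms) \<and>
     mdeg p \<le> mdeg (snd (last ms)) + 2 ^ (length ms - 1) * gaps (map (mdeg \<circ> snd) ms) \<and>
     (length ms = 1 \<longrightarrow> mdeg p = mdeg (snd (last ms))) \<and>
     mdeg (snd (last ms)) \<le> mdeg p \<and>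
     \<delta> i p \<le> (\<Prod>x\<leftarrow>ms. D (fst x) (snd x)) * (\<Prod>s\<leftarrow>ss. bnd s) *
       (C ^ (mdeg p - mdeg (snd (last ms))) * (4 ^ T / C) ^ (length ms - 1) / real (gaps (map (mdeg \<circ> snd) ms)) ^ (2 * T))"
  using p
proof (induction "mdeg p" arbitrary: i p rule: less_induct)
  case less
  have deg2: "2 \<le> mdeg p" using less.prems k by linarith
  then obtain ds where ds: "ds \<in> decomps wt p" and \<delta>: "\<delta> i p = D i p * (\<Prod>x\<leftarrow>ds. \<delta> (fst x) (snd x))"
    using step less.prems by blast
  have good: "good_mode wt (fst x) (snd x)" if "x \<in> set ds" for x
    using ds that by (auto simp: decomps_def)
  note deg = decomps_degree[OF ds]
  show ?case
  proof (cases "\<forall>x\<in>set ds. 2 * mdeg (snd x) \<le> k")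
    \<comment> \<open>No factor is above half of \<open>k\<close>: the chain consists of this mode
      alone, and the degrees of its factors form \<open>ss\<close>.\<close>
    case True
    have "(\<Prod>x\<leftarrow>ds. \<delta> (fst x) (snd x)) \<le> (\<Prod>x\<leftarrow>ds. bnd (mdeg (snd x)))"
    proof (rule prod_list_map_mono)
      fix x assume x: "x \<in> set ds"
      then have "mdeg (snd x) < k" using True k by fastforce
      then show "\<delta> (fst x) (snd x) \<le> bnd (mdeg (snd x))" using IH good deg(2) x by blast
    qed (simp add: nonneg)
    then have "\<delta> i p \<le> D i p * (\<Prod>x\<leftarrow>ds. bnd (mdeg (snd x)))"
      unfolding \<delta> using D_nonneg by (intro mult_left_mono)
    then have "\<delta> i p \<le> D i p * (\<Prod>s\<leftarrow>map (mdeg \<circ> snd) ds. bnd s)" by (simp add: comp_def)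
    moreover have "2 \<le> length ds" using ds by (simp add: decomps_def)
    ultimately show ?thesis
      using True less.prems deg by (intro exI[of _ "[(i, p)]"] exI[of _ "map (mdeg \<circ> snd) ds"]) (auto simp: comp_def)
  next
    case False
    \<comment> \<open>The heavy factor continues the chain. The others have total degree
      \<open>mdeg p - mdeg q\<close>, which is below \<open>k\<close>, so \<open>IH\<close> applies
      to each of them.\<close>
    then obtain j q where jq: "(j, q) \<in> set ds" "k < 2 * mdeg q" by fastforce
    obtain as bs where split: "ds = as @ (j, q) # bs" using jq(1) by (meson split_list)
    define rest where "rest = as @ bs"
    have qp: "mdeg q < mdeg p" using deg(3)[OF jq(1)] by simp
    have S: "(\<Sum>x\<leftarrow>rest. mdeg (snd x)) = mdeg p - mdeg q"
      using deg(1) by (simp add: rest_def split)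
    have rest_sub: "set rest \<subseteq> set ds" by (auto simp: rest_def split)
    have "rest \<noteq> []" using ds by (auto simp: decomps_def rest_def split)
    have prod_ds: "(\<Prod>x\<leftarrow>ds. \<delta> (fst x) (snd x)) = \<delta> j q * (\<Prod>x\<leftarrow>rest. \<delta> (fst x) (snd x))"
      by (simp add: rest_def split mult_ac)
    have "\<delta> j q \<noteq> 0" using less.prems(4) unfolding \<delta> prod_ds by auto
    moreover have "good_mode wt j q" using good[OF jq(1)] by simp
    ultimately obtain ms ss where M: "ms \<noteq> []" "hd ms = (j, q)"
      "\<forall>x\<in>set ms. good_mode wt (fst x) (snd x) \<and> k < 2 * mdeg (snd x) \<and> snd x \<le> q"
      "sorted_wrt (\<lambda>x y. snd y \<le> snd x \<and> snd y \<noteq> snd x) ms"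
      "\<forall>s\<in>set ss. 1 \<le> s \<and> 2 * s \<le> k" "2 \<le> length ss" "sum_list ss = mdeg (snd (last ms))"
      "1 \<le> gaps (map (mdeg \<circ> snd) ms)"
      "mdeg q \<le> mdeg (snd (last ms)) + 2 ^ (length ms - 1) * gaps (map (mdeg \<circ> snd) ms)"
      "mdeg (snd (last ms)) \<le> mdeg q"
      "\<delta> j q \<le> (\<Prod>x\<leftarrow>ms. D (fst x) (snd x)) * (\<Prod>s\<leftarrow>ss. bnd s) *
       (C ^ (mdeg q - mdeg (snd (last ms))) * (4 ^ T / C) ^ (length ms - 1) / real (gaps (map (mdeg \<circ> snd) ms)) ^ (2 * T))"
      using less.hyps[OF qp, of j] less.prems(2) jq(2) qp by fastforce
    define S' where "S' = mdeg p - mdeg q"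
    have S'1: "1 \<le> S'" using qp by (simp add: S'_def)
    have q_le: "q \<le> p"
    proof -
      have "p = q + sum_list (map snd rest)"
        using ds by (simp add: decomps_def rest_def split add_ac del: plus_fun_apply)
      then show ?thesis by (metis index_le_add(1))
    qed
    obtain ms' where ms: "ms = (j, q) # ms'" using M(1,2) by (cases ms) auto
    have gaps: "gaps (map (mdeg \<circ> snd) ((i, p) # ms)) = S' * gaps (map (mdeg \<circ> snd) ms)"
      by (simp add: ms S'_def)
    have "(\<Prod>x\<leftarrow>rest. \<delta> (fst x) (snd x)) \<le> (\<Prod>x\<leftarrow>rest. bnd (mdeg (snd x)))"
    proof (rule prod_list_map_mono)
      fix x assume x: "x \<in> set rest"
      then have "mdeg (snd x) \<le> (\<Sum>x\<leftarrow>rest. mdeg (snd x))"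
        by (intro member_le_sum_list) auto
      then have "mdeg (snd x) < k" using S qp jq(2) less.prems(2) by linarith
      then show "\<delta> (fst x) (snd x) \<le> bnd (mdeg (snd x))" using IH good deg(2) rest_sub x by blast
    qed (simp add: nonneg)
    also have "\<dots> = (\<Prod>s\<leftarrow>map (mdeg \<circ> snd) rest. bnd s)" by (simp add: comp_def)
    also have "\<dots> \<le> C ^ S' * (4 ^ T / C) / real S' ^ (2 * T)"
      using prod_list_bnd_le[of "map (mdeg \<circ> snd) rest"] deg(2) rest_sub \<open>rest \<noteq> []\<close> S
      by (force simp: comp_def S'_def)
    finally have rest_bound: "(\<Prod>x\<leftarrow>rest. \<delta> (fst x) (snd x)) \<le> C ^ S' * (4 ^ T / C) / real S' ^ (2 * T)" .
    have "\<delta> i p = D i p * (\<delta> j q * (\<Prod>x\<leftarrow>rest. \<delta> (fst x) (snd x)))"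
      using \<delta> prod_ds by simp
    also have "\<dots> \<le> D i p * (((\<Prod>x\<leftarrow>ms. D (fst x) (snd x)) * (\<Prod>s\<leftarrow>ss. bnd s) *
       (C ^ (mdeg q - mdeg (snd (last ms))) * (4 ^ T / C) ^ (length ms - 1) / real (gaps (map (mdeg \<circ> snd) ms)) ^ (2 * T)))
       * (C ^ S' * (4 ^ T / C) / real S' ^ (2 * T)))"
      using M(11) rest_bound D_nonneg nonneg
      by (intro mult_left_mono mult_mono') (auto intro!: prod_list_nonneg)
    also have "\<dots> = (\<Prod>x\<leftarrow>(i, p) # ms. D (fst x) (snd x)) * (\<Prod>s\<leftarrow>ss. bnd s) *
       ((C ^ S' * C ^ (mdeg q - mdeg (snd (last ms)))) * ((4 ^ T / C) * (4 ^ T / C) ^ (length ms - 1)) /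
         (real S' ^ (2 * T) * real (gaps (map (mdeg \<circ> snd) ms)) ^ (2 * T)))"
      by (simp add: mult_ac)
    also have "C ^ S' * C ^ (mdeg q - mdeg (snd (last ms))) = C ^ (mdeg p - mdeg (snd (last ((i, p) # ms))))"
    proof -
      have "mdeg p - mdeg (snd (last ms)) = S' + (mdeg q - mdeg (snd (last ms)))"
        using M(10) qp by (simp add: S'_def)
      then show ?thesis using M(1) by (simp add: power_add)
    qed
    also have "(4 ^ T / C) * (4 ^ T / C) ^ (length ms - 1) = (4 ^ T / C) ^ (length ((i, p) # ms) - 1)"
      using M(1) by (cases ms) auto
    also have "real S' ^ (2 * T) * real (gaps (map (mdeg \<circ> snd) ms)) ^ (2 * T) =
        real (gaps (map (mdeg \<circ> snd) ((i, p) # ms))) ^ (2 * T)"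
      unfolding gaps by (simp add: power_mult_distrib)
    finally have bound: "\<delta> i p \<le> (\<Prod>x\<leftarrow>(i, p) # ms. D (fst x) (snd x)) * (\<Prod>s\<leftarrow>ss. bnd s) *
       (C ^ (mdeg p - mdeg (snd (last ((i, p) # ms)))) * (4 ^ T / C) ^ (length ((i, p) # ms) - 1) /
         real (gaps (map (mdeg \<circ> snd) ((i, p) # ms))) ^ (2 * T))" .
    have last: "last ((i, p) # ms) = last ms" using M(1) by simp
    have len: "2 ^ (length ((i, p) # ms) - 1) = 2 * (2::nat) ^ (length ms - 1)"
      using M(1) by (cases ms) auto
    \<comment> \<open>For integers at least 1, \<open>S' + g \<le> 2 * (S' * g)\<close>; iterated
      along the chain this produces the power of 2 in front of the gaps.\<close>
    have sum_gap: "mdeg p \<le> mdeg (snd (last ms)) + 2 * 2 ^ (length ms - 1) * (S' * gaps (map (mdeg \<circ> snd) ms))"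
    proof -
      define g where "g = 2 ^ (length ms - 1) * gaps (map (mdeg \<circ> snd) ms)"
      have "g \<ge> 1" using M(8) by (simp add: g_def one_le_mult_iff)
      then have "S' + g \<le> S' * g + S' * g" using S'1 by (intro add_mono) auto
      then have "S' + g \<le> 2 * 2 ^ (length ms - 1) * (S' * gaps (map (mdeg \<circ> snd) ms))"
        by (simp add: g_def mult_ac)
      moreover have "mdeg p = S' + mdeg q" using qp by (simp add: S'_def)
      ultimately show ?thesis using M(9) unfolding g_def by linarith
    qed
    have elems: "snd x \<le> p \<and> snd x \<noteq> p" if "x \<in> set ms" for x
    proof -
      have "snd x \<le> q" using M(3) that by blast
      then have "mdeg (snd x) < mdeg p" using mdeg_mono[of "snd x" q] qp by linarith
      then show ?thesis using \<open>snd x \<le> q\<close> q_le order_trans by blast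
    qed
    show ?thesis
    proof (rule exI[of _ "(i, p) # ms"], rule exI[of _ ss], intro conjI)
      show "\<forall>x\<in>set ((i, p) # ms). good_mode wt (fst x) (snd x) \<and> k < 2 * mdeg (snd x) \<and> snd x \<le> p"
        using M(3) elems less.prems by auto
      show "sorted_wrt (\<lambda>x y. snd y \<le> snd x \<and> snd y \<noteq> snd x) ((i, p) # ms)"
        using M(4) elems by auto
      show "mdeg p \<le> mdeg (snd (last ((i, p) # ms))) +
          2 ^ (length ((i, p) # ms) - 1) * gaps (map (mdeg \<circ> snd) ((i, p) # ms))"
        unfolding last len gaps using sum_gap by simp
      show "1 \<le> gaps (map (mdeg \<circ> snd) ((i, p) # ms))"
        unfolding gaps using S'1 M(8) by (simp add: one_le_mult_iff)
      show "length ((i, p) # ms) = 1 \<longrightarrow> mdeg p = mdeg (snd (last ((i, p) # ms)))"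
        using M(1) by simp
    qed (use M last qp bound in auto)
  qed
qed

text \<open>Up to constants the divisors along the heavy chain give \<open>(G * q) ^ T\<close>, the
  factors set aside give \<open>1 / G ^ (2 * T)\<close> and those at the end
  \<open>1 / P ^ (2 * T)\<close>. The inequality \<open>siegel_endgame\<close> turns what is left
  into the denominator of \<open>bnd k\<close>.\<close>

lemma weight_bound:
  fixes \<delta> :: "'k \<Rightarrow> ('k \<Rightarrow> nat) \<Rightarrow> real"
  assumes nonneg: "\<And>i p. \<delta> i p \<ge> 0"
    and low: "\<And>i p. mdeg p \<le> 1 \<Longrightarrow> \<delta> i p = 1"
    and step: "\<And>i p. good_mode wt i p \<Longrightarrow> 2 \<le> mdeg p \<Longrightarrow> \<delta> i p \<noteq> 0 \<Longrightarrow>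
        \<exists>ds\<in>decomps wt p. \<delta> i p = D i p * (\<Prod>x\<leftarrow>ds. \<delta> (fst x) (snd x))"
    and "good_mode wt i p" "1 \<le> mdeg p"
  shows "\<delta> i p \<le> bnd (mdeg p)"
  using assms(4,5)
proof (induction "mdeg p" arbitrary: i p rule: less_induct)
  case less
  show ?case
  proof (cases "mdeg p = 1 \<or> \<delta> i p = 0")
    case True
    then show ?thesis
    proof
      assume "mdeg p = 1" then show ?thesis using low[of p i] C_ge(1) by (simp add: bnd_def)
    qed (simp add: bnd_nonneg)
  next
    case False
    define k where "k = mdeg p"
    have k: "2 \<le> k" using False less.prems by (simp add: k_def)
    have IH: "\<delta> i p \<le> bnd (mdeg p)" if "good_mode wt i p" "1 \<le> mdeg p" "mdeg p < k" for i p
      using less.hyps that by (simp add: k_def)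
    obtain ms ss where M: "ms \<noteq> []" "hd ms = (i, p)"
      "\<forall>x\<in>set ms. good_mode wt (fst x) (snd x) \<and> k < 2 * mdeg (snd x) \<and> snd x \<le> p"
      "sorted_wrt (\<lambda>x y. snd y \<le> snd x \<and> snd y \<noteq> snd x) ms"
      "\<forall>s\<in>set ss. 1 \<le> s \<and> 2 * s \<le> k" "2 \<le> length ss" "sum_list ss = mdeg (snd (last ms))"
      "1 \<le> gaps (map (mdeg \<circ> snd) ms)"
      "k \<le> mdeg (snd (last ms)) + 2 ^ (length ms - 1) * gaps (map (mdeg \<circ> snd) ms)"
      "length ms = 1 \<longrightarrow> k = mdeg (snd (last ms))"
      "mdeg (snd (last ms)) \<le> k"
      "\<delta> i p \<le> (\<Prod>x\<leftarrow>ms. D (fst x) (snd x)) * (\<Prod>s\<leftarrow>ss. bnd s) *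
       (C ^ (k - mdeg (snd (last ms))) * (4 ^ T / C) ^ (length ms - 1) / real (gaps (map (mdeg \<circ> snd) ms)) ^ (2 * T))"
      using chain_exists[OF nonneg step IH k, of i p] less.prems False k unfolding k_def by fastforce
    define q r G m P where "q = mdeg (snd (last ms))" and "r = length ms - 1"
      and "G = gaps (map (mdeg \<circ> snd) ms)" and "m = length ss" and "P = real (prod_list ss)"
    have lenms: "length ms = Suc r" using M(1) by (simp add: r_def)
    have kq: "k < 2 * q" using M(1,3) by (simp add: q_def)
    have P1: "P \<ge> 1" using sum_list_le_prod_list_double(2)[of ss] M(5) by (simp add: P_def)
    have G1: "real G \<ge> 1" using M(8) by (simp add: G_def)
    have Dprod: "(\<Prod>x\<leftarrow>ms. D (fst x) (snd x)) \<le> (2 ^ T * N) ^ Suc r * (real G * real q) ^ T"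
    proof -
      define xs where "xs = map (\<lambda>x. (mdeg (snd x), D (fst x) (snd x))) ms"
      have "prod_list (map snd xs) \<le> (2 ^ T * N) ^ length xs * real (gaps (map fst xs @ [0])) ^ T"
      proof (rule siegel_chain)
        show "0 \<le> snd x \<and> snd x \<le> N * real (fst x) ^ T \<and> 0 < fst x" if "x \<in> set xs" for x
        proof -
          obtain y where y: "y \<in> set ms" "x = (mdeg (snd y), D (fst y) (snd y))"
            using \<open>x \<in> set xs\<close> by (auto simp: xs_def)
          then have "2 \<le> mdeg (snd y)" using M(3) k by fastforce
          then show ?thesis using y M(3) D_nonneg D_le by auto
        qed
        have "sorted_wrt (\<lambda>x y. mdeg (snd y) < mdeg (snd x) \<and>
            min (D (fst x) (snd x)) (D (fst y) (snd y)) \<le> N * real (mdeg (snd x) - mdeg (snd y)) ^ T) ms"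
        proof (rule sorted_wrt_mono_rel[OF _ M(4)])
          fix x y assume xy: "x \<in> set ms" "y \<in> set ms" "snd y \<le> snd x \<and> snd y \<noteq> snd x"
          have "2 \<le> mdeg (snd y)" using M(3) xy(2) k by fastforce
          moreover have "mdeg (snd y) < mdeg (snd x)"
          proof (rule ccontr)
            assume "\<not> ?thesis"
            then have "mdeg (snd x - snd y) = 0" using xy by (simp add: mdeg_diff)
            then have "snd x - snd y = 0" by (simp only: mdeg_eq_0_iff)
            then show False using xy index_diff_add(1) by (metis add_0_right)
          qed
          ultimately show "mdeg (snd y) < mdeg (snd x) \<and>
            min (D (fst x) (snd x)) (D (fst y) (snd y)) \<le> N * real (mdeg (snd x) - mdeg (snd y)) ^ T"
            using D_min xy M(3) by blast
        qed
        then show "sorted_wrt (\<lambda>x y. fst y < fst x \<and> min (snd x) (snd y) \<le> N * real (fst x - fst y) ^ T) xs"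
          by (simp add: xs_def sorted_wrt_map)
      qed (rule N_ge_1)
      \<comment> \<open>The appended 0 turns the last degree \<open>q\<close> into the final
        gap.\<close>
      moreover have "gaps (map fst xs @ [0]) = G * q"
      proof -
        have "map fst xs = map (mdeg \<circ> snd) ms" by (simp add: xs_def comp_def)
        moreover have "map (mdeg \<circ> snd) ms = butlast (map (mdeg \<circ> snd) ms) @ [q]"
          using M(1) append_butlast_last_id[of "map (mdeg \<circ> snd) ms"] by (simp add: q_def last_map)
        ultimately show ?thesis unfolding G_def
          by (metis append.assoc append_Cons append_Nil gaps.simps(2,3) gaps_append diff_zero mult_1_right)
      qed
      moreover have "prod_list (map snd xs) = (\<Prod>x\<leftarrow>ms. D (fst x) (snd x))"
        by (simp add: xs_def comp_def)
      moreover have "length xs = Suc r" by (simp add: xs_def lenms)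
      ultimately show ?thesis by simp
    qed
    have endgame: "real q * real k ^ 2 * 4 ^ r \<le> 256 ^ (m + 2 * r) * P ^ 2 * real G"
      unfolding m_def P_def
    proof (rule siegel_endgame)
      show "r = 0 \<Longrightarrow> k = q" using M(10) lenms by (simp add: q_def)
      show "\<And>s. s \<in> set ss \<Longrightarrow> 1 \<le> s \<and> 2 * s \<le> k" using M(5) by blast
    qed (use M kq in \<open>simp_all add: q_def r_def G_def\<close>)
    define N' where "N' = 2 ^ T * N"
    have N'1: "N' \<ge> 1"
    proof -
      have "1 * 1 \<le> 2 ^ T * N" using N_ge_1 by (intro mult_mono) auto
      then show ?thesis by (simp add: N'_def)
    qed
    have "(real q * real k ^ 2 * 4 ^ r) ^ T \<le> (256 ^ (m + 2 * r) * P ^ 2 * real G) ^ T"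
      using endgame by (intro power_mono) auto
    then have "N' ^ Suc r * (real q * real k ^ 2 * 4 ^ r) ^ T \<le> N' ^ Suc r * (256 ^ (m + 2 * r) * P ^ 2 * real G) ^ T"
      using N'1 by (intro mult_left_mono) auto
    also have "\<dots> = (N' ^ Suc r * (256 ^ (m + 2 * r)) ^ T) * (P ^ (2 * T) * real G ^ T)"
    proof -
      have "P ^ (2 * T) = (P ^ 2) ^ T" by (simp add: power_mult)
      then show ?thesis by (simp only: power_mult_distrib mult_ac)
    qed
    \<comment> \<open>Because \<open>m \<ge> 2\<close>, both \<open>Suc r \<le> m - 1 + r\<close>
      and \<open>m + 2 * r \<le> 2 * (m - 1 + r)\<close> hold.\<close>
    also have "N' ^ Suc r * (256 ^ (m + 2 * r)) ^ T \<le> C ^ (m - 1 + r)"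
    proof -
      have "N' ^ Suc r \<le> N' ^ (m - 1 + r)"
        using N'1 M(6) by (intro power_increasing) (auto simp: m_def)
      moreover have "(256::real) ^ (m + 2 * r) \<le> 256 ^ (2 * (m - 1 + r))"
        using M(6) by (intro power_increasing) (auto simp: m_def)
      then have "((256::real) ^ (m + 2 * r)) ^ T \<le> (256 ^ (2 * (m - 1 + r))) ^ T"
        by (intro power_mono) auto
      moreover have "((256::real) ^ (2 * (m - 1 + r))) ^ T = (65536 ^ T) ^ (m - 1 + r)"
      proof -
        have "(65536::real) = 256 ^ 2" by simp
        then show ?thesis by (simp only: power_mult[symmetric] mult_ac)
      qed
      ultimately have "N' ^ Suc r * (256 ^ (m + 2 * r)) ^ T \<le> N' ^ (m - 1 + r) * (65536 ^ T) ^ (m - 1 + r)"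
        using N'1 by (intro mult_mono) auto
      then show ?thesis by (simp add: C_def N'_def power_mult_distrib)
    qed
    then have "N' ^ Suc r * (256 ^ (m + 2 * r)) ^ T * (P ^ (2 * T) * real G ^ T) \<le> C ^ (m - 1 + r) * (P ^ (2 * T) * real G ^ T)"
      using P1 by (intro mult_right_mono) auto
    finally have main: "N' ^ Suc r * (real q ^ T * real k ^ (2 * T) * (4 ^ T) ^ r) \<le> C ^ (m - 1 + r) * (P ^ (2 * T) * real G ^ T)"
      by (simp add: power_mult_distrib power_mult[symmetric] mult.commute[of T])
    have C0: "C > 0" using C_ge(1) by linarith
    have "\<delta> i p \<le> (\<Prod>x\<leftarrow>ms. D (fst x) (snd x)) * (C ^ q / (C ^ m * P ^ (2 * T))) *
        (C ^ (k - q) * (4 ^ T / C) ^ r / real G ^ (2 * T))"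
      using M(12) unfolding prod_list_bnd M(7) by (simp add: q_def r_def G_def m_def P_def)
    also have "\<dots> \<le> (N' ^ Suc r * (real G * real q) ^ T) * (C ^ q / (C ^ m * P ^ (2 * T))) *
        (C ^ (k - q) * (4 ^ T / C) ^ r / real G ^ (2 * T))"
      using Dprod P1 G1 C0 unfolding N'_def by (intro mult_right_mono) auto
    also have "\<dots> = (C ^ q * C ^ (k - q)) * (N' ^ Suc r * (real q ^ T * real k ^ (2 * T) * (4 ^ T) ^ r)) /
        (C ^ m * C ^ r * P ^ (2 * T) * real G ^ T * real k ^ (2 * T))"
    proof -
      have "real G ^ (2 * T) = real G ^ T * real G ^ T" by (simp add: mult_2 power_add)
      then show ?thesis
        using G1 P1 C0 k by (simp add: field_simps power_mult_distrib power_divide)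
    qed
    also have "\<dots> \<le> (C ^ q * C ^ (k - q)) * (C ^ (m - 1 + r) * (P ^ (2 * T) * real G ^ T)) /
        (C ^ m * C ^ r * P ^ (2 * T) * real G ^ T * real k ^ (2 * T))"
      using main C0 P1 G1 by (intro divide_right_mono mult_left_mono) auto
    \<comment> \<open>\<open>C ^ (m - 1 + r)\<close> against \<open>C ^ m * C ^ r\<close> leaves one
      factor \<open>C\<close> below the line, the one in the definition of
      \<open>bnd\<close>.\<close>
    also have "\<dots> = bnd k"
    proof -
      have "C ^ q * C ^ (k - q) = C ^ k" using M(11) by (simp add: q_def flip: power_add)
      moreover have "C ^ m = C * C ^ (m - 1)" using M(6) by (cases ss) (auto simp: m_def)
      ultimately show ?thesis using C0 P1 G1 by (simp add: bnd_def power_add)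
    qed
    finally show ?thesis by (simp add: k_def)
  qed
qed

text \<open>\<open>\<delta> i p\<close> is the largest product of divisors over all trees of
  successive decompositions of \<open>p\<close>. The last property is the form in which the estimate
  of the solution uses it.\<close>

theorem weights_exist:
  "\<exists>\<delta>. (\<forall>i p. \<delta> i p \<ge> 0) \<and> (\<forall>i p. mdeg p \<le> 1 \<longrightarrow> \<delta> i p = 1) \<and>
    (\<forall>i p. good_mode wt i p \<longrightarrow> \<delta> i p \<le> C ^ mdeg p) \<and>
    (\<forall>i p. \<forall>ds\<in>decomps wt p. D i p * (\<Prod>x\<leftarrow>ds. \<delta> (fst x) (snd x)) \<le> \<delta> i p)"
proof -
  \<comment> \<open>The inserted 0 keeps the maximum defined and nonnegative when \<open>p\<close>
    has no decomposition.\<close>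
  define F where "F u i p = (if mdeg p \<le> 1 then 1 else
      D i p * Max (insert 0 ((\<lambda>ds. \<Prod>x\<leftarrow>ds. u (fst x) (snd x)) ` decomps wt p)))"
    for u :: "'k \<Rightarrow> ('k \<Rightarrow> nat) \<Rightarrow> real" and i :: 'k and p :: "'k \<Rightarrow> nat"
  have "\<exists>\<delta>. F \<delta> = \<delta>"
  proof (rule degree_recursion)
    fix u v :: "'k \<Rightarrow> ('k \<Rightarrow> nat) \<Rightarrow> real" and i :: 'k and p :: "'k \<Rightarrow> nat"
    assume uv: "\<And>j (q :: 'k \<Rightarrow> nat). mdeg q < mdeg p \<Longrightarrow> u j q = v j q"
    have "(\<lambda>ds. \<Prod>x\<leftarrow>ds. u (fst x) (snd x)) ` decomps wt p = (\<lambda>ds. \<Prod>x\<leftarrow>ds. v (fst x) (snd x)) ` decomps wt p"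
    proof (rule image_cong[OF refl])
      fix ds assume "ds \<in> decomps wt p"
      then show "(\<Prod>x\<leftarrow>ds. u (fst x) (snd x)) = (\<Prod>x\<leftarrow>ds. v (fst x) (snd x))"
        using uv decomps_degree(3) by (metis (no_types, lifting) map_cong)
    qed
    then show "F u i p = F v i p" by (simp add: F_def)
  qed
  then obtain \<delta> where F: "F \<delta> = \<delta>" ..
  have \<delta>: "\<delta> i p = (if mdeg p \<le> 1 then 1 else
      D i p * Max (insert 0 ((\<lambda>ds. \<Prod>x\<leftarrow>ds. \<delta> (fst x) (snd x)) ` decomps wt p)))" for i p
    using fun_cong[OF fun_cong[OF F], of i p] unfolding F_def by (rule sym)
  have fin: "finite (insert 0 ((\<lambda>ds. \<Prod>x\<leftarrow>ds. \<delta> (fst x) (snd x)) ` decomps wt p))" for p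
    by (simp add: finite_decomps)
  have nonneg: "\<delta> i p \<ge> 0" for i p
  proof -
    have "Max (insert 0 ((\<lambda>ds. \<Prod>x\<leftarrow>ds. \<delta> (fst x) (snd x)) ` decomps wt p)) \<ge> 0"
      using fin by (intro Max_ge) auto
    then show ?thesis using D_nonneg[of i p] by (subst \<delta>) auto
  qed
  have low: "\<delta> i p = 1" if "mdeg p \<le> 1" for i p
    using that by (subst \<delta>) simp
  have step: "\<exists>ds\<in>decomps wt p. \<delta> i p = D i p * (\<Prod>x\<leftarrow>ds. \<delta> (fst x) (snd x))"
    if "2 \<le> mdeg p" "\<delta> i p \<noteq> 0" for i p
  proof -
    have "Max (insert 0 ((\<lambda>ds. \<Prod>x\<leftarrow>ds. \<delta> (fst x) (snd x)) ` decomps wt p))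
        \<in> insert 0 ((\<lambda>ds. \<Prod>x\<leftarrow>ds. \<delta> (fst x) (snd x)) ` decomps wt p)"
      using fin by (intro Max_in) auto
    moreover have "Max (insert 0 ((\<lambda>ds. \<Prod>x\<leftarrow>ds. \<delta> (fst x) (snd x)) ` decomps wt p)) \<noteq> 0"
      using that by (subst (asm) \<delta>) auto
    ultimately obtain ds where "ds \<in> decomps wt p"
      "Max (insert 0 ((\<lambda>ds. \<Prod>x\<leftarrow>ds. \<delta> (fst x) (snd x)) ` decomps wt p)) = (\<Prod>x\<leftarrow>ds. \<delta> (fst x) (snd x))"
      by auto
    then show ?thesis using that by (subst \<delta>) auto
  qed
  have "\<delta> i p \<le> C ^ mdeg p" if "good_mode wt i p" for i p
  proof (cases "mdeg p = 0")
    case True then show ?thesis using low[of p i] by simp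
  next
    case False
    then have deg: "1 \<le> mdeg p" by linarith
    then have "\<delta> i p \<le> bnd (mdeg p)"
      using that by (intro weight_bound nonneg low step) auto
    also have "\<dots> \<le> C ^ mdeg p"
    proof -
      have "1 * 1 \<le> C * real (mdeg p) ^ (2 * T)"
        using C_ge(1) deg by (intro mult_mono one_le_power) auto
      then show ?thesis using C_ge(1) by (simp add: bnd_def divide_le_eq mult_le_cancel_left1)
    qed
    finally show ?thesis .
  qed
  moreover have "D i p * (\<Prod>x\<leftarrow>ds. \<delta> (fst x) (snd x)) \<le> \<delta> i p" if ds: "ds \<in> decomps wt p" for i p ds
  proof -
    have "2 \<le> mdeg p" using decomps_degree(4)[OF ds] ds by (simp add: decomps_def)
    moreover have "(\<Prod>x\<leftarrow>ds. \<delta> (fst x) (snd x)) \<le> Max (insert 0 ((\<lambda>ds. \<Prod>x\<leftarrow>ds. \<delta> (fst x) (snd x)) ` decomps wt p))"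
      using ds fin by (intro Max_ge) auto
    ultimately show ?thesis using D_nonneg by (subst \<delta>) (auto intro: mult_left_mono)
  qed
  ultimately show ?thesis using nonneg low by blast
qed

end

section \<open>Mode equations and majorants\<close>

lemma exp_integral_bound:
  fixes f :: "real \<Rightarrow> complex"
  assumes f: "continuous_on {x..y} f" and bound: "\<And>s. x \<le> s \<Longrightarrow> s \<le> y \<Longrightarrow> norm (f s) \<le> K * exp (c * s)"
    and "c \<noteq> 0" "x \<le> y"
  shows "norm (integral {x..y} f) \<le> K * ((exp (c * y) - exp (c * x)) / c)"
proof -
  have "((\<lambda>s. exp (c * s)) has_integral (exp (c * y) / c - exp (c * x) / c)) {x..y}"
    using assms(3,4)
    by (intro fundamental_theorem_of_calculus)
       (auto intro!: derivative_eq_intros simp: has_real_derivative_iff_has_vector_derivative[symmetric])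
  then have I: "((\<lambda>s. K * exp (c * s)) has_integral (K * (exp (c * y) / c - exp (c * x) / c))) {x..y}"
    by (rule has_integral_mult_right)
  have "norm (integral {x..y} f) \<le> integral {x..y} (\<lambda>s. K * exp (c * s))"
    using bound by (intro integral_norm_bound_integral[OF integrable_continuous_real[OF f] has_integral_integrable[OF I]]) auto
  then show ?thesis unfolding integral_unique[OF I] by (simp add: diff_divide_distrib)
qed

text \<open>Variation of constants for \<open>X' = g - \<mu> * X\<close>. The limit is the integral
  from 0 to infinity, so subtracting it moves the lower limit to infinity. Should it fail to exist,
  \<open>lim\<close> is still some constant and the differential equation holds all the
  same.\<close>

definition mode_solution :: "complex \<Rightarrow> (real \<Rightarrow> complex) \<Rightarrow> real \<Rightarrow> complex" where
  "mode_solution \<mu> g t = exp (- \<mu> * of_real t) *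
     ((if Re \<mu> > 0 then 0 else - lim (\<lambda>n. integral {0..real n} (\<lambda>s. exp (\<mu> * of_real s) * g s)))
      + integral {0..t} (\<lambda>s. exp (\<mu> * of_real s) * g s))"

lemma mode_solution_cong:
  assumes "\<And>s. s \<ge> 0 \<Longrightarrow> g s = h s"
  shows "mode_solution \<mu> g = mode_solution \<mu> h"
proof -
  have "integral {0..t} (\<lambda>s. exp (\<mu> * of_real s) * g s) = integral {0..t} (\<lambda>s. exp (\<mu> * of_real s) * h s)" for t
    by (rule Henstock_Kurzweil_Integration.integral_cong) (use assms in auto)
  then show ?thesis by (simp add: mode_solution_def fun_eq_iff)
qed

lemma mode_solution_zero: "mode_solution \<mu> (\<lambda>_. 0) = (\<lambda>_. 0)"
  by (simp add: mode_solution_def fun_eq_iff)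

lemma mode_solution_at_0: "Re \<mu> > 0 \<Longrightarrow> mode_solution \<mu> g 0 = 0"
  by (simp add: mode_solution_def)

lemma has_vector_derivative_within_atLeast:
  fixes f :: "real \<Rightarrow> 'a::real_normed_vector"
  assumes "(f has_vector_derivative f') (at t within {0..b})" "t < b"
  shows "(f has_vector_derivative f') (at t within {0..})"
proof -
  have "at t within {0..} = at t within {0..b}"
    by (rule at_within_nhd[of _ "{..<b}"]) (use assms(2) in auto)
  then show ?thesis using assms(1) by simp
qed

lemma mode_solution_has_derivative:
  assumes g: "continuous_on {0..} g" and t: "t \<ge> 0"
  shows "(mode_solution \<mu> g has_vector_derivative g t - \<mu> * mode_solution \<mu> g t) (at t within {0..})"
proof -
  let ?f = "\<lambda>s. exp (\<mu> * of_real s) * g s"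
  define c where "c = (if Re \<mu> > 0 then 0 else - lim (\<lambda>n. integral {0..real n} ?f))"
  have "continuous_on {0..t + 1} ?f"
    by (intro continuous_intros continuous_on_subset[OF g]) auto
  then have "((\<lambda>u. integral {0..u} ?f) has_vector_derivative ?f t) (at t within {0..t + 1})"
    using t by (intro integral_has_vector_derivative) auto
  then have I: "((\<lambda>u. integral {0..u} ?f) has_vector_derivative ?f t) (at t within {0..})"
    by (rule has_vector_derivative_within_atLeast) simp
  have E: "((\<lambda>s. exp (- \<mu> * of_real s)) has_vector_derivative (- \<mu> * exp (- \<mu> * of_real t))) (at t within {0..})"
  proof -
    have "((\<lambda>s. exp (- \<mu> * s)) has_field_derivative (- \<mu> * exp (- \<mu> * of_real t))) (at (of_real t))"
      by (auto intro!: derivative_eq_intros)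
    then show ?thesis
      using has_vector_derivative_real_field has_vector_derivative_at_within by blast
  qed
  have "((\<lambda>s. exp (- \<mu> * of_real s) * (c + integral {0..s} ?f)) has_vector_derivative
      (exp (- \<mu> * of_real t) * (0 + ?f t) + (- \<mu> * exp (- \<mu> * of_real t)) * (c + integral {0..t} ?f)))
      (at t within {0..})"
    by (intro has_vector_derivative_mult E has_vector_derivative_add has_vector_derivative_const I)
  moreover have "exp (- \<mu> * of_real t) * (0 + ?f t) + (- \<mu> * exp (- \<mu> * of_real t)) * (c + integral {0..t} ?f) =
     g t - \<mu> * mode_solution \<mu> g t"
    by (simp add: mode_solution_def c_def flip: mult.assoc exp_add)
  moreover have "(\<lambda>s. exp (- \<mu> * of_real s) * (c + integral {0..s} ?f)) = mode_solution \<mu> g"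
    by (simp add: mode_solution_def c_def fun_eq_iff)
  ultimately show ?thesis by simp
qed

lemma norm_exp_mult_le:
  assumes "norm (z :: complex) \<le> G * exp (- a * s)"
  shows "norm (exp (\<mu> * of_real s) * z) \<le> G * exp ((Re \<mu> - a) * s)"
proof -
  have "norm (exp (\<mu> * of_real s) * z) = exp (Re \<mu> * s) * norm z"
    by (simp add: norm_mult)
  also have "\<dots> \<le> exp (Re \<mu> * s) * (G * exp (- a * s))"
    using assms by (intro mult_left_mono) auto
  also have "\<dots> = G * exp ((Re \<mu> - a) * s)"
    by (simp add: exp_add[symmetric] algebra_simps)
  finally show ?thesis .
qed

text \<open>Integration from infinity involves \<open>exp ((Re \<mu> - a) * s)\<close>, which is
  integrable there as \<open>Re \<mu> < a\<close>. The result keeps the full rate \<open>a\<close>,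
  and the divisor is \<open>a - Re \<mu>\<close>.\<close>

lemma mode_solution_bound_nonpos:
  assumes g: "continuous_on {0..} g" and bound: "\<And>s. s \<ge> 0 \<Longrightarrow> norm (g s) \<le> G * exp (- a * s)"
    and \<mu>: "Re \<mu> \<le> 0" and pos: "Re \<mu> < a" and t: "t \<ge> 0"
  shows "norm (mode_solution \<mu> g t) \<le> G * exp (- a * t) / (a - Re \<mu>)"
proof -
  let ?f = "\<lambda>s. exp (\<mu> * of_real s) * g s"
  define c where "c = Re \<mu> - a"
  have c: "c < 0" using pos by (simp add: c_def)
  have "0 \<le> norm (g 0)" by simp
  also have "\<dots> \<le> G" using bound[of 0] by simp
  finally have G: "G \<ge> 0" .
  have cont: "continuous_on {x..y} ?f" if "0 \<le> x" for x y
    by (intro continuous_intros continuous_on_subset[OF g]) (use that in auto)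
  have piece: "norm (integral {x..y} ?f) \<le> G * exp (c * x) / (- c)" if "0 \<le> x" "x \<le> y" for x y
  proof -
    have "norm (integral {x..y} ?f) \<le> G * ((exp (c * y) - exp (c * x)) / c)"
      unfolding c_def
      by (intro exp_integral_bound cont norm_exp_mult_le bound) (use that c in \<open>auto simp: c_def\<close>)
    also have "\<dots> = G * ((exp (c * x) - exp (c * y)) / (- c))"
      using c by (simp add: field_simps)
    also have "\<dots> \<le> G * (exp (c * x) / (- c))"
      using c G by (intro mult_left_mono divide_right_mono) auto
    finally show ?thesis by simp
  qed
  have split: "integral {0..x} ?f + integral {x..y} ?f = integral {0..y} ?f" if "0 \<le> x" "x \<le> y" for x y
    using that by (intro Henstock_Kurzweil_Integration.integral_combine integrable_continuous_real cont) auto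
  define I where "I n = integral {0..real n} ?f" for n
  have "convergent I"
  proof (rule Cauchy_convergent, rule metric_CauchyI)
    fix e :: real assume e: "e > 0"
    have "(\<lambda>n. G * exp (c * real n) / (- c)) \<longlonglongrightarrow> G * 0 / (- c)"
    proof (intro tendsto_intros)
      have "filterlim (\<lambda>n. c * real n) at_bot sequentially"
        using c by (intro filterlim_tendsto_neg_mult_at_bot[OF tendsto_const _ filterlim_real_sequentially])
      then show "(\<lambda>n. exp (c * real n)) \<longlonglongrightarrow> 0"
        by (rule filterlim_compose[OF exp_at_bot])
    qed (use c in auto)
    then have "eventually (\<lambda>n. G * exp (c * real n) / (- c) < e) sequentially"
      using e by (intro order_tendstoD(2)) auto
    then obtain M where M: "\<And>n. n \<ge> M \<Longrightarrow> G * exp (c * real n) / (- c) < e"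
      by (auto simp: eventually_sequentially)
    have "dist (I m) (I n) < e" if "m \<ge> M" "n \<ge> m" for m n
    proof -
      have "I n - I m = integral {real m..real n} ?f"
        using split[of "real m" "real n"] that by (simp add: I_def algebra_simps)
      then show ?thesis
        using piece[of "real m" "real n"] M[of m] that by (simp add: dist_norm norm_minus_commute[of "I m"])
    qed
    then have "dist (I m) (I n) < e" if "m \<ge> M" "n \<ge> M" for m n
      using that by (metis dist_commute nle_le)
    then show "\<exists>M. \<forall>m\<ge>M. \<forall>n\<ge>M. dist (I m) (I n) < e" by blast
  qed
  then have lim: "I \<longlonglongrightarrow> lim I" by (simp add: convergent_LIMSEQ_iff)
  have "norm (integral {0..t} ?f - lim I) \<le> G * exp (c * t) / (- c)"
  proof (rule tendsto_upperbound)
    show "(\<lambda>n. norm (integral {0..t} ?f - I n)) \<longlonglongrightarrow> norm (integral {0..t} ?f - lim I)"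
      by (intro tendsto_intros lim)
    have "eventually (\<lambda>n. real n \<ge> t) sequentially"
      using filterlim_real_sequentially by (simp add: filterlim_at_top)
    then show "eventually (\<lambda>n. norm (integral {0..t} ?f - I n) \<le> G * exp (c * t) / (- c)) sequentially"
    proof eventually_elim
      case (elim n)
      have "integral {0..t} ?f - I n = - integral {t..real n} ?f"
        using split[OF t elim] by (simp add: I_def algebra_simps)
      then show ?case using piece[OF t elim] by simp
    qed
  qed simp
  moreover have "mode_solution \<mu> g t = exp (- \<mu> * of_real t) * (integral {0..t} ?f - lim I)"
    using \<mu> by (simp add: mode_solution_def I_def[abs_def])
  moreover have "norm (exp (- \<mu> * of_real t)) = exp (- Re \<mu> * t)" by simp
  ultimately have "norm (mode_solution \<mu> g t) \<le> exp (- Re \<mu> * t) * (G * exp (c * t) / (- c))"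
    by (simp only: norm_mult) (intro mult_left_mono, auto)
  also have "\<dots> = G * exp (- a * t) / (a - Re \<mu>)"
    by (simp add: c_def exp_add[symmetric] algebra_simps)
  finally show ?thesis .
qed

text \<open>Two estimates of the integral from 0. For \<open>b < Re \<mu>\<close> the decay survives
  at the price of the divisor \<open>Re \<mu> - b\<close>, which may be small; replacing the growing
  exponential by its value at \<open>t\<close> gives up the decay but leaves no small
  divisor.\<close>

lemma mode_solution_bound_pos:
  assumes g: "continuous_on {0..} g" and bound: "\<And>s. s \<ge> 0 \<Longrightarrow> norm (g s) \<le> G * exp (- b * s)"
    and \<mu>: "Re \<mu> > 0" and t: "t \<ge> 0"
  shows "b < Re \<mu> \<Longrightarrow> norm (mode_solution \<mu> g t) \<le> G * exp (- b * t) / (Re \<mu> - b)"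
    and "b > 0 \<Longrightarrow> norm (mode_solution \<mu> g t) \<le> G / b"
proof -
  let ?f = "\<lambda>s. exp (\<mu> * of_real s) * g s"
  have "0 \<le> norm (g 0)" by simp
  also have "\<dots> \<le> G" using bound[of 0] by simp
  finally have G: "G \<ge> 0" .
  have cont: "continuous_on {0..t} ?f"
    by (intro continuous_intros continuous_on_subset[OF g]) auto
  have eq: "norm (mode_solution \<mu> g t) = exp (- Re \<mu> * t) * norm (integral {0..t} ?f)"
    using \<mu> by (simp add: mode_solution_def norm_mult)
  {
    assume b: "b < Re \<mu>"
    have "norm (integral {0..t} ?f) \<le> G * ((exp ((Re \<mu> - b) * t) - exp ((Re \<mu> - b) * 0)) / (Re \<mu> - b))"
      by (intro exp_integral_bound cont norm_exp_mult_le bound) (use b t in auto)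
    also have "\<dots> \<le> G * (exp ((Re \<mu> - b) * t) / (Re \<mu> - b))"
      using b G by (intro mult_left_mono divide_right_mono) auto
    finally have "norm (mode_solution \<mu> g t) \<le> exp (- Re \<mu> * t) * (G * (exp ((Re \<mu> - b) * t) / (Re \<mu> - b)))"
      unfolding eq by (intro mult_left_mono) auto
    also have "\<dots> = G * exp (- b * t) / (Re \<mu> - b)"
      by (simp add: exp_add[symmetric] algebra_simps)
    finally show "norm (mode_solution \<mu> g t) \<le> G * exp (- b * t) / (Re \<mu> - b)" .
  }
  {
    assume b: "b > 0"
    have "norm (?f s) \<le> (G * exp (Re \<mu> * t)) * exp (- b * s)" if "0 \<le> s" "s \<le> t" for s
    proof -
      have "norm (?f s) = exp (Re \<mu> * s) * norm (g s)" by (simp add: norm_mult)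
      also have "\<dots> \<le> exp (Re \<mu> * t) * (G * exp (- b * s))"
        using that \<mu> bound[of s] by (intro mult_mono) auto
      finally show ?thesis by (simp add: mult_ac)
    qed
    then have "norm (integral {0..t} ?f) \<le> (G * exp (Re \<mu> * t)) * ((exp (- b * t) - exp (- b * 0)) / (- b))"
      by (intro exp_integral_bound cont) (use b t in auto)
    also have "\<dots> = (G * exp (Re \<mu> * t)) * ((1 - exp (- b * t)) / b)"
      using b by (simp add: field_simps)
    also have "\<dots> \<le> (G * exp (Re \<mu> * t)) * (1 / b)"
      using b G by (intro mult_left_mono divide_right_mono) auto
    finally have "norm (mode_solution \<mu> g t) \<le> exp (- Re \<mu> * t) * ((G * exp (Re \<mu> * t)) * (1 / b))"
      unfolding eq by (intro mult_left_mono) auto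
    also have "\<dots> = G / b"
      by (simp add: exp_minus field_simps)
    finally show "norm (mode_solution \<mu> g t) \<le> G / b" .
  }
qed

text \<open>Under decay the loss 1/a is uniform in \<open>\<mu>\<close>: for
  \<open>Re \<mu> > 0\<close> by the estimate without small divisor, otherwise because
  \<open>a - Re \<mu> \<ge> a\<close>. For \<open>a = 0\<close> both directions of integration lose
  \<open>1 / \<bar>Re \<mu>\<bar>\<close>.\<close>

lemma mode_solution_bound:
  assumes g: "continuous_on {0..} g" and bound: "\<And>s. s \<ge> 0 \<Longrightarrow> norm (g s) \<le> G * exp (- a * s)"
    and a: "a \<ge> 0" "a = 0 \<Longrightarrow> Re \<mu> \<noteq> 0" and t: "t \<ge> 0"
  shows "norm (mode_solution \<mu> g t) \<le> (if a > 0 then 1 / a else 1 / \<bar>Re \<mu>\<bar>) * G"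
proof -
  have "0 \<le> norm (g 0)" by simp
  also have "\<dots> \<le> G" using bound[of 0] by simp
  finally have G: "G \<ge> 0" .
  show ?thesis
  proof (cases "Re \<mu> > 0")
    case True
    show ?thesis
    proof (cases "a > 0")
      case False
      then show ?thesis
        using mode_solution_bound_pos(1)[OF g bound True t] a True by simp
    next
      case a': True
      then show ?thesis using mode_solution_bound_pos(2)[OF g bound True t] by simp
    qed
  next
    case False
    then have "norm (mode_solution \<mu> g t) \<le> G * exp (- a * t) / (a - Re \<mu>)"
      using a t by (intro mode_solution_bound_nonpos[OF g bound]) (auto simp: not_less dest: order_antisym)
    also have "\<dots> \<le> G * 1 / (a - Re \<mu>)"
      using a t G False by (intro divide_right_mono mult_left_mono) auto
    also have "\<dots> \<le> (if a > 0 then 1 / a else 1 / \<bar>Re \<mu>\<bar>) * G"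
      using a G False by (auto intro: divide_left_mono simp: divide_left_mono)
    finally show ?thesis .
  qed
qed

text \<open>The value at infinity is the boundary condition that will settle brackets whose rate has
  real part zero.\<close>

lemma mode_solution_tendsto_0:
  assumes g: "continuous_on {0..} g" and bound: "\<And>s. s \<ge> 0 \<Longrightarrow> norm (g s) \<le> G * exp (- a * s)"
    and a: "a > 0"
  shows "(mode_solution \<mu> g \<longlongrightarrow> 0) at_top"
proof -
  have "0 \<le> norm (g 0)" by simp
  also have "\<dots> \<le> G" using bound[of 0] by simp
  finally have G: "G \<ge> 0" .
  obtain b K where b: "b > 0" "\<And>t. t \<ge> 0 \<Longrightarrow> norm (mode_solution \<mu> g t) \<le> K * exp (- b * t)"
  proof (cases "Re \<mu> > 0")
    case True
    \<comment> \<open>A lower rate, strictly below \<open>Re \<mu>\<close>, excludes a coincidence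
      of the two rates and still gives decay.\<close>
    define b where "b = min a (Re \<mu> / 2)"
    have "norm (g s) \<le> G * exp (- b * s)" if "s \<ge> 0" for s
    proof -
      have "G * exp (- a * s) \<le> G * exp (- b * s)"
        using that G by (intro mult_left_mono) (auto simp: b_def mult_right_mono)
      then show ?thesis using bound[OF that] by linarith
    qed
    then have *: "norm (mode_solution \<mu> g t) \<le> (G / (Re \<mu> - b)) * exp (- b * t)" if "t \<ge> 0" for t
      using mode_solution_bound_pos(1)[OF g _ True that, of G b] True by (simp add: b_def)
    have "b > 0" using a True by (simp add: b_def)
    then show thesis using * by (rule that)
  next
    case False
    then have "norm (mode_solution \<mu> g t) \<le> (G / (a - Re \<mu>)) * exp (- a * t)" if "t \<ge> 0" for t
      using mode_solution_bound_nonpos[OF g bound _ _ that] a by simp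
    then show thesis using that a by blast
  qed
  have "((\<lambda>t. K * exp (- b * t)) \<longlongrightarrow> K * 0) at_top"
    using b(1) by (intro tendsto_intros filterlim_compose[OF exp_at_bot]
        filterlim_tendsto_neg_mult_at_bot[OF tendsto_const _ filterlim_ident]) auto
  then have "((\<lambda>t. K * exp (- b * t)) \<longlongrightarrow> 0) at_top" by simp
  moreover have "eventually (\<lambda>t. norm (mode_solution \<mu> g t) \<le> K * exp (- b * t)) at_top"
    by (rule eventually_at_top_linorderI[of 0]) (rule b(2))
  ultimately show ?thesis by (rule Lim_null_comparison[rotated])
qed

section \<open>Continuity, positivity and weighted bounds for powers of series\<close>

lemma continuous_on_mcoeff_mult:
  fixes a b :: "'t::topological_space \<Rightarrow> ('k::finite, complex) mps"
  assumes "\<And>q. continuous_on S (\<lambda>t. mcoeff (a t) q)" "\<And>q. continuous_on S (\<lambda>t. mcoeff (b t) q)"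
  shows "continuous_on S (\<lambda>t. mcoeff (a t * b t) p)"
  unfolding mcoeff_mult using assms by (intro continuous_intros)

lemma continuous_on_mcoeff_wpow:
  fixes w :: "'t::topological_space \<Rightarrow> 'j::finite \<Rightarrow> ('k::finite, complex) mps"
  assumes "\<And>k q. continuous_on S (\<lambda>t. mcoeff (w t k) q)"
  shows "continuous_on S (\<lambda>t. mcoeff (wpow (w t) m) p)"
proof -
  have "\<forall>p. continuous_on S (\<lambda>t. mcoeff (wpow (w t) m) p)"
  proof (rule multi_index_induct[of "\<lambda>m. \<forall>p. continuous_on S (\<lambda>t. mcoeff (wpow (w t) m) p)" m])
    fix m k assume IH: "\<forall>p. continuous_on S (\<lambda>t. mcoeff (wpow (w t) m) p)"
    show "\<forall>p. continuous_on S (\<lambda>t. mcoeff (wpow (w t) (m + unit_index k)) p)"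
      unfolding wpow_add wpow_unit using IH by (intro allI continuous_on_mcoeff_mult assms) blast
  qed simp
  then show ?thesis by blast
qed

lemma continuous_on_mcoeff_mcomp:
  fixes w :: "'t::topological_space \<Rightarrow> 'j::finite \<Rightarrow> ('k::finite, complex) mps"
  assumes "\<And>k q. continuous_on S (\<lambda>t. mcoeff (w t k) q)" "\<And>m. continuous_on S (\<lambda>t. mcoeff (F t) m)"
  shows "continuous_on S (\<lambda>t. mcoeff (mcomp (F t) (w t)) p)"
  unfolding mcoeff_mcomp by (intro continuous_intros assms continuous_on_mcoeff_wpow)

lemma mcoeff_mult_nonneg:
  fixes a b :: "('k::finite, real) mps"
  assumes "\<And>q. mcoeff a q \<ge> 0" "\<And>q. mcoeff b q \<ge> 0"
  shows "mcoeff (a * b) p \<ge> 0"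
  unfolding mcoeff_mult using assms by (intro sum_nonneg mult_nonneg_nonneg)

lemma mcoeff_wpow_nonneg:
  fixes v :: "'j::finite \<Rightarrow> ('k::finite, real) mps"
  assumes "\<And>k q. mcoeff (v k) q \<ge> 0"
  shows "mcoeff (wpow v m) p \<ge> 0"
proof -
  have "\<forall>p. mcoeff (wpow v m) p \<ge> 0"
  proof (rule multi_index_induct[of "\<lambda>m. \<forall>p. mcoeff (wpow v m) p \<ge> 0" m])
    fix m k assume "\<forall>p. mcoeff (wpow v m) p \<ge> 0"
    then show "\<forall>p. mcoeff (wpow v (m + unit_index k)) p \<ge> 0"
      unfolding wpow_add wpow_unit using assms by (blast intro: mcoeff_mult_nonneg)
  qed (simp add: mcoeff_one)
  then show ?thesis by blast
qed

text \<open>Each term of the expanded power is a product of coefficients and carries the product of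
  their \<open>\<delta>\<close>, which together with \<open>c\<close> is at most \<open>K\<close>;
  what remains is the matching term of the power of \<open>v\<close>.\<close>

lemma wpow_weighted_bound:
  fixes w :: "'k::finite \<Rightarrow> ('k, complex) mps" and v :: "'k \<Rightarrow> ('k, real) mps"
  assumes bound: "\<And>k q. norm (mcoeff (w k) q) \<le> \<delta> k q * mcoeff (v k) q"
    and nonneg: "\<And>k q. mcoeff (v k) q \<ge> 0" "\<And>k q. \<delta> k q \<ge> 0"
    and supp: "\<And>k q. mcoeff (w k) q \<noteq> 0 \<Longrightarrow> q \<noteq> 0 \<and> good_mode wt k q"
    and c: "c \<ge> 0" "K \<ge> 0"
    and K: "\<And>ds. \<forall>(j, q)\<in>set ds. q \<noteq> 0 \<and> good_mode wt j q \<Longrightarrow> sum_list (map snd ds) = p \<Longrightarrow> length ds = mdeg m \<Longrightarrow>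
      c * (\<Prod>x\<leftarrow>ds. \<delta> (fst x) (snd x)) \<le> K"
  shows "c * norm (mcoeff (wpow w m) p) \<le> K * mcoeff (wpow v m) p"
proof -
  \<comment> \<open>The scalar \<open>c\<close> is generalised along with \<open>p\<close>: in the
    induction it absorbs the \<open>\<delta>\<close> of the factors already split off.\<close>
  define P where "P m \<longleftrightarrow> (\<forall>p c. c \<ge> 0 \<longrightarrow>
     (\<forall>ds. (\<forall>(j, q)\<in>set ds. q \<noteq> 0 \<and> good_mode wt j q) \<longrightarrow> sum_list (map snd ds) = p \<longrightarrow> length ds = mdeg m \<longrightarrow>
      c * (\<Prod>x\<leftarrow>ds. \<delta> (fst x) (snd x)) \<le> K) \<longrightarrow>
     c * norm (mcoeff (wpow w m) p) \<le> K * mcoeff (wpow v m) p)" for m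
  have "P m"
  proof (rule multi_index_induct[of P m])
    show "P 0"
      unfolding P_def
    proof (intro allI impI)
      fix p and c :: real
      assume c: "\<forall>ds. (\<forall>(j, q)\<in>set ds. q \<noteq> 0 \<and> good_mode wt j q) \<longrightarrow> sum_list (map snd ds) = p \<longrightarrow>
        length ds = mdeg (0 :: 'k \<Rightarrow> nat) \<longrightarrow> c * (\<Prod>x\<leftarrow>ds. \<delta> (fst x) (snd x)) \<le> K"
      show "c * norm (mcoeff (wpow w 0) p) \<le> K * mcoeff (wpow v 0) p"
      proof (cases "p = 0")
        case True
        then have "c \<le> K" using c[THEN spec, of "[]"] by (simp only: sum_list.Nil list.map) simp
        then show ?thesis using True by (simp add: mcoeff_one)
      qed (simp add: mcoeff_one)
    qed
  next
    fix m k assume IH: "P m"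
    show "P (m + unit_index k)"
      unfolding P_def
    proof (intro allI impI)
      fix p and c :: real
      assume c0: "c \<ge> 0" and c: "\<forall>ds. (\<forall>(j, q)\<in>set ds. q \<noteq> 0 \<and> good_mode wt j q) \<longrightarrow> sum_list (map snd ds) = p \<longrightarrow>
        length ds = mdeg (m + unit_index k) \<longrightarrow> c * (\<Prod>x\<leftarrow>ds. \<delta> (fst x) (snd x)) \<le> K"
      have step: "c * norm (mcoeff (wpow w m) q * mcoeff (w k) (p - q)) \<le> K * (mcoeff (wpow v m) q * mcoeff (v k) (p - q))"
        if q: "q \<le> p" for q
      proof (cases "mcoeff (w k) (p - q) = 0")
        case True
        have "0 \<le> K * (mcoeff (wpow v m) q * mcoeff (v k) (p - q))"
          using nonneg assms(6) by (intro mult_nonneg_nonneg mcoeff_wpow_nonneg)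
        then show ?thesis using True by simp
      next
        case False
        then have pq: "p - q \<noteq> 0" "good_mode wt k (p - q)" using supp by blast+
        have IH': "c * \<delta> k (p - q) * norm (mcoeff (wpow w m) q) \<le> K * mcoeff (wpow v m) q"
        proof (rule IH[unfolded P_def, THEN spec, THEN spec, THEN mp, THEN mp], goal_cases)
          case 2
          show ?case
          proof (intro allI impI)
          fix ds assume ds: "\<forall>(j, q)\<in>set ds. q \<noteq> 0 \<and> good_mode wt j q" "sum_list (map snd ds) = q" "length ds = mdeg m"
          have "c * (\<Prod>x\<leftarrow>(k, p - q) # ds. \<delta> (fst x) (snd x)) \<le> K"
            by (rule c[THEN spec, THEN mp, THEN mp, THEN mp])
               (use ds pq q in \<open>auto simp: index_diff_add simp del: plus_fun_apply\<close>)
          then show "c * \<delta> k (p - q) * (\<Prod>x\<leftarrow>ds. \<delta> (fst x) (snd x)) \<le> K" by simp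
          qed
        qed (use c0 nonneg in auto)
        have "c * norm (mcoeff (wpow w m) q * mcoeff (w k) (p - q)) =
            c * norm (mcoeff (wpow w m) q) * norm (mcoeff (w k) (p - q))"
          by (simp add: norm_mult)
        also have "\<dots> \<le> c * norm (mcoeff (wpow w m) q) * (\<delta> k (p - q) * mcoeff (v k) (p - q))"
          using c0 bound by (intro mult_left_mono) auto
        also have "\<dots> = (c * \<delta> k (p - q) * norm (mcoeff (wpow w m) q)) * mcoeff (v k) (p - q)"
          by (simp add: mult_ac)
        also have "\<dots> \<le> (K * mcoeff (wpow v m) q) * mcoeff (v k) (p - q)"
          using IH' nonneg by (intro mult_right_mono)
        finally show ?thesis by (simp add: mult_ac)
      qed
      have "c * norm (mcoeff (wpow w m * w k) p) \<le> c * (\<Sum>q | q \<le> p. norm (mcoeff (wpow w m) q * mcoeff (w k) (p - q)))"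
        unfolding mcoeff_mult using c0 by (intro mult_left_mono norm_sum)
      also have "\<dots> = (\<Sum>q | q \<le> p. c * norm (mcoeff (wpow w m) q * mcoeff (w k) (p - q)))"
        by (simp add: sum_distrib_left)
      also have "\<dots> \<le> (\<Sum>q | q \<le> p. K * (mcoeff (wpow v m) q * mcoeff (v k) (p - q)))"
        by (rule sum_mono) (use step in blast)
      also have "\<dots> = K * mcoeff (wpow v m * v k) p"
        by (simp add: mcoeff_mult sum_distrib_left)
      finally show "c * norm (mcoeff (wpow w (m + unit_index k)) p) \<le> K * mcoeff (wpow v (m + unit_index k)) p"
        by (simp add: wpow_add)
    qed
  qed
  then show ?thesis using c K unfolding P_def by blast
qed

section \<open>The majorant equation without divisors\<close>

lemma sum_power_mdeg_le:
  fixes y :: real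
  assumes "0 \<le> y" "y < 1" "finite M"
  shows "(\<Sum>m\<in>M. y ^ mdeg (m :: 'k::finite \<Rightarrow> nat)) \<le> (1 / (1 - y)) ^ CARD('k)"
proof -
  obtain N where N: "\<And>m k. m \<in> M \<Longrightarrow> m k \<le> (N::nat)"
  proof -
    have "finite (mdeg ` M)" using assms by simp
    then obtain N where "\<forall>d\<in>mdeg ` M. d \<le> N" by (meson Max_ge)
    then show thesis using that index_le_mdeg by (metis imageI order_trans)
  qed
  have "(\<Sum>m\<in>M. y ^ mdeg m) \<le> (\<Sum>m\<in>(\<Pi>\<^sub>E k\<in>(UNIV :: 'k set). {..N}). y ^ mdeg m)"
  proof (rule sum_mono2)
    show "finite (\<Pi>\<^sub>E k\<in>(UNIV :: 'k set). {..N})" by (intro finite_PiE) auto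
    show "M \<subseteq> (\<Pi>\<^sub>E k\<in>UNIV. {..N})" using N by (auto simp: PiE_UNIV_domain)
  qed (use assms in auto)
  also have "\<dots> = (\<Sum>m\<in>(\<Pi>\<^sub>E k\<in>(UNIV :: 'k set). {..N}). \<Prod>k\<in>UNIV. y ^ m k)"
    by (simp add: mdeg_def power_sum)
  also have "\<dots> = (\<Prod>k\<in>(UNIV :: 'k set). \<Sum>j\<le>N. y ^ j)"
    by (rule prod_sum_PiE[symmetric]) auto
  also have "\<dots> \<le> (\<Prod>k\<in>(UNIV :: 'k set). 1 / (1 - y))"
  proof (rule prod_mono)
    have "(\<Sum>j\<le>N. y ^ j) \<le> 1 / (1 - y)"
    proof -
      have "(\<Sum>j\<le>N. y ^ j) = (1 - y ^ Suc N) / (1 - y)"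
        using assms sum_gp0[of y N] by simp
      also have "\<dots> \<le> 1 / (1 - y)" using assms by (intro divide_right_mono) auto
      finally show ?thesis .
    qed
    then show "0 \<le> (\<Sum>j\<le>N. y ^ j) \<and> (\<Sum>j\<le>N. y ^ j) \<le> 1 / (1 - y)"
      using assms by (auto intro: sum_nonneg)
  qed
  finally show ?thesis by simp
qed

text \<open>Evaluation at the point with all coordinates \<open>x\<close>, cut off by degree. For
  nonnegative coefficients it is submultiplicative and raises no question of convergence.\<close>

definition ev_upto :: "nat \<Rightarrow> real \<Rightarrow> ('k::finite, real) mps \<Rightarrow> real" where
  "ev_upto N x a = (\<Sum>p | mdeg p \<le> N. mcoeff a p * x ^ mdeg p)"

lemma ev_upto_mult_le:
  fixes a b :: "('k::finite, real) mps"
  assumes "\<And>q. mcoeff a q \<ge> 0" "\<And>q. mcoeff b q \<ge> 0" "x \<ge> 0"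
  shows "ev_upto N x (a * b) \<le> ev_upto N x a * ev_upto N x b"
proof -
  let ?f = "\<lambda>(q, r). (mcoeff a q * x ^ mdeg q) * (mcoeff b r * x ^ mdeg r)"
  have "ev_upto N x (a * b) = (\<Sum>p | mdeg p \<le> N. \<Sum>q | q \<le> p. ?f (q, p - q))"
    unfolding ev_upto_def mcoeff_mult sum_distrib_right
  proof (intro sum.cong refl)
    fix p q :: "'k \<Rightarrow> nat" assume "q \<in> {q. q \<le> p}"
    then have "mdeg p = mdeg q + mdeg (p - q)" by (metis index_diff_add(1) mdeg_add mem_Collect_eq)
    then show "mcoeff a q * mcoeff b (p - q) * x ^ mdeg p = ?f (q, p - q)"
      by (simp add: power_add mult_ac)
  qed
  also have "\<dots> = (\<Sum>(p, q)\<in>(SIGMA p:{p. mdeg p \<le> N}. {q. q \<le> p}). ?f (q, p - q))"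
    by (rule sum.Sigma) (auto simp: finite_mdeg_le finite_le_index)
  also have "\<dots> = sum ?f ((\<lambda>(p, q). (q, p - q)) ` (SIGMA p:{p. mdeg p \<le> N}. {q. q \<le> p}))"
  proof (subst sum.reindex)
    show "inj_on (\<lambda>(p, q). (q, p - q)) (SIGMA p:{p :: 'k \<Rightarrow> nat. mdeg p \<le> N}. {q. q \<le> p})"
      by (rule inj_onI) (clarsimp, metis index_diff_add(1))
  qed (simp add: case_prod_unfold comp_def)
  also have "\<dots> \<le> sum ?f ({p. mdeg p \<le> N} \<times> {p. mdeg p \<le> N})"
  proof (rule sum_mono2)
    show "(\<lambda>(p, q). (q, p - q)) ` (SIGMA p:{p. mdeg p \<le> N}. {q. q \<le> p}) \<subseteq> {p. mdeg p \<le> N} \<times> {p :: 'k \<Rightarrow> nat. mdeg p \<le> N}"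
      by (auto intro: order_trans[OF mdeg_mono] order_trans[OF mdeg_mono[OF index_diff_le]])
  qed (use assms in \<open>auto simp: finite_mdeg_le\<close>)
  also have "\<dots> = ev_upto N x a * ev_upto N x b"
    unfolding ev_upto_def by (simp add: sum_product sum.cartesian_product)
  finally show ?thesis .
qed

lemma ev_upto_nonneg: "(\<And>q. mcoeff a q \<ge> 0) \<Longrightarrow> x \<ge> 0 \<Longrightarrow> ev_upto N x a \<ge> 0"
  unfolding ev_upto_def by (intro sum_nonneg) auto

lemma ev_upto_wpow_le:
  fixes v :: "'j::finite \<Rightarrow> ('k::finite, real) mps"
  assumes "\<And>k q. mcoeff (v k) q \<ge> 0" "x \<ge> 0" "\<And>k. ev_upto N x (v k) \<le> X"
  shows "ev_upto N x (wpow v m) \<le> X ^ mdeg m"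
proof (rule multi_index_induct[of "\<lambda>m. ev_upto N x (wpow v m) \<le> X ^ mdeg m" m])
  have "ev_upto N x (wpow v 0) = (\<Sum>p\<in>{0 :: 'k \<Rightarrow> nat}. 1)"
    unfolding ev_upto_def wpow_zero
    by (rule sum.mono_neutral_cong_right) (auto simp: finite_mdeg_le mcoeff_one)
  then show "ev_upto N x (wpow v 0) \<le> X ^ mdeg (0 :: 'j \<Rightarrow> nat)" by simp
next
  fix m k assume IH: "ev_upto N x (wpow v m) \<le> X ^ mdeg m"
  have "ev_upto N x (wpow v (m + unit_index k)) \<le> ev_upto N x (wpow v m) * ev_upto N x (v k)"
    unfolding wpow_add wpow_unit using assms by (intro ev_upto_mult_le mcoeff_wpow_nonneg)
  also have "\<dots> \<le> X ^ mdeg m * X"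
    using IH assms by (intro mult_mono' ev_upto_nonneg mcoeff_wpow_nonneg)
  finally show "ev_upto N x (wpow v (m + unit_index k)) \<le> X ^ mdeg (m + unit_index k)"
    by (simp add: mult.commute del: plus_fun_apply)
qed

text \<open>Coefficients of \<open>u\<close> below degree two are ignored, so the linear part is the
  identity for every \<open>u\<close> and recursions on \<open>u\<close> need no side
  condition.\<close>

definition near_identity :: "('k::finite \<Rightarrow> ('k \<Rightarrow> nat) \<Rightarrow> 'a::comm_semiring_1) \<Rightarrow> 'k \<Rightarrow> ('k, 'a) mps" where
  "near_identity u k = mvar k + Mps (\<lambda>q. if 2 \<le> mdeg q then u k q else 0)"

lemma mcoeff_near_identity:
  "mcoeff (near_identity u k) q = (if 2 \<le> mdeg q then u k q else if q = unit_index k then 1 else 0)"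
  by (auto simp: near_identity_def mcoeff_mvar)

lemma mcoeff_near_identity_0 [simp]: "mcoeff (near_identity u k) 0 = 0"
  using unit_index_neq_0[of k] by (simp add: mcoeff_near_identity del: unit_index_neq_0)

lemma mcomp_near_identity_cong:
  assumes "\<And>k q. mdeg q < mdeg p \<Longrightarrow> u k q = v k q" and "\<And>m. mdeg m < 2 \<Longrightarrow> mcoeff F m = 0"
  shows "mcoeff (mcomp F (near_identity u)) p = mcoeff (mcomp F (near_identity v)) p"
  unfolding mcoeff_mcomp
proof (rule sum.cong)
  fix m :: "'a \<Rightarrow> nat" assume m: "m \<in> {m. mdeg m \<le> mdeg p}"
  show "mcoeff F m * mcoeff (wpow (near_identity u) m) p = mcoeff F m * mcoeff (wpow (near_identity v) m) p"
  proof (cases "mdeg m < 2")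
    case False
    have "mcoeff (wpow (near_identity u) m) p = mcoeff (wpow (near_identity v) m) p"
      by (rule mcoeff_wpow_agree[where d = "mdeg p"])
         (use False m assms(1) in \<open>auto simp: mcoeff_near_identity\<close>)
    then show ?thesis by simp
  qed (use assms(2) in simp)
qed simp

text \<open>The equation of the solution with divisors replaced by 1 and the nonlinearity by
  \<open>A\<close> times a geometric series; all components coincide. Convergence is an induction on
  the truncation degree: if the nonlinear part, evaluated at \<open>x\<close>, is at most
  \<open>x\<close>, the argument is at most \<open>2 * x\<close>, and the right-hand side returns at
  most \<open>B * x ^ 2 \<le> x\<close>.\<close>

lemma majorant_exists:
  assumes "A \<ge> 0" "r > 0"
  shows "\<exists>(\<sigma> :: ('k::finite \<Rightarrow> nat) \<Rightarrow> real) x. x > 0 \<and> (\<forall>p. \<sigma> p \<ge> 0) \<and> (\<forall>p. 2 \<le> mdeg p \<longrightarrow> \<sigma> p * x ^ mdeg p \<le> x) \<and>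
    (\<forall>p. \<sigma> p = mcoeff (mcomp (Mps (\<lambda>m. if 2 \<le> mdeg m then A / r ^ mdeg m else 0)) (near_identity (\<lambda>_ :: 'k. \<sigma>))) p)"
proof -
  define G :: "('k, real) mps" where "G = Mps (\<lambda>m. if 2 \<le> mdeg m then A / r ^ mdeg m else 0)"
  \<comment> \<open>One scalar unknown serves all components, hence the one-element type of
    components.\<close>
  have "\<exists>s :: unit \<Rightarrow> ('k \<Rightarrow> nat) \<Rightarrow> real. (\<lambda>_ p. mcoeff (mcomp G (near_identity (\<lambda>_. s ()))) p) = s"
    by (rule degree_recursion[of "\<lambda>s _ p. mcoeff (mcomp G (near_identity (\<lambda>_. s ()))) p"],
        rule mcomp_near_identity_cong) (auto simp: G_def)
  then obtain s :: "unit \<Rightarrow> ('k \<Rightarrow> nat) \<Rightarrow> real"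
    where s: "(\<lambda>_ p. mcoeff (mcomp G (near_identity (\<lambda>_. s ()))) p) = s" by blast
  define \<sigma> where "\<sigma> = s ()"
  have \<sigma>: "\<sigma> p = mcoeff (mcomp G (near_identity (\<lambda>_. \<sigma>))) p" for p
    using arg_cong[OF s, of "\<lambda>f. f () p"] by (simp add: \<sigma>_def)
  have G: "mcoeff G m \<ge> 0" for m using assms by (simp add: G_def)
  have nonneg: "\<sigma> p \<ge> 0" for p
  proof (induction "mdeg p" arbitrary: p rule: less_induct)
    case less
    define \<sigma>' where "\<sigma>' q = (if mdeg q < mdeg p then \<sigma> q else 0)" for q
    have "\<sigma> p = mcoeff (mcomp G (near_identity (\<lambda>_. \<sigma>'))) p"
      by (subst \<sigma>, rule mcomp_near_identity_cong) (auto simp: \<sigma>'_def G_def)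
    also have "\<dots> \<ge> 0"
      unfolding mcoeff_mcomp using less
      by (intro sum_nonneg mult_nonneg_nonneg G mcoeff_wpow_nonneg) (auto simp: mcoeff_near_identity \<sigma>'_def)
    finally show ?case .
  qed
  \<comment> \<open>For \<open>x \<le> r / 4\<close> and degree \<open>m \<ge> 2\<close>,
    \<open>(2 * x / r) ^ m\<close> is at most \<open>16 * (x / r) ^ 2 * (1 / 2) ^ m\<close>, and the
    powers of 1/2 over all indices sum to at most \<open>2 ^ CARD('k)\<close>.\<close>
  define B where "B = A * 16 / r ^ 2 * 2 ^ CARD('k)"
  have B: "B \<ge> 0" using assms by (simp add: B_def)
  define x where "x = min (r / 4) (1 / (B + 1))"
  have x: "x > 0" "x \<le> r / 4" "B * x \<le> 1"
  proof -
    show "x > 0" using assms B by (simp add: x_def add_nonneg_pos)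
    show "x \<le> r / 4" by (simp add: x_def)
    have "B * x \<le> B * (1 / (B + 1))" using B by (intro mult_left_mono) (auto simp: x_def)
    also have "\<dots> \<le> 1" using B by (simp add: divide_le_eq)
    finally show "B * x \<le> 1" .
  qed
  define S where "S N = (\<Sum>p | 2 \<le> mdeg p \<and> mdeg p \<le> N. \<sigma> p * x ^ mdeg p)" for N
  have fin: "finite {p :: 'k \<Rightarrow> nat. 2 \<le> mdeg p \<and> mdeg p \<le> N}" for N
    by (rule finite_subset[OF _ finite_mdeg_le[of N]]) auto
  have S: "S N \<le> x" for N
  proof (induction N)
    case 0
    have "{p :: 'k \<Rightarrow> nat. 2 \<le> mdeg p \<and> mdeg p \<le> 0} = {}" by auto
    then have "S 0 = 0" by (simp only: S_def sum.empty)
    then show ?case using x by simp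
  next
    case (Suc N)
    \<comment> \<open>As \<open>G\<close> has no terms below degree two, dropping degrees above
      \<open>N\<close> from its argument leaves the composition unchanged up to degree
      \<open>Suc N\<close>.\<close>
    define \<sigma>' where "\<sigma>' q = (if mdeg q \<le> N then \<sigma> q else 0)" for q
    define v :: "'k \<Rightarrow> ('k, real) mps" where "v = near_identity (\<lambda>_. \<sigma>')"
    have v0: "mcoeff (v k) q \<ge> 0" for k q
      using nonneg by (simp add: v_def mcoeff_near_identity \<sigma>'_def)
    have ev: "ev_upto (Suc N) x (v k) \<le> 2 * x" for k
    proof -
      have "ev_upto (Suc N) x (v k) =
          (\<Sum>p\<in>insert (unit_index k) {p. 2 \<le> mdeg p \<and> mdeg p \<le> N}. mcoeff (v k) p * x ^ mdeg p)"
        unfolding ev_upto_def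
      proof (rule sum.mono_neutral_right)
        show "\<forall>p\<in>{p. mdeg p \<le> Suc N} - insert (unit_index k) {p. 2 \<le> mdeg p \<and> mdeg p \<le> N}. mcoeff (v k) p * x ^ mdeg p = 0"
          by (simp add: v_def mcoeff_near_identity \<sigma>'_def)
      qed (auto simp: finite_mdeg_le)
      also have "\<dots> = x + S N"
        using fin by (subst sum.insert) (auto simp: v_def mcoeff_near_identity \<sigma>'_def S_def intro!: sum.cong)
      finally show ?thesis using Suc by simp
    qed
    have "S (Suc N) = (\<Sum>p | 2 \<le> mdeg p \<and> mdeg p \<le> Suc N. mcoeff (mcomp G v) p * x ^ mdeg p)"
      unfolding S_def v_def
    proof (intro sum.cong refl)
      fix p :: "'k \<Rightarrow> nat" assume "p \<in> {p. 2 \<le> mdeg p \<and> mdeg p \<le> Suc N}"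
      then show "\<sigma> p * x ^ mdeg p = mcoeff (mcomp G (near_identity (\<lambda>_. \<sigma>'))) p * x ^ mdeg p"
        by (subst \<sigma>, subst mcomp_near_identity_cong[of p "\<lambda>_. \<sigma>" "\<lambda>_. \<sigma>'"]) (auto simp: \<sigma>'_def G_def)
    qed
    also have "\<dots> \<le> (\<Sum>p | mdeg p \<le> Suc N. mcoeff (mcomp G v) p * x ^ mdeg p)"
    proof (rule sum_mono2)
      show "0 \<le> mcoeff (mcomp G v) p * x ^ mdeg p" for p
        unfolding mcoeff_mcomp using x(1)
        by (intro mult_nonneg_nonneg sum_nonneg G mcoeff_wpow_nonneg v0) auto
    qed (auto simp: finite_mdeg_le)
    also have "\<dots> = (\<Sum>p | mdeg p \<le> Suc N. \<Sum>m | mdeg m \<le> Suc N. mcoeff G m * mcoeff (wpow v m) p * x ^ mdeg p)"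
    proof (intro sum.cong refl)
      fix p :: "'k \<Rightarrow> nat" assume "p \<in> {p. mdeg p \<le> Suc N}"
      moreover have "mcoeff (v k) 0 = 0" for k by (simp add: v_def)
      ultimately show "mcoeff (mcomp G v) p * x ^ mdeg p =
          (\<Sum>m | mdeg m \<le> Suc N. mcoeff G m * mcoeff (wpow v m) p * x ^ mdeg p)"
        by (subst mcoeff_mcomp_upto[of v _ "Suc N"]) (auto simp: sum_distrib_right)
    qed
    also have "\<dots> = (\<Sum>m | mdeg m \<le> Suc N. mcoeff G m * ev_upto (Suc N) x (wpow v m))"
      by (subst sum.swap) (simp add: ev_upto_def sum_distrib_left mult.assoc)
    also have "\<dots> \<le> (\<Sum>m | mdeg m \<le> Suc N. mcoeff G m * (2 * x) ^ mdeg m)"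
      using x(1) by (intro sum_mono mult_left_mono G ev_upto_wpow_le v0 ev) auto
    also have "\<dots> \<le> (\<Sum>m | mdeg m \<le> Suc N. (A * 16 / r ^ 2 * x ^ 2) * (1 / 2) ^ mdeg (m :: 'k \<Rightarrow> nat))"
    proof (rule sum_mono)
      fix m :: "'k \<Rightarrow> nat"
      show "mcoeff G m * (2 * x) ^ mdeg m \<le> (A * 16 / r ^ 2 * x ^ 2) * (1 / 2) ^ mdeg m"
      proof (cases "2 \<le> mdeg m")
        case True
        then obtain d where d: "mdeg m = d + 2" by (metis add.commute le_Suc_ex)
        have "(2 * x / r) ^ d \<le> (1 / 2) ^ d"
          using x assms by (intro power_mono) (auto simp: field_simps)
        then have "A * ((2 * x / r) ^ 2 * (2 * x / r) ^ d) \<le> A * ((2 * x / r) ^ 2 * (1 / 2) ^ d)"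
          using assms by (intro mult_left_mono) auto
        moreover have "(2 * x / r) ^ 2 * (2 * x / r) ^ d = (2 * x / r) ^ (d + 2)"
          by (simp only: power_add mult.commute)
        moreover have "(A * 16 / r ^ 2 * x ^ 2) * (1 / 2) ^ (d + 2) = A * ((2 * x / r) ^ 2 * (1 / 2) ^ d)"
          by (simp add: power_add power_divide power_mult_distrib)
        ultimately have "A * (2 * x / r) ^ (d + 2) \<le> (A * 16 / r ^ 2 * x ^ 2) * (1 / 2) ^ (d + 2)"
          by (simp only:)
        then show ?thesis by (simp only: G_def d mcoeff_Mps power_divide) simp
      qed (use assms in \<open>simp add: G_def\<close>)
    qed
    also have "\<dots> = (A * 16 / r ^ 2 * x ^ 2) * (\<Sum>m | mdeg m \<le> Suc N. (1 / 2) ^ mdeg (m :: 'k \<Rightarrow> nat))"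
      by (simp add: sum_distrib_left)
    also have "\<dots> \<le> (A * 16 / r ^ 2 * x ^ 2) * (1 / (1 - 1 / 2)) ^ CARD('k)"
      using assms by (intro mult_left_mono sum_power_mdeg_le finite_mdeg_le) auto
    also have "\<dots> = B * x * x" by (simp add: B_def power2_eq_square)
    also have "\<dots> \<le> 1 * x" using x by (intro mult_right_mono) auto
    finally show ?case by simp
  qed
  have "\<sigma> p * x ^ mdeg p \<le> x" if "2 \<le> mdeg p" for p
  proof -
    have "\<sigma> p * x ^ mdeg p \<le> S (mdeg p)"
      unfolding S_def using that x nonneg fin
      by (intro member_le_sum[of p _ "\<lambda>p. \<sigma> p * x ^ mdeg p"]) auto
    then show ?thesis using S[of "mdeg p"] by linarith
  qed
  then show ?thesis using x(1) nonneg \<sigma> unfolding G_def by blast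
qed

section \<open>The formal solution\<close>

text \<open>A system with diagonal linear part \<open>\<nu>\<close> and nonlinearity
  \<open>F\<close>, expanded in the phase variables. By \<open>F_supp\<close> the field respects the
  grading by \<open>wt\<close>, so divisors have to be controlled for good modes only.\<close>

locale mode_system = small_divisors wt D N T
  for wt :: "'k::finite \<Rightarrow> nat" and D :: "'k \<Rightarrow> ('k \<Rightarrow> nat) \<Rightarrow> real" and N :: real and T :: nat +
  fixes \<nu> :: "'k \<Rightarrow> complex" and F :: "'k \<Rightarrow> real \<Rightarrow> ('k, complex) mps" and a A r :: real
  assumes F_cont: "continuous_on {0..} (\<lambda>t. mcoeff (F i t) m)"
    and F_bound: "t \<ge> 0 \<Longrightarrow> norm (mcoeff (F i t) m) \<le> A * exp (- a * t) / r ^ mdeg m"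
    and F_supp: "t \<ge> 0 \<Longrightarrow> mcoeff (F i t) m \<noteq> 0 \<Longrightarrow> 2 \<le> mdeg m \<and> good_mode wt i m"
    and A_nonneg: "A \<ge> 0" and r_pos: "r > 0" and a_nonneg: "a \<ge> 0"
    and nonres: "a = 0 \<Longrightarrow> good_mode wt i p \<Longrightarrow> 2 \<le> mdeg p \<Longrightarrow> Re (idot \<nu> p - \<nu> i) \<noteq> 0"
    and D_eq: "D i p = (if a > 0 then 1 / a else 1 / \<bar>Re (idot \<nu> p - \<nu> i)\<bar>)"
begin

text \<open>The equations are imposed in integrated form, which builds in the limits of integration.
  The forcing is cut to 0 at negative times, where \<open>F\<close> is not controlled; a mode
  without forcing then has literally the zero function on the right.\<close>

definition solves :: "('k \<Rightarrow> ('k \<Rightarrow> nat) \<Rightarrow> real \<Rightarrow> complex) \<Rightarrow> bool" where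
  "solves u \<longleftrightarrow> (\<forall>i p. u i p = mode_solution (idot \<nu> p - \<nu> i)
     (\<lambda>s. if s \<ge> 0 then mcoeff (mcomp (F i s) (near_identity (\<lambda>k q. u k q s))) p else 0))"

lemma solution_exists: "\<exists>u. solves u"
proof -
  have "\<exists>u. (\<lambda>u i p. mode_solution (idot \<nu> p - \<nu> i)
     (\<lambda>s. if s \<ge> 0 then mcoeff (mcomp (F i s) (near_identity (\<lambda>k q. u k q s))) p else 0)) u = u"
  proof (rule degree_recursion, rule mode_solution_cong)
    fix u v :: "'k \<Rightarrow> ('k \<Rightarrow> nat) \<Rightarrow> real \<Rightarrow> complex" and i :: 'k and p :: "'k \<Rightarrow> nat" and s :: real
    assume uv: "\<And>j (q :: 'k \<Rightarrow> nat). mdeg q < mdeg p \<Longrightarrow> u j q = v j q" and s: "s \<ge> 0"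
    have "mcoeff (mcomp (F i s) (near_identity (\<lambda>k q. u k q s))) p = mcoeff (mcomp (F i s) (near_identity (\<lambda>k q. v k q s))) p"
      using uv F_supp[OF s] by (intro mcomp_near_identity_cong) (auto simp flip: not_less)
    then show "(if s \<ge> 0 then mcoeff (mcomp (F i s) (near_identity (\<lambda>k q. u k q s))) p else 0) =
      (if s \<ge> 0 then mcoeff (mcomp (F i s) (near_identity (\<lambda>k q. v k q s))) p else 0)" by simp
  qed
  then obtain u where u: "(\<lambda>i p. mode_solution (idot \<nu> p - \<nu> i)
     (\<lambda>s. if s \<ge> 0 then mcoeff (mcomp (F i s) (near_identity (\<lambda>k q. u k q s))) p else 0)) = u" by blast
  have "solves u"
    unfolding solves_def
  proof (intro allI)
    fix i p
    show "u i p = mode_solution (idot \<nu> p - \<nu> i)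
      (\<lambda>s. if s \<ge> 0 then mcoeff (mcomp (F i s) (near_identity (\<lambda>k q. u k q s))) p else 0)"
      using arg_cong[OF u, of "\<lambda>f. f i p"] by (rule sym)
  qed
  then show ?thesis by blast
qed

context
  fixes u :: "'k \<Rightarrow> ('k \<Rightarrow> nat) \<Rightarrow> real \<Rightarrow> complex"
  assumes u: "solves u"
begin

abbreviation series :: "real \<Rightarrow> 'k \<Rightarrow> ('k, complex) mps" where
  "series t \<equiv> near_identity (\<lambda>k q. u k q t)"

lemma u_eq: "u i p = mode_solution (idot \<nu> p - \<nu> i) (\<lambda>s. if s \<ge> 0 then mcoeff (mcomp (F i s) (series s)) p else 0)"
  using u by (simp add: solves_def)

text \<open>\<open>F i t\<close> consists of monomials of weight \<open>wt i\<close>, and replacing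
  the variable \<open>k\<close> by a series of weight \<open>wt k\<close> preserves weights.\<close>

lemma forcing_supp:
  assumes "t \<ge> 0"
    and supp: "\<And>k q. mdeg q < mdeg p \<Longrightarrow> 2 \<le> mdeg q \<Longrightarrow> u k q t \<noteq> 0 \<Longrightarrow> good_mode wt k q"
    and nz: "mcoeff (mcomp (F i t) (series t)) p \<noteq> 0"
  shows "2 \<le> mdeg p \<and> good_mode wt i p"
proof -
  obtain m where m: "mdeg m \<le> mdeg p" "mcoeff (F i t) m \<noteq> 0" "mcoeff (wpow (series t) m) p \<noteq> 0"
    using nz unfolding mcoeff_mcomp by (metis (mono_tags, lifting) mem_Collect_eq mult_eq_0_iff sum.neutral)
  have F: "2 \<le> mdeg m" "good_mode wt i m" using F_supp[OF assms(1) m(2)] by auto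
  \<comment> \<open>The grading is known only below degree \<open>mdeg p\<close>; cutting the series
    there does not affect the coefficient at \<open>p\<close>.\<close>
  define w' :: "'k \<Rightarrow> ('k, complex) mps" where "w' k = Mps (\<lambda>q. if mdeg q < mdeg p then mcoeff (series t k) q else 0)" for k
  have "mcoeff (wpow w' m) p = mcoeff (wpow (series t) m) p"
    by (rule mcoeff_wpow_agree[where d = "mdeg p"]) (use F in \<open>auto simp: w'_def\<close>)
  then have nz': "mcoeff (wpow w' m) p \<noteq> 0" using m by simp
  have w'_good: "good_mode wt k q" if "mcoeff (w' k) q \<noteq> 0" for k q
    using that supp[of q k] by (auto simp: w'_def mcoeff_near_identity good_mode_def split: if_splits)
  have "\<forall>p. mcoeff (wpow w' m) p \<noteq> 0 \<longrightarrow> idot wt p = idot wt m"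
  proof (rule multi_index_induct[of "\<lambda>m. \<forall>p. mcoeff (wpow w' m) p \<noteq> 0 \<longrightarrow> idot wt p = idot wt m" m])
    fix m k assume IH: "\<forall>p. mcoeff (wpow w' m) p \<noteq> 0 \<longrightarrow> idot wt p = idot wt m"
    show "\<forall>p. mcoeff (wpow w' (m + unit_index k)) p \<noteq> 0 \<longrightarrow> idot wt p = idot wt (m + unit_index k)"
    proof (intro allI impI)
      fix p assume "mcoeff (wpow w' (m + unit_index k)) p \<noteq> 0"
      then obtain q where q: "q \<le> p" "mcoeff (wpow w' m) q \<noteq> 0" "mcoeff (w' k) (p - q) \<noteq> 0"
        unfolding wpow_add wpow_unit mcoeff_mult
        by (metis (mono_tags, lifting) mem_Collect_eq mult_eq_0_iff sum.neutral)
      have "idot wt p = idot wt q + idot wt (p - q)"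
        using q(1) by (metis idot_add index_diff_add(1))
      also have "\<dots> = idot wt m + wt k"
        using IH q w'_good[OF q(3)] by (simp add: good_mode_def)
      finally show "idot wt p = idot wt (m + unit_index k)" by (simp add: idot_add del: plus_fun_apply)
    qed
  qed (auto simp: mcoeff_one split: if_splits)
  then have "good_mode wt i p" using nz' F(2) by (simp add: good_mode_def)
  then show ?thesis using F m by simp
qed

text \<open>The facts are proved together, since the forcing of a mode is built from lower modes and
  its continuity, size and support all depend on theirs. Its factor \<open>exp (- a * t)\<close>
  comes from \<open>F\<close> alone, so bounded lower modes are enough.\<close>

lemma solution_induct_facts:
  assumes \<delta>: "\<And>i p. \<delta> i p \<ge> 0" "\<And>i p. mdeg p \<le> 1 \<Longrightarrow> \<delta> i p = 1"
    and \<delta>D: "\<And>i p ds. ds \<in> decomps wt p \<Longrightarrow> D i p * (\<Prod>x\<leftarrow>ds. \<delta> (fst x) (snd x)) \<le> \<delta> i p"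
    and \<sigma>0: "\<And>p. \<sigma> p \<ge> 0"
    and \<sigma>: "\<And>p. \<sigma> p = mcoeff (mcomp (Mps (\<lambda>m. if 2 \<le> mdeg m then A / r ^ mdeg m else 0)) (near_identity (\<lambda>_ :: 'k. \<sigma>))) p"
  shows "continuous_on {0..} (u i p) \<and>
     (\<forall>t\<ge>0. norm (u i p t) \<le> \<delta> i p * \<sigma> p \<and> (u i p t \<noteq> 0 \<longrightarrow> 2 \<le> mdeg p \<and> good_mode wt i p)) \<and>
     (\<exists>G. \<forall>s\<ge>0. norm (mcoeff (mcomp (F i s) (series s)) p) \<le> G * exp (- a * s)) \<and>
     continuous_on {0..} (\<lambda>s. mcoeff (mcomp (F i s) (series s)) p)"
proof (induction "mdeg p" arbitrary: i p rule: less_induct)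
  case less
  define w' :: "real \<Rightarrow> 'k \<Rightarrow> ('k, complex) mps"
    where "w' t k = Mps (\<lambda>q. if mdeg q < mdeg p then mcoeff (series t k) q else 0)" for t k
  have IH: "continuous_on {0..} (u j q)"
    "\<And>t. t \<ge> 0 \<Longrightarrow> norm (u j q t) \<le> \<delta> j q * \<sigma> q"
    "\<And>t. t \<ge> 0 \<Longrightarrow> u j q t \<noteq> 0 \<Longrightarrow> 2 \<le> mdeg q \<and> good_mode wt j q" if "mdeg q < mdeg p" for j q
    using less[OF that, of j] by blast+
  have wpow_eq: "mcoeff (wpow (w' t) m) p = mcoeff (wpow (series t) m) p" if "2 \<le> mdeg m" for m t
    by (rule mcoeff_wpow_agree[where d = "mdeg p"]) (use that in \<open>auto simp: w'_def\<close>)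
  have comp_eq: "mcoeff (mcomp (F i t) (series t)) p = mcoeff (mcomp (F i t) (w' t)) p" if "t \<ge> 0" for t
    unfolding mcoeff_mcomp
  proof (rule sum.cong[OF refl])
    fix m show "mcoeff (F i t) m * mcoeff (wpow (series t) m) p = mcoeff (F i t) m * mcoeff (wpow (w' t) m) p"
      using wpow_eq[of m t] F_supp[OF that, of i m] by (cases "mcoeff (F i t) m = 0") auto
  qed
  have cont': "continuous_on {0..} (\<lambda>t. mcoeff (mcomp (F i t) (w' t)) p)"
  proof (rule continuous_on_mcoeff_mcomp)
    show "continuous_on {0..} (\<lambda>t. mcoeff (w' t k) q)" for k q
      using IH(1)[of q k]
      by (cases "mdeg q < mdeg p"; cases "2 \<le> mdeg q") (simp_all add: w'_def mcoeff_near_identity)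
  qed (rule F_cont)
  then have cont: "continuous_on {0..} (\<lambda>t. mcoeff (mcomp (F i t) (series t)) p)"
    by (rule continuous_on_eq) (simp add: comp_eq)
  have supp: "2 \<le> mdeg p \<and> good_mode wt i p" if "t \<ge> 0" "mcoeff (mcomp (F i t) (series t)) p \<noteq> 0" for t
    using that IH(3)[OF _ that(1)] by (intro forcing_supp[of t]) auto
  define v :: "'k \<Rightarrow> ('k, real) mps" where "v = near_identity (\<lambda>_. \<sigma>)"
  have v0: "mcoeff (v k) q \<ge> 0" for k q using \<sigma>0 by (simp add: v_def mcoeff_near_identity)
  \<comment> \<open>The divisor is multiplied in before estimating: \<open>\<delta> i p\<close>
    dominates \<open>D i p\<close> times the product of the weights of the factors, not that product
    by itself.\<close>
  have main: "D i p * norm (mcoeff (mcomp (F i t) (series t)) p) \<le> \<delta> i p * \<sigma> p * exp (- a * t)"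
    if t: "t \<ge> 0" and good: "good_mode wt i p" for t
  proof -
    have wp: "D i p * norm (mcoeff (wpow (w' t) m) p) \<le> \<delta> i p * mcoeff (wpow v m) p" if m: "2 \<le> mdeg m" for m
    proof (rule wpow_weighted_bound[where \<delta> = \<delta> and wt = wt])
      show "norm (mcoeff (w' t k) q) \<le> \<delta> k q * mcoeff (v k) q" for k q
        using IH(2)[OF _ t, of q k] \<delta> v0[of k q] by (auto simp: w'_def v_def mcoeff_near_identity)
      show "q \<noteq> 0 \<and> good_mode wt k q" if "mcoeff (w' t k) q \<noteq> 0" for k q
      proof
        show "q \<noteq> 0"
        proof
          assume q: "q = 0"
          have "mcoeff (w' t k) q = 0"
            unfolding q by (simp only: w'_def mcoeff_Mps mcoeff_near_identity_0 if_cancel)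
          then show False using that by blast
        qed
        show "good_mode wt k q"
          using that IH(3)[OF _ t, of q k] by (auto simp: w'_def mcoeff_near_identity good_mode_def split: if_splits)
      qed
      fix ds :: "('k \<times> ('k \<Rightarrow> nat)) list"
      assume "\<forall>(j, q)\<in>set ds. q \<noteq> 0 \<and> good_mode wt j q" "sum_list (map snd ds) = p" "length ds = mdeg m"
      then have "ds \<in> decomps wt p" using m by (simp add: decomps_def)
      then show "D i p * (\<Prod>x\<leftarrow>ds. \<delta> (fst x) (snd x)) \<le> \<delta> i p" by (rule \<delta>D)
    qed (use \<delta> v0 D_nonneg in auto)
    have "D i p * norm (mcoeff (mcomp (F i t) (series t)) p) \<le>
        D i p * (\<Sum>m | mdeg m \<le> mdeg p. norm (mcoeff (F i t) m * mcoeff (wpow (w' t) m) p))"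
      unfolding comp_eq[OF t] unfolding mcoeff_mcomp using D_nonneg by (intro mult_left_mono norm_sum)
    also have "\<dots> = (\<Sum>m | mdeg m \<le> mdeg p. norm (mcoeff (F i t) m) * (D i p * norm (mcoeff (wpow (w' t) m) p)))"
      by (simp add: sum_distrib_left norm_mult mult_ac)
    also have "\<dots> \<le> (\<Sum>m | mdeg m \<le> mdeg p. (\<delta> i p * exp (- a * t)) *
        ((if 2 \<le> mdeg m then A / r ^ mdeg m else 0) * mcoeff (wpow v m) p))"
    proof (rule sum_mono)
      fix m :: "'k \<Rightarrow> nat"
      show "norm (mcoeff (F i t) m) * (D i p * norm (mcoeff (wpow (w' t) m) p)) \<le> (\<delta> i p * exp (- a * t)) *
        ((if 2 \<le> mdeg m then A / r ^ mdeg m else 0) * mcoeff (wpow v m) p)"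
      proof (cases "2 \<le> mdeg m")
        case True
        have "norm (mcoeff (F i t) m) * (D i p * norm (mcoeff (wpow (w' t) m) p)) \<le>
            (A * exp (- a * t) / r ^ mdeg m) * (\<delta> i p * mcoeff (wpow v m) p)"
          by (rule mult_mono[OF F_bound[OF t] wp[OF True]]) (use A_nonneg r_pos D_nonneg in auto)
        then show ?thesis using True by (simp add: mult_ac)
      next
        case False
        then have "mcoeff (F i t) m = 0" using F_supp[OF t, of i m] by blast
        then show ?thesis using False by simp
      qed
    qed
    also have "\<dots> = (\<delta> i p * exp (- a * t)) * \<sigma> p"
      unfolding sum_distrib_left[symmetric] by (subst \<sigma>) (simp add: mcoeff_mcomp v_def)
    finally show ?thesis by (simp add: mult_ac)
  qed
  \<comment> \<open>The constant in the decay of the forcing; 0 for modes outside the grading or of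
    low degree, whose forcing vanishes.\<close>
  define G where "G = (if good_mode wt i p \<and> 2 \<le> mdeg p then \<delta> i p * \<sigma> p / D i p else 0)"
  have D_pos: "D i p > 0" if "good_mode wt i p" "2 \<le> mdeg p"
    using that nonres a_nonneg by (auto simp: D_eq)
  have G: "norm (mcoeff (mcomp (F i s) (series s)) p) \<le> G * exp (- a * s)" if "s \<ge> 0" for s
  proof (cases "mcoeff (mcomp (F i s) (series s)) p = 0")
    case True
    have "G \<ge> 0" using \<delta> \<sigma>0 D_nonneg by (simp add: G_def)
    then show ?thesis using True by simp
  next
    case False
    then have s: "good_mode wt i p" "2 \<le> mdeg p" using supp[OF that] by auto
    then show ?thesis
      using main[OF that s(1)] D_pos[OF s] by (simp add: G_def field_simps)
  qed
  define g where "g = (\<lambda>s. if s \<ge> 0 then mcoeff (mcomp (F i s) (series s)) p else 0)"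
  have g_cont: "continuous_on {0..} g"
    by (rule continuous_on_eq[OF cont]) (simp add: g_def)
  have g_bound: "norm (g s) \<le> G * exp (- a * s)" if "s \<ge> 0" for s using G[OF that] that by (simp add: g_def)
  have ueq: "u i p = mode_solution (idot \<nu> p - \<nu> i) g" unfolding g_def by (rule u_eq)
  have u_supp: "2 \<le> mdeg p \<and> good_mode wt i p" if "t \<ge> 0" "u i p t \<noteq> 0" for t
  proof (rule ccontr)
    assume "\<not> ?thesis"
    then have "g s = 0" for s using supp[of s] by (auto simp: g_def)
    then have "g = (\<lambda>_. 0)" by blast
    then have "u i p t = 0" unfolding ueq by (simp add: mode_solution_zero)
    then show False using that by simp
  qed
  have u_bound: "norm (u i p t) \<le> \<delta> i p * \<sigma> p" if t: "t \<ge> 0" for t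
  proof (cases "u i p t = 0")
    case True then show ?thesis using \<delta> \<sigma>0 by simp
  next
    case False
    then have s: "good_mode wt i p" "2 \<le> mdeg p" using u_supp[OF t] by auto
    have "norm (u i p t) \<le> D i p * G"
      unfolding ueq D_eq using a_nonneg nonres s t by (intro mode_solution_bound[OF g_cont g_bound]) auto
    also have "\<dots> = \<delta> i p * \<sigma> p" using D_pos[OF s] s by (simp add: G_def)
    finally show ?thesis .
  qed
  have "continuous_on {0..} (u i p)"
    unfolding continuous_on_eq_continuous_within
    using mode_solution_has_derivative[OF g_cont] has_vector_derivative_continuous unfolding ueq by blast
  then show ?case using u_bound u_supp G cont by blast
qed

end

theorem formal_solution:
  "\<exists>u B s. s > 0 \<and> B \<ge> 0 \<and> (\<forall>i p t. t \<ge> 0 \<longrightarrow>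
      norm (u i p t) \<le> B / s ^ mdeg p \<and>
      (u i p t \<noteq> 0 \<longrightarrow> 2 \<le> mdeg p \<and> good_mode wt i p) \<and>
      (u i p has_vector_derivative mcoeff (mcomp (F i t) (near_identity (\<lambda>k q. u k q t))) p - (idot \<nu> p - \<nu> i) * u i p t)
        (at t within {0..})) \<and>
    (\<forall>i p. Re (idot \<nu> p - \<nu> i) > 0 \<longrightarrow> u i p 0 = 0) \<and>
    (a > 0 \<longrightarrow> (\<forall>i p. (u i p \<longlongrightarrow> 0) at_top))"
proof -
  obtain u where u: "solves u" using solution_exists by blast
  obtain \<delta> where \<delta>: "\<And>i p. \<delta> i p \<ge> 0" "\<And>i p. mdeg p \<le> 1 \<Longrightarrow> \<delta> i p = 1"
    "\<And>i p. good_mode wt i p \<Longrightarrow> \<delta> i p \<le> C ^ mdeg p"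
    "\<And>i p ds. ds \<in> decomps wt p \<Longrightarrow> D i p * (\<Prod>x\<leftarrow>ds. \<delta> (fst x) (snd x)) \<le> \<delta> i p"
    using weights_exist by metis
  define \<Psi> where "\<Psi> \<sigma> x \<longleftrightarrow> x > 0 \<and> (\<forall>p. \<sigma> p \<ge> 0) \<and> (\<forall>p. 2 \<le> mdeg p \<longrightarrow> \<sigma> p * x ^ mdeg p \<le> x) \<and>
    (\<forall>p. \<sigma> p = mcoeff (mcomp (Mps (\<lambda>m. if 2 \<le> mdeg m then A / r ^ mdeg m else 0)) (near_identity (\<lambda>_ :: 'k. \<sigma>))) p)"
    for \<sigma> :: "('k \<Rightarrow> nat) \<Rightarrow> real" and x :: real
  have "\<exists>\<sigma> x. \<Psi> \<sigma> x" unfolding \<Psi>_def by (rule majorant_exists[OF A_nonneg r_pos])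
  then obtain \<sigma> x where "\<Psi> \<sigma> x" by blast
  then have \<sigma>: "x > 0" "\<And>p. \<sigma> p \<ge> 0" "\<And>p. 2 \<le> mdeg p \<Longrightarrow> \<sigma> p * x ^ mdeg p \<le> x"
    "\<And>p. \<sigma> p = mcoeff (mcomp (Mps (\<lambda>m. if 2 \<le> mdeg m then A / r ^ mdeg m else 0)) (near_identity (\<lambda>_ :: 'k. \<sigma>))) p"
    unfolding \<Psi>_def by blast+
  note facts = solution_induct_facts[OF u \<delta>(1,2,4) \<sigma>(2,4)]
  have C: "C > 0" using C_ge(1) by linarith
  \<comment> \<open>Weights are at most \<open>C ^ mdeg p\<close> and the majorant at most
    \<open>x / x ^ mdeg p\<close>, so the radius shrinks by the factor \<open>C\<close>.\<close>
  define s where "s = x / C"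
  have s: "s > 0" using \<sigma> C by (simp add: s_def)
  have bound: "norm (u i p t) \<le> x / s ^ mdeg p" if t: "t \<ge> 0" for i p t
  proof (cases "u i p t = 0")
    case True then show ?thesis using s \<sigma> by simp
  next
    case False
    then have p: "2 \<le> mdeg p" "good_mode wt i p" using facts[of i p] t by blast+
    have "norm (u i p t) \<le> \<delta> i p * \<sigma> p" using facts[of i p] t by blast
    also have "\<dots> \<le> C ^ mdeg p * (x / x ^ mdeg p)"
      using \<delta>(1,3) p \<sigma> C by (intro mult_mono) (auto simp: pos_le_divide_eq)
    also have "\<dots> = x / s ^ mdeg p" using C by (simp add: s_def power_divide)
    finally show ?thesis .
  qed
  have g: "continuous_on {0..} (\<lambda>s. if s \<ge> 0 then mcoeff (mcomp (F i s) (near_identity (\<lambda>k q. u k q s))) p else 0)" for i p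
    by (rule continuous_on_eq[of _ "\<lambda>s. mcoeff (mcomp (F i s) (near_identity (\<lambda>k q. u k q s))) p"])
       (use facts[of i p] in auto)
  have deriv: "(u i p has_vector_derivative mcoeff (mcomp (F i t) (near_identity (\<lambda>k q. u k q t))) p - (idot \<nu> p - \<nu> i) * u i p t)
        (at t within {0..})" if t: "t \<ge> 0" for i p t
    using mode_solution_has_derivative[OF g t, of "idot \<nu> p - \<nu> i" i p] t unfolding u_eq[OF u, of i p, symmetric] by simp
  have zero: "u i p 0 = 0" if "Re (idot \<nu> p - \<nu> i) > 0" for i p
    by (subst u_eq[OF u]) (rule mode_solution_at_0[OF that])
  have tends: "(u i p \<longlongrightarrow> 0) at_top" if "a > 0" for i p
  proof -
    obtain G where G: "\<And>s. s \<ge> 0 \<Longrightarrow> norm (mcoeff (mcomp (F i s) (near_identity (\<lambda>k q. u k q s))) p) \<le> G * exp (- a * s)"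
      using facts[of i p] by blast
    show ?thesis
      by (subst u_eq[OF u], rule mode_solution_tendsto_0[where G = G, OF g _ that]) (use G in auto)
  qed
  show ?thesis
    using s \<sigma>(1) bound facts deriv zero tends
    by (intro exI[of _ u] exI[of _ x] exI[of _ s]) (auto intro: less_imp_le)
qed

end

section \<open>Lagrange brackets of the formal solution\<close>

text \<open>Coefficientwise and one-sided at 0, so that brackets can be differentiated formally,
  before any convergence is discussed.\<close>

definition mps_deriv :: "(real \<Rightarrow> ('k::finite, complex) mps) \<Rightarrow> ('k, complex) mps \<Rightarrow> real \<Rightarrow> bool" where
  "mps_deriv f f' t \<longleftrightarrow> (\<forall>p. ((\<lambda>t. mcoeff (f t) p) has_vector_derivative mcoeff f' p) (at t within {0..}))"

lemma mps_deriv_mult: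
  assumes "mps_deriv f f' t" "mps_deriv g g' t"
  shows "mps_deriv (\<lambda>t. f t * g t) (f' * g t + f t * g') t"
  unfolding mps_deriv_def
proof
  fix p
  have "((\<lambda>t. \<Sum>q | q \<le> p. mcoeff (f t) q * mcoeff (g t) (p - q)) has_vector_derivative
     (\<Sum>q | q \<le> p. mcoeff (f t) q * mcoeff g' (p - q) + mcoeff f' q * mcoeff (g t) (p - q))) (at t within {0..})"
    using assms unfolding mps_deriv_def
    by (intro has_vector_derivative_sum has_vector_derivative_mult) auto
  then show "((\<lambda>t. mcoeff (f t * g t) p) has_vector_derivative mcoeff (f' * g t + f t * g') p) (at t within {0..})"
    by (simp add: mcoeff_mult sum.distrib add.commute)
qed

lemma mps_deriv_mconst_mult: "mps_deriv f f' t \<Longrightarrow> mps_deriv (\<lambda>t. mconst c * f t) (mconst c * f') t"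
  unfolding mps_deriv_def mcoeff_mconst_mult by (intro allI has_vector_derivative_mult_right) blast

lemma mps_deriv_sum:
  "(\<And>i. i \<in> I \<Longrightarrow> mps_deriv (f i) (f' i) t) \<Longrightarrow> mps_deriv (\<lambda>t. \<Sum>i\<in>I. f i t) (\<Sum>i\<in>I. f' i) t"
  unfolding mps_deriv_def mcoeff_sum by (intro allI has_vector_derivative_sum) blast

lemma mps_deriv_mderiv: "mps_deriv f f' t \<Longrightarrow> mps_deriv (\<lambda>t. mderiv a (f t)) (mderiv a f') t"
  unfolding mps_deriv_def mcoeff_mderiv by (intro allI has_vector_derivative_mult_right) blast

lemma mderiv_weighted_euler:
  "mderiv a (weighted_euler \<nu> x) = weighted_euler \<nu> (mderiv a x) + mconst (\<nu> a) * mderiv a x"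
  by (rule mps_eqI)
     (simp add: mcoeff_mderiv mcoeff_weighted_euler idot_add algebra_simps del: plus_fun_apply)

lemma mderiv_diff: "mderiv a (x - y) = mderiv a x - mderiv a (y :: ('k::finite, complex) mps)"
  by (rule mps_eqI) (simp add: mcoeff_mderiv algebra_simps)

lemma mcomp_mconst_mult: "mcomp (mconst c * F) w = mconst c * mcomp F w"
  by (rule mps_eqI) (simp add: mcoeff_mcomp sum_distrib_left mult.assoc)

lemma weighted_euler_sum: "weighted_euler \<nu> (\<Sum>i\<in>I. x i) = (\<Sum>i\<in>I. weighted_euler \<nu> (x i))"
  by (rule mps_eqI) (simp add: mcoeff_weighted_euler sum_distrib_left)

lemma weighted_euler_mconst_mult: "weighted_euler \<nu> (mconst c * x) = mconst c * weighted_euler \<nu> x"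
  by (rule mps_eqI) (simp only: mcoeff_weighted_euler mcoeff_mconst_mult mult.left_commute)

lemma linear_ode_solution:
  fixes X :: "real \<Rightarrow> complex"
  assumes "\<And>t. t \<ge> 0 \<Longrightarrow> (X has_vector_derivative - \<mu> * X t) (at t within {0..})" and t: "t \<ge> 0"
  shows "X t = X 0 * exp (- \<mu> * of_real t)"
proof -
  have "((\<lambda>s. X s * exp (\<mu> * of_real s)) has_vector_derivative 0) (at s within {0..})" if "s \<in> {0..}" for s
  proof -
    have E: "((\<lambda>s. exp (\<mu> * of_real s)) has_vector_derivative (\<mu> * exp (\<mu> * of_real s))) (at s within {0..})"
    proof -
      have "((\<lambda>s. exp (\<mu> * s)) has_field_derivative (\<mu> * exp (\<mu> * of_real s))) (at (of_real s))"
        by (auto intro!: derivative_eq_intros)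
      then show ?thesis
        using has_vector_derivative_real_field has_vector_derivative_at_within by blast
    qed
    have "((\<lambda>s. X s * exp (\<mu> * of_real s)) has_vector_derivative
       (X s * (\<mu> * exp (\<mu> * of_real s)) + (- \<mu> * X s) * exp (\<mu> * of_real s))) (at s within {0..})"
      by (intro has_vector_derivative_mult E assms) (use that in auto)
    then show ?thesis by (simp add: algebra_simps)
  qed
  then obtain c where c: "\<And>s. s \<in> {0..} \<Longrightarrow> X s * exp (\<mu> * of_real s) = c"
    using has_vector_derivative_zero_constant[of "{0..}" "\<lambda>s. X s * exp (\<mu> * of_real s)"] by auto
  have "X t * exp (\<mu> * of_real t) = X 0" using c[of t] c[of 0] t by simp
  then have "X 0 * exp (- \<mu> * of_real t) = X t * (exp (\<mu> * of_real t) * exp (- \<mu> * of_real t))" by simp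
  also have "exp (\<mu> * of_real t) * exp (- \<mu> * of_real t) = 1" by (simp flip: exp_add)
  finally show ?thesis by simp
qed

context mode_system
begin

text \<open>The conclusion of \<open>formal_solution\<close> under a name. The conditions at 0 and
  at infinity belong to it because they are what determines the brackets.\<close>

definition normalizing :: "('k \<Rightarrow> ('k \<Rightarrow> nat) \<Rightarrow> real \<Rightarrow> complex) \<Rightarrow> real \<Rightarrow> real \<Rightarrow> bool" where
  "normalizing u B s \<longleftrightarrow> s > 0 \<and> B \<ge> 0 \<and> (\<forall>i p t. t \<ge> 0 \<longrightarrow>
      norm (u i p t) \<le> B / s ^ mdeg p \<and>
      (u i p t \<noteq> 0 \<longrightarrow> 2 \<le> mdeg p \<and> good_mode wt i p) \<and>
      (u i p has_vector_derivative mcoeff (mcomp (F i t) (near_identity (\<lambda>k q. u k q t))) p - (idot \<nu> p - \<nu> i) * u i p t)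
        (at t within {0..})) \<and>
    (\<forall>i p. Re (idot \<nu> p - \<nu> i) > 0 \<longrightarrow> u i p 0 = 0) \<and>
    (a > 0 \<longrightarrow> (\<forall>i p. (u i p \<longlongrightarrow> 0) at_top))"

lemma normalizing_exists: "\<exists>u B s. normalizing u B s"
  unfolding normalizing_def by (rule formal_solution)

text \<open>The coefficient equations assembled into one for the series: the map carries the flow of
  the diagonal linear field to that of the full system. In degrees below two both sides
  vanish.\<close>

lemma normalizing_deriv:
  assumes u: "normalizing u B s" and t: "t \<ge> 0"
  shows "mps_deriv (\<lambda>t. near_identity (\<lambda>k q. u k q t) i)
    (mcomp (F i t) (near_identity (\<lambda>k q. u k q t)) - weighted_euler \<nu> (near_identity (\<lambda>k q. u k q t) i)
      + mconst (\<nu> i) * near_identity (\<lambda>k q. u k q t) i) t"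
  unfolding mps_deriv_def
proof
  fix p
  show "((\<lambda>t. mcoeff (near_identity (\<lambda>k q. u k q t) i) p) has_vector_derivative
      mcoeff (mcomp (F i t) (near_identity (\<lambda>k q. u k q t)) - weighted_euler \<nu> (near_identity (\<lambda>k q. u k q t) i)
      + mconst (\<nu> i) * near_identity (\<lambda>k q. u k q t) i) p) (at t within {0..})"
  proof (cases "2 \<le> mdeg p")
    case True
    have "(u i p has_vector_derivative mcoeff (mcomp (F i t) (near_identity (\<lambda>k q. u k q t))) p - (idot \<nu> p - \<nu> i) * u i p t)
        (at t within {0..})"
      using u t unfolding normalizing_def by blast
    then show ?thesis
      using True by (simp add: mcoeff_near_identity mcoeff_weighted_euler algebra_simps)
  next
    case False
    have "mcoeff (mcomp (F i t) (near_identity (\<lambda>k q. u k q t))) p = 0"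
      unfolding mcoeff_mcomp
    proof (rule sum.neutral, rule ballI)
      fix m :: "'k \<Rightarrow> nat" assume "m \<in> {m. mdeg m \<le> mdeg p}"
      then have "mcoeff (F i t) m = 0" using F_supp[OF t, of i m] False by auto
      then show "mcoeff (F i t) m * mcoeff (wpow (near_identity (\<lambda>k q. u k q t)) m) p = 0" by simp
    qed
    then show ?thesis
      using False by (simp add: mcoeff_near_identity mcoeff_weighted_euler)
  qed
qed

end

text \<open>Positions and momenta share one index type: \<open>cj\<close> exchanges conjugate
  variables and \<open>sg\<close> carries the sign, so \<open>F_eq\<close> expresses both halves of
  Hamilton's equations.\<close>

locale hamiltonian_system = mode_system wt D N T \<nu> F a A r
  for wt :: "'k::finite \<Rightarrow> nat" and D N T \<nu> F a A r +
  fixes cj :: "'k \<Rightarrow> 'k" and sg :: "'k \<Rightarrow> complex" and f :: "real \<Rightarrow> ('k, complex) mps" and \<kappa> :: nat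
  assumes cj_cj: "cj (cj i) = i" and sg_square: "sg i * sg i = 1" and sg_cj: "sg (cj i) = - sg i"
    and \<nu>_cj: "\<nu> (cj i) = - \<nu> i" and wt_cj: "wt i + wt (cj i) = \<kappa>"
    and F_eq: "F i t = mconst (sg i) * mderiv (cj i) (f t)"
begin

context
  fixes u B s
  assumes u: "normalizing u B s"
begin

abbreviation \<Phi> :: "real \<Rightarrow> 'k \<Rightarrow> ('k, complex) mps" where
  "\<Phi> t \<equiv> near_identity (\<lambda>k q. u k q t)"

text \<open>The pullback of the symplectic form under the map, evaluated on the coordinate
  directions \<open>b\<close> and \<open>d\<close>.\<close>

definition lagrange_bracket :: "'k \<Rightarrow> 'k \<Rightarrow> real \<Rightarrow> ('k, complex) mps" where
  "lagrange_bracket b d t = (\<Sum>i\<in>UNIV. mconst (sg i) * (mderiv b (\<Phi> t i) * mderiv d (\<Phi> t (cj i))))"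

text \<open>The terms with second derivatives of \<open>f\<close> cancel because the Hessian is
  symmetric and \<open>sg\<close> is odd under \<open>cj\<close>; the frequencies of
  \<open>i\<close> and \<open>cj i\<close> cancel as well. Only the terms of the linear flow
  remain.\<close>

lemma lagrange_bracket_deriv:
  assumes t: "t \<ge> 0"
  shows "mps_deriv (lagrange_bracket b d)
    (- (weighted_euler \<nu> (lagrange_bracket b d t) + mconst (\<nu> b + \<nu> d) * lagrange_bracket b d t)) t"
proof -
  define P where "P b i = mderiv b (\<Phi> t i)" for b i
  define H where "H k j = mcomp (mderiv k (mderiv j (f t))) (\<Phi> t)" for k j
  define P' where "P' b i = mconst (sg i) * (\<Sum>k\<in>UNIV. H k (cj i) * P b k)
      - weighted_euler \<nu> (P b i) - mconst (\<nu> b) * P b i + mconst (\<nu> i) * P b i" for b i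
  have H_sym: "H k j = H j k" for k j by (simp add: H_def mderiv_commute[of k j])
  have P'_deriv: "mps_deriv (\<lambda>t. mderiv b (\<Phi> t i)) (P' b i) t" for b i
  proof -
    have "mderiv b (mcomp (F i t) (\<Phi> t)) = mconst (sg i) * (\<Sum>k\<in>UNIV. H k (cj i) * P b k)"
      by (subst mderiv_mcomp)
         (simp_all add: F_eq mderiv_mconst_mult mcomp_mconst_mult H_def P_def sum_distrib_left mult.assoc)
    then have "mderiv b (mcomp (F i t) (\<Phi> t) - weighted_euler \<nu> (\<Phi> t i) + mconst (\<nu> i) * \<Phi> t i) = P' b i"
      by (simp add: mderiv_add mderiv_diff mderiv_weighted_euler mderiv_mconst_mult P'_def P_def algebra_simps)
    then show ?thesis using mps_deriv_mderiv[OF normalizing_deriv[OF u t, of i], of b] by simp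
  qed
  have "mps_deriv (lagrange_bracket b d) (\<Sum>i\<in>UNIV. mconst (sg i) * (P' b i * P d (cj i) + P b i * P' d (cj i))) t"
    unfolding lagrange_bracket_def P_def
    by (intro mps_deriv_sum mps_deriv_mconst_mult mps_deriv_mult P'_deriv)
  also have "(\<Sum>i\<in>UNIV. mconst (sg i) * (P' b i * P d (cj i) + P b i * P' d (cj i))) =
      (\<Sum>i\<in>UNIV. (\<Sum>k\<in>UNIV. H k (cj i) * P b k * P d (cj i)) - (\<Sum>k\<in>UNIV. H k i * P d k * P b i)
        - mconst (sg i) * weighted_euler \<nu> (P b i * P d (cj i))
        - mconst (\<nu> b + \<nu> d) * (mconst (sg i) * (P b i * P d (cj i))))"
  proof (rule sum.cong[OF refl])
    fix i
    have s1: "mconst (sg i) * (mconst (sg i) * x) = x" for x :: "('k, complex) mps"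
      by (simp add: mult.assoc[symmetric] sg_square mconst_one flip: mconst_mult)
    have s2: "mconst (sg i) * (mconst (sg (cj i)) * x) = - x" for x :: "('k, complex) mps"
      by (simp add: sg_cj mconst_uminus s1)
    define X where "X = (\<Sum>k\<in>UNIV. H k (cj i) * P b k)"
    define Y where "Y = (\<Sum>k\<in>UNIV. H k i * P d k)"
    define S Nb Nd Ni :: "('k, complex) mps"
      where "S = mconst (sg i)" and "Nb = mconst (\<nu> b)" and "Nd = mconst (\<nu> d)" and "Ni = mconst (\<nu> i)"
    have "mconst (sg i) * (P' b i * P d (cj i) + P b i * P' d (cj i)) =
        (S * (S * X)) * P d (cj i) + (S * (mconst (sg (cj i)) * Y)) * P b i
        - S * (weighted_euler \<nu> (P b i) * P d (cj i) + P b i * weighted_euler \<nu> (P d (cj i)))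
        - (Nb + Nd) * (S * (P b i * P d (cj i))) + (Ni + mconst (\<nu> (cj i))) * (S * (P b i * P d (cj i)))"
    proof -
      have PB: "P' b i = S * X - weighted_euler \<nu> (P b i) - Nb * P b i + Ni * P b i"
        by (simp only: P'_def X_def S_def Nb_def Ni_def)
      have PD: "P' d (cj i) = mconst (sg (cj i)) * Y - weighted_euler \<nu> (P d (cj i)) - Nd * P d (cj i)
          + mconst (\<nu> (cj i)) * P d (cj i)"
        by (simp only: P'_def Y_def Nd_def cj_cj)
      show ?thesis unfolding PB PD S_def[symmetric] by (simp add: algebra_simps)
    qed
    also have "Ni + mconst (\<nu> (cj i)) = 0" by (simp add: Ni_def \<nu>_cj mconst_uminus)
    finally show "mconst (sg i) * (P' b i * P d (cj i) + P b i * P' d (cj i)) =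
        (\<Sum>k\<in>UNIV. H k (cj i) * P b k * P d (cj i)) - (\<Sum>k\<in>UNIV. H k i * P d k * P b i)
        - mconst (sg i) * weighted_euler \<nu> (P b i * P d (cj i))
        - mconst (\<nu> b + \<nu> d) * (mconst (sg i) * (P b i * P d (cj i)))"
      unfolding S_def s1 s2 Nb_def Nd_def mconst_add[symmetric] weighted_euler_mult
      by (simp add: X_def Y_def sum_distrib_right)
  qed
  also have "\<dots> = - (weighted_euler \<nu> (lagrange_bracket b d t) + mconst (\<nu> b + \<nu> d) * lagrange_bracket b d t)"
  proof -
    \<comment> \<open>Reindexing by \<open>cj\<close>, exchanging the two summations and using the
      symmetry of \<open>H\<close> identify the two Hessian sums.\<close>
    have bij: "bij cj" by (rule o_bij[of cj]) (auto simp: cj_cj fun_eq_iff)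
    have "(\<Sum>i\<in>UNIV. \<Sum>k\<in>UNIV. H k (cj i) * P b k * P d (cj i)) = (\<Sum>i\<in>UNIV. \<Sum>k\<in>UNIV. H k i * P b k * P d i)"
      by (rule sum.reindex_bij_betw[OF bij, of "\<lambda>i. \<Sum>k\<in>UNIV. H k i * P b k * P d i"])
    also have "\<dots> = (\<Sum>k\<in>UNIV. \<Sum>i\<in>UNIV. H k i * P b k * P d i)"
      by (rule sum.swap)
    also have "\<dots> = (\<Sum>i\<in>UNIV. \<Sum>k\<in>UNIV. H k i * P d k * P b i)"
      by (intro sum.cong refl) (simp add: H_sym mult_ac)
    finally have "(\<Sum>i\<in>UNIV. \<Sum>k\<in>UNIV. H k (cj i) * P b k * P d (cj i)) = (\<Sum>i\<in>UNIV. \<Sum>k\<in>UNIV. H k i * P d k * P b i)" .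
    then show ?thesis
      by (simp add: sum_subtractf lagrange_bracket_def P_def weighted_euler_sum weighted_euler_mconst_mult
          sum_distrib_left del: mcoeff_sum)
  qed
  finally show ?thesis .
qed

lemma mcoeff_\<Phi>_supp: "t \<ge> 0 \<Longrightarrow> mcoeff (\<Phi> t i) q \<noteq> 0 \<Longrightarrow> good_mode wt i q"
  using u unfolding normalizing_def by (auto simp: mcoeff_near_identity good_mode_def split: if_splits)

lemma mcoeff_\<Phi>_0: "Re (idot \<nu> q - \<nu> i) > 0 \<Longrightarrow> mcoeff (\<Phi> 0 i) q = 0"
  using u unfolding normalizing_def by (auto simp: mcoeff_near_identity)

lemma mcoeff_\<Phi>_bounded: "\<exists>M. \<forall>t\<ge>0. norm (mcoeff (\<Phi> t i) q) \<le> M"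
proof (cases "2 \<le> mdeg q")
  case True
  then show ?thesis using u unfolding normalizing_def by (intro exI[of _ "B / s ^ mdeg q"]) (simp add: mcoeff_near_identity)
next
  case False
  then show ?thesis by (intro exI[of _ 1]) (simp add: mcoeff_near_identity)
qed

lemma mcoeff_\<Phi>_tendsto: "a > 0 \<Longrightarrow> ((\<lambda>t. mcoeff (\<Phi> t i) q) \<longlongrightarrow> mcoeff (mvar i) q) at_top"
proof (cases "2 \<le> mdeg q")
  case True
  then have "q \<noteq> unit_index i" by auto
  moreover assume "a > 0"
  then have "(u i q \<longlongrightarrow> 0) at_top" using u unfolding normalizing_def by blast
  ultimately show ?thesis using True by (simp add: mcoeff_near_identity mcoeff_mvar)
qed (simp add: mcoeff_near_identity mcoeff_mvar)

lemma mcoeff_lagrange_bracket: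
  "mcoeff (lagrange_bracket b d t) p = (\<Sum>i\<in>UNIV. sg i * (\<Sum>q | q \<le> p.
     (of_nat (q b + 1) * mcoeff (\<Phi> t i) (q + unit_index b)) *
     (of_nat ((p - q) d + 1) * mcoeff (\<Phi> t (cj i)) (p - q + unit_index d))))"
  unfolding lagrange_bracket_def mcoeff_sum mcoeff_mconst_mult unfolding mcoeff_mult mcoeff_mderiv ..

text \<open>The rate \<open>\<mu>\<close> of a coefficient of the bracket is the sum of the divisors
  of the two modes in every product contributing to it. The constant coefficient is read off from
  the linear part of the map.\<close>

theorem lagrange_bracket_eq:
  assumes t: "t \<ge> 0"
  shows "lagrange_bracket b d t = mconst (if d = cj b then sg b else 0)"
proof (rule mps_eqI)
  fix p
  define \<mu> where "\<mu> = idot \<nu> p + \<nu> b + \<nu> d"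
  define X where "X t = mcoeff (lagrange_bracket b d t) p" for t
  have X_ode: "(X has_vector_derivative - \<mu> * X t) (at t within {0..})" if "t \<ge> 0" for t
  proof -
    have "mcoeff (- (weighted_euler \<nu> (lagrange_bracket b d t) + mconst (\<nu> b + \<nu> d) * lagrange_bracket b d t)) p = - \<mu> * X t"
      by (simp add: X_def mcoeff_weighted_euler \<mu>_def algebra_simps)
    then show ?thesis
      using lagrange_bracket_deriv[OF that, of b d, unfolded mps_deriv_def, THEN spec, of p]
      by (simp only: X_def[abs_def])
  qed
  have X: "X t = X 0 * exp (- \<mu> * of_real t)" if "t \<ge> 0" for t
    by (rule linear_ode_solution[OF X_ode that])
  have norm_X: "norm (X t) = norm (X 0) * exp (- Re \<mu> * t)" if "t \<ge> 0" for t
    unfolding X[OF that] by (simp add: norm_mult)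
  have X_sum: "X t = (\<Sum>i\<in>UNIV. sg i * (\<Sum>q | q \<le> p.
     (of_nat (q b + 1) * mcoeff (\<Phi> t i) (q + unit_index b)) *
     (of_nat ((p - q) d + 1) * mcoeff (\<Phi> t (cj i)) (p - q + unit_index d))))" for t
    unfolding X_def by (rule mcoeff_lagrange_bracket)
  have weights: "idot wt (q + unit_index b) + idot wt (p - q + unit_index d) = idot wt p + wt b + wt d"
    "(idot \<nu> (q + unit_index b) - \<nu> i) + (idot \<nu> (p - q + unit_index d) - \<nu> (cj i)) = \<mu>"
    if "q \<le> p" for q i
  proof -
    have "idot wt p = idot wt q + idot wt (p - q)" "idot \<nu> p = idot \<nu> q + idot \<nu> (p - q)"
      using that by (metis idot_add index_diff_add(1))+
    then show "idot wt (q + unit_index b) + idot wt (p - q + unit_index d) = idot wt p + wt b + wt d"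
      "(idot \<nu> (q + unit_index b) - \<nu> i) + (idot \<nu> (p - q + unit_index d) - \<nu> (cj i)) = \<mu>"
      by (simp_all add: idot_add \<mu>_def \<nu>_cj del: plus_fun_apply)
  qed
  show "mcoeff (lagrange_bracket b d t) p = mcoeff (mconst (if d = cj b then sg b else 0)) p"
  proof (cases "p = 0")
    case True
    have "X t = (\<Sum>i\<in>UNIV. if i = b then (if d = cj b then sg b else 0) else 0)"
      unfolding X_def True lagrange_bracket_def mcoeff_sum
      by (intro sum.cong) (auto simp: mcoeff_mderiv mcoeff_near_identity mcoeff_mconst)
    also have "\<dots> = (if d = cj b then sg b else 0)"
      by simp
    finally show ?thesis by (simp add: X_def True mcoeff_mconst)
  next
    case False
    have X0: "X 0 = 0"
    proof (rule ccontr)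
      assume nz: "X 0 \<noteq> 0"
      consider "Re \<mu> > 0" | "Re \<mu> < 0" | "Re \<mu> = 0" by linarith
      then show False
      proof cases
        \<comment> \<open>In each product one of the two divisors has positive real part, and that
          factor starts from 0.\<close>
        case 1
        have "X 0 = 0"
          unfolding X_sum
        proof (rule sum.neutral, rule ballI)
          fix i
          have "(of_nat (q b + 1) * mcoeff (\<Phi> 0 i) (q + unit_index b)) *
            (of_nat ((p - q) d + 1) * mcoeff (\<Phi> 0 (cj i)) (p - q + unit_index d)) = 0" if "q \<in> {q. q \<le> p}" for q
          proof -
            have "Re (idot \<nu> (q + unit_index b) - \<nu> i) > 0 \<or> Re (idot \<nu> (p - q + unit_index d) - \<nu> (cj i)) > 0"
            proof (rule ccontr)
              assume "\<not> ?thesis"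
              then have "Re ((idot \<nu> (q + unit_index b) - \<nu> i) + (idot \<nu> (p - q + unit_index d) - \<nu> (cj i))) \<le> 0"
                unfolding plus_complex.sel by linarith
              then show False using weights(2)[of q i] that 1 by (metis linorder_not_le mem_Collect_eq)
            qed
            then show ?thesis
              using mcoeff_\<Phi>_0[of "q + unit_index b" i] mcoeff_\<Phi>_0[of "p - q + unit_index d" "cj i"]
              by (metis mult_zero_left mult_zero_right)
          qed
          then have "(\<Sum>q | q \<le> p. (of_nat (q b + 1) * mcoeff (\<Phi> 0 i) (q + unit_index b)) *
            (of_nat ((p - q) d + 1) * mcoeff (\<Phi> 0 (cj i)) (p - q + unit_index d))) = 0"
            by (intro sum.neutral) blast
          then show "sg i * (\<Sum>q | q \<le> p. (of_nat (q b + 1) * mcoeff (\<Phi> 0 i) (q + unit_index b)) *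
            (of_nat ((p - q) d + 1) * mcoeff (\<Phi> 0 (cj i)) (p - q + unit_index d))) = 0"
            by (simp only: mult_zero_right)
        qed
        then show False using nz by simp
      next
        \<comment> \<open>A nonzero solution would grow exponentially, while the coefficients of the
          map stay bounded.\<close>
        case 2
        obtain M where M: "\<And>i q t. t \<ge> 0 \<Longrightarrow> norm (mcoeff (\<Phi> t i) q) \<le> M i q"
          using mcoeff_\<Phi>_bounded by metis
        define K where "K = (\<Sum>i\<in>UNIV. norm (sg i) * (\<Sum>q | q \<le> p.
          (real (q b + 1) * M i (q + unit_index b)) * (real ((p - q) d + 1) * M (cj i) (p - q + unit_index d))))"
        have M0: "M i q \<ge> 0" for i q using M[of 0 i q] norm_ge_zero order_trans by blast
        have K: "norm (X t) \<le> K" if "t \<ge> 0" for t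
          unfolding X_sum K_def
        proof (intro sum_norm_le)
          fix i
          have "norm (\<Sum>q | q \<le> p. (of_nat (q b + 1) * mcoeff (\<Phi> t i) (q + unit_index b)) *
              (of_nat ((p - q) d + 1) * mcoeff (\<Phi> t (cj i)) (p - q + unit_index d))) \<le>
              (\<Sum>q | q \<le> p. (real (q b + 1) * M i (q + unit_index b)) * (real ((p - q) d + 1) * M (cj i) (p - q + unit_index d)))"
            by (intro sum_norm_le) (unfold norm_mult norm_of_nat, intro mult_mono mult_left_mono M that mult_nonneg_nonneg M0, auto)
          then show "norm (sg i * (\<Sum>q | q \<le> p. (of_nat (q b + 1) * mcoeff (\<Phi> t i) (q + unit_index b)) *
              (of_nat ((p - q) d + 1) * mcoeff (\<Phi> t (cj i)) (p - q + unit_index d)))) \<le>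
              norm (sg i) * (\<Sum>q | q \<le> p. (real (q b + 1) * M i (q + unit_index b)) * (real ((p - q) d + 1) * M (cj i) (p - q + unit_index d)))"
            unfolding norm_mult by (intro mult_left_mono) auto
        qed
        \<comment> \<open>At this time the linear lower bound of the exponential already yields
          \<open>norm (X 0) + \<bar>K\<bar>\<close>, more than \<open>K\<close>.\<close>
        define \<tau> where "\<tau> = \<bar>K\<bar> / (norm (X 0) * (- Re \<mu>))"
        have \<tau>: "\<tau> \<ge> 0"
          unfolding \<tau>_def using 2 by (intro divide_nonneg_nonneg mult_nonneg_nonneg) auto
        have "norm (X 0) * (1 + - Re \<mu> * \<tau>) \<le> norm (X 0) * exp (- Re \<mu> * \<tau>)"
          by (intro mult_left_mono exp_ge_add_one_self) auto
        also have "\<dots> \<le> K" using K[OF \<tau>] norm_X[OF \<tau>] by simp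
        finally have "norm (X 0) + \<bar>K\<bar> \<le> K"
          using nz 2 by (simp add: \<tau>_def distrib_left)
        then show False using nz by (smt (verit) zero_less_norm_iff)
      next
        case 3
        show False
        proof (cases "a > 0")
          \<comment> \<open>\<open>norm (X t)\<close> is constant in time, and at infinity the map
            tends to the identity, whose brackets have no nonconstant coefficients.\<close>
          case True
          have "(X \<longlongrightarrow> (\<Sum>i\<in>UNIV. sg i * (\<Sum>q | q \<le> p.
             (of_nat (q b + 1) * mcoeff (mvar i) (q + unit_index b)) *
             (of_nat ((p - q) d + 1) * mcoeff (mvar (cj i)) (p - q + unit_index d))))) at_top"
            unfolding X_sum[abs_def] using True by (intro tendsto_intros mcoeff_\<Phi>_tendsto)
          also have "(\<Sum>i\<in>UNIV. sg i * (\<Sum>q | q \<le> p.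
             (of_nat (q b + 1) * mcoeff (mvar i) (q + unit_index b)) *
             (of_nat ((p - q) d + 1) * mcoeff (mvar (cj i)) (p - q + unit_index d)))) =
             (\<Sum>i\<in>UNIV. sg i * mcoeff (mderiv b (mvar i) * mderiv d (mvar (cj i))) p)"
            by (simp only: mcoeff_mult mcoeff_mderiv)
          also have "\<dots> = 0"
            using False by (intro sum.neutral) (auto simp: mderiv_mvar mcoeff_one)
          finally have "((\<lambda>t. norm (X t)) \<longlongrightarrow> 0) at_top" by (rule tendsto_norm_zero)
          moreover have "((\<lambda>t. norm (X t)) \<longlongrightarrow> norm (X 0)) at_top"
          proof (rule tendsto_eventually, rule eventually_at_top_linorderI[of 0])
            show "norm (X t) = norm (X 0)" if "0 \<le> t" for t
              using norm_X[OF that] 3 by (simp only: minus_zero mult_zero_left exp_zero mult_1_right)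
          qed
          ultimately have "norm (X 0) = 0"
            using tendsto_unique[OF trivial_limit_at_top_linorder] by blast
          then show False using nz by simp
        next
          \<comment> \<open>Without decay the grading decides: a nonzero coefficient has total
            weight \<open>\<kappa>\<close>, which makes \<open>\<mu>\<close> the divisor of the good
            mode \<open>(cj b, p + unit_index d)\<close>.\<close>
          case a: False
          then have a0: "a = 0" using a_nonneg by simp
          have "idot wt p + wt b + wt d = \<kappa>"
          proof (rule ccontr)
            assume ne: "idot wt p + wt b + wt d \<noteq> \<kappa>"
            have "X 0 = 0"
              unfolding X_sum
            proof (rule sum.neutral, rule ballI)
              fix i
              have "(of_nat (q b + 1) * mcoeff (\<Phi> 0 i) (q + unit_index b)) *
                (of_nat ((p - q) d + 1) * mcoeff (\<Phi> 0 (cj i)) (p - q + unit_index d)) = 0" if "q \<in> {q. q \<le> p}" for q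
              proof -
                have "\<not> (good_mode wt i (q + unit_index b) \<and> good_mode wt (cj i) (p - q + unit_index d))"
                  unfolding good_mode_def using weights(1)[of q] that ne wt_cj[of i] by auto
                then show ?thesis
                  using mcoeff_\<Phi>_supp[of 0 i "q + unit_index b"] mcoeff_\<Phi>_supp[of 0 "cj i" "p - q + unit_index d"]
                  by (metis mult_zero_left mult_zero_right order_refl)
              qed
              then have "(\<Sum>q | q \<le> p. (of_nat (q b + 1) * mcoeff (\<Phi> 0 i) (q + unit_index b)) *
                (of_nat ((p - q) d + 1) * mcoeff (\<Phi> 0 (cj i)) (p - q + unit_index d))) = 0"
                by (intro sum.neutral) blast
              then show "sg i * (\<Sum>q | q \<le> p. (of_nat (q b + 1) * mcoeff (\<Phi> 0 i) (q + unit_index b)) *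
                (of_nat ((p - q) d + 1) * mcoeff (\<Phi> 0 (cj i)) (p - q + unit_index d))) = 0"
                by (simp only: mult_zero_right)
            qed
            then show False using nz by simp
          qed
          then have "good_mode wt (cj b) (p + unit_index d)"
            using wt_cj[of b] by (simp add: good_mode_def idot_add del: plus_fun_apply)
          moreover have "2 \<le> mdeg (p + unit_index d)"
          proof -
            have "mdeg p \<noteq> 0" using False by (simp only: mdeg_eq_0_iff) simp
            then show ?thesis by (simp del: plus_fun_apply mdeg_eq_0_iff)
          qed
          ultimately have "Re (idot \<nu> (p + unit_index d) - \<nu> (cj b)) \<noteq> 0"
            using nonres[OF a0] by blast
          then show False using 3 by (simp add: idot_add \<nu>_cj \<mu>_def add_ac del: plus_fun_apply)
        qed
      qed
    qed
    then have "X t = 0" using X[OF t] by simp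
    then show ?thesis using False by (simp add: X_def mcoeff_mconst)
  qed
qed

end

end

section \<open>Absolutely convergent power series\<close>

no_notation Infinite_Set_Sum.abs_summable_on (infix "abs'_summable'_on" 50)

lemma max_norm_le_iff: "max_norm z \<le> \<rho> \<longleftrightarrow> (\<forall>k. norm (z $ k) \<le> \<rho>)"
  unfolding max_norm_def by (subst Max_le_iff) auto

lemma max_norm_less_iff: "max_norm z < \<rho> \<longleftrightarrow> (\<forall>k. norm (z $ k) < \<rho>)"
  unfolding max_norm_def by (subst Max_less_iff) auto

lemma norm_nth_le_max_norm: "norm (z $ k) \<le> max_norm z"
  using max_norm_le_iff[of z "max_norm z"] by simp

lemma max_norm_nonneg: "0 \<le> max_norm z"
  using norm_nth_le_max_norm[of z undefined] norm_ge_zero order_trans by blast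

lemma max_norm_triangle: "max_norm (x + y) \<le> max_norm x + max_norm y"
  unfolding max_norm_le_iff
  by (auto intro: order_trans[OF norm_triangle_ineq] add_mono norm_nth_le_max_norm)

lemma max_norm_le_norm: "max_norm z \<le> norm z"
  unfolding max_norm_le_iff by (blast intro: Finite_Cartesian_Product.norm_nth_le)

lemma mpow_zero_index [simp]: "mpow z 0 = 1"
  by (simp add: mpow_def)

lemma mpow_add_index: "mpow z (p + q) = mpow z p * mpow z q"
  by (simp add: mpow_def power_add prod.distrib)

lemma mpow_unit_index [simp]: "mpow z (unit_index k) = z $ k"
proof -
  have "mpow z (unit_index k) = (\<Prod>l\<in>UNIV. if l = k then z $ l else 1)"
    unfolding mpow_def unit_index_def by (rule prod.cong) auto
  then show ?thesis by simp
qed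

lemma norm_mpow_le:
  assumes "max_norm z \<le> \<rho>"
  shows "norm (mpow z p) \<le> \<rho> ^ mdeg p"
proof -
  have "norm (mpow z p) = (\<Prod>k\<in>UNIV. norm (z $ k) ^ p k)"
    by (simp add: mpow_def norm_power flip: prod_norm)
  also have "\<dots> \<le> (\<Prod>k\<in>UNIV. \<rho> ^ p k)"
    using assms by (intro prod_mono) (auto intro: power_mono simp: max_norm_le_iff)
  also have "\<dots> = \<rho> ^ mdeg p" by (simp add: mdeg_def power_sum)
  finally show ?thesis .
qed

text \<open>Absolute convergence on the closed polydisc of radius \<open>\<rho>\<close>. With
  \<open>mnorm\<close> these series form a normed algebra on which evaluation is
  multiplicative.\<close>

definition asum :: "real \<Rightarrow> ('k::finite, complex) mps \<Rightarrow> bool" where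
  "asum \<rho> a \<longleftrightarrow> \<rho> \<ge> 0 \<and> (\<lambda>p. norm (mcoeff a p) * \<rho> ^ mdeg p) summable_on UNIV"

definition mnorm :: "real \<Rightarrow> ('k::finite, complex) mps \<Rightarrow> real" where
  "mnorm \<rho> a = (\<Sum>\<^sub>\<infinity>p. norm (mcoeff a p) * \<rho> ^ mdeg p)"

definition ev :: "('k::finite, complex) mps \<Rightarrow> complex ^ 'k \<Rightarrow> complex" where
  "ev a z = (\<Sum>\<^sub>\<infinity>p. mcoeff a p * mpow z p)"

lemma mnorm_nonneg: "asum \<rho> a \<Longrightarrow> mnorm \<rho> a \<ge> 0"
  unfolding mnorm_def asum_def by (intro infsum_nonneg) auto

lemma abs_summable_ev:
  assumes "asum \<rho> a" "max_norm z \<le> \<rho>"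
  shows "(\<lambda>p. mcoeff a p * mpow z p) abs_summable_on UNIV"
proof (rule summable_on_comparison_test)
  show "(\<lambda>p. norm (mcoeff a p) * \<rho> ^ mdeg p) summable_on UNIV" using assms by (simp add: asum_def)
qed (use assms in \<open>auto simp: norm_mult intro: mult_left_mono norm_mpow_le\<close>)

lemma ev_has_sum:
  assumes "asum \<rho> a" "max_norm z \<le> \<rho>"
  shows "((\<lambda>p. mcoeff a p * mpow z p) has_sum ev a z) UNIV"
  unfolding ev_def by (rule has_sum_infsum, rule abs_summable_summable, rule abs_summable_ev[OF assms])

lemma norm_ev_le:
  assumes "asum \<rho> a" "max_norm z \<le> \<rho>"
  shows "norm (ev a z) \<le> mnorm \<rho> a"
proof -
  have "norm (ev a z) \<le> (\<Sum>\<^sub>\<infinity>p. norm (mcoeff a p * mpow z p))"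
    unfolding ev_def by (rule norm_infsum_bound[OF abs_summable_ev[OF assms]])
  also have "\<dots> \<le> mnorm \<rho> a"
    unfolding mnorm_def using assms abs_summable_ev[OF assms]
    by (intro infsum_mono) (auto simp: asum_def norm_mult intro: mult_left_mono norm_mpow_le)
  finally show ?thesis .
qed

lemma summable_power_mdeg:
  fixes y :: real
  assumes "0 \<le> y" "y < 1"
  shows "(\<lambda>p :: 'k::finite \<Rightarrow> nat. y ^ mdeg p) summable_on UNIV"
    and "(\<Sum>\<^sub>\<infinity>p :: 'k \<Rightarrow> nat. y ^ mdeg p) \<le> (1 / (1 - y)) ^ CARD('k)"
proof -
  show s: "(\<lambda>p :: 'k \<Rightarrow> nat. y ^ mdeg p) summable_on UNIV"
  proof (rule nonneg_bdd_above_summable_on)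
    show "bdd_above (sum (\<lambda>p :: 'k \<Rightarrow> nat. y ^ mdeg p) ` {F. F \<subseteq> UNIV \<and> finite F})"
      using sum_power_mdeg_le[OF assms] by (intro bdd_aboveI2) auto
  qed (use assms in auto)
  show "(\<Sum>\<^sub>\<infinity>p :: 'k \<Rightarrow> nat. y ^ mdeg p) \<le> (1 / (1 - y)) ^ CARD('k)"
    using sum_power_mdeg_le[OF assms] by (intro infsum_le_finite_sums s) auto
qed

text \<open>Turns Cauchy-type bounds at radius \<open>s\<close>, uniform in time in the
  applications, into a norm bound at any smaller radius.\<close>

lemma asum_geometric:
  fixes a :: "('k::finite, complex) mps"
  assumes bound: "\<And>p. norm (mcoeff a p) \<le> B / s ^ mdeg p" and "0 \<le> \<rho>" "\<rho> < s"
  shows "asum \<rho> a" "mnorm \<rho> a \<le> B * (1 / (1 - \<rho> / s)) ^ CARD('k)"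
proof -
  have s: "s > 0" using assms by linarith
  have "0 \<le> norm (mcoeff a 0)" by simp
  also have "\<dots> \<le> B" using bound[of 0] by simp
  finally have B: "B \<ge> 0" .
  define y where "y = \<rho> / s"
  have y: "0 \<le> y" "y < 1" using assms s by (auto simp: y_def)
  have le: "norm (mcoeff a p) * \<rho> ^ mdeg p \<le> B * y ^ mdeg p" for p
  proof -
    have "norm (mcoeff a p) * \<rho> ^ mdeg p \<le> B / s ^ mdeg p * \<rho> ^ mdeg p"
      using bound assms by (intro mult_right_mono) auto
    then show ?thesis by (simp add: y_def power_divide)
  qed
  have sB: "(\<lambda>p :: 'k \<Rightarrow> nat. B * y ^ mdeg p) summable_on UNIV"
    by (intro summable_on_cmult_right summable_power_mdeg y)
  have "(\<lambda>p. norm (mcoeff a p) * \<rho> ^ mdeg p) summable_on UNIV"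
    by (rule summable_on_comparison_test[OF sB]) (use le assms in auto)
  then show "asum \<rho> a" using assms by (simp add: asum_def)
  then have "mnorm \<rho> a \<le> (\<Sum>\<^sub>\<infinity>p :: 'k \<Rightarrow> nat. B * y ^ mdeg p)"
    unfolding mnorm_def asum_def using le sB by (intro infsum_mono) auto
  also have "\<dots> = B * (\<Sum>\<^sub>\<infinity>p :: 'k \<Rightarrow> nat. y ^ mdeg p)"
    by (rule infsum_cmult_right) (intro summable_power_mdeg y)
  also have "\<dots> \<le> B * (1 / (1 - y)) ^ CARD('k)"
    using B summable_power_mdeg(2)[OF y] by (intro mult_left_mono) auto
  finally show "mnorm \<rho> a \<le> B * (1 / (1 - \<rho> / s)) ^ CARD('k)" by (simp add: y_def)
qed

lemma asum_add:
  assumes "asum \<rho> a" "asum \<rho> b"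
  shows "asum \<rho> (a + b)"
proof -
  have s: "(\<lambda>p. norm (mcoeff a p) * \<rho> ^ mdeg p + norm (mcoeff b p) * \<rho> ^ mdeg p) summable_on UNIV"
    using assms unfolding asum_def by (intro summable_on_add) auto
  have "norm (mcoeff (a + b) p) * \<rho> ^ mdeg p \<le> norm (mcoeff a p) * \<rho> ^ mdeg p + norm (mcoeff b p) * \<rho> ^ mdeg p" for p
    unfolding distrib_right[symmetric] using assms
    by (intro mult_right_mono) (auto simp: asum_def intro: norm_triangle_ineq)
  then have "(\<lambda>p. norm (mcoeff (a + b) p) * \<rho> ^ mdeg p) summable_on UNIV"
    using assms by (intro summable_on_comparison_test[OF s]) (auto simp: asum_def)
  then show ?thesis using assms by (simp add: asum_def)
qed

lemma asum_mconst_mult: "asum \<rho> a \<Longrightarrow> asum \<rho> (mconst c * a)"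
  unfolding asum_def by (simp add: norm_mult mult.assoc summable_on_cmult_right)

lemma asum_uminus: "asum \<rho> a \<Longrightarrow> asum \<rho> (- a)"
  by (simp add: asum_def)

lemma asum_diff: "asum \<rho> a \<Longrightarrow> asum \<rho> b \<Longrightarrow> asum \<rho> (a - b)"
  using asum_add[of \<rho> a "- b"] asum_uminus[of \<rho> b] by simp

lemma asum_finite_support:
  assumes "finite P" "\<And>p. p \<notin> P \<Longrightarrow> mcoeff a p = 0" "\<rho> \<ge> 0"
  shows "asum \<rho> a"
proof -
  have "(\<lambda>p. norm (mcoeff a p) * \<rho> ^ mdeg p) summable_on UNIV \<longleftrightarrow> (\<lambda>p. norm (mcoeff a p) * \<rho> ^ mdeg p) summable_on P"
    by (rule summable_on_cong_neutral) (use assms in auto)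
  then show ?thesis using assms by (simp add: asum_def)
qed

lemma asum_zero: "\<rho> \<ge> 0 \<Longrightarrow> asum \<rho> 0"
  by (rule asum_finite_support[of "{}"]) auto

lemma asum_one: "\<rho> \<ge> 0 \<Longrightarrow> asum \<rho> 1"
  by (rule asum_finite_support[of "{0}"]) (auto simp: mcoeff_one)

lemma asum_mvar: "\<rho> \<ge> 0 \<Longrightarrow> asum \<rho> (mvar k)"
  by (rule asum_finite_support[of "{unit_index k}"]) (auto simp: mcoeff_mvar)

lemma ev_add:
  assumes "asum \<rho> a" "asum \<rho> b" "max_norm z \<le> \<rho>"
  shows "ev (a + b) z = ev a z + ev b z"
  using infsumI[OF has_sum_add[OF ev_has_sum[OF assms(1,3)] ev_has_sum[OF assms(2,3)]]]
  by (simp add: ev_def distrib_right)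

lemma ev_mconst_mult: "ev (mconst c * a) z = c * ev a z"
  by (simp add: ev_def mult.assoc infsum_cmult_right')

lemma ev_uminus: "ev (- a) z = - ev a z"
  using ev_mconst_mult[of "-1" a z] by (simp add: mconst_uminus mconst_one)

lemma ev_diff:
  assumes "asum \<rho> a" "asum \<rho> b" "max_norm z \<le> \<rho>"
  shows "ev (a - b) z = ev a z - ev b z"
  using ev_add[OF assms(1) asum_uminus[OF assms(2)] assms(3)] by (simp add: ev_uminus)

lemma ev_zero [simp]: "ev 0 z = 0"
  by (simp add: ev_def)

lemma ev_one [simp]: "ev 1 z = 1"
proof -
  have "ev 1 z = infsum (\<lambda>p. 1) {0 :: 'a \<Rightarrow> nat}"
    unfolding ev_def by (rule infsum_cong_neutral) (auto simp: mcoeff_one)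
  then show ?thesis by simp
qed

lemma ev_mvar [simp]: "ev (mvar k) z = z $ k"
proof -
  have "ev (mvar k) z = infsum (\<lambda>p. z $ k) {unit_index k}"
    unfolding ev_def by (rule infsum_cong_neutral) (auto simp: mcoeff_mvar)
  then show ?thesis by simp
qed

section \<open>Products and substitution of convergent series\<close>

text \<open>The double family is absolutely summable and is regrouped by the sum of its two
  indices.\<close>

lemma has_sum_convolution:
  fixes f g :: "('k::finite \<Rightarrow> nat) \<Rightarrow> 'a::{banach, real_normed_algebra}"
  assumes f: "f abs_summable_on UNIV" and g: "g abs_summable_on UNIV"
  shows "((\<lambda>p. \<Sum>q | q \<le> p. f q * g (p - q)) has_sum (infsum f UNIV * infsum g UNIV)) UNIV"
proof -
  have "(\<lambda>x. f (fst x) * g (snd x)) abs_summable_on (UNIV \<times> UNIV)"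
  proof (rule Infinite_Sum.abs_summable_on_comparison_test)
    show "(\<lambda>x. norm (f (fst x)) * norm (g (snd x))) abs_summable_on (UNIV \<times> UNIV)"
      unfolding Infinite_Sum.abs_summable_on_Sigma_iff
      using f g by (auto simp: infsum_cmult_right' abs_mult abs_of_nonneg[OF infsum_nonneg] intro!: summable_on_cmult_left summable_on_cmult_right)
  qed (simp add: norm_mult_ineq)
  then have summ: "(\<lambda>x. f (fst x) * g (snd x)) summable_on (UNIV \<times> UNIV)"
    by (rule abs_summable_summable)
  have "((\<lambda>x. f (fst x) * g (snd x)) has_sum (infsum f UNIV * infsum g UNIV)) (UNIV \<times> UNIV)"
  proof (rule has_sum_SigmaI)
    show "((\<lambda>y. f (fst (x, y)) * g (snd (x, y))) has_sum f x * infsum g UNIV) UNIV" for x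
      unfolding fst_conv snd_conv
      by (rule has_sum_cmult_right[OF has_sum_infsum[OF abs_summable_summable[OF g]]])
    show "((\<lambda>x. f x * infsum g UNIV) has_sum infsum f UNIV * infsum g UNIV) UNIV"
      by (rule has_sum_cmult_left[OF has_sum_infsum[OF abs_summable_summable[OF f]]])
  qed (rule summ)
  also have "?this \<longleftrightarrow> ((\<lambda>(p, q). f q * g (p - q)) has_sum (infsum f UNIV * infsum g UNIV)) (SIGMA p:UNIV. {q. q \<le> p})"
    by (rule has_sum_reindex_bij_witness[where i = "\<lambda>(p, q). (q, p - q)" and j = "\<lambda>(q, r). (q + r, q)"])
       (auto simp: index_diff_add)
  finally show ?thesis
  proof (rule has_sum_SigmaD)
    show "((\<lambda>y. case (p, y) of (p, q) \<Rightarrow> f q * g (p - q)) has_sum (\<Sum>q | q \<le> p. f q * g (p - q))) {q. q \<le> p}" for p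
      by (intro has_sum_finiteI) (auto simp: finite_le_index)
  qed
qed

lemma asum_mult:
  assumes "asum \<rho> a" "asum \<rho> b"
  shows "asum \<rho> (a * b)" "mnorm \<rho> (a * b) \<le> mnorm \<rho> a * mnorm \<rho> b"
proof -
  define f where "f p = norm (mcoeff a p) * \<rho> ^ mdeg p" for p
  define g where "g p = norm (mcoeff b p) * \<rho> ^ mdeg p" for p
  have \<rho>: "\<rho> \<ge> 0" using assms by (simp add: asum_def)
  have "f abs_summable_on UNIV" "g abs_summable_on UNIV"
    using assms \<rho> by (simp_all add: f_def g_def asum_def abs_mult)
  then have conv: "((\<lambda>p. \<Sum>q | q \<le> p. f q * g (p - q)) has_sum (mnorm \<rho> a * mnorm \<rho> b)) UNIV"
    unfolding mnorm_def f_def[symmetric] g_def[symmetric] by (rule has_sum_convolution)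
  have le: "norm (mcoeff (a * b) p) * \<rho> ^ mdeg p \<le> (\<Sum>q | q \<le> p. f q * g (p - q))" for p
  proof -
    have "norm (mcoeff (a * b) p) * \<rho> ^ mdeg p \<le> (\<Sum>q | q \<le> p. norm (mcoeff a q * mcoeff b (p - q))) * \<rho> ^ mdeg p"
      unfolding mcoeff_mult using \<rho> by (intro mult_right_mono norm_sum) auto
    also have "\<dots> = (\<Sum>q | q \<le> p. f q * g (p - q))"
      unfolding sum_distrib_right
    proof (intro sum.cong refl)
      fix q assume "q \<in> {q. q \<le> p}"
      then have "mdeg p = mdeg q + mdeg (p - q)" by (metis index_diff_add(1) mdeg_add mem_Collect_eq)
      then show "norm (mcoeff a q * mcoeff b (p - q)) * \<rho> ^ mdeg p = f q * g (p - q)"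
        by (simp add: f_def g_def norm_mult power_add mult_ac)
    qed
    finally show ?thesis .
  qed
  have s: "(\<lambda>p. norm (mcoeff (a * b) p) * \<rho> ^ mdeg p) summable_on UNIV"
    by (rule summable_on_comparison_test[OF has_sum_imp_summable[OF conv]]) (use le \<rho> in auto)
  then show "asum \<rho> (a * b)" using \<rho> by (simp add: asum_def)
  show "mnorm \<rho> (a * b) \<le> mnorm \<rho> a * mnorm \<rho> b"
    unfolding mnorm_def[of \<rho> "a * b"] by (rule has_sum_mono[OF has_sum_infsum[OF s] conv le])
qed

lemma ev_mult:
  assumes "asum \<rho> a" "asum \<rho> b" "max_norm z \<le> \<rho>"
  shows "ev (a * b) z = ev a z * ev b z"
proof -
  have "((\<lambda>p. \<Sum>q | q \<le> p. (mcoeff a q * mpow z q) * (mcoeff b (p - q) * mpow z (p - q))) has_sum (ev a z * ev b z)) UNIV"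
    unfolding ev_def by (intro has_sum_convolution abs_summable_ev[OF assms(1,3)] abs_summable_ev[OF assms(2,3)])
  also have "(\<lambda>p. \<Sum>q | q \<le> p. (mcoeff a q * mpow z q) * (mcoeff b (p - q) * mpow z (p - q))) = (\<lambda>p. mcoeff (a * b) p * mpow z p)"
  proof
    fix p
    have "mpow z p = mpow z q * mpow z (p - q)" if "q \<le> p" for q
      using that by (metis index_diff_add(1) mpow_add_index)
    then show "(\<Sum>q | q \<le> p. (mcoeff a q * mpow z q) * (mcoeff b (p - q) * mpow z (p - q))) = mcoeff (a * b) p * mpow z p"
      unfolding mcoeff_mult sum_distrib_right by (intro sum.cong refl) (simp add: mult_ac)
  qed
  finally show ?thesis by (simp add: ev_def infsumI)
qed

lemma mnorm_one [simp]: "mnorm \<rho> (1 :: ('k::finite, complex) mps) = 1"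
proof -
  have "mnorm \<rho> (1 :: ('k::finite, complex) mps) = infsum (\<lambda>p. 1 :: real) {0 :: 'k \<Rightarrow> nat}"
    unfolding mnorm_def by (rule infsum_cong_neutral) (auto simp: mcoeff_one)
  then show ?thesis by simp
qed

lemma asum_wpow:
  fixes w :: "'k::finite \<Rightarrow> ('j::finite, complex) mps"
  assumes "\<And>k. asum \<rho> (w k)" "\<And>k. mnorm \<rho> (w k) \<le> r"
  shows "asum \<rho> (wpow w m)" "mnorm \<rho> (wpow w m) \<le> r ^ mdeg m"
    "max_norm z \<le> \<rho> \<Longrightarrow> ev (wpow w m) z = mpow (\<chi> k. ev (w k) z) m"
proof -
  have \<rho>: "\<rho> \<ge> 0" using assms(1) by (auto simp: asum_def)
  have r: "r \<ge> 0" using assms mnorm_nonneg order_trans by blast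
  define P where "P m \<longleftrightarrow> asum \<rho> (wpow w m) \<and> mnorm \<rho> (wpow w m) \<le> r ^ mdeg m \<and>
    (max_norm z \<le> \<rho> \<longrightarrow> ev (wpow w m) z = mpow (\<chi> k. ev (w k) z) m)" for m
  have "P m"
  proof (rule multi_index_induct[of P m])
    show "P 0" using \<rho> by (simp add: P_def asum_one)
    fix m k assume IH: "P m"
    have "mnorm \<rho> (wpow w m * w k) \<le> mnorm \<rho> (wpow w m) * mnorm \<rho> (w k)"
      using IH assms(1) unfolding P_def by (intro asum_mult) auto
    also have "\<dots> \<le> r ^ mdeg m * r"
      using IH assms r unfolding P_def by (intro mult_mono mnorm_nonneg) auto
    finally have "mnorm \<rho> (wpow w (m + unit_index k)) \<le> r ^ mdeg (m + unit_index k)"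
      unfolding wpow_add wpow_unit mdeg_add mdeg_unit by (simp add: mult.commute)
    moreover have "asum \<rho> (wpow w (m + unit_index k))"
      unfolding wpow_add wpow_unit using IH assms(1) unfolding P_def by (intro asum_mult) auto
    moreover have "ev (wpow w (m + unit_index k)) z = mpow (\<chi> k. ev (w k) z) (m + unit_index k)" if "max_norm z \<le> \<rho>"
      unfolding wpow_add wpow_unit mpow_add_index mpow_unit_index
      using IH assms(1) that ev_mult[of \<rho> "wpow w m" "w k" z] unfolding P_def by simp
    ultimately show "P (m + unit_index k)" unfolding P_def by blast
  qed
  then show "asum \<rho> (wpow w m)" "mnorm \<rho> (wpow w m) \<le> r ^ mdeg m"
    "max_norm z \<le> \<rho> \<Longrightarrow> ev (wpow w m) z = mpow (\<chi> k. ev (w k) z) m" unfolding P_def by blast+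
qed

text \<open>The double series over \<open>m\<close> and \<open>p\<close> is absolutely summable,
  since summation over \<open>p\<close> gives at most the terms of the norm of \<open>F\<close> at
  radius \<open>r\<close>. Summed over \<open>m\<close> first it is the composition, where each
  \<open>p\<close> meets finitely many \<open>m\<close>.\<close>

lemma asum_mcomp:
  fixes w :: "'k::finite \<Rightarrow> ('j::finite, complex) mps" and F :: "('k, complex) mps"
  assumes F: "asum r F" and w: "\<And>k. asum \<rho> (w k)" "\<And>k. mnorm \<rho> (w k) \<le> r" "\<And>k. mcoeff (w k) 0 = 0"
  shows "asum \<rho> (mcomp F w)" "mnorm \<rho> (mcomp F w) \<le> mnorm r F"
    "max_norm z \<le> \<rho> \<Longrightarrow> ev (mcomp F w) z = ev F (\<chi> k. ev (w k) z)"
proof -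
  have \<rho>: "\<rho> \<ge> 0" using w(1) by (auto simp: asum_def)
  define b where "b = (\<lambda>(m, p). norm (mcoeff F m) * norm (mcoeff (wpow w m) p) * \<rho> ^ mdeg p)"
  have wp: "asum \<rho> (wpow w m)" "mnorm \<rho> (wpow w m) \<le> r ^ mdeg m" for m
    by (rule asum_wpow[OF w(1,2)])+
  have inner: "(\<lambda>p. b (m, p)) summable_on UNIV" "infsum (\<lambda>p. b (m, p)) UNIV = norm (mcoeff F m) * mnorm \<rho> (wpow w m)" for m
    using wp(1)[of m] unfolding b_def asum_def mnorm_def
    by (simp_all add: mult.assoc summable_on_cmult_right infsum_cmult_right)
  have b0: "b x \<ge> 0" for x using \<rho> by (simp add: b_def split: prod.split)
  have infb: "(\<lambda>m. norm (mcoeff F m) * mnorm \<rho> (wpow w m)) summable_on UNIV"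
  proof (rule summable_on_comparison_test)
    show "(\<lambda>m. norm (mcoeff F m) * r ^ mdeg m) summable_on UNIV" using F by (simp add: asum_def)
  qed (use wp mnorm_nonneg[OF wp(1)] in \<open>auto intro: mult_left_mono\<close>)
  have b_abs: "b abs_summable_on (UNIV \<times> UNIV)"
    unfolding Infinite_Sum.abs_summable_on_Sigma_iff
    using inner infb b0 mnorm_nonneg[OF wp(1)] by (simp add: abs_mult)
  then have b_sum: "b summable_on (UNIV \<times> UNIV)" by (rule abs_summable_summable)
  have b_swap: "(\<lambda>(p, m). b (m, p)) summable_on (UNIV \<times> UNIV)"
    using b_sum by (subst summable_on_swap[symmetric]) (simp add: case_prod_unfold)
  have fin: "mcoeff (wpow w m) p = 0" if "mdeg p < mdeg m" for m p
    using that w(3) by (rule mcoeff_wpow_low_degree[rotated])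
  have tot: "(b has_sum (infsum b (UNIV \<times> UNIV))) (UNIV \<times> UNIV)" using b_sum by simp
  have "((\<lambda>m. norm (mcoeff F m) * mnorm \<rho> (wpow w m)) has_sum (infsum b (UNIV \<times> UNIV))) UNIV"
    by (rule has_sum_SigmaD[OF tot]) (metis inner has_sum_infsum)
  then have tot_le: "infsum b (UNIV \<times> UNIV) \<le> mnorm r F"
    unfolding mnorm_def[of r F] using F wp(2)
    by (elim has_sum_mono[OF _ has_sum_infsum]) (auto simp: asum_def intro: mult_left_mono)
  have "((\<lambda>(p, m). b (m, p)) has_sum (infsum b (UNIV \<times> UNIV))) (UNIV \<times> UNIV)"
    using tot by (subst has_sum_swap[symmetric]) (simp add: case_prod_unfold)
  then have conv: "((\<lambda>p. \<Sum>m | mdeg m \<le> mdeg p. b (m, p)) has_sum (infsum b (UNIV \<times> UNIV))) UNIV"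
  proof (rule has_sum_SigmaD)
    fix p
    show "((\<lambda>y. case (p, y) of (p, m) \<Rightarrow> b (m, p)) has_sum (\<Sum>m | mdeg m \<le> mdeg p. b (m, p))) UNIV"
      by (rule has_sum_finite_neutralI) (auto simp: finite_mdeg_le b_def fin not_le)
  qed
  have le: "norm (mcoeff (mcomp F w) p) * \<rho> ^ mdeg p \<le> (\<Sum>m | mdeg m \<le> mdeg p. b (m, p))" for p
  proof -
    have "norm (mcoeff (mcomp F w) p) * \<rho> ^ mdeg p \<le>
        (\<Sum>m | mdeg m \<le> mdeg p. norm (mcoeff F m * mcoeff (wpow w m) p)) * \<rho> ^ mdeg p"
      unfolding mcoeff_mcomp using \<rho> by (intro mult_right_mono norm_sum) auto
    then show ?thesis by (simp add: b_def sum_distrib_right norm_mult)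
  qed
  have s: "(\<lambda>p. norm (mcoeff (mcomp F w) p) * \<rho> ^ mdeg p) summable_on UNIV"
    by (rule summable_on_comparison_test[OF has_sum_imp_summable[OF conv]]) (use le \<rho> in auto)
  then show "asum \<rho> (mcomp F w)" using \<rho> by (simp add: asum_def)
  have "mnorm \<rho> (mcomp F w) \<le> infsum b (UNIV \<times> UNIV)"
    unfolding mnorm_def by (rule has_sum_mono[OF has_sum_infsum[OF s] conv le])
  then show "mnorm \<rho> (mcomp F w) \<le> mnorm r F" using tot_le by linarith
  assume z: "max_norm z \<le> \<rho>"
  define e where "e = (\<lambda>(m, p). mcoeff F m * (mcoeff (wpow w m) p * mpow z p))"
  have "e abs_summable_on (UNIV \<times> UNIV)"
  proof (rule Infinite_Sum.abs_summable_on_comparison_test[OF b_abs])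
    fix x :: "('k \<Rightarrow> nat) \<times> ('j \<Rightarrow> nat)"
    obtain m p where x: "x = (m, p)" by fastforce
    have "norm (e x) \<le> norm (mcoeff F m) * (norm (mcoeff (wpow w m) p) * \<rho> ^ mdeg p)"
      unfolding e_def x using norm_mpow_le[OF z, of p] by (auto simp: norm_mult intro!: mult_left_mono)
    then show "norm (e x) \<le> norm (b x)" using b0[of x] by (simp add: b_def x mult_ac)
  qed
  then have e_sum: "e summable_on (UNIV \<times> UNIV)" by (rule abs_summable_summable)
  have "(e has_sum (infsum e (UNIV \<times> UNIV))) (UNIV \<times> UNIV)" using e_sum by simp
  then have "((\<lambda>m. mcoeff F m * ev (wpow w m) z) has_sum (infsum e (UNIV \<times> UNIV))) UNIV"
    by (rule has_sum_SigmaD) (simp add: e_def has_sum_cmult_right ev_has_sum[OF wp(1) z])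
  then have 1: "infsum e (UNIV \<times> UNIV) = ev F (\<chi> k. ev (w k) z)"
    unfolding asum_wpow(3)[OF w(1,2) z] by (simp add: ev_def[of F] infsumI)
  have "((\<lambda>(p, m). e (m, p)) has_sum (infsum e (UNIV \<times> UNIV))) (UNIV \<times> UNIV)"
    using e_sum by (subst has_sum_swap[symmetric]) (simp add: case_prod_unfold)
  then have "((\<lambda>p. mcoeff (mcomp F w) p * mpow z p) has_sum (infsum e (UNIV \<times> UNIV))) UNIV"
  proof (rule has_sum_SigmaD)
    fix p
    show "((\<lambda>y. case (p, y) of (p, m) \<Rightarrow> e (m, p)) has_sum mcoeff (mcomp F w) p * mpow z p) UNIV"
      by (rule has_sum_finite_neutralI[of "{m. mdeg m \<le> mdeg p}"])
         (auto simp: finite_mdeg_le e_def fin not_le mcoeff_mcomp sum_distrib_right mult.assoc)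
  qed
  then show "ev (mcomp F w) z = ev F (\<chi> k. ev (w k) z)"
    using 1 by (simp add: ev_def infsumI)
qed

section \<open>Taylor expansion about another point\<close>

lemma prod_add_expand:
  fixes x y :: "'k::finite \<Rightarrow> 'a::comm_semiring_1"
  shows "(\<Prod>k\<in>UNIV. (x k + y k) ^ m k) =
    (\<Sum>q | q \<le> m. (\<Prod>k\<in>UNIV. of_nat (m k choose q k)) * (\<Prod>k\<in>UNIV. x k ^ (m k - q k)) * (\<Prod>k\<in>UNIV. y k ^ q k))"
proof -
  have "(\<Prod>k\<in>UNIV. (x k + y k) ^ m k) = (\<Prod>k\<in>UNIV. \<Sum>j\<le>m k. of_nat (m k choose j) * y k ^ j * x k ^ (m k - j))"
    by (subst add.commute) (simp add: binomial_ring)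
  also have "\<dots> = (\<Sum>q\<in>(\<Pi>\<^sub>E k\<in>UNIV. {..m k}). \<Prod>k\<in>UNIV. of_nat (m k choose q k) * y k ^ q k * x k ^ (m k - q k))"
    by (rule prod_sum_PiE) auto
  also have "(\<Pi>\<^sub>E k\<in>UNIV. {..m k}) = {q. q \<le> m}"
    by (auto simp: le_fun_def PiE_UNIV_domain)
  finally show ?thesis by (simp add: prod.distrib mult_ac)
qed

definition multi_binomial :: "('k::finite \<Rightarrow> nat) \<Rightarrow> ('k \<Rightarrow> nat) \<Rightarrow> nat" where
  "multi_binomial m q = (\<Prod>k\<in>UNIV. m k choose q k)"

lemma multi_binomial_unit: "multi_binomial (p + unit_index k) (unit_index k) = p k + 1"
proof -
  have "multi_binomial (p + unit_index k) (unit_index k) = (\<Prod>j\<in>UNIV. if j = k then p k + 1 else 1)"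
    unfolding multi_binomial_def by (rule prod.cong) (auto simp: unit_index_def)
  then show ?thesis by simp
qed

text \<open>The derivative of order \<open>q\<close> at \<open>z\<close>, divided by the factorial
  of \<open>q\<close>.\<close>

definition taylor_coeff :: "('k::finite, complex) mps \<Rightarrow> complex ^ 'k \<Rightarrow> ('k \<Rightarrow> nat) \<Rightarrow> complex" where
  "taylor_coeff a z q = (\<Sum>\<^sub>\<infinity>p. mcoeff a (p + q) * of_nat (multi_binomial (p + q) q) * mpow z p)"

text \<open>Expanding \<open>(\<rho> + s) ^ mdeg m\<close> binomially shows that the double series
  of absolute values has total \<open>mnorm (\<rho> + s) a\<close>. This justifies the rearrangement
  and contains the Cauchy estimate for the coefficients.\<close>

lemma taylor_expansion:
  fixes a :: "('k::finite, complex) mps"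
  assumes a: "asum (\<rho> + s) a" and "\<rho> \<ge> 0" "s \<ge> 0"
  shows "(\<lambda>p. norm (mcoeff a (p + q)) * real (multi_binomial (p + q) q) * \<rho> ^ mdeg p * s ^ mdeg q) summable_on UNIV"
    and "max_norm z \<le> \<rho> \<Longrightarrow> norm (taylor_coeff a z q) * s ^ mdeg q \<le> mnorm (\<rho> + s) a"
    and "max_norm z \<le> \<rho> \<Longrightarrow> max_norm w \<le> s \<Longrightarrow> ((\<lambda>q. taylor_coeff a z q * mpow w q) has_sum ev a (z + w)) UNIV"
proof -
  define b where "b = (\<lambda>(q, p). norm (mcoeff a (p + q)) * real (multi_binomial (p + q) q) * \<rho> ^ mdeg p * s ^ mdeg q)"
  have b0: "b x \<ge> 0" for x using assms by (simp add: b_def split: prod.split)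
  have expand: "(\<Sum>q | q \<le> m. b (q, m - q)) = norm (mcoeff a m) * (\<rho> + s) ^ mdeg m" for m
  proof -
    have "(\<rho> + s) ^ mdeg m = (\<Prod>k\<in>UNIV. (\<rho> + s) ^ m k)" by (simp add: mdeg_def power_sum)
    also have "\<dots> = (\<Sum>q | q \<le> m. real (multi_binomial m q) * \<rho> ^ mdeg (m - q) * s ^ mdeg q)"
      by (subst prod_add_expand) (simp add: multi_binomial_def mdeg_def power_sum)
    finally show ?thesis
      by (auto simp: b_def sum_distrib_left index_diff_add mult_ac intro!: sum.cong)
  qed
  define B where "B = (\<lambda>(m, q). b (q, m - q))"
  have "B abs_summable_on (SIGMA m:UNIV. {q. q \<le> m})"
    unfolding Infinite_Sum.abs_summable_on_Sigma_iff
  proof (intro conjI ballI)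
    fix m :: "'k \<Rightarrow> nat"
    show "(\<lambda>q. B (m, q)) abs_summable_on {q. q \<le> m}" by (simp add: finite_le_index)
  next
    have eq: "(\<Sum>\<^sub>\<infinity>q\<in>{q. q \<le> m}. norm (B (m, q))) = norm (mcoeff a m) * (\<rho> + s) ^ mdeg m" for m
      using b0 by (simp add: B_def finite_le_index expand)
    show "(\<lambda>m. \<Sum>\<^sub>\<infinity>q\<in>{q. q \<le> m}. norm (B (m, q))) abs_summable_on UNIV"
      unfolding eq using a assms by (simp add: asum_def abs_mult)
  qed
  then have B: "B summable_on (SIGMA m:UNIV. {q. q \<le> m})" by (rule abs_summable_summable)
  have reindex: "((\<lambda>(m, q). h (q, m - q)) has_sum S) (SIGMA m:UNIV. {q. q \<le> m}) \<longleftrightarrow> (h has_sum S) (UNIV \<times> UNIV)"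
    for h :: "('k \<Rightarrow> nat) \<times> ('k \<Rightarrow> nat) \<Rightarrow> 'b::{comm_monoid_add, topological_space}" and S
    by (rule has_sum_reindex_bij_witness[where j = "\<lambda>(m, q). (q, m - q)" and i = "\<lambda>(q, r). (q + r, q)"])
       (auto simp: index_diff_add)
  have "(B has_sum (infsum B (SIGMA m:UNIV. {q. q \<le> m}))) (SIGMA m:UNIV. {q. q \<le> m})" using B by simp
  moreover have "(B has_sum (mnorm (\<rho> + s) a)) (SIGMA m:UNIV. {q. q \<le> m})"
  proof (rule has_sum_SigmaI[OF _ _ B])
    show "((\<lambda>q. B (m, q)) has_sum norm (mcoeff a m) * (\<rho> + s) ^ mdeg m) {q. q \<le> m}" for m
      by (rule has_sum_finiteI) (simp_all add: finite_le_index B_def expand)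
    show "((\<lambda>m. norm (mcoeff a m) * (\<rho> + s) ^ mdeg m) has_sum mnorm (\<rho> + s) a) UNIV"
      using a by (simp add: mnorm_def asum_def)
  qed
  ultimately have b_has: "(b has_sum mnorm (\<rho> + s) a) (UNIV \<times> UNIV)"
    unfolding B_def reindex by (simp add: has_sum_unique)
  then have b_sum: "b summable_on (UNIV \<times> UNIV)" by (rule has_sum_imp_summable)
  have b_abs: "b abs_summable_on (UNIV \<times> UNIV)" using b_sum b0 by simp
  then have inner: "(\<lambda>p. b (q, p)) summable_on UNIV" for q
    unfolding Infinite_Sum.abs_summable_on_Sigma_iff using b0 by simp
  then show "(\<lambda>p. norm (mcoeff a (p + q)) * real (multi_binomial (p + q) q) * \<rho> ^ mdeg p * s ^ mdeg q) summable_on UNIV"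
    by (simp add: b_def)
  assume z: "max_norm z \<le> \<rho>"
  have inner_le: "infsum (\<lambda>p. b (q, p)) UNIV \<le> mnorm (\<rho> + s) a"
  proof -
    have "((\<lambda>q. infsum (\<lambda>p. b (q, p)) UNIV) has_sum mnorm (\<rho> + s) a) UNIV"
      by (rule has_sum_SigmaD[OF b_has]) (simp add: inner)
    then have "sum (\<lambda>q. infsum (\<lambda>p. b (q, p)) UNIV) {q} \<le> mnorm (\<rho> + s) a"
      using b0 by (intro has_sum_mono2[OF has_sum_finite]) (auto intro: infsum_nonneg)
    then show ?thesis by simp
  qed
  have term_le: "norm (mcoeff a (p + q) * of_nat (multi_binomial (p + q) q) * mpow z p) * s ^ mdeg q \<le> b (q, p)" for p q
    using norm_mpow_le[OF z, of p] assms
    by (auto simp: b_def norm_mult intro!: mult_left_mono mult_right_mono)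
  show "norm (taylor_coeff a z q) * s ^ mdeg q \<le> mnorm (\<rho> + s) a"
  proof -
    have scaled: "(\<lambda>p. (mcoeff a (p + q) * of_nat (multi_binomial (p + q) q) * mpow z p) * of_real (s ^ mdeg q)) abs_summable_on UNIV"
      by (rule summable_on_comparison_test[OF inner[of q]])
         (use term_le[of _ q] assms in \<open>auto simp: norm_mult norm_power\<close>)
    have "norm (taylor_coeff a z q) * s ^ mdeg q = norm (taylor_coeff a z q * of_real (s ^ mdeg q))"
      using assms by (simp add: norm_mult norm_power)
    also have "\<dots> = norm (\<Sum>\<^sub>\<infinity>p. (mcoeff a (p + q) * of_nat (multi_binomial (p + q) q) * mpow z p) * of_real (s ^ mdeg q))"
      unfolding taylor_coeff_def by (subst infsum_cmult_left'[symmetric]) simp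
    also have "\<dots> \<le> (\<Sum>\<^sub>\<infinity>p. norm ((mcoeff a (p + q) * of_nat (multi_binomial (p + q) q) * mpow z p) * of_real (s ^ mdeg q)))"
      by (rule norm_infsum_bound[OF scaled])
    also have "\<dots> \<le> infsum (\<lambda>p. b (q, p)) UNIV"
      by (rule infsum_mono[OF scaled inner]) (use term_le[of _ q] assms in \<open>auto simp: norm_mult norm_power\<close>)
    finally show ?thesis using inner_le by linarith
  qed
  assume w: "max_norm w \<le> s"
  define e where "e = (\<lambda>(q, p). mcoeff a (p + q) * of_nat (multi_binomial (p + q) q) * mpow z p * mpow w q)"
  have "e abs_summable_on (UNIV \<times> UNIV)"
  proof (rule Infinite_Sum.abs_summable_on_comparison_test[OF b_abs])
    fix x :: "('k \<Rightarrow> nat) \<times> ('k \<Rightarrow> nat)"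
    obtain q p where x: "x = (q, p)" by fastforce
    have "norm (e x) \<le> norm (mcoeff a (p + q) * of_nat (multi_binomial (p + q) q) * mpow z p) * s ^ mdeg q"
      unfolding e_def x using norm_mpow_le[OF w, of q] by (auto simp: norm_mult intro!: mult_left_mono)
    also have "\<dots> \<le> b x" unfolding x by (rule term_le)
    finally show "norm (e x) \<le> norm (b x)" using b0[of x] by simp
  qed
  then have e_sum: "e summable_on (UNIV \<times> UNIV)" and e_abs: "e abs_summable_on (UNIV \<times> UNIV)"
    using abs_summable_summable by blast+
  have e_has: "(e has_sum (infsum e (UNIV \<times> UNIV))) (UNIV \<times> UNIV)" using e_sum by simp
  have 1: "((\<lambda>q. taylor_coeff a z q * mpow w q) has_sum (infsum e (UNIV \<times> UNIV))) UNIV"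
  proof (rule has_sum_SigmaD[OF e_has])
    fix q
    have s: "(\<lambda>p. e (q, p)) summable_on UNIV"
      by (rule abs_summable_summable) (use e_abs[unfolded Infinite_Sum.abs_summable_on_Sigma_iff] in blast)
    have "infsum (\<lambda>p. e (q, p)) UNIV = taylor_coeff a z q * mpow w q"
      unfolding taylor_coeff_def e_def by (simp add: infsum_cmult_left')
    then show "((\<lambda>p. e (q, p)) has_sum taylor_coeff a z q * mpow w q) UNIV"
      using has_sum_infsum[OF s] by simp
  qed
  have "((\<lambda>(m, q). e (q, m - q)) has_sum (infsum e (UNIV \<times> UNIV))) (SIGMA m:UNIV. {q. q \<le> m})"
    unfolding reindex by (rule e_has)
  then have "((\<lambda>m. mcoeff a m * mpow (z + w) m) has_sum (infsum e (UNIV \<times> UNIV))) UNIV"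
  proof (rule has_sum_SigmaD)
    fix m :: "'k \<Rightarrow> nat"
    have "mpow (z + w) m = (\<Sum>q | q \<le> m. of_nat (multi_binomial m q) * mpow z (m - q) * mpow w q)"
      unfolding mpow_def vector_add_component
      by (subst prod_add_expand) (simp add: multi_binomial_def)
    then have "mcoeff a m * mpow (z + w) m = (\<Sum>q | q \<le> m. e (q, m - q))"
      by (auto simp: e_def sum_distrib_left index_diff_add mult_ac intro!: sum.cong)
    then show "((\<lambda>q. case (m, q) of (m, q) \<Rightarrow> e (q, m - q)) has_sum mcoeff a m * mpow (z + w) m) {q. q \<le> m}"
      by (intro has_sum_finiteI) (auto simp: finite_le_index)
  qed
  then have "infsum e (UNIV \<times> UNIV) = ev a (z + w)" by (simp add: ev_def infsumI)
  then show "((\<lambda>q. taylor_coeff a z q * mpow w q) has_sum ev a (z + w)) UNIV" using 1 by simp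
qed

lemma taylor_coeff_0: "taylor_coeff a z 0 = ev a z"
proof -
  have "multi_binomial p 0 = 1" for p :: "'a \<Rightarrow> nat" by (simp add: multi_binomial_def)
  then show ?thesis unfolding taylor_coeff_def ev_def by (simp only: add_0_right of_nat_1 mult_1_right)
qed

lemma taylor_coeff_unit: "taylor_coeff a z (unit_index k) = ev (mderiv k a) z"
  unfolding taylor_coeff_def ev_def multi_binomial_unit mcoeff_mderiv by (simp add: mult_ac)

lemma asum_mderiv:
  assumes "asum (\<rho> + s) a" "\<rho> \<ge> 0" "s > 0"
  shows "asum \<rho> (mderiv k a)"
proof -
  have "(\<lambda>p. norm (mcoeff a (p + unit_index k)) * real (multi_binomial (p + unit_index k) (unit_index k)) *
      \<rho> ^ mdeg p * s ^ mdeg (unit_index k) * inverse s) summable_on UNIV"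
    using assms by (intro summable_on_cmult_left taylor_expansion) auto
  moreover have "norm (mcoeff a (p + unit_index k)) * real (multi_binomial (p + unit_index k) (unit_index k)) *
      \<rho> ^ mdeg p * s ^ mdeg (unit_index k) * inverse s = norm (mcoeff (mderiv k a) p) * \<rho> ^ mdeg p" for p
    unfolding multi_binomial_unit mcoeff_mderiv norm_mult norm_of_nat mdeg_unit using assms by simp
  ultimately have "(\<lambda>p. norm (mcoeff (mderiv k a) p) * \<rho> ^ mdeg p) summable_on UNIV"
    by (simp only:)
  then show ?thesis using assms by (simp add: asum_def)
qed

text \<open>Dominated convergence for unordered sums along any filter: domination makes the finite
  partial sums converge uniformly, so the two limits may be exchanged.\<close>

lemma tendsto_infsum_dominated:
  fixes \<phi> :: "'x \<Rightarrow> 'b \<Rightarrow> complex"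
  assumes lim: "\<And>p. ((\<lambda>x. \<phi> x p) \<longlongrightarrow> L p) G" and dom: "eventually (\<lambda>x. \<forall>p. norm (\<phi> x p) \<le> M p) G"
    and M: "M summable_on UNIV" and G: "G \<noteq> bot"
  shows "((\<lambda>x. infsum (\<phi> x) UNIV) \<longlongrightarrow> infsum L UNIV) G"
proof -
  define S where "S = {x. \<forall>p. norm (\<phi> x p) \<le> M p}"
  have LM: "norm (L p) \<le> M p" for p
    by (rule tendsto_upperbound[OF tendsto_norm[OF lim] _ G]) (use dom in \<open>auto elim: eventually_mono\<close>)
  have "L abs_summable_on UNIV"
    by (rule summable_on_comparison_test[OF M]) (use LM in auto)
  then have L: "L summable_on UNIV" by (rule abs_summable_summable)
  show ?thesis
  proof (rule swap_uniform_limit')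
    show "\<forall>\<^sub>F X in finite_subsets_at_top UNIV. ((\<lambda>x. \<Sum>p\<in>X. \<phi> x p) \<longlongrightarrow> (\<Sum>p\<in>X. L p)) G"
      by (intro always_eventually allI tendsto_sum lim)
    show "((\<lambda>X. \<Sum>p\<in>X. L p) \<longlongrightarrow> infsum L UNIV) (finite_subsets_at_top UNIV)"
      using has_sum_infsum[OF L] by (simp add: has_sum_def)
    show "uniform_limit S (\<lambda>X x. \<Sum>p\<in>X. \<phi> x p) (\<lambda>x. infsum (\<phi> x) UNIV) (finite_subsets_at_top UNIV)"
      by (rule Weierstrass_m_test_general[OF _ M]) (auto simp: S_def)
    show "\<forall>\<^sub>F x in G. x \<in> S" using dom by (simp add: S_def)
  qed (rule finite_subsets_at_top_neq_bot)
qed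

section \<open>Power series depending on a parameter\<close>

lemma has_sum_remove_finite:
  fixes f :: "'a \<Rightarrow> 'b::real_normed_vector"
  assumes "(f has_sum S) UNIV" "finite P"
  shows "((\<lambda>q. if q \<in> P then 0 else f q) has_sum (S - sum f P)) UNIV"
proof -
  have "((\<lambda>q. if q \<in> P then f q else 0) has_sum sum f P) UNIV"
    by (rule has_sum_finite_neutralI[of P]) (use assms in auto)
  then have "((\<lambda>q. f q + - (if q \<in> P then f q else 0)) has_sum (S + - sum f P)) UNIV"
    using assms(1) by (intro has_sum_add) (auto simp: has_sum_uminus)
  also have "(\<lambda>q. f q + - (if q \<in> P then f q else 0)) = (\<lambda>q. if q \<in> P then 0 else f q)"
    by auto
  finally show ?thesis by simp
qed

lemma mdeg_eq_1_iff: "mdeg q = 1 \<longleftrightarrow> (\<exists>k. q = unit_index k)"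
proof
  assume 1: "mdeg q = 1"
  then have "q \<noteq> 0" by (metis mdeg_zero zero_neq_one)
  then obtain k p where q: "q = p + unit_index k" by (rule nonzero_index_split)
  then have "mdeg p = 0" using 1 by (simp del: plus_fun_apply mdeg_eq_0_iff)
  then have "p = 0" by (simp only: mdeg_eq_0_iff)
  then show "\<exists>k. q = unit_index k" using q by (metis add_0)
qed auto

text \<open>The increment uses at most half of the spare radius, so the terms of degree two and more
  are dominated by a geometric series of ratio 1/2; the factor 4 makes up for
  \<open>(1 / 2) ^ 2\<close>.\<close>

lemma taylor_remainder:
  fixes a :: "('k::finite, complex) mps"
  assumes a: "asum (\<rho> + s) a" and "s > 0" and z: "max_norm z \<le> \<rho>" and w: "max_norm w \<le> s / 2"
  shows "norm (ev a (z + w) - ev a z - (\<Sum>k\<in>UNIV. ev (mderiv k a) z * w $ k))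
    \<le> 4 * 2 ^ CARD('k) * mnorm (\<rho> + s) a * (max_norm w / s) ^ 2"
proof -
  define P where "P = insert 0 (range (unit_index :: 'k \<Rightarrow> 'k \<Rightarrow> nat))"
  define M where "M = mnorm (\<rho> + s) a"
  define y where "y = max_norm w / s"
  have \<rho>: "\<rho> \<ge> 0" using z max_norm_nonneg order_trans by blast
  have M: "M \<ge> 0" unfolding M_def by (rule mnorm_nonneg[OF a])
  have y: "0 \<le> y" "y \<le> 1 / 2" using w \<open>s > 0\<close> max_norm_nonneg[of w] by (auto simp: y_def divide_le_eq)
  have "((\<lambda>q. taylor_coeff a z q * mpow w q) has_sum ev a (z + w)) UNIV"
    by (rule taylor_expansion(3)[OF a]) (use assms \<rho> in auto)
  then have "((\<lambda>q. if q \<in> P then 0 else taylor_coeff a z q * mpow w q) has_sum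
      (ev a (z + w) - (\<Sum>q\<in>P. taylor_coeff a z q * mpow w q))) UNIV"
    by (rule has_sum_remove_finite) (simp add: P_def)
  moreover have "(\<Sum>q\<in>P. taylor_coeff a z q * mpow w q) = ev a z + (\<Sum>k\<in>UNIV. ev (mderiv k a) z * w $ k)"
    unfolding P_def
    by (subst sum.insert)
       (auto simp: sum.reindex inj_on_def taylor_coeff_0 taylor_coeff_unit unit_index_neq_0[symmetric] simp del: unit_index_neq_0)
  ultimately have rem: "((\<lambda>q. if q \<in> P then 0 else taylor_coeff a z q * mpow w q) has_sum
      (ev a (z + w) - ev a z - (\<Sum>k\<in>UNIV. ev (mderiv k a) z * w $ k))) UNIV"
    by (simp add: diff_diff_add)
  have le: "norm (if q \<in> P then 0 else taylor_coeff a z q * mpow w q) \<le> (4 * y ^ 2 * M) * (1 / 2) ^ mdeg q" for q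
  proof (cases "q \<in> P")
    case True then show ?thesis using M by simp
  next
    case False
    then have "mdeg q \<noteq> 0" "mdeg q \<noteq> 1" unfolding mdeg_eq_1_iff mdeg_eq_0_iff by (auto simp: P_def)
    then obtain d where d: "mdeg q = d + 2" by (metis add_2_eq_Suc' One_nat_def not0_implies_Suc)
    have "norm (taylor_coeff a z q * mpow w q) \<le> norm (taylor_coeff a z q) * (max_norm w) ^ mdeg q"
      unfolding norm_mult by (intro mult_left_mono norm_mpow_le) auto
    also have "\<dots> = (norm (taylor_coeff a z q) * s ^ mdeg q) * y ^ mdeg q"
      using \<open>s > 0\<close> by (simp add: y_def power_divide)
    also have "\<dots> \<le> M * y ^ mdeg q"
      unfolding M_def using taylor_expansion(2)[OF a \<rho> _ z] \<open>s > 0\<close> y by (intro mult_right_mono) auto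
    also have "\<dots> = M * (y ^ 2 * y ^ d)" by (simp only: d power_add mult.commute[of "y ^ d"])
    also have "\<dots> \<le> M * (y ^ 2 * (1 / 2) ^ d)"
      using y M by (intro mult_left_mono power_mono) auto
    also have "\<dots> = (4 * y ^ 2 * M) * (1 / 2) ^ mdeg q" by (simp add: d)
    finally show ?thesis using False by simp
  qed
  have "((\<lambda>q :: 'k \<Rightarrow> nat. (4 * y ^ 2 * M) * (1 / 2) ^ mdeg q) has_sum
      (4 * y ^ 2 * M) * (\<Sum>\<^sub>\<infinity>q :: 'k \<Rightarrow> nat. (1 / 2) ^ mdeg q)) UNIV"
    by (intro has_sum_cmult_right has_sum_infsum summable_power_mdeg) auto
  then have "norm (ev a (z + w) - ev a z - (\<Sum>k\<in>UNIV. ev (mderiv k a) z * w $ k))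
      \<le> (4 * y ^ 2 * M) * (\<Sum>\<^sub>\<infinity>q :: 'k \<Rightarrow> nat. (1 / 2) ^ mdeg q)"
    by (rule norm_infsum_le[OF rem]) (rule le)
  also have "\<dots> \<le> (4 * y ^ 2 * M) * (1 / (1 - 1 / 2)) ^ CARD('k)"
    using M by (intro mult_left_mono summable_power_mdeg) auto
  finally show ?thesis by (simp add: y_def M_def mult_ac)
qed

lemma has_derivative_quadratic:
  assumes "eventually (\<lambda>x. norm (f x) \<le> C * norm (x - x0) ^ 2) (at x0 within S)" "f x0 = 0"
  shows "(f has_derivative (\<lambda>_. 0)) (at x0 within S)"
  unfolding has_derivative_iff_norm
proof
  show "((\<lambda>y. norm (f y - f x0 - 0) / norm (y - x0)) \<longlongrightarrow> 0) (at x0 within S)"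
  proof (rule Lim_null_comparison)
    have "((\<lambda>x. C * norm (x - x0)) \<longlongrightarrow> C * norm (x0 - x0)) (at x0 within S)"
      by (intro tendsto_intros)
    then show "((\<lambda>x. C * norm (x - x0)) \<longlongrightarrow> 0) (at x0 within S)" by simp
    show "\<forall>\<^sub>F x in at x0 within S. norm (norm (f x - f x0 - 0) / norm (x - x0)) \<le> C * norm (x - x0)"
      using assms(1)
    proof eventually_elim
      case (elim x)
      then show ?case using assms(2)
        by (cases "x = x0") (auto simp: power2_eq_square divide_le_eq mult.assoc)
    qed
  qed
qed simp

text \<open>Where the linear factor vanishes, continuity of the other factor suffices. This admits a
  gradient in \<open>z\<close> that depends on time merely continuously.\<close>

lemma has_derivative_mult_vanishing:
  fixes \<phi> :: "'a::real_normed_vector \<Rightarrow> complex"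
  assumes \<phi>: "(\<phi> \<longlongrightarrow> \<phi> x0) (at x0 within S)" and L: "bounded_linear L"
  shows "((\<lambda>x. \<phi> x * L (x - x0)) has_derivative (\<lambda>h. \<phi> x0 * L h)) (at x0 within S)"
  unfolding has_derivative_iff_norm
proof
  show "bounded_linear (\<lambda>h. \<phi> x0 * L h)" by (rule bounded_linear_const_mult[OF L])
  obtain K where K: "\<And>x. norm (L x) \<le> norm x * K" using bounded_linear.bounded[OF L] by blast
  have L0: "L 0 = 0" using L by (simp add: bounded_linear.linear linear_0)
  show "((\<lambda>y. norm (\<phi> y * L (y - x0) - \<phi> x0 * L (x0 - x0) - \<phi> x0 * L (y - x0)) / norm (y - x0)) \<longlongrightarrow> 0) (at x0 within S)"
  proof (rule Lim_null_comparison)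
    have "((\<lambda>x. norm (\<phi> x - \<phi> x0) * K) \<longlongrightarrow> norm (\<phi> x0 - \<phi> x0) * K) (at x0 within S)"
      by (intro tendsto_intros \<phi>)
    then show "((\<lambda>x. norm (\<phi> x - \<phi> x0) * K) \<longlongrightarrow> 0) (at x0 within S)" by simp
    have "norm (\<phi> x * L (x - x0) - \<phi> x0 * L (x0 - x0) - \<phi> x0 * L (x - x0)) / norm (x - x0) \<le> norm (\<phi> x - \<phi> x0) * K" for x
    proof (cases "x = x0")
      case False
      have "norm (\<phi> x * L (x - x0) - \<phi> x0 * L (x0 - x0) - \<phi> x0 * L (x - x0)) = norm (\<phi> x - \<phi> x0) * norm (L (x - x0))"
        by (simp add: L0 norm_mult[symmetric] algebra_simps)
      also have "\<dots> \<le> norm (\<phi> x - \<phi> x0) * (norm (x - x0) * K)" by (intro mult_left_mono K) auto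
      finally show ?thesis using False by (simp add: divide_le_eq mult_ac)
    qed (simp add: L0)
    then show "\<forall>\<^sub>F x in at x0 within S. norm (norm (\<phi> x * L (x - x0) - \<phi> x0 * L (x0 - x0) - \<phi> x0 * L (x - x0)) / norm (x - x0))
      \<le> norm (\<phi> x - \<phi> x0) * K"
      by (intro always_eventually allI) simp
  qed
qed

lemma at_within_atLeast_neq_bot:
  assumes "t \<ge> 0"
  shows "at t within {0..} \<noteq> (bot :: real filter)"
proof
  assume bot: "at t within {0..} = bot"
  have "at_right t \<le> at t within {0..}" by (rule at_le) (use assms in auto)
  then have "at_right t = bot" unfolding bot by (simp add: bot_unique)
  then show False using trivial_limit_at_right_real[of t] by simp
qed

text \<open>Joint differentiability from a time derivative at the single point \<open>z0\<close>.
  The function is a remainder quadratic in \<open>z - z0\<close> uniformly in time, plus the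
  gradient at \<open>z0\<close> applied to \<open>z - z0\<close>, plus the value at
  \<open>z0\<close>.\<close>

lemma ev_joint_derivative:
  fixes g :: "real \<Rightarrow> ('k::finite, complex) mps"
  assumes bound: "\<And>t m. t \<ge> 0 \<Longrightarrow> norm (mcoeff (g t) m) \<le> B / r ^ mdeg m"
    and cont: "\<And>m. continuous_on {0..} (\<lambda>t. mcoeff (g t) m)"
    and t0: "t0 \<ge> 0" and z0: "max_norm z0 < r"
    and deriv: "((\<lambda>t. ev (g t) z0) has_vector_derivative G') (at t0 within {0..})"
  shows "((\<lambda>(z, t). ev (g t) z) has_derivative
     (\<lambda>(w, s). (\<Sum>k\<in>UNIV. ev (mderiv k (g t0)) z0 * w $ k) + of_real s * G')) (at (z0, t0) within UNIV \<times> {0..})"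
proof -
  define \<rho> where "\<rho> = max_norm z0"
  define s where "s = (r - \<rho>) / 2"
  have \<rho>: "\<rho> \<ge> 0" by (simp add: \<rho>_def max_norm_nonneg)
  have s: "s > 0" "\<rho> + s < r" using z0 by (auto simp: s_def \<rho>_def field_simps)
  have r: "r > 0" using \<rho> s by linarith
  define M where "M = B * (1 / (1 - (\<rho> + s) / r)) ^ CARD('k)"
  have g: "asum (\<rho> + s) (g t)" "mnorm (\<rho> + s) (g t) \<le> M" if "t \<ge> 0" for t
    unfolding M_def by (rule asum_geometric[OF bound]; use that \<rho> s in auto)+
  define X where "X = (UNIV :: (complex ^ 'k) set) \<times> {0::real..}"
  define rem where "rem = (\<lambda>(z, t). ev (g t) z - ev (g t) z0 - (\<Sum>k\<in>UNIV. ev (mderiv k (g t)) z0 * (z - z0) $ k))"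
  have "eventually (\<lambda>x. norm (rem x) \<le> (4 * 2 ^ CARD('k) * M / s ^ 2) * norm (x - (z0, t0)) ^ 2) (at (z0, t0) within X)"
    unfolding eventually_at
  proof (intro exI[of _ "s / 2"] conjI ballI impI)
    fix x assume x: "x \<in> X" "x \<noteq> (z0, t0) \<and> dist x (z0, t0) < s / 2"
    obtain z t where zt: "x = (z, t)" by fastforce
    have t: "t \<ge> 0" using x by (simp add: X_def zt)
    have wn: "max_norm (z - z0) \<le> norm (x - (z0, t0))"
      using max_norm_le_norm[of "z - z0"] norm_fst_le[of "z - z0" "t - t0"] by (simp add: zt)
    then have w: "max_norm (z - z0) \<le> s / 2" using x by (simp add: dist_norm)
    have "norm (rem x) \<le> 4 * 2 ^ CARD('k) * mnorm (\<rho> + s) (g t) * (max_norm (z - z0) / s) ^ 2"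
      using taylor_remainder[OF g(1)[OF t] s(1) _ w, of z0] by (simp add: rem_def zt \<rho>_def)
    also have "\<dots> \<le> 4 * 2 ^ CARD('k) * M * (norm (x - (z0, t0)) / s) ^ 2"
      using g(2)[OF t] mnorm_nonneg[OF g(1)[OF t]] wn s max_norm_nonneg[of "z - z0"]
      by (intro mult_mono power_mono divide_right_mono) auto
    finally show "norm (rem x) \<le> (4 * 2 ^ CARD('k) * M / s ^ 2) * norm (x - (z0, t0)) ^ 2"
      by (simp add: power_divide)
  qed (use s in auto)
  then have R: "(rem has_derivative (\<lambda>_. 0)) (at (z0, t0) within X)"
    by (rule has_derivative_quadratic) (simp add: rem_def)
  have Dc: "((\<lambda>t. ev (mderiv k (g t)) z0) \<longlongrightarrow> ev (mderiv k (g t0)) z0) (at t0 within {0..})" for k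
    unfolding ev_def
  proof (rule tendsto_infsum_dominated)
    \<comment> \<open>A time-independent series dominating every \<open>g t\<close>; its derivative
      converges at radius \<open>\<rho>\<close> and dominates the gradients.\<close>
    define G where "G = Mps (\<lambda>m :: 'k \<Rightarrow> nat. complex_of_real (B / r ^ mdeg m))"
    have B: "B \<ge> 0" using bound[OF t0, of 0] norm_ge_zero[of "mcoeff (g t0) 0"] by (simp del: norm_ge_zero)
    have "asum (\<rho> + s) G"
      by (rule asum_geometric[of G B r]) (use B r \<rho> s in \<open>auto simp: G_def norm_divide norm_power\<close>)
    then have "asum \<rho> (mderiv k G)" using \<rho> s by (intro asum_mderiv) auto
    then show "(\<lambda>p. norm (mcoeff (mderiv k G) p) * \<rho> ^ mdeg p) summable_on UNIV" by (simp add: asum_def)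
    show "\<forall>\<^sub>F t in at t0 within {0..}. \<forall>p. norm (mcoeff (mderiv k (g t)) p * mpow z0 p) \<le> norm (mcoeff (mderiv k G) p) * \<rho> ^ mdeg p"
      unfolding eventually_at
    proof (intro exI[of _ 1] conjI ballI impI allI)
      fix t :: real and p assume "t \<in> {0..}"
      then have "t \<ge> 0" by simp
      then have "norm (mcoeff (g t) (p + unit_index k)) \<le> norm (mcoeff G (p + unit_index k))"
        unfolding G_def mcoeff_Mps norm_of_real by (rule order_trans[OF bound abs_ge_self])
      then have "norm (mcoeff (mderiv k (g t)) p) \<le> norm (mcoeff (mderiv k G) p)"
        unfolding mcoeff_mderiv norm_mult by (rule mult_left_mono) simp
      then show "norm (mcoeff (mderiv k (g t)) p * mpow z0 p) \<le> norm (mcoeff (mderiv k G) p) * \<rho> ^ mdeg p"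
        unfolding norm_mult by (intro mult_mono norm_mpow_le) (auto simp: \<rho>_def)
    qed simp
    show "((\<lambda>t. mcoeff (mderiv k (g t)) p * mpow z0 p) \<longlongrightarrow> mcoeff (mderiv k (g t0)) p * mpow z0 p) (at t0 within {0..})" for p
      unfolding mcoeff_mderiv using cont t0 by (intro tendsto_intros) (auto simp: continuous_on_def)
  qed (rule at_within_atLeast_neq_bot[OF t0])
  have Dj: "((\<lambda>x. ev (mderiv k (g (snd x))) z0) \<longlongrightarrow> ev (mderiv k (g (snd (z0, t0)))) z0) (at (z0, t0) within X)" for k
  proof -
    have "continuous (at t0 within {0..}) (\<lambda>t. ev (mderiv k (g t)) z0)"
      using Dc by (simp add: continuous_within)
    moreover have "\<forall>\<^sub>F x in at (z0, t0) within X. snd x \<in> {0..}"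
      unfolding eventually_at by (intro exI[of _ 1]) (auto simp: X_def)
    moreover have "((\<lambda>x. snd x) \<longlongrightarrow> t0) (at (z0, t0) within X)"
      using tendsto_snd[OF tendsto_ident_at, of "(z0, t0)" X] by simp
    ultimately have "((\<lambda>x. ev (mderiv k (g (snd x))) z0) \<longlongrightarrow> ev (mderiv k (g t0)) z0) (at (z0, t0) within X)"
      by (rule continuous_within_tendsto_compose)
    then show ?thesis by simp
  qed
  have P: "((\<lambda>x. ev (mderiv k (g (snd x))) z0 * (fst (x - (z0, t0)) $ k)) has_derivative
      (\<lambda>h. ev (mderiv k (g (snd (z0, t0)))) z0 * (fst h $ k))) (at (z0, t0) within X)" for k
  proof (rule has_derivative_mult_vanishing[OF Dj])
    show "bounded_linear (\<lambda>x :: (complex ^ 'k) \<times> real. fst x $ k)"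
      using bounded_linear_compose[OF bounded_linear_vec_nth bounded_linear_fst] .
  qed
  have T: "((\<lambda>x. ev (g (snd x)) z0) has_derivative (\<lambda>h. snd h *\<^sub>R G')) (at (z0, t0) within X)"
  proof -
    have "((\<lambda>t. ev (g t) z0) has_derivative (\<lambda>h. h *\<^sub>R G')) (at (snd (z0, t0)) within snd ` X)"
      using deriv unfolding has_vector_derivative_def snd_conv
      by (rule has_derivative_subset) (auto simp: X_def)
    moreover have "(snd has_derivative snd) (at (z0, t0) within X)"
      by (rule bounded_linear_imp_has_derivative[OF bounded_linear_snd])
    ultimately show ?thesis using has_derivative_in_compose[of snd snd "(z0, t0)" X] by blast
  qed
  have "((\<lambda>x. rem x + (\<Sum>k\<in>UNIV. ev (mderiv k (g (snd x))) z0 * (fst (x - (z0, t0)) $ k)) + ev (g (snd x)) z0) has_derivative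
     (\<lambda>h. 0 + (\<Sum>k\<in>UNIV. ev (mderiv k (g (snd (z0, t0)))) z0 * (fst h $ k)) + snd h *\<^sub>R G')) (at (z0, t0) within X)"
    by (intro has_derivative_add has_derivative_sum R P T)
  then show ?thesis
    by (simp add: rem_def case_prod_unfold X_def scaleR_conv_of_real)
qed

lemma has_vector_derivative_iff_quotient:
  fixes f :: "real \<Rightarrow> 'a::real_normed_vector"
  shows "(f has_vector_derivative D) (at t within S) \<longleftrightarrow> ((\<lambda>y. (f y - f t) /\<^sub>R (y - t)) \<longlongrightarrow> D) (at t within S)"
proof -
  have "norm (f y - f t - (y - t) *\<^sub>R D) / norm (y - t) = norm ((f y - f t) /\<^sub>R (y - t) - D)" if "y \<noteq> t" for y
  proof -
    have "f y - f t - (y - t) *\<^sub>R D = (y - t) *\<^sub>R ((f y - f t) /\<^sub>R (y - t) - D)"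
      using that by (simp add: scaleR_diff_right)
    then show ?thesis using that by simp
  qed
  then have "((\<lambda>y. norm (f y - f t - (y - t) *\<^sub>R D) / norm (y - t)) \<longlongrightarrow> 0) (at t within S) \<longleftrightarrow>
     ((\<lambda>y. norm ((f y - f t) /\<^sub>R (y - t) - D)) \<longlongrightarrow> 0) (at t within S)"
    by (intro tendsto_cong) (auto simp: eventually_at intro!: exI[of _ 1])
  then show ?thesis
    unfolding has_vector_derivative_def has_derivative_iff_norm
    by (simp add: bounded_linear_scaleR_left tendsto_norm_zero_iff LIM_zero_iff)
qed

text \<open>By the mean value inequality the difference quotients obey the bounds \<open>K\<close>
  on the derivatives, so the series may be differentiated term by term.\<close>

lemma ev_time_derivative:
  fixes h h' :: "real \<Rightarrow> ('k::finite, complex) mps"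
  assumes deriv: "\<And>t. t \<ge> 0 \<Longrightarrow> mps_deriv h (h' t) t"
    and bound: "\<And>t p. t \<ge> 0 \<Longrightarrow> norm (mcoeff (h' t) p) \<le> K p"
    and K: "(\<lambda>p. K p * \<rho> ^ mdeg p) summable_on UNIV"
    and h: "\<And>t. t \<ge> 0 \<Longrightarrow> asum \<rho> (h t)" and z: "max_norm z \<le> \<rho>" and t0: "t0 \<ge> 0"
  shows "((\<lambda>t. ev (h t) z) has_vector_derivative ev (h' t0) z) (at t0 within {0..})"
proof -
  define q where "q t p = ((mcoeff (h t) p - mcoeff (h t0) p) /\<^sub>R (t - t0)) * mpow z p" for t p
  have lip: "norm (mcoeff (h t) p - mcoeff (h t0) p) \<le> K p * norm (t - t0)" if "t \<ge> 0" for t p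
  proof (rule differentiable_bound[of "{0..}"])
    show "((\<lambda>t. mcoeff (h t) p) has_derivative (\<lambda>s. s *\<^sub>R mcoeff (h' x) p)) (at x within {0..})" if "x \<in> {0..}" for x
      using deriv[of x] that unfolding mps_deriv_def has_vector_derivative_def by simp
    show "onorm (\<lambda>s. s *\<^sub>R mcoeff (h' x) p) \<le> K p" if "x \<in> {0..}" for x
      using bound[of x p] that by (intro onorm_le) (auto simp: mult_left_mono mult.commute)
  qed (use that t0 in auto)
  have "((\<lambda>t. infsum (q t) UNIV) \<longlongrightarrow> (\<Sum>\<^sub>\<infinity>p. mcoeff (h' t0) p * mpow z p)) (at t0 within {0..})"
  proof (rule tendsto_infsum_dominated[OF _ _ K at_within_atLeast_neq_bot[OF t0]])
    show "((\<lambda>t. q t p) \<longlongrightarrow> mcoeff (h' t0) p * mpow z p) (at t0 within {0..})" for p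
      using deriv[OF t0] unfolding q_def mps_deriv_def has_vector_derivative_iff_quotient
      by (intro tendsto_mult tendsto_const) blast
    have "norm (q t p) \<le> K p * \<rho> ^ mdeg p" if "t \<ge> 0" "t \<noteq> t0" for t p
    proof -
      have K0: "0 \<le> K p" using bound[OF t0, of p] norm_ge_zero order_trans by blast
      have "norm ((mcoeff (h t) p - mcoeff (h t0) p) /\<^sub>R (t - t0)) \<le> K p"
      proof -
        have "norm ((mcoeff (h t) p - mcoeff (h t0) p) /\<^sub>R (t - t0)) =
            norm (mcoeff (h t) p - mcoeff (h t0) p) * inverse \<bar>t - t0\<bar>"
          by (simp only: norm_scaleR abs_inverse mult.commute)
        also have "\<dots> \<le> (K p * norm (t - t0)) * inverse \<bar>t - t0\<bar>"
          using lip[OF that(1)] by (intro mult_right_mono) auto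
        also have "\<dots> = K p" using that(2) by simp
        finally show ?thesis .
      qed
      then show ?thesis unfolding q_def norm_mult
        by (intro mult_mono norm_mpow_le z K0) auto
    qed
    then show "\<forall>\<^sub>F t in at t0 within {0..}. \<forall>p. norm (q t p) \<le> K p * \<rho> ^ mdeg p"
      unfolding eventually_at by (intro exI[of _ 1]) auto
  qed
  moreover have "infsum (q t) UNIV = (ev (h t) z - ev (h t0) z) /\<^sub>R (t - t0)" if "t \<ge> 0" for t
  proof -
    have "ev (h t) z - ev (h t0) z = (\<Sum>\<^sub>\<infinity>p. mcoeff (h t - h t0) p * mpow z p)"
      using ev_diff[OF h[OF that] h[OF t0] z] by (simp add: ev_def)
    then have "(ev (h t) z - ev (h t0) z) /\<^sub>R (t - t0) = (\<Sum>\<^sub>\<infinity>p. (mcoeff (h t - h t0) p * mpow z p) /\<^sub>R (t - t0))"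
      by (simp add: infsum_scaleR_right)
    then show ?thesis by (simp add: q_def[abs_def] scaleR_conv_of_real mult_ac)
  qed
  ultimately show ?thesis
    unfolding has_vector_derivative_iff_quotient ev_def[of "h' t0"]
    by (elim Lim_transform_eventually) (auto simp: eventually_at intro!: exI[of _ 1])
qed

section \<open>Recovering coefficients from values at real points\<close>

text \<open>Subtracting the lower coefficients, which tend to 0 by induction, and dividing by
  \<open>s ^ e\<close> leaves \<open>c x e\<close> up to an error of order \<open>s\<close>,
  uniformly in \<open>x\<close>. So \<open>s\<close> is fixed first, and only then is the limit
  taken.\<close>

lemma coefficient_tendsto_zero_nat:
  fixes c :: "'x \<Rightarrow> nat \<Rightarrow> complex"
  assumes bound: "\<And>x e. norm (c x e) \<le> M * 2 ^ e"
    and lim: "\<And>s. 0 < s \<Longrightarrow> s < 1 / 2 \<Longrightarrow> ((\<lambda>x. \<Sum>\<^sub>\<infinity>e. c x e * of_real (s ^ e)) \<longlongrightarrow> 0) G"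
  shows "((\<lambda>x. c x e) \<longlongrightarrow> 0) G"
proof -
  have "0 \<le> norm (c undefined 0)" by (rule norm_ge_zero)
  also have "\<dots> \<le> M" using bound[of undefined 0] by simp
  finally have M: "M \<ge> 0" .
  show ?thesis
  proof (induction e rule: less_induct)
    case (less e)
    show ?case
    proof (rule tendstoI)
      fix \<epsilon> :: real assume \<epsilon>: "\<epsilon> > 0"
      define Q where "Q = M * 4 ^ Suc e * 2"
      have Q: "Q \<ge> 0" using M by (simp add: Q_def)
      \<comment> \<open>Small enough that the tail beyond \<open>e\<close>, divided by
        \<open>s ^ e\<close>, is at most \<open>\<epsilon> / 2\<close>, and at most 1/4 so that the
        tail is dominated by a geometric series of ratio 1/2.\<close>
      define s where "s = min (1 / 4) (\<epsilon> / (2 * (Q + 1)))"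
      have s: "0 < s" using \<epsilon> Q by (simp add: s_def)
      have s4: "s \<le> 1 / 4" unfolding s_def by (rule min.cobounded1)
      have "s * Q \<le> \<epsilon> / (2 * (Q + 1)) * (Q + 1)"
        using Q s by (intro mult_mono) (auto simp: s_def)
      also have "\<dots> = \<epsilon> / 2" using Q by (simp add: field_simps)
      finally have tail_small: "s * (M * 4 ^ Suc e * 2) \<le> \<epsilon> / 2" by (simp only: Q_def)
      have geo: "((\<lambda>n. (1 / 2 :: real) ^ n) has_sum 2) UNIV"
        using geometric_sums[of "1 / 2 :: real"] by (intro norm_summable_imp_has_sum) (auto intro: summable_geometric)
      have summ: "(\<lambda>n. c x n * of_real (s ^ n)) summable_on UNIV" for x
      proof (rule abs_summable_summable, rule summable_on_comparison_test)
        show "(\<lambda>n. M * (1 / 2) ^ n) summable_on UNIV"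
          using geo by (intro summable_on_cmult_right) (auto simp: summable_on_def)
        fix n
        have "norm (c x n * of_real (s ^ n)) \<le> (M * 2 ^ n) * (1 / 4) ^ n"
          unfolding norm_mult using bound[of x n] s s4 M by (intro mult_mono) (auto intro: power_mono simp: norm_power)
        also have "(M * 2 ^ n) * (1 / 4) ^ n = M * (1 / 2) ^ n"
        proof -
          have "(1 / 2 :: real) ^ n = 2 ^ n * (1 / 4) ^ n" by (subst power_mult_distrib[symmetric]) simp
          then show ?thesis by (simp only: mult.assoc)
        qed
        finally show "norm (c x n * of_real (s ^ n)) \<le> M * (1 / 2) ^ n" .
      qed auto
      have tail: "norm ((\<Sum>\<^sub>\<infinity>n. c x n * of_real (s ^ n)) - (\<Sum>n\<le>e. c x n * of_real (s ^ n))) \<le> M * (4 * s) ^ Suc e * 2" for x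
      proof (rule norm_infsum_le[OF has_sum_remove_finite[OF has_sum_infsum[OF summ], of "{..e}"]])
        show "((\<lambda>n. (M * (4 * s) ^ Suc e) * (1 / 2) ^ n) has_sum M * (4 * s) ^ Suc e * 2) UNIV"
          by (rule has_sum_cmult_right[OF geo])
        fix n
        show "norm (if n \<in> {..e} then 0 else c x n * of_real (s ^ n)) \<le> (M * (4 * s) ^ Suc e) * (1 / 2) ^ n"
        proof (cases "n \<le> e")
          case True then show ?thesis using M s by simp
        next
          case False
          then obtain d where d: "n = Suc e + d" by (metis Suc_leI le_Suc_ex not_less)
          have "norm (c x n * of_real (s ^ n)) \<le> (M * 2 ^ n) * s ^ n"
            unfolding norm_mult using bound[of x n] s s4 M by (intro mult_mono) (auto simp: norm_power)
          also have "\<dots> = M * (2 * s) ^ Suc e * (2 * s) ^ d"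
            by (simp add: d power_add power_mult_distrib)
          also have "\<dots> \<le> M * (2 * s) ^ Suc e * (1 / 2) ^ d"
            using s s4 M by (intro mult_left_mono power_mono) auto
          also have "\<dots> = (M * (4 * s) ^ Suc e) * (1 / 2) ^ n"
          proof -
            have "(2 * s) ^ Suc e = (4 * s) ^ Suc e * (1 / 2) ^ Suc e"
              by (subst power_mult_distrib[symmetric]) simp
            then show ?thesis unfolding d power_add by (simp only: mult_ac)
          qed
          finally show ?thesis using False by simp
        qed
      qed simp
      define A where "A x = ((\<Sum>\<^sub>\<infinity>n. c x n * of_real (s ^ n)) - (\<Sum>n<e. c x n * of_real (s ^ n))) / of_real (s ^ e)" for x
      have "(A \<longlongrightarrow> (0 - (\<Sum>n<e. 0 * of_real (s ^ n))) / of_real (s ^ e)) G"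
        unfolding A_def[abs_def] using s s4 by (intro tendsto_intros lim less) auto
      then have "eventually (\<lambda>x. norm (A x) < \<epsilon> / 2) G"
        using \<epsilon> by (auto dest!: tendstoD[of _ _ _ "\<epsilon> / 2"])
      then show "eventually (\<lambda>x. dist (c x e) 0 < \<epsilon>) G"
      proof eventually_elim
        case (elim x)
        have "norm (A x - c x e) * s ^ e = norm ((A x - c x e) * of_real (s ^ e))"
          using s by (simp add: norm_mult norm_power)
        also have "(A x - c x e) * of_real (s ^ e) =
            (\<Sum>\<^sub>\<infinity>n. c x n * of_real (s ^ n)) - (\<Sum>n\<le>e. c x n * of_real (s ^ n))"
        proof -
          have E: "complex_of_real (s ^ e) \<noteq> 0" using s by simp
          have "A x * of_real (s ^ e) = (\<Sum>\<^sub>\<infinity>n. c x n * of_real (s ^ n)) - (\<Sum>n<e. c x n * of_real (s ^ n))"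
            using A_def[of x] nonzero_eq_divide_eq[OF E] by blast
          then show ?thesis unfolding left_diff_distrib lessThan_Suc_atMost[symmetric] by simp
        qed
        also have "norm \<dots> \<le> (s * (M * 4 ^ Suc e * 2)) * s ^ e"
          using tail[of x] by (simp add: power_mult_distrib mult_ac)
        finally have "norm (A x - c x e) \<le> s * (M * 4 ^ Suc e * 2)" using s by simp
        then have "norm (A x - c x e) \<le> \<epsilon> / 2" using tail_small by linarith
        moreover have "norm (c x e) \<le> norm (A x) + norm (A x - c x e)"
          by (metis norm_minus_commute norm_triangle_sub)
        ultimately show ?case using elim by (simp add: dist_norm)
      qed
    qed
  qed
qed

text \<open>Uniqueness of coefficients, with a parameter. Variables are treated one at a time:
  \<open>\<Lambda> S q\<close> fixes the exponents of those in \<open>S\<close>, while the rest is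
  still summed at \<open>z\<close>. Adding \<open>k\<close> to \<open>S\<close> applies the
  one-variable statement to the power series in the coordinate \<open>k\<close>.\<close>

lemma coefficient_tendsto_zero:
  fixes d :: "'x \<Rightarrow> ('k::finite \<Rightarrow> nat) \<Rightarrow> complex"
  assumes bound: "\<And>x m. norm (d x m) \<le> B"
    and lim: "\<And>z :: 'k \<Rightarrow> real. (\<And>k. 0 < z k \<and> z k < 1 / 2) \<Longrightarrow>
      ((\<lambda>x. \<Sum>\<^sub>\<infinity>m. d x m * of_real (\<Prod>k\<in>UNIV. z k ^ m k)) \<longlongrightarrow> 0) G"
  shows "((\<lambda>x. d x m) \<longlongrightarrow> 0) G"
proof -
  have "0 \<le> norm (d undefined 0)" by (rule norm_ge_zero)
  also have "\<dots> \<le> B" using bound[of undefined 0] by simp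
  finally have B: "B \<ge> 0" .
  define \<Lambda> where "\<Lambda> S q = {m :: 'k \<Rightarrow> nat. \<forall>k\<in>S. m k = q k}" for S q
  define mon where "mon S z m = (\<Prod>k\<in>-S. z k ^ m k)" for S and z :: "'k \<Rightarrow> real" and m :: "'k \<Rightarrow> nat"
  have mon_le: "0 \<le> mon S z m \<and> mon S z m \<le> 2 ^ mdeg q * (1 / 2) ^ mdeg m"
    if z: "\<And>k. 0 < z k \<and> z k < 1 / 2" and m: "m \<in> \<Lambda> S q" for S z m q
  proof -
    have "0 \<le> z k" for k using z[of k] by linarith
    moreover have "z k \<le> 1 / 2" for k using z[of k] by linarith
    ultimately have 1: "0 \<le> mon S z m" "mon S z m \<le> (\<Prod>k\<in>-S. (1 / 2) ^ m k)"
      unfolding mon_def by (auto intro!: prod_nonneg prod_mono power_mono)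
    have "(1 / 2 :: real) ^ mdeg m = (\<Prod>k\<in>-S. (1 / 2) ^ m k) * (\<Prod>k\<in>S. (1 / 2) ^ m k)"
      unfolding mdeg_def power_sum by (subst prod.union_disjoint[symmetric]) (auto intro!: prod.cong)
    moreover have "(\<Prod>k\<in>S. (1 / 2 :: real) ^ m k) \<ge> (1 / 2) ^ mdeg q"
    proof -
      have "(1 / 2 :: real) ^ mdeg q \<le> (1 / 2) ^ (\<Sum>k\<in>S. q k)"
        unfolding mdeg_def by (intro power_decreasing sum_mono2) auto
      also have "\<dots> = (\<Prod>k\<in>S. (1 / 2 :: real) ^ m k)"
        using m unfolding power_sum \<Lambda>_def by (intro prod.cong) auto
      finally show ?thesis .
    qed
    ultimately have "(\<Prod>k\<in>-S. (1 / 2 :: real) ^ m k) * (1 / 2) ^ mdeg q \<le> (1 / 2) ^ mdeg m"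
      by (simp add: mult_left_mono prod_nonneg)
    then have "(\<Prod>k\<in>-S. (1 / 2 :: real) ^ m k) \<le> 2 ^ mdeg q * (1 / 2) ^ mdeg m"
      by (simp add: power_divide field_simps)
    then show ?thesis using 1 by linarith
  qed
  have geo: "(\<lambda>m :: 'k \<Rightarrow> nat. (1 / 2 :: real) ^ mdeg m) summable_on UNIV"
    by (rule summable_power_mdeg) auto
  have dom: "(\<lambda>m. B * (2 ^ mdeg q * (1 / 2) ^ mdeg m)) summable_on A" for q :: "'k \<Rightarrow> nat" and A :: "('k \<Rightarrow> nat) set"
    by (intro summable_on_cmult_right summable_on_subset_banach[OF geo]) auto
  have term_le: "norm (d x m * of_real (mon S z m)) \<le> B * (2 ^ mdeg q * (1 / 2) ^ mdeg m)"
    if "\<And>k. 0 < z k \<and> z k < 1 / 2" "m \<in> \<Lambda> S q" for x S z m q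
    unfolding norm_mult using bound[of x m] mon_le[OF that] B by (intro mult_mono) auto
  have summ: "(\<lambda>m. d x m * of_real (mon S z m)) abs_summable_on \<Lambda> S q"
    if "\<And>k. 0 < z k \<and> z k < 1 / 2" for x S z q
    by (rule summable_on_comparison_test[OF dom[of q]]) (use term_le[OF that] in auto)
  have main: "((\<lambda>x. \<Sum>\<^sub>\<infinity>m\<in>\<Lambda> S q. d x m * of_real (mon S z m)) \<longlongrightarrow> 0) G"
    if "finite S" "\<And>k. 0 < z k \<and> z k < 1 / 2" for S q z
    using that
  proof (induction S arbitrary: q z rule: finite_induct)
    case empty
    then show ?case using lim[of z] by (simp add: \<Lambda>_def mon_def)
  next
    case (insert k S)
    \<comment> \<open>The coefficient of the power \<open>e\<close> of the variable
      \<open>k\<close>.\<close>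
    define c where "c x e = (\<Sum>\<^sub>\<infinity>m\<in>\<Lambda> (insert k S) (q(k := e)). d x m * of_real (mon (insert k S) z m))" for x e
    have mon_insert: "mon S (z(k := s)) m = mon (insert k S) z m * s ^ e" if "m \<in> \<Lambda> (insert k S) (q(k := e))" for m e s
    proof -
      have "- S = insert k (- insert k S)" using insert.hyps by auto
      then have "mon S (z(k := s)) m = s ^ m k * (\<Prod>j\<in>- insert k S. (z(k := s)) j ^ m j)"
        unfolding mon_def by (subst \<open>- S = insert k (- insert k S)\<close>) (subst prod.insert, auto)
      also have "(\<Prod>j\<in>- insert k S. (z(k := s)) j ^ m j) = mon (insert k S) z m"
        unfolding mon_def by (intro prod.cong) auto
      also have "m k = e" using that by (simp add: \<Lambda>_def)
      finally show ?thesis by (simp add: mult.commute del: fun_upd_apply)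
    qed
    have part: "(\<Union>e. \<Lambda> (insert k S) (q(k := e))) = \<Lambda> S q"
      using insert.hyps by (auto simp: \<Lambda>_def)
    have c_sum: "(\<Sum>\<^sub>\<infinity>e. c x e * of_real (s ^ e)) = (\<Sum>\<^sub>\<infinity>m\<in>\<Lambda> S q. d x m * of_real (mon S (z(k := s)) m))"
      if s: "0 < s" "s < 1 / 2" for x s
    proof -
      have z': "0 < (z(k := s)) j \<and> (z(k := s)) j < 1 / 2" for j using insert.prems s by auto
      define F where "F = (\<lambda>m. d x m * of_real (mon S (z(k := s)) m))"
      have "(F has_sum infsum F (\<Lambda> S q)) (\<Lambda> S q)"
        unfolding F_def by (rule has_sum_infsum[OF abs_summable_summable[OF summ[OF z']]])
      then have "((\<lambda>(e, m). F m) has_sum infsum F (\<Lambda> S q)) (SIGMA e:UNIV. \<Lambda> (insert k S) (q(k := e)))"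
        by (rule has_sum_reindex_bij_witness[where i = snd and j = "\<lambda>m. (m k, m)", THEN iffD1, rotated -1])
           (use insert.hyps in \<open>auto simp: \<Lambda>_def\<close>)
      then have "((\<lambda>e. c x e * of_real (s ^ e)) has_sum infsum F (\<Lambda> S q)) UNIV"
      proof (rule has_sum_SigmaD)
        fix e
        have "((\<lambda>m. d x m * of_real (mon (insert k S) z m) * of_real (s ^ e)) has_sum (c x e * of_real (s ^ e)))
            (\<Lambda> (insert k S) (q(k := e)))"
          unfolding c_def
          by (rule has_sum_cmult_left[OF has_sum_infsum[OF abs_summable_summable[OF summ[OF insert.prems]]]])
        then show "((\<lambda>m. case (e, m) of (e, m) \<Rightarrow> F m) has_sum c x e * of_real (s ^ e)) (\<Lambda> (insert k S) (q(k := e)))"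
          by (rule has_sum_cong[THEN iffD1, rotated]) (simp add: F_def mon_insert)
      qed
      then show ?thesis by (simp add: F_def infsumI)
    qed
    have "((\<lambda>x. c x (q k)) \<longlongrightarrow> 0) G"
    proof (rule coefficient_tendsto_zero_nat)
      fix x e
      \<comment> \<open>Prescribing the exponent \<open>e\<close> costs a factor
        \<open>2 ^ e\<close>, just the growth that the one-variable statement allows.\<close>
      have "norm (c x e) \<le> (\<Sum>\<^sub>\<infinity>m\<in>\<Lambda> (insert k S) (q(k := e)). norm (d x m * of_real (mon (insert k S) z m)))"
        unfolding c_def by (rule norm_infsum_bound[OF summ[OF insert.prems]])
      also have "\<dots> \<le> (\<Sum>\<^sub>\<infinity>m\<in>\<Lambda> (insert k S) (q(k := e)). B * (2 ^ mdeg (q(k := e)) * (1 / 2) ^ mdeg m))"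
        by (rule infsum_mono[OF summ[OF insert.prems] dom term_le[OF insert.prems]])
      also have "\<dots> \<le> (\<Sum>\<^sub>\<infinity>m :: 'k \<Rightarrow> nat. B * (2 ^ mdeg (q(k := e)) * (1 / 2) ^ mdeg m))"
        by (rule infsum_mono2[OF dom dom]) (use B in auto)
      also have "\<dots> = (B * 2 ^ mdeg (q(k := e))) * (\<Sum>\<^sub>\<infinity>m :: 'k \<Rightarrow> nat. (1 / 2) ^ mdeg m)"
        by (subst infsum_cmult_right[OF geo, symmetric]) (simp add: mult.assoc)
      also have "\<dots> \<le> (B * 2 ^ (mdeg q + e)) * (\<Sum>\<^sub>\<infinity>m :: 'k \<Rightarrow> nat. (1 / 2) ^ mdeg m)"
      proof (intro mult_right_mono mult_left_mono power_increasing B infsum_nonneg)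
        have "mdeg (q(k := e)) \<le> (\<Sum>j\<in>UNIV. q j + (if j = k then e else 0))"
          unfolding mdeg_def by (intro sum_mono) auto
        then show "mdeg (q(k := e)) \<le> mdeg q + e" by (simp add: sum.distrib mdeg_def)
      qed auto
      finally show "norm (c x e) \<le> (B * 2 ^ mdeg q * (\<Sum>\<^sub>\<infinity>m :: 'k \<Rightarrow> nat. (1 / 2) ^ mdeg m)) * 2 ^ e"
        by (simp add: power_add mult_ac)
    next
      fix s :: real assume s: "0 < s" "s < 1 / 2"
      show "((\<lambda>x. \<Sum>\<^sub>\<infinity>e. c x e * of_real (s ^ e)) \<longlongrightarrow> 0) G"
        unfolding c_sum[OF s] by (rule insert.IH) (use insert.prems s in auto)
    qed
    then show ?case by (simp add: c_def)
  qed
  have "((\<lambda>x. \<Sum>\<^sub>\<infinity>j\<in>\<Lambda> UNIV m. d x j * of_real (mon UNIV (\<lambda>_. 1 / 4) j)) \<longlongrightarrow> 0) G"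
    by (rule main) auto
  moreover have "\<Lambda> UNIV m = {m}" by (auto simp: \<Lambda>_def)
  ultimately show ?thesis by (simp add: mon_def)
qed

section \<open>The transformation and its energy shift\<close>

lemma asum_sum:
  assumes "\<And>i. i \<in> I \<Longrightarrow> asum \<rho> (f i)" "\<rho> \<ge> 0"
  shows "asum \<rho> (\<Sum>i\<in>I. f i)"
  using assms by (induction I rule: infinite_finite_induct) (auto intro: asum_zero asum_add)

lemma ev_sum:
  assumes "\<And>i. i \<in> I \<Longrightarrow> asum \<rho> (f i)" "max_norm z \<le> \<rho>"
  shows "ev (\<Sum>i\<in>I. f i) z = (\<Sum>i\<in>I. ev (f i) z)"
proof -
  have "\<rho> \<ge> 0" using max_norm_nonneg assms(2) by (rule order_trans)
  then show ?thesis
    using assms by (induction I rule: infinite_finite_induct) (auto simp: ev_add[of \<rho>] asum_sum)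
qed

lemma norm_mcoeff_le_mnorm:
  assumes "asum \<rho> a"
  shows "norm (mcoeff a p) * \<rho> ^ mdeg p \<le> mnorm \<rho> a"
proof -
  have "sum (\<lambda>p. norm (mcoeff a p) * \<rho> ^ mdeg p) {p} \<le> mnorm \<rho> a"
    unfolding mnorm_def using assms by (intro finite_sum_le_infsum) (auto simp: asum_def)
  then show ?thesis by simp
qed

text \<open>The difference telescopes over the factors of the monomial; multiplying by
  \<open>\<rho>\<close> avoids the exponent \<open>mdeg p - 1\<close>.\<close>

lemma mult_norm_mpow_diff_le:
  assumes "max_norm z \<le> \<rho>" "max_norm z' \<le> \<rho>"
  shows "\<rho> * norm (mpow z p - mpow z' p) \<le> real (mdeg p) * \<rho> ^ mdeg p * max_norm (z - z')"
proof -
  have \<rho>: "\<rho> \<ge> 0" using max_norm_nonneg assms(1) by (rule order_trans)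
  define P where "P p \<longleftrightarrow> \<rho> * norm (mpow z p - mpow z' p) \<le> real (mdeg p) * \<rho> ^ mdeg p * max_norm (z - z')" for p
  have "P p"
  proof (rule multi_index_induct[of P p])
    show "P 0" by (simp add: P_def)
    fix p k assume IH: "P p"
    have "mpow z p * z $ k - mpow z' p * z' $ k = (mpow z p - mpow z' p) * z $ k + mpow z' p * (z - z') $ k"
      by (simp add: algebra_simps)
    then have "norm (mpow z p * z $ k - mpow z' p * z' $ k) \<le> norm (mpow z p - mpow z' p) * norm (z $ k) + norm (mpow z' p) * norm ((z - z') $ k)"
      by (metis norm_mult norm_triangle_ineq)
    then have "\<rho> * norm (mpow z p * z $ k - mpow z' p * z' $ k) \<le>
        (\<rho> * norm (mpow z p - mpow z' p)) * norm (z $ k) + \<rho> * (norm (mpow z' p) * norm ((z - z') $ k))"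
      using \<rho> by (metis distrib_left mult.assoc mult_left_mono)
    also have "\<dots> \<le> (real (mdeg p) * \<rho> ^ mdeg p * max_norm (z - z')) * \<rho> + \<rho> * (\<rho> ^ mdeg p * max_norm (z - z'))"
    proof (rule add_mono)
      show "(\<rho> * norm (mpow z p - mpow z' p)) * norm (z $ k) \<le> (real (mdeg p) * \<rho> ^ mdeg p * max_norm (z - z')) * \<rho>"
        using IH \<rho> assms(1) max_norm_nonneg[of "z - z'"] by (intro mult_mono[OF IH[unfolded P_def]]) (auto simp: max_norm_le_iff)
      show "\<rho> * (norm (mpow z' p) * norm ((z - z') $ k)) \<le> \<rho> * (\<rho> ^ mdeg p * max_norm (z - z'))"
        using \<rho> norm_nth_le_max_norm[of "z - z'" k] by (intro mult_left_mono mult_mono norm_mpow_le assms(2)) auto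
    qed
    also have "\<dots> = real (mdeg (p + unit_index k)) * \<rho> ^ mdeg (p + unit_index k) * max_norm (z - z')"
      unfolding mdeg_add mdeg_unit by (simp add: algebra_simps)
    finally show "P (p + unit_index k)" unfolding P_def mpow_add_index mpow_unit_index .
  qed
  then show ?thesis by (simp add: P_def)
qed

lemma power_mdeg_ge2_le:
  assumes "0 \<le> y" "y \<le> (1 / 2 :: real)" "2 \<le> n"
  shows "y ^ n \<le> 4 * y ^ 2 * (1 / 2) ^ n"
proof -
  obtain d where d: "n = d + 2" using assms(3) by (metis add.commute le_Suc_ex)
  have "y ^ 2 * y ^ d \<le> y ^ 2 * (1 / 2) ^ d"
    using assms by (intro mult_left_mono power_mono) auto
  then show ?thesis by (simp add: d power_add power2_eq_square mult_ac)
qed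

lemma has_derivative_vec_lambda:
  fixes f :: "'k::finite \<Rightarrow> 'a::real_normed_vector \<Rightarrow> complex"
  assumes "\<And>i. (f i has_derivative f' i) (at x within S)"
  shows "((\<lambda>x. \<chi> i. f i x) has_derivative (\<lambda>h. \<chi> i. f' i h)) (at x within S)"
proof -
  have eq: "(\<chi> i. g i) = (\<Sum>i\<in>UNIV. axis i (g i))" for g :: "'k \<Rightarrow> complex"
  proof -
    have "(\<Sum>i\<in>UNIV. axis i (g i)) $ j = g j" for j
    proof -
      have "(\<Sum>i\<in>UNIV. axis i (g i)) $ j = (\<Sum>i\<in>UNIV. if i = j then g i else 0)"
        unfolding sum_component by (rule sum.cong) (auto simp: axis_def)
      then show ?thesis by simp
    qed
    then show ?thesis by (simp add: vec_eq_iff)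
  qed
  have lin: "bounded_linear (axis i :: complex \<Rightarrow> complex ^ 'k)" for i
    unfolding linear_conv_bounded_linear[symmetric] by (rule linearI) (auto simp: axis_def vec_eq_iff)
  show ?thesis
    unfolding eq by (intro has_derivative_sum bounded_linear.has_derivative[OF lin] assms)
qed

text \<open>Adds analytic data of the Hamiltonian itself, which enters the energy shift: size, value
  0 at the origin, and differentiability in time at each point.\<close>

locale hamiltonian_flow = hamiltonian_system wt D N T \<nu> F a A r cj sg f \<kappa>
  for wt :: "'k::finite \<Rightarrow> nat" and D N T \<nu> F a A r cj sg f \<kappa> +
  fixes Af :: real
  assumes f_bound: "t \<ge> 0 \<Longrightarrow> norm (mcoeff (f t) m) \<le> Af / r ^ mdeg m"
    and f_cont: "continuous_on {0..} (\<lambda>t. mcoeff (f t) m)"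
    and f_zero: "t \<ge> 0 \<Longrightarrow> mcoeff (f t) 0 = 0"
    and f_diff: "t \<ge> 0 \<Longrightarrow> max_norm z < r \<Longrightarrow> \<exists>f'. ((\<lambda>t. ev (f t) z) has_vector_derivative f') (at t within {0..})"
begin

text \<open>The quadratic part of the Hamiltonian. Each conjugate pair occurs twice with the same
  coefficient, hence the factor 1/2.\<close>

definition hquad :: "complex ^ 'k \<Rightarrow> complex" where
  "hquad z = (1 / 2) * (\<Sum>j\<in>UNIV. sg j * \<nu> j * (z $ j * z $ cj j))"

lemma bij_cj: "bij cj"
  by (rule o_bij[of cj]) (auto simp: cj_cj fun_eq_iff)

lemma sum_cj: "(\<Sum>i\<in>UNIV. g (cj i)) = (\<Sum>i\<in>UNIV. g i)"
  by (rule sum.reindex_bij_betw[OF bij_cj])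

lemma sg_\<nu>_cj: "sg (cj j) * \<nu> (cj j) = sg j * \<nu> j"
  by (simp add: sg_cj \<nu>_cj)

lemma norm_sg: "norm (sg i) = 1"
proof -
  have "norm (sg i) * norm (sg i) = 1" by (metis norm_mult norm_one sg_square)
  then show ?thesis by (metis abs_norm_cancel power2_eq_square power2_eq_1_iff abs_1 abs_minus_cancel)
qed

lemma norm_hquad_le:
  assumes "max_norm z \<le> \<rho>"
  shows "norm (hquad z) \<le> (\<Sum>j\<in>UNIV. norm (\<nu> j)) * \<rho> ^ 2"
proof -
  have "norm (\<Sum>j\<in>UNIV. sg j * \<nu> j * (z $ j * z $ cj j)) \<le> (\<Sum>j\<in>UNIV. norm (\<nu> j) * (\<rho> * \<rho>))"
    using assms by (intro sum_norm_le) (auto simp: norm_mult norm_sg max_norm_le_iff intro!: mult_left_mono mult_mono')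
  then have "norm (\<Sum>j\<in>UNIV. sg j * \<nu> j * (z $ j * z $ cj j)) \<le> (\<Sum>j\<in>UNIV. norm (\<nu> j)) * \<rho> ^ 2"
    by (simp only: sum_distrib_right power2_eq_square)
  moreover have "norm (hquad z) \<le> norm (\<Sum>j\<in>UNIV. sg j * \<nu> j * (z $ j * z $ cj j))"
    by (simp add: hquad_def norm_mult)
  ultimately show ?thesis by (rule order_trans[rotated])
qed

context
  fixes u B s
  assumes u: "normalizing u B s"
begin

abbreviation \<Psi> :: "real \<Rightarrow> 'k \<Rightarrow> ('k, complex) mps" where
  "\<Psi> t \<equiv> near_identity (\<lambda>k q. u k q t)"

definition \<phi> :: "complex ^ 'k \<Rightarrow> real \<Rightarrow> complex ^ 'k" where
  "\<phi> z t = (\<chi> i. ev (\<Psi> t i) z)"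

definition energy_shift :: "complex ^ 'k \<Rightarrow> real \<Rightarrow> complex" where
  "energy_shift z t = hquad z - hquad (\<phi> z t) - ev (f t) (\<phi> z t)"

lemma s_pos: "s > 0" and B_nonneg: "B \<ge> 0"
  using u by (simp_all add: normalizing_def)

lemma u_bound: "t \<ge> 0 \<Longrightarrow> norm (u i p t) \<le> B / s ^ mdeg p"
  using u by (simp add: normalizing_def)

lemma \<Psi>_bound: "t \<ge> 0 \<Longrightarrow> norm (mcoeff (\<Psi> t i) p) \<le> (B + s) / s ^ mdeg p"
proof -
  assume t: "t \<ge> 0"
  show ?thesis
  proof (cases "2 \<le> mdeg p")
    case True
    have "B / s ^ mdeg p \<le> (B + s) / s ^ mdeg p" using s_pos by (intro divide_right_mono) auto
    then show ?thesis using True u_bound[OF t, of i p] by (simp add: mcoeff_near_identity)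
  next
    case False
    then show ?thesis using s_pos B_nonneg by (auto simp: mcoeff_near_identity le_divide_eq)
  qed
qed

lemma \<Psi>_cont: "continuous_on {0..} (\<lambda>t. mcoeff (\<Psi> t i) p)"
proof (cases "2 \<le> mdeg p")
  case True
  have "continuous_on {0..} (u i p)"
    unfolding continuous_on_eq_continuous_within
    using u has_vector_derivative_continuous unfolding normalizing_def by fastforce
  then show ?thesis using True by (simp add: mcoeff_near_identity)
qed (simp add: mcoeff_near_identity)

text \<open>\<open>\<sigma>\<close> is the radius on which the map is used. The third condition
  makes the nonlinear part a contraction by 1/2; the others keep points and their images, of size at
  most \<open>2 * \<sigma> \<le> r / 2\<close>, inside the domains of convergence.\<close>

context
  fixes \<sigma> :: real
  assumes \<sigma>: "0 < \<sigma>" "\<sigma> \<le> s / 8" "8 * (4 * 2 ^ CARD('k) * B / s ^ 2 * \<sigma>) \<le> 1" "4 * \<sigma> \<le> r" "\<sigma> \<le> 1"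
begin

lemma asum_\<Psi>: "t \<ge> 0 \<Longrightarrow> \<rho> \<ge> 0 \<Longrightarrow> \<rho> < s \<Longrightarrow> asum \<rho> (\<Psi> t i)"
  by (rule asum_geometric(1)[OF \<Psi>_bound]) auto

lemma geo_sum: "((\<lambda>p :: 'k \<Rightarrow> nat. c * (1 / 2) ^ mdeg p) has_sum (c * (\<Sum>\<^sub>\<infinity>p :: 'k \<Rightarrow> nat. (1 / 2) ^ mdeg p))) UNIV" for c :: real
  by (intro has_sum_cmult_right has_sum_infsum summable_power_mdeg) auto

lemma geo_sum_le: "c \<ge> 0 \<Longrightarrow> c * (\<Sum>\<^sub>\<infinity>p :: 'k \<Rightarrow> nat. (1 / 2) ^ mdeg p) \<le> c * 2 ^ CARD('k)" for c :: real
  using summable_power_mdeg(2)[of "1 / 2", where 'k = 'k] by (intro mult_left_mono) auto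

text \<open>The linear part contributes \<open>\<sigma>\<close>; the rest is of order
  \<open>\<sigma> ^ 2\<close> and at most \<open>\<sigma>\<close> by the smallness
  condition.\<close>

lemma mnorm_\<Psi>: "t \<ge> 0 \<Longrightarrow> mnorm \<sigma> (\<Psi> t i) \<le> 2 * \<sigma>"
proof -
  assume t: "t \<ge> 0"
  define y where "y = \<sigma> / s"
  have y: "0 \<le> y" "y \<le> 1 / 2" using \<sigma> s_pos by (auto simp: y_def divide_le_eq)
  have asum: "asum \<sigma> (\<Psi> t i)" using \<sigma> s_pos by (intro asum_\<Psi> t) auto
  have one: "((\<lambda>p. if p = unit_index i then \<sigma> else 0) has_sum \<sigma>) UNIV"
    by (rule has_sum_finite_neutralI[of "{unit_index i}"]) auto
  have le: "norm (mcoeff (\<Psi> t i) p) * \<sigma> ^ mdeg p \<le> (if p = unit_index i then \<sigma> else 0) + (4 * y ^ 2 * B) * (1 / 2) ^ mdeg p" for p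
  proof (cases "2 \<le> mdeg p")
    case True
    then have "p \<noteq> unit_index i" by auto
    have "norm (u i p t) * \<sigma> ^ mdeg p \<le> B / s ^ mdeg p * \<sigma> ^ mdeg p"
      using u_bound[OF t] \<sigma> by (intro mult_right_mono) auto
    also have "\<dots> = B * y ^ mdeg p" by (simp add: y_def power_divide)
    also have "\<dots> \<le> B * (4 * y ^ 2 * (1 / 2) ^ mdeg p)"
      using B_nonneg by (intro mult_left_mono power_mdeg_ge2_le y True)
    finally show ?thesis using True \<open>p \<noteq> unit_index i\<close> by (simp add: mcoeff_near_identity mult_ac)
  next
    case False
    then show ?thesis using B_nonneg \<sigma> by (auto simp: mcoeff_near_identity)
  qed
  have "mnorm \<sigma> (\<Psi> t i) \<le> \<sigma> + (4 * y ^ 2 * B) * (\<Sum>\<^sub>\<infinity>p :: 'k \<Rightarrow> nat. (1 / 2) ^ mdeg p)"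
    unfolding mnorm_def
    by (rule has_sum_mono[OF has_sum_infsum has_sum_add[OF one geo_sum]]) (use asum le in \<open>auto simp: asum_def\<close>)
  also have "\<dots> \<le> \<sigma> + (4 * y ^ 2 * B) * 2 ^ CARD('k)"
    using B_nonneg by (intro add_left_mono geo_sum_le) auto
  also have "(4 * y ^ 2 * B) * 2 ^ CARD('k) = (4 * 2 ^ CARD('k) * B / s ^ 2 * \<sigma>) * \<sigma>"
    by (simp add: y_def power2_eq_square)
  also have "\<dots> \<le> 1 * \<sigma>" using \<sigma>(1,3) by (intro mult_right_mono) auto
  finally show ?thesis by simp
qed

lemma max_norm_\<phi>: "t \<ge> 0 \<Longrightarrow> max_norm z \<le> \<sigma> \<Longrightarrow> max_norm (\<phi> z t) \<le> 2 * \<sigma>"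
  unfolding max_norm_le_iff[of "\<phi> z t"]
proof
  fix i assume t: "t \<ge> 0" and z: "max_norm z \<le> \<sigma>"
  have "asum \<sigma> (\<Psi> t i)" using \<sigma> s_pos by (intro asum_\<Psi> t) auto
  then show "norm (\<phi> z t $ i) \<le> 2 * \<sigma>"
    using norm_ev_le[OF _ z, of "\<Psi> t i"] mnorm_\<Psi>[OF t, of i] by (simp add: \<phi>_def)
qed

text \<open>The nonlinear part has Lipschitz constant 1/2 in the maximum norm, so the distance of
  two points with the same image is at most half of itself.\<close>

lemma \<phi>_inj:
  assumes t: "t \<ge> 0" and z: "max_norm z \<le> \<sigma>" "max_norm z' \<le> \<sigma>" and eq: "\<phi> z t = \<phi> z' t"
  shows "z = z'"
proof -
  define \<delta> where "\<delta> = max_norm (z - z')"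
  have \<delta>: "\<delta> \<ge> 0" by (simp add: \<delta>_def max_norm_nonneg)
  \<comment> \<open>The 2 absorbs the degree that appears in the differences of monomials, by
    \<open>mdeg p \<le> 2 ^ mdeg p\<close>.\<close>
  define y where "y = 2 * \<sigma> / s"
  have y: "0 \<le> y" "y \<le> 1 / 2" using \<sigma> s_pos by (auto simp: y_def divide_le_eq)
  have comp: "norm ((z - z') $ i) \<le> \<delta> / 2" for i
  proof -
    have asum: "asum \<sigma> (\<Psi> t i)" using \<sigma> s_pos by (intro asum_\<Psi> t) auto
    have "((\<lambda>p. mcoeff (\<Psi> t i) p * mpow z p + - (mcoeff (\<Psi> t i) p * mpow z' p)) has_sum (ev (\<Psi> t i) z + - ev (\<Psi> t i) z')) UNIV"
      by (intro has_sum_add ev_has_sum[OF asum] z) (simp add: has_sum_uminus ev_has_sum[OF asum] z)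
    moreover have "ev (\<Psi> t i) z = ev (\<Psi> t i) z'" using eq by (simp add: \<phi>_def vec_eq_iff)
    ultimately have "((\<lambda>p. mcoeff (\<Psi> t i) p * (mpow z p - mpow z' p)) has_sum 0) UNIV"
      by (simp add: algebra_simps)
    then have diff: "((\<lambda>p. if p \<in> {unit_index i} then 0 else mcoeff (\<Psi> t i) p * (mpow z p - mpow z' p)) has_sum
        (0 - (z - z') $ i)) UNIV"
      by (drule_tac has_sum_remove_finite[where P = "{unit_index i}"]) (simp_all add: mcoeff_near_identity)
    have le: "norm (if p \<in> {unit_index i} then 0 else mcoeff (\<Psi> t i) p * (mpow z p - mpow z' p))
        \<le> (4 * y ^ 2 * B * \<delta> / \<sigma>) * (1 / 2) ^ mdeg p" for p
    proof (cases "2 \<le> mdeg p")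
      case True
      then have "p \<noteq> unit_index i" by auto
      have m: "real (mdeg p) \<le> 2 ^ mdeg p" using less_exp[of "mdeg p"] by (metis less_imp_le of_nat_le_numeral_power_cancel_iff of_nat_numeral of_nat_power of_nat_le_iff)
      have "norm (mpow z p - mpow z' p) \<le> real (mdeg p) * \<sigma> ^ mdeg p * \<delta> / \<sigma>"
        using mult_norm_mpow_diff_le[OF z, of p] \<sigma>(1) by (simp add: \<delta>_def le_divide_eq mult.commute)
      also have "\<dots> \<le> 2 ^ mdeg p * \<sigma> ^ mdeg p * \<delta> / \<sigma>"
        using m \<sigma>(1) \<delta> by (intro divide_right_mono mult_right_mono) auto
      finally have d: "norm (mpow z p - mpow z' p) \<le> 2 ^ mdeg p * \<sigma> ^ mdeg p * \<delta> / \<sigma>" .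
      have "norm (mcoeff (\<Psi> t i) p * (mpow z p - mpow z' p)) \<le> B / s ^ mdeg p * (2 ^ mdeg p * \<sigma> ^ mdeg p * \<delta> / \<sigma>)"
        unfolding norm_mult using True u_bound[OF t, of i p] d B_nonneg s_pos
        by (intro mult_mono) (auto simp: mcoeff_near_identity)
      also have "\<dots> = (B * \<delta> / \<sigma>) * y ^ mdeg p" by (simp add: y_def power_divide power_mult_distrib mult_ac)
      also have "\<dots> \<le> (B * \<delta> / \<sigma>) * (4 * y ^ 2 * (1 / 2) ^ mdeg p)"
        using B_nonneg \<delta> \<sigma>(1) by (intro mult_left_mono power_mdeg_ge2_le y True) auto
      finally show ?thesis using \<open>p \<noteq> unit_index i\<close> by (simp add: mult_ac)
    next
      case False
      then show ?thesis using B_nonneg \<delta> \<sigma>(1) by (auto simp: mcoeff_near_identity)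
    qed
    have "norm (0 - (z - z') $ i) \<le> (4 * y ^ 2 * B * \<delta> / \<sigma>) * (\<Sum>\<^sub>\<infinity>p :: 'k \<Rightarrow> nat. (1 / 2) ^ mdeg p)"
      by (rule norm_infsum_le[OF diff geo_sum]) (rule le)
    also have "\<dots> \<le> (4 * y ^ 2 * B * \<delta> / \<sigma>) * 2 ^ CARD('k)"
      using B_nonneg \<delta> \<sigma>(1) by (intro geo_sum_le) auto
    also have "\<dots> = (4 * (4 * 2 ^ CARD('k) * B / s ^ 2 * \<sigma>)) * \<delta>"
      using \<sigma>(1) by (simp add: y_def power2_eq_square field_simps)
    also have "\<dots> \<le> (1 / 2) * \<delta>" using \<sigma>(3) \<delta> by (intro mult_right_mono) auto
    finally show ?thesis by (simp add: norm_minus_commute)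
  qed
  then have "\<delta> \<le> \<delta> / 2" unfolding \<delta>_def by (subst max_norm_le_iff) (simp add: \<delta>_def)
  then have "max_norm (z - z') \<le> 0" using \<delta> by (simp add: \<delta>_def)
  then show ?thesis by (auto simp: max_norm_le_iff vec_eq_iff)
qed

lemma asum_f: "t \<ge> 0 \<Longrightarrow> asum (2 * \<sigma>) (f t)"
  using \<sigma> by (intro asum_geometric(1)[OF f_bound]) auto

lemma asum_F: "t \<ge> 0 \<Longrightarrow> asum (2 * \<sigma>) (F i t)" "t \<ge> 0 \<Longrightarrow> mnorm (2 * \<sigma>) (F i t) \<le> A * (1 / (1 - 2 * \<sigma> / r)) ^ CARD('k)"
proof -
  assume t: "t \<ge> 0"
  have "norm (mcoeff (F i t) m) \<le> A / r ^ mdeg m" for m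
  proof -
    have "A * exp (- a * t) \<le> A * 1" using a_nonneg t A_nonneg by (intro mult_left_mono) auto
    then have "A * exp (- a * t) / r ^ mdeg m \<le> A / r ^ mdeg m" using r_pos by (intro divide_right_mono) auto
    then show ?thesis using F_bound[OF t, of i m] by linarith
  qed
  note b = this
  show "asum (2 * \<sigma>) (F i t)" "mnorm (2 * \<sigma>) (F i t) \<le> A * (1 / (1 - 2 * \<sigma> / r)) ^ CARD('k)"
    using \<sigma> by (intro asum_geometric[OF b]; auto)+
qed

lemma comp_\<Psi>:
  assumes "t \<ge> 0" "asum (2 * \<sigma>) G"
  shows "asum \<sigma> (mcomp G (\<Psi> t))" "mnorm \<sigma> (mcomp G (\<Psi> t)) \<le> mnorm (2 * \<sigma>) G"
    "max_norm z \<le> \<sigma> \<Longrightarrow> ev (mcomp G (\<Psi> t)) z = ev G (\<phi> z t)"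
  unfolding \<phi>_def
  using asum_mcomp[OF assms(2) asum_\<Psi>[OF assms(1)] mnorm_\<Psi>[OF assms(1)]] \<sigma> s_pos by auto

text \<open>The energy shift as a convergent series in the phase variables, from which its
  analyticity is read off.\<close>

definition energy_series :: "real \<Rightarrow> ('k, complex) mps" where
  "energy_series t = mconst (1 / 2) * (\<Sum>j\<in>UNIV. mconst (sg j * \<nu> j) * (mvar j * mvar (cj j) - \<Psi> t j * \<Psi> t (cj j)))
     - mcomp (f t) (\<Psi> t)"

lemma energy_series:
  assumes t: "t \<ge> 0"
  shows "asum \<sigma> (energy_series t)" "max_norm z \<le> \<sigma> \<Longrightarrow> ev (energy_series t) z = energy_shift z t"
proof -
  have S: "asum \<sigma> (\<Psi> t j)" for j using \<sigma> s_pos by (intro asum_\<Psi> t) auto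
  have V: "asum \<sigma> (mvar j)" for j using \<sigma> by (intro asum_mvar) auto
  have T: "asum \<sigma> (mconst (sg j * \<nu> j) * (mvar j * mvar (cj j) - \<Psi> t j * \<Psi> t (cj j)))" for j
    by (intro asum_mconst_mult asum_diff asum_mult(1) S V)
  have Sum: "asum \<sigma> (\<Sum>j\<in>UNIV. mconst (sg j * \<nu> j) * (mvar j * mvar (cj j) - \<Psi> t j * \<Psi> t (cj j)))"
    using \<sigma> by (intro asum_sum T) auto
  show "asum \<sigma> (energy_series t)"
    unfolding energy_series_def by (intro asum_diff asum_mconst_mult Sum comp_\<Psi>(1)[OF t asum_f[OF t]])
  assume z: "max_norm z \<le> \<sigma>"
  have "ev (mconst (sg j * \<nu> j) * (mvar j * mvar (cj j) - \<Psi> t j * \<Psi> t (cj j))) z =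
      sg j * \<nu> j * (z $ j * z $ cj j - \<phi> z t $ j * \<phi> z t $ cj j)" for j
    by (simp add: ev_mconst_mult ev_diff[OF asum_mult(1)[OF V V] asum_mult(1)[OF S S] z] ev_mult[OF V V z] ev_mult[OF S S z] \<phi>_def)
  then have "ev (energy_series t) z =
      (1 / 2) * (\<Sum>j\<in>UNIV. sg j * \<nu> j * (z $ j * z $ cj j - \<phi> z t $ j * \<phi> z t $ cj j)) - ev (f t) (\<phi> z t)"
    unfolding energy_series_def ev_diff[OF asum_mconst_mult[OF Sum] comp_\<Psi>(1)[OF t asum_f[OF t]] z] ev_mconst_mult[of "1 / 2"]
      ev_sum[OF T z] comp_\<Psi>(3)[OF t asum_f[OF t] z] by simp
  then show "ev (energy_series t) z = energy_shift z t"
    by (simp add: energy_shift_def hquad_def right_diff_distrib sum_subtractf)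
qed

text \<open>The linear rate in \<open>\<sigma>\<close> keeps the image of a thin strip in
  \<open>\<eta>\<close> inside a given one. The 5 is 1 + 4, from the radii \<open>\<sigma>\<close>
  and \<open>2 * \<sigma>\<close> in the two quadratic terms, with
  \<open>\<sigma> ^ 2 \<le> \<sigma>\<close>; the term of \<open>f\<close> is small because
  \<open>f\<close> has no constant coefficient.\<close>

lemma norm_energy_shift_le:
  assumes t: "t \<ge> 0" and z: "max_norm z \<le> \<sigma>"
  shows "norm (energy_shift z t) \<le> (5 * (\<Sum>j\<in>UNIV. norm (\<nu> j)) + 4 * \<bar>Af\<bar> / r * 2 ^ CARD('k)) * \<sigma>"
proof -
  define n where "n = (\<Sum>j\<in>UNIV. norm (\<nu> j))"
  have n: "n \<ge> 0" by (simp add: n_def sum_nonneg)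
  have w: "max_norm (\<phi> z t) \<le> 2 * \<sigma>" by (rule max_norm_\<phi>[OF t z])
  have "norm (hquad z) \<le> n * \<sigma> ^ 2" "norm (hquad (\<phi> z t)) \<le> n * (2 * \<sigma>) ^ 2"
    unfolding n_def by (rule norm_hquad_le[OF z], rule norm_hquad_le[OF w])
  moreover have "n * \<sigma> ^ 2 + n * (2 * \<sigma>) ^ 2 \<le> 5 * n * \<sigma>"
  proof -
    have "\<sigma> * \<sigma> \<le> \<sigma> * 1" using \<sigma> by (intro mult_left_mono) auto
    then have "n * (\<sigma> * \<sigma>) \<le> n * \<sigma>" using n by (intro mult_left_mono) auto
    moreover have "n * \<sigma> ^ 2 + n * (2 * \<sigma>) ^ 2 = 5 * (n * (\<sigma> * \<sigma>))" by (simp add: power2_eq_square)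
    ultimately show ?thesis by linarith
  qed
  moreover have "norm (ev (f t) (\<phi> z t)) \<le> 4 * \<bar>Af\<bar> / r * 2 ^ CARD('k) * \<sigma>"
  proof -
    define y where "y = 2 * \<sigma> / r"
    have y: "0 \<le> y" "y \<le> 1 / 2" using \<sigma> r_pos by (auto simp: y_def divide_le_eq)
    have "norm (mcoeff (f t) m * mpow (\<phi> z t) m) \<le> (2 * y * \<bar>Af\<bar>) * (1 / 2) ^ mdeg m" for m
    proof (cases "mdeg m = 0")
      case True
      then have "m = 0" by (simp only: mdeg_eq_0_iff)
      then show ?thesis using f_zero[OF t] y by simp
    next
      case False
      then obtain d where d: "mdeg m = Suc d" by (metis not0_implies_Suc)
      have "norm (mcoeff (f t) m * mpow (\<phi> z t) m) \<le> \<bar>Af\<bar> / r ^ mdeg m * (2 * \<sigma>) ^ mdeg m"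
        unfolding norm_mult using r_pos \<sigma>
        by (intro mult_mono norm_mpow_le w order_trans[OF f_bound[OF t]] divide_right_mono) auto
      also have "\<dots> = \<bar>Af\<bar> * (y * y ^ d)" by (simp add: y_def d power_divide)
      also have "\<dots> \<le> \<bar>Af\<bar> * (y * (1 / 2) ^ d)" using y by (intro mult_left_mono power_mono) auto
      finally show ?thesis by (simp add: d mult_ac)
    qed
    then have "norm (ev (f t) (\<phi> z t)) \<le> (2 * y * \<bar>Af\<bar>) * (\<Sum>\<^sub>\<infinity>p :: 'k \<Rightarrow> nat. (1 / 2) ^ mdeg p)"
      by (intro norm_infsum_le[OF ev_has_sum[OF asum_f[OF t] w] geo_sum])
    also have "\<dots> \<le> (2 * y * \<bar>Af\<bar>) * 2 ^ CARD('k)" using y by (intro geo_sum_le) auto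
    finally show ?thesis by (simp add: y_def mult_ac)
  qed
  moreover have "norm (energy_shift z t) \<le> norm (hquad z) + norm (hquad (\<phi> z t)) + norm (ev (f t) (\<phi> z t))"
    unfolding energy_shift_def by (meson add_right_mono norm_triangle_ineq4 order_trans)
  ultimately show ?thesis by (simp add: n_def[symmetric] distrib_right)
qed

section \<open>Derivatives of the map and the symplectic identities\<close>

text \<open>Term-by-term differentiation of the series equation. The coefficients of the derivative
  are bounded by \<open>Q / \<sigma> ^ mdeg p\<close>, summable at points strictly inside radius
  \<open>\<sigma>\<close>.\<close>

lemma \<phi>_time_derivative:
  assumes t: "t \<ge> 0" and z: "max_norm z < \<sigma>"
  shows "((\<lambda>t. ev (\<Psi> t i) z) has_vector_derivative
     ev (F i t) (\<phi> z t) - (\<Sum>k\<in>UNIV. \<nu> k * (z $ k * ev (mderiv k (\<Psi> t i)) z)) + \<nu> i * ev (\<Psi> t i) z) (at t within {0..})"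
proof -
  define h' where "h' t = mcomp (F i t) (\<Psi> t) - weighted_euler \<nu> (\<Psi> t i) + mconst (\<nu> i) * \<Psi> t i" for t
  define MF where "MF = A * (1 / (1 - 2 * \<sigma> / r)) ^ CARD('k)"
  define n where "n = (\<Sum>j\<in>UNIV. norm (\<nu> j))"
  define Q where "Q = MF + 2 * n * (B + s)"
  have n: "n \<ge> 0" by (simp add: n_def sum_nonneg)
  have \<nu>n: "norm (\<nu> j) \<le> n" for j unfolding n_def by (rule member_le_sum) auto
  have Bs: "B + s \<ge> 0" using B_nonneg s_pos by simp
  define \<rho> where "\<rho> = max_norm z"
  have \<rho>: "0 \<le> \<rho>" "\<rho> < \<sigma>" using z by (auto simp: \<rho>_def max_norm_nonneg)
  have "((\<lambda>t. ev (\<Psi> t i) z) has_vector_derivative ev (h' t) z) (at t within {0..})"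
  proof (rule ev_time_derivative[where K = "\<lambda>p. Q / \<sigma> ^ mdeg p" and \<rho> = \<rho>])
    show "mps_deriv (\<lambda>t. \<Psi> t i) (h' t) t" if "t \<ge> 0" for t
      unfolding h'_def by (rule normalizing_deriv[OF u that])
    fix t :: real and p assume t: "t \<ge> 0"
    have 1: "norm (mcoeff (mcomp (F i t) (\<Psi> t)) p) \<le> MF / \<sigma> ^ mdeg p"
    proof -
      have "norm (mcoeff (mcomp (F i t) (\<Psi> t)) p) * \<sigma> ^ mdeg p \<le> MF"
        using norm_mcoeff_le_mnorm[OF comp_\<Psi>(1)[OF t asum_F(1)[OF t]], of i p]
          comp_\<Psi>(2)[OF t asum_F(1)[OF t], of i] asum_F(2)[OF t, of i] unfolding MF_def by linarith
      then show ?thesis using \<sigma>(1) by (simp add: le_divide_eq)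
    qed
    \<comment> \<open>The second bound pays for the Euler field: \<open>norm (idot \<nu> p)\<close>
      is at most a multiple of \<open>mdeg p \<le> 2 ^ mdeg p\<close>, and
      \<open>2 * \<sigma> \<le> s\<close>.\<close>
    have pow: "1 / s ^ mdeg p \<le> 1 / \<sigma> ^ mdeg p" "2 ^ mdeg p / s ^ mdeg p \<le> 1 / \<sigma> ^ mdeg p"
    proof -
      have "\<sigma> ^ mdeg p \<le> s ^ mdeg p" "(2 * \<sigma>) ^ mdeg p \<le> s ^ mdeg p" using \<sigma> by (intro power_mono; simp)+
      then show "1 / s ^ mdeg p \<le> 1 / \<sigma> ^ mdeg p" "2 ^ mdeg p / s ^ mdeg p \<le> 1 / \<sigma> ^ mdeg p"
        using \<sigma>(1) s_pos by (simp_all add: field_simps power_mult_distrib)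
    qed
    have C: "norm (mcoeff (\<Psi> t i) p) \<le> (B + s) / s ^ mdeg p" by (rule \<Psi>_bound[OF t])
    have 2: "norm (mcoeff (weighted_euler \<nu> (\<Psi> t i)) p) \<le> n * (B + s) / \<sigma> ^ mdeg p"
    proof -
      have "norm (idot \<nu> p) \<le> (\<Sum>k\<in>UNIV. norm (\<nu> k) * real (mdeg p))"
        unfolding idot_def by (intro sum_norm_le) (auto simp: norm_mult index_le_mdeg intro!: mult_left_mono)
      also have "\<dots> = n * real (mdeg p)" by (simp add: n_def sum_distrib_right)
      also have "\<dots> \<le> n * 2 ^ mdeg p"
        using n less_exp[of "mdeg p"]
        by (intro mult_left_mono) (metis less_imp_le of_nat_le_numeral_power_cancel_iff of_nat_numeral of_nat_power of_nat_le_iff)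
      finally have "norm (idot \<nu> p) \<le> n * 2 ^ mdeg p" .
      then have "norm (mcoeff (weighted_euler \<nu> (\<Psi> t i)) p) \<le> (n * 2 ^ mdeg p) * ((B + s) / s ^ mdeg p)"
        unfolding mcoeff_weighted_euler norm_mult using C n by (intro mult_mono) auto
      also have "\<dots> = (n * (B + s)) * (2 ^ mdeg p / s ^ mdeg p)" by simp
      also have "\<dots> \<le> (n * (B + s)) * (1 / \<sigma> ^ mdeg p)" using n Bs pow by (intro mult_left_mono) auto
      finally show ?thesis by simp
    qed
    have 3: "norm (mcoeff (mconst (\<nu> i) * \<Psi> t i) p) \<le> n * (B + s) / \<sigma> ^ mdeg p"
    proof -
      have "norm (mcoeff (mconst (\<nu> i) * \<Psi> t i) p) \<le> n * ((B + s) / s ^ mdeg p)"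
        unfolding mcoeff_mconst_mult norm_mult using C \<nu>n n by (intro mult_mono) auto
      also have "\<dots> = (n * (B + s)) * (1 / s ^ mdeg p)" by simp
      also have "\<dots> \<le> (n * (B + s)) * (1 / \<sigma> ^ mdeg p)" using n Bs pow by (intro mult_left_mono) auto
      finally show ?thesis by simp
    qed
    have "norm (mcoeff (h' t) p) \<le> norm (mcoeff (mcomp (F i t) (\<Psi> t)) p) + norm (mcoeff (weighted_euler \<nu> (\<Psi> t i)) p)
        + norm (mcoeff (mconst (\<nu> i) * \<Psi> t i) p)"
      unfolding h'_def mcoeff_add mcoeff_minus
      by (rule order_trans[OF norm_triangle_ineq]) (intro add_right_mono norm_triangle_ineq4)
    also have "\<dots> \<le> Q / \<sigma> ^ mdeg p"
    proof -
      have "Q / \<sigma> ^ mdeg p = MF / \<sigma> ^ mdeg p + n * (B + s) / \<sigma> ^ mdeg p + n * (B + s) / \<sigma> ^ mdeg p"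
        unfolding Q_def by (simp add: add_divide_distrib)
      then show ?thesis using 1 2 3 by linarith
    qed
    finally show "norm (mcoeff (h' t) p) \<le> Q / \<sigma> ^ mdeg p" .
  next
    have "(\<lambda>p :: 'k \<Rightarrow> nat. Q * (\<rho> / \<sigma>) ^ mdeg p) summable_on UNIV"
      using \<rho> by (intro summable_on_cmult_right summable_power_mdeg) auto
    then show "(\<lambda>p :: 'k \<Rightarrow> nat. Q / \<sigma> ^ mdeg p * \<rho> ^ mdeg p) summable_on UNIV"
      by (simp add: power_divide)
    show "asum \<rho> (\<Psi> t i)" if "t \<ge> 0" for t using \<rho> \<sigma> s_pos by (intro asum_\<Psi> that) auto
  qed (use t in \<open>auto simp: \<rho>_def\<close>)
  moreover have "ev (h' t) z = ev (F i t) (\<phi> z t) - (\<Sum>k\<in>UNIV. \<nu> k * (z $ k * ev (mderiv k (\<Psi> t i)) z)) + \<nu> i * ev (\<Psi> t i) z"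
  proof -
    have z': "max_norm z \<le> \<sigma>" using z by simp
    have S: "asum \<sigma> (\<Psi> t i)" using \<sigma> s_pos by (intro asum_\<Psi> t) auto
    have V: "asum \<sigma> (mvar k)" for k using \<sigma> by (intro asum_mvar) auto
    have Dk: "asum \<sigma> (mderiv k (\<Psi> t i))" for k
      using \<sigma> s_pos by (intro asum_mderiv[of \<sigma> \<sigma>] asum_\<Psi> t) auto
    have W: "asum \<sigma> (mconst (\<nu> k) * (mvar k * mderiv k (\<Psi> t i)))" for k
      by (intro asum_mconst_mult asum_mult(1) V Dk)
    have WE: "asum \<sigma> (weighted_euler \<nu> (\<Psi> t i))"
      unfolding weighted_euler_eq_sum using \<sigma> by (intro asum_sum W) auto
    have evWE: "ev (weighted_euler \<nu> (\<Psi> t i)) z = (\<Sum>k\<in>UNIV. \<nu> k * (z $ k * ev (mderiv k (\<Psi> t i)) z))"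
      unfolding weighted_euler_eq_sum ev_sum[OF W z'] by (simp add: ev_mconst_mult ev_mult[OF V Dk z'])
    note comp = comp_\<Psi>[OF t asum_F(1)[OF t]]
    show ?thesis
      unfolding h'_def
      by (simp add: ev_add[OF asum_diff[OF comp(1) WE] asum_mconst_mult[OF S] z'] ev_diff[OF comp(1) WE z'] comp(3)[OF z']
          evWE ev_mconst_mult)
  qed
  ultimately show ?thesis by simp
qed

lemma symplectic_jacobian:
  assumes t: "t \<ge> 0" and z: "max_norm z \<le> \<sigma>"
  shows "(\<Sum>i\<in>UNIV. sg i * ((\<Sum>b\<in>UNIV. ev (mderiv b (\<Psi> t i)) z * v $ b) * (\<Sum>d\<in>UNIV. ev (mderiv d (\<Psi> t (cj i))) z * w $ d)))
    = (\<Sum>i\<in>UNIV. sg i * (v $ i * w $ cj i))"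
proof -
  define P where "P b i = ev (mderiv b (\<Psi> t i)) z" for b i
  have Dk: "asum \<sigma> (mderiv k (\<Psi> t i))" for k i
    using \<sigma> s_pos by (intro asum_mderiv[of \<sigma> \<sigma>] asum_\<Psi> t) auto
  have W: "asum \<sigma> (mconst (sg i) * (mderiv b (\<Psi> t i) * mderiv d (\<Psi> t (cj i))))" for b d i
    by (intro asum_mconst_mult asum_mult(1) Dk)
  have bracket: "(\<Sum>i\<in>UNIV. sg i * (P b i * P d (cj i))) = (if d = cj b then sg b else 0)" for b d
  proof -
    have "ev (lagrange_bracket u b d t) z = (\<Sum>i\<in>UNIV. sg i * (P b i * P d (cj i)))"
      unfolding lagrange_bracket_def[OF u] ev_sum[OF W z] by (simp add: ev_mconst_mult ev_mult[OF Dk Dk z] P_def)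
    moreover have "ev (mconst c) z = c" for c
      using ev_mconst_mult[of c 1 z] by simp
    ultimately show ?thesis using lagrange_bracket_eq[OF u t, of b d] by simp
  qed
  have "(\<Sum>i\<in>UNIV. sg i * ((\<Sum>b\<in>UNIV. P b i * v $ b) * (\<Sum>d\<in>UNIV. P d (cj i) * w $ d))) =
      (\<Sum>i\<in>UNIV. \<Sum>b\<in>UNIV. \<Sum>d\<in>UNIV. v $ b * w $ d * (sg i * (P b i * P d (cj i))))"
    unfolding sum_product unfolding sum_distrib_left by (intro sum.cong refl) (simp add: mult_ac)
  also have "\<dots> = (\<Sum>b\<in>UNIV. \<Sum>d\<in>UNIV. \<Sum>i\<in>UNIV. v $ b * w $ d * (sg i * (P b i * P d (cj i))))"
    by (subst sum.swap) (intro sum.cong refl sum.swap)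
  also have "\<dots> = (\<Sum>b\<in>UNIV. \<Sum>d\<in>UNIV. v $ b * w $ d * (if d = cj b then sg b else 0))"
    by (simp add: bracket flip: sum_distrib_left)
  also have "\<dots> = (\<Sum>b\<in>UNIV. sg b * (v $ b * w $ cj b))"
    by (intro sum.cong refl) (simp add: if_distrib[of "\<lambda>x. _ * x"] mult_ac cong: if_cong)
  finally show ?thesis by (simp add: P_def)
qed

lemma hquad_derivative: "(hquad has_derivative (\<lambda>w. \<Sum>j\<in>UNIV. sg j * \<nu> j * (z $ cj j * w $ j))) (at z within S)"
proof -
  have "((\<lambda>z. (1 / 2) * (\<Sum>j\<in>UNIV. sg j * \<nu> j * (z $ j * z $ cj j))) has_derivative
     (\<lambda>w. (1 / 2) * (\<Sum>j\<in>UNIV. sg j * \<nu> j * (z $ j * w $ cj j + w $ j * z $ cj j)))) (at z within S)"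
    by (intro has_derivative_mult_right has_derivative_sum has_derivative_mult
        bounded_linear_imp_has_derivative bounded_linear_vec_nth)
  moreover have "(1 / 2) * (\<Sum>j\<in>UNIV. sg j * \<nu> j * (z $ j * w $ cj j + w $ j * z $ cj j)) =
      (\<Sum>j\<in>UNIV. sg j * \<nu> j * (z $ cj j * w $ j))" for w :: "complex ^ 'k"
  proof -
    have "(\<Sum>j\<in>UNIV. sg j * \<nu> j * (z $ j * w $ cj j)) = (\<Sum>j\<in>UNIV. sg (cj j) * \<nu> (cj j) * (z $ cj (cj j) * w $ cj j))"
      by (simp only: sg_\<nu>_cj cj_cj)
    also have "\<dots> = (\<Sum>j\<in>UNIV. sg j * \<nu> j * (z $ cj j * w $ j))"
      by (rule sum_cj[of "\<lambda>j. sg j * \<nu> j * (z $ cj j * w $ j)"])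
    finally show ?thesis by (simp add: distrib_left sum.distrib mult_ac)
  qed
  ultimately show ?thesis by (simp add: hquad_def[abs_def])
qed

text \<open>\<open>L\<close> is the Jacobian in the phase variables and \<open>c\<close> the time
  derivative of the map. The last identity is what makes the time direction pair correctly with the
  phase directions once \<open>\<eta>\<close> is shifted.\<close>

theorem extended_derivative:
  assumes t: "t \<ge> 0" and z: "max_norm z < \<sigma>"
  shows "\<exists>L c dK K'.
     ((\<lambda>(z, t). \<phi> z t) has_derivative (\<lambda>(w, s). L w + of_real s *s c)) (at (z, t) within UNIV \<times> {0..}) \<and>
     ((\<lambda>(z, t). energy_shift z t) has_derivative (\<lambda>(w, s). dK w + of_real s * K')) (at (z, t) within UNIV \<times> {0..}) \<and>
     (\<forall>v w. (\<Sum>i\<in>UNIV. sg i * (L v $ i * L w $ cj i)) = (\<Sum>i\<in>UNIV. sg i * (v $ i * w $ cj i))) \<and>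
     (\<forall>w. (\<Sum>i\<in>UNIV. sg i * (c $ i * L w $ cj i)) = - dK w)"
proof -
  define X where "X = (UNIV :: (complex ^ 'k) set) \<times> {0::real..}"
  have z': "max_norm z \<le> \<sigma>" using z by simp
  define P where "P b i = ev (mderiv b (\<Psi> t i)) z" for b i
  define L where "L w = (\<chi> i. \<Sum>b\<in>UNIV. P b i * w $ b)" for w :: "complex ^ 'k"
  define c where "c = (\<chi> i. ev (F i t) (\<phi> z t) - (\<Sum>k\<in>UNIV. \<nu> k * (z $ k * P k i)) + \<nu> i * \<phi> z t $ i)"
  have \<phi>i: "((\<lambda>(z, t). ev (\<Psi> t i) z) has_derivative (\<lambda>(w, s). (\<Sum>k\<in>UNIV. ev (mderiv k (\<Psi> t i)) z * w $ k) + of_real s * c $ i))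
      (at (z, t) within X)" for i
    unfolding X_def
  proof (rule ev_joint_derivative[where B = "B + s" and r = s])
    show "((\<lambda>t. ev (\<Psi> t i) z) has_vector_derivative c $ i) (at t within {0..})"
      using \<phi>_time_derivative[OF t z, of i] by (simp add: c_def P_def \<phi>_def)
  qed (use \<Psi>_bound \<Psi>_cont t z \<sigma> s_pos in auto)
  have \<phi>_der: "((\<lambda>x. \<phi> (fst x) (snd x)) has_derivative (\<lambda>h. L (fst h) + of_real (snd h) *s c)) (at (z, t) within X)"
  proof -
    have "((\<lambda>x. \<chi> i. ev (\<Psi> (snd x) i) (fst x)) has_derivative
        (\<lambda>h. \<chi> i. (\<Sum>k\<in>UNIV. P k i * fst h $ k) + of_real (snd h) * c $ i)) (at (z, t) within X)"
      using \<phi>i unfolding case_prod_unfold P_def by (intro has_derivative_vec_lambda) simp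
    moreover have "(\<chi> i. (\<Sum>k\<in>UNIV. P k i * fst h $ k) + of_real (snd h) * c $ i) = L (fst h) + of_real (snd h) *s c"
      for h :: "(complex ^ 'k) \<times> real"
      by (simp add: L_def vec_eq_iff)
    ultimately show ?thesis by (simp add: \<phi>_def)
  qed
  have w: "max_norm (\<phi> z t) < r" using max_norm_\<phi>[OF t z'] \<sigma> by linarith
  \<comment> \<open>The point \<open>\<phi> z t0\<close> stays frozen while time varies; the
    separate name protects it from the bound variable \<open>t\<close>.\<close>
  obtain f' where f': "((\<lambda>t. ev (f t) (\<phi> z t0)) has_vector_derivative f') (at t within {0..})" if "t0 = t" for t0
    using f_diff[OF t w] by blast
  have f_der: "((\<lambda>(z, t). ev (f t) z) has_derivative
      (\<lambda>(w, s). (\<Sum>k\<in>UNIV. ev (mderiv k (f t)) (\<phi> z t) * w $ k) + of_real s * f')) (at (\<phi> z t, t) within X)"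
    unfolding X_def by (rule ev_joint_derivative[OF f_bound f_cont t w f'[OF refl]])
  define g where "g k = ev (mderiv k (f t)) (\<phi> z t)" for k
  have comp_der: "((\<lambda>x. ev (f (snd x)) (\<phi> (fst x) (snd x))) has_derivative
      (\<lambda>h. (\<Sum>k\<in>UNIV. g k * (L (fst h) + of_real (snd h) *s c) $ k) + of_real (snd h) * f')) (at (z, t) within X)"
  proof -
    have "((\<lambda>x. (\<phi> (fst x) (snd x), snd x)) has_derivative (\<lambda>h. (L (fst h) + of_real (snd h) *s c, snd h))) (at (z, t) within X)"
      by (intro has_derivative_Pair \<phi>_der bounded_linear_imp_has_derivative bounded_linear_snd)
    moreover have "((\<lambda>(z, t). ev (f t) z) has_derivative
      (\<lambda>(w, s). (\<Sum>k\<in>UNIV. g k * w $ k) + of_real s * f'))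
      (at (\<phi> (fst (z, t)) (snd (z, t)), snd (z, t)) within (\<lambda>x. (\<phi> (fst x) (snd x), snd x)) ` X)"
      unfolding g_def fst_conv snd_conv by (rule has_derivative_subset[OF f_der]) (auto simp: X_def)
    ultimately have "((\<lambda>x. case (\<phi> (fst x) (snd x), snd x) of (z, t) \<Rightarrow> ev (f t) z) has_derivative
        (\<lambda>h. case (L (fst h) + of_real (snd h) *s c, snd h) of (w, s) \<Rightarrow> (\<Sum>k\<in>UNIV. g k * w $ k) + of_real s * f')) (at (z, t) within X)"
      by (rule has_derivative_in_compose)
    then show ?thesis by (simp only: prod.case)
  qed
  define \<eta> where "\<eta> j = sg j * \<nu> j" for j
  define dK where "dK w = (\<Sum>j\<in>UNIV. \<eta> j * (z $ cj j * w $ j)) - (\<Sum>j\<in>UNIV. \<eta> j * (\<phi> z t $ cj j * L w $ j)) - (\<Sum>k\<in>UNIV. g k * L w $ k)"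
    for w :: "complex ^ 'k"
  define K' where "K' = - (\<Sum>j\<in>UNIV. \<eta> j * (\<phi> z t $ cj j * c $ j)) - (\<Sum>k\<in>UNIV. g k * c $ k) - f'"
  have h1: "((\<lambda>x. hquad (fst x)) has_derivative (\<lambda>h. \<Sum>j\<in>UNIV. \<eta> j * (z $ cj j * fst h $ j))) (at (z, t) within X)"
  proof -
    have "(hquad has_derivative (\<lambda>w. \<Sum>j\<in>UNIV. \<eta> j * (z $ cj j * w $ j))) (at (fst (z, t)) within fst ` X)"
      unfolding fst_conv \<eta>_def by (rule hquad_derivative)
    then show ?thesis
      using has_derivative_in_compose[OF bounded_linear_imp_has_derivative[OF bounded_linear_fst], of hquad _ "(z, t)" X] by blast
  qed
  have h2: "((\<lambda>x. hquad (\<phi> (fst x) (snd x))) has_derivative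
      (\<lambda>h. \<Sum>j\<in>UNIV. \<eta> j * (\<phi> z t $ cj j * (L (fst h) + of_real (snd h) *s c) $ j))) (at (z, t) within X)"
  proof -
    have "(hquad has_derivative (\<lambda>w. \<Sum>j\<in>UNIV. \<eta> j * (\<phi> z t $ cj j * w $ j)))
        (at (\<phi> (fst (z, t)) (snd (z, t))) within (\<lambda>x. \<phi> (fst x) (snd x)) ` X)"
      unfolding fst_conv snd_conv \<eta>_def by (rule hquad_derivative)
    then show ?thesis using has_derivative_in_compose[OF \<phi>_der, of hquad] by blast
  qed
  have "((\<lambda>x. energy_shift (fst x) (snd x)) has_derivative (\<lambda>h. dK (fst h) + of_real (snd h) * K')) (at (z, t) within X)"
  proof -
    have "((\<lambda>x. hquad (fst x) - hquad (\<phi> (fst x) (snd x)) - ev (f (snd x)) (\<phi> (fst x) (snd x))) has_derivative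
      (\<lambda>h. (\<Sum>j\<in>UNIV. \<eta> j * (z $ cj j * fst h $ j)) - (\<Sum>j\<in>UNIV. \<eta> j * (\<phi> z t $ cj j * (L (fst h) + of_real (snd h) *s c) $ j))
        - ((\<Sum>k\<in>UNIV. g k * (L (fst h) + of_real (snd h) *s c) $ k) + of_real (snd h) * f'))) (at (z, t) within X)"
      by (intro has_derivative_diff h1 h2 comp_der)
    moreover have "(\<Sum>j\<in>UNIV. \<eta> j * (z $ cj j * fst h $ j)) - (\<Sum>j\<in>UNIV. \<eta> j * (\<phi> z t $ cj j * (L (fst h) + of_real (snd h) *s c) $ j))
        - ((\<Sum>k\<in>UNIV. g k * (L (fst h) + of_real (snd h) *s c) $ k) + of_real (snd h) * f') = dK (fst h) + of_real (snd h) * K'"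
      for h :: "(complex ^ 'k) \<times> real"
      by (simp add: dK_def K'_def distrib_left sum.distrib right_diff_distrib sum_distrib_left mult_ac)
    ultimately show ?thesis by (simp add: energy_shift_def)
  qed
  moreover have symp: "(\<Sum>i\<in>UNIV. sg i * (L v $ i * L w $ cj i)) = (\<Sum>i\<in>UNIV. sg i * (v $ i * w $ cj i))" for v w
    using symplectic_jacobian[OF t z', of v w] by (simp add: L_def P_def)
  moreover have "(\<Sum>i\<in>UNIV. sg i * (c $ i * L w $ cj i)) = - dK w" for w
  proof -
    \<comment> \<open>The linear field at \<open>z\<close>. The time derivative \<open>c\<close> is
      the full field at the image minus \<open>L \<zeta>\<close>. Paired with \<open>L w\<close>,
      the first part gives the derivative of the Hamiltonian at the image, and symplecticity of
      \<open>L\<close> turns the second into the derivative of \<open>hquad\<close> at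
      \<open>z\<close>.\<close>
    define \<zeta> where "\<zeta> = (\<chi> k. \<nu> k * z $ k)"
    have F_ev: "ev (F i t) (\<phi> z t) = sg i * g (cj i)" for i
      by (simp add: F_eq ev_mconst_mult g_def)
    have c_i: "c $ i = sg i * g (cj i) - L \<zeta> $ i + \<nu> i * \<phi> z t $ i" for i
      by (simp add: c_def F_ev L_def \<zeta>_def mult_ac)
    have "sg i * (c $ i * L w $ cj i) = g (cj i) * L w $ cj i - sg i * (L \<zeta> $ i * L w $ cj i)
        + \<eta> (cj i) * (\<phi> z t $ cj (cj i) * L w $ cj i)" for i
    proof -
      have "sg i * (sg i * x) = x" for x by (simp add: mult.assoc[symmetric] sg_square)
      then show ?thesis by (simp add: c_i \<eta>_def sg_cj \<nu>_cj cj_cj algebra_simps)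
    qed
    then have "(\<Sum>i\<in>UNIV. sg i * (c $ i * L w $ cj i)) = (\<Sum>i\<in>UNIV. g (cj i) * L w $ cj i)
        - (\<Sum>i\<in>UNIV. sg i * (L \<zeta> $ i * L w $ cj i)) + (\<Sum>i\<in>UNIV. \<eta> (cj i) * (\<phi> z t $ cj (cj i) * L w $ cj i))"
      by (simp add: sum.distrib sum_subtractf)
    also have "(\<Sum>i\<in>UNIV. g (cj i) * L w $ cj i) = (\<Sum>k\<in>UNIV. g k * L w $ k)"
      by (rule sum_cj[of "\<lambda>k. g k * L w $ k"])
    also have "(\<Sum>i\<in>UNIV. \<eta> (cj i) * (\<phi> z t $ cj (cj i) * L w $ cj i)) = (\<Sum>j\<in>UNIV. \<eta> j * (\<phi> z t $ cj j * L w $ j))"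
      by (rule sum_cj[of "\<lambda>j. \<eta> j * (\<phi> z t $ cj j * L w $ j)"])
    also have "(\<Sum>i\<in>UNIV. sg i * (L \<zeta> $ i * L w $ cj i)) = (\<Sum>i\<in>UNIV. \<eta> (cj i) * (z $ cj (cj i) * w $ cj i))"
      unfolding symp by (intro sum.cong refl) (simp add: \<zeta>_def \<eta>_def sg_cj \<nu>_cj cj_cj mult_ac)
    also have "\<dots> = (\<Sum>j\<in>UNIV. \<eta> j * (z $ cj j * w $ j))"
      by (rule sum_cj[of "\<lambda>j. \<eta> j * (z $ cj j * w $ j)"])
    finally show ?thesis by (simp add: dK_def)
  qed
  ultimately show ?thesis
    using \<phi>_der unfolding X_def case_prod_unfold by blast
qed

end

end

text \<open>Every requirement is an upper bound on \<open>\<sigma>\<close>. The last two put the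
  image within \<open>R0\<close>: size \<open>2 * \<sigma>\<close> in the phase variables, and the
  shift \<open>Q * \<sigma>\<close> added to the strip in \<open>\<eta>\<close>.\<close>

lemma radius_exists:
  assumes "R0 > 0" "s > 0" "B \<ge> 0" "Q \<ge> 0"
  shows "\<exists>\<sigma>. 0 < \<sigma> \<and> \<sigma> \<le> s / 8 \<and> 8 * (4 * 2 ^ CARD('k) * B / s ^ 2 * \<sigma>) \<le> 1 \<and> 4 * \<sigma> \<le> r \<and> \<sigma> \<le> 1 \<and>
    2 * \<sigma> \<le> R0 \<and> Q * \<sigma> + \<sigma> \<le> R0"
proof -
  define c where "c = 4 * 2 ^ CARD('k) * B / s ^ 2"
  have c: "c \<ge> 0" using assms by (simp add: c_def)
  define \<sigma> where "\<sigma> = Min {s / 8, 1 / (8 * (c + 1)), r / 4, 1, R0 / (2 * (Q + 1))}"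
  have "\<sigma> \<in> {s / 8, 1 / (8 * (c + 1)), r / 4, 1, R0 / (2 * (Q + 1))}"
    unfolding \<sigma>_def by (rule Min_in) auto
  then have pos: "0 < \<sigma>" using assms c r_pos by auto
  have le: "\<sigma> \<le> s / 8" "\<sigma> \<le> 1 / (8 * (c + 1))" "\<sigma> \<le> r / 4" "\<sigma> \<le> 1" "\<sigma> \<le> R0 / (2 * (Q + 1))"
    unfolding \<sigma>_def by (rule Min_le; simp)+
  have "8 * (c * \<sigma>) \<le> 8 * ((c + 1) * \<sigma>)" using pos by simp
  also have "\<dots> \<le> 1" using le(2) c by (simp add: le_divide_eq mult_ac)
  finally have "8 * (c * \<sigma>) \<le> 1" .
  moreover have q: "2 * ((Q + 1) * \<sigma>) \<le> R0" using le(5) assms by (simp add: le_divide_eq mult_ac)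
  moreover have "1 * \<sigma> \<le> (Q + 1) * \<sigma>" using pos assms by (intro mult_right_mono) auto
  ultimately show ?thesis using pos le unfolding c_def by (intro exI[of _ \<sigma>]) (auto simp: distrib_right)
qed

end

section \<open>The phase space\<close>

lemma UNIV_sum_split:
  fixes g :: "'n::finite + 'm::finite \<Rightarrow> 'b::comm_monoid_add"
  shows "(\<Sum>k\<in>UNIV. g k) = (\<Sum>l\<in>UNIV. g (Inl l)) + (\<Sum>l\<in>UNIV. g (Inr l))"
  unfolding UNIV_Plus_UNIV[symmetric] by (subst sum.Plus) (auto simp: o_def)

text \<open>The phase point \<open>(x, y)\<close> as one vector over two copies of the index type,
  so that the general theory applies with \<open>'n + 'n\<close> variables.\<close>

definition vec_join :: "complex ^ 'n \<Rightarrow> complex ^ 'n \<Rightarrow> complex ^ ('n::finite + 'n)" where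
  "vec_join x y = (\<chi> k. case k of Inl l \<Rightarrow> x $ l | Inr l \<Rightarrow> y $ l)"

definition vec_left :: "complex ^ ('n::finite + 'n) \<Rightarrow> complex ^ 'n" where
  "vec_left v = (\<chi> l. v $ Inl l)"

definition vec_right :: "complex ^ ('n::finite + 'n) \<Rightarrow> complex ^ 'n" where
  "vec_right v = (\<chi> l. v $ Inr l)"

lemma vec_join_nth [simp]: "vec_join x y $ Inl l = x $ l" "vec_join x y $ Inr l = y $ l"
  by (simp_all add: vec_join_def)

lemma vec_left_right_nth [simp]: "vec_left v $ l = v $ Inl l" "vec_right v $ l = v $ Inr l"
  by (simp_all add: vec_left_def vec_right_def)

lemma all_sum_iff: "(\<forall>k :: 'n + 'm. P k) \<longleftrightarrow> (\<forall>l. P (Inl l)) \<and> (\<forall>l. P (Inr l))"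
  by (metis sum.exhaust)

lemma vec_sum_eq_iff: "v = w \<longleftrightarrow> vec_left v = vec_left w \<and> vec_right v = vec_right w"
  by (simp add: vec_eq_iff all_sum_iff)

lemma vec_join_simps [simp]:
  "vec_left (vec_join x y) = x" "vec_right (vec_join x y) = y" "vec_join (vec_left v) (vec_right v) = v"
  by (simp_all add: vec_eq_iff all_sum_iff)

lemma max_norm_vec_join_le: "max_norm (vec_join x y) \<le> \<rho> \<longleftrightarrow> max_norm x \<le> \<rho> \<and> max_norm y \<le> \<rho>"
  by (simp add: max_norm_le_iff all_sum_iff)

lemma max_norm_vec_join_less: "max_norm (vec_join x y) < \<rho> \<longleftrightarrow> max_norm x < \<rho> \<and> max_norm y < \<rho>"
  by (simp add: max_norm_less_iff all_sum_iff)

lemma vec_join_diff: "vec_join x y - vec_join x' y' = vec_join (x - x') (y - y')"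
  by (simp add: vec_eq_iff all_sum_iff)

lemma mpow_vec_join: "mpow (vec_join x y) m = mpow x (m \<circ> Inl) * mpow y (m \<circ> Inr)"
  unfolding mpow_def UNIV_Plus_UNIV[symmetric] by (subst prod.Plus) (auto simp: o_def)

lemma mdeg_sum_type: "mdeg m = mdeg (m \<circ> Inl) + mdeg (m \<circ> Inr)"
  unfolding mdeg_def UNIV_sum_split[of m] by simp

definition index_split :: "('n + 'n \<Rightarrow> nat) \<Rightarrow> ('n \<Rightarrow> nat) \<times> ('n \<Rightarrow> nat)" where
  "index_split m = (m \<circ> Inl, m \<circ> Inr)"

lemma case_sum_comp: "case_sum \<alpha> \<beta> \<circ> Inl = \<alpha>" "case_sum \<alpha> \<beta> \<circ> Inr = \<beta>"
  by auto

lemma bij_index_split: "bij index_split"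
  by (rule o_bij[where g = "\<lambda>(\<alpha>, \<beta>). case_sum \<alpha> \<beta>"])
    (auto simp: index_split_def fun_eq_iff case_sum_comp split: sum.split)

text \<open>The series is expanded about the point and the affine dependence on
  \<open>\<eta>\<close> is added by hand; \<open>\<kappa>\<close> is 0 for components of
  \<open>x\<close> and \<open>y\<close> and 1 for that of \<open>\<eta>\<close>.\<close>

lemma analytic_at_D_ev:
  fixes A :: "('n::finite + 'n, complex) mps"
  assumes A: "asum \<sigma> A" and z0: "max_norm (vec_join x0 y0) < \<sigma>"
    and F: "\<And>x y \<eta>. max_norm (vec_join x y) \<le> \<sigma> \<Longrightarrow> F (x, y, \<eta>) = \<kappa> * \<eta> + ev A (vec_join x y)"
  shows "analytic_at_D F (x0, y0, \<eta>0)"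
proof -
  define z0 where "z0 = vec_join x0 y0"
  define \<rho> where "\<rho> = max_norm z0"
  define s where "s = \<sigma> - \<rho>"
  have s: "0 < s" "0 \<le> \<rho>" "\<rho> + s = \<sigma>" using z0 by (auto simp: s_def \<rho>_def z0_def max_norm_nonneg)
  \<comment> \<open>The coefficients of \<open>\<kappa> * \<eta>\<close> expanded about
    \<open>\<eta>0\<close>.\<close>
  define e where "e \<alpha> \<beta> k = (if \<alpha> = 0 \<and> \<beta> = 0 then (if k = 0 then \<kappa> * \<eta>0 else if k = 1 then \<kappa> else 0) else 0)"
    for \<alpha> \<beta> :: "'n \<Rightarrow> nat" and k :: nat
  define c where "c \<alpha> \<beta> k = (if k = 0 then taylor_coeff A z0 (case_sum \<alpha> \<beta>) else 0) + e \<alpha> \<beta> k"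
    for \<alpha> \<beta> :: "'n \<Rightarrow> nat" and k :: nat
  have "((\<lambda>(\<alpha>, \<beta>, k). c \<alpha> \<beta> k * mpow (x - x0) \<alpha> * mpow (y - y0) \<beta> * (\<eta> - \<eta>0) ^ k) has_sum F (x, y, \<eta>)) UNIV"
    if near: "max_norm (x - x0) < s" "max_norm (y - y0) < s" for x y \<eta>
  proof -
    define z where "z = vec_join x y"
    have zs: "max_norm (z - z0) \<le> s"
      unfolding z_def z0_def vec_join_diff max_norm_vec_join_le using near by simp
    have z\<sigma>: "max_norm z \<le> \<sigma>" using max_norm_triangle[of "z - z0" z0] zs s by (simp add: \<rho>_def)
    define X where "X = (\<lambda>(\<alpha>, \<beta>). taylor_coeff A z0 (case_sum \<alpha> \<beta>) * mpow (x - x0) \<alpha> * mpow (y - y0) \<beta>)"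
    define Y where "Y = (\<lambda>(\<alpha>, \<beta>, k :: nat). if k = 0 then X (\<alpha>, \<beta>) else 0)"
    define W where "W = (\<lambda>(\<alpha>, \<beta>, k). e \<alpha> \<beta> k * mpow (x - x0) \<alpha> * mpow (y - y0) \<beta> * (\<eta> - \<eta>0) ^ k)"
    have "((\<lambda>q. taylor_coeff A z0 q * mpow (z - z0) q) has_sum ev A (z0 + (z - z0))) UNIV"
      using A s zs by (intro taylor_expansion(3)[of \<rho> s]) (auto simp: \<rho>_def)
    moreover have "taylor_coeff A z0 q * mpow (z - z0) q = X (index_split q)" for q
    proof -
      have "case_sum (q \<circ> Inl) (q \<circ> Inr) = q" by (auto simp: fun_eq_iff split: sum.split)
      then show ?thesis by (simp add: X_def index_split_def z_def z0_def vec_join_diff mpow_vec_join)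
    qed
    ultimately have "((\<lambda>q. X (index_split q)) has_sum ev A z) UNIV" by simp
    then have X: "(X has_sum ev A z) UNIV"
      using has_sum_reindex_bij_betw[of index_split UNIV UNIV X] bij_index_split by blast
    have "((\<lambda>p. Y (fst p, snd p, 0)) has_sum ev A z) UNIV" using X by (simp add: Y_def)
    then have "((Y \<circ> (\<lambda>p. (fst p, snd p, 0))) has_sum ev A z) UNIV" by (simp add: o_def)
    then have "(Y has_sum ev A z) ((\<lambda>p. (fst p, snd p, 0)) ` UNIV)"
      by (subst has_sum_reindex) (auto simp: inj_on_def)
    then have Y: "(Y has_sum ev A z) UNIV"
      by (rule has_sum_cong_neutral[THEN iffD1, rotated -1]) (auto simp: Y_def image_iff)
    have W: "(W has_sum \<kappa> * \<eta>) UNIV"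
    proof (rule has_sum_finite_neutralI[of "{(0, 0, 0), (0, 0, 1)}"])
      show "W p = 0" if "p \<in> UNIV - {(0, 0, 0), (0, 0, 1)}" for p
        using that by (cases p) (auto simp: W_def e_def)
      show "\<kappa> * \<eta> = sum W {(0, 0, 0), (0, 0, 1)}"
        by (simp add: W_def e_def algebra_simps)
    qed auto
    have "((\<lambda>p. Y p + W p) has_sum (ev A z + \<kappa> * \<eta>)) UNIV" by (rule has_sum_add[OF Y W])
    moreover have "Y p + W p = (\<lambda>(\<alpha>, \<beta>, k). c \<alpha> \<beta> k * mpow (x - x0) \<alpha> * mpow (y - y0) \<beta> * (\<eta> - \<eta>0) ^ k) p" for p
    proof (cases p)
      case (fields \<alpha> \<beta> k)
      then show ?thesis by (cases "k = 0") (simp_all add: Y_def W_def X_def c_def algebra_simps)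
    qed
    ultimately show ?thesis using F[of x y \<eta>] z\<sigma> by (simp add: z_def add.commute)
  qed
  then show ?thesis unfolding analytic_at_D_def prod.case using s(1) by (intro exI[of _ s] exI[of _ c] conjI) auto
qed

definition frequency :: "complex ^ 'n::finite \<Rightarrow> 'n + 'n \<Rightarrow> complex" where
  "frequency \<Lambda> k = (case k of Inl l \<Rightarrow> \<Lambda> $ l | Inr l \<Rightarrow> - \<Lambda> $ l)"

definition conjugate :: "'n + 'n \<Rightarrow> 'n + 'n" where
  "conjugate k = (case k of Inl l \<Rightarrow> Inr l | Inr l \<Rightarrow> Inl l)"

definition orientation :: "'n + 'n \<Rightarrow> complex" where
  "orientation k = (case k of Inl l \<Rightarrow> 1 | Inr l \<Rightarrow> - 1)"

lemma conjugate_simps [simp]: "conjugate (Inl l) = Inr l" "conjugate (Inr l) = Inl l"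
  by (simp_all add: conjugate_def)

lemma orientation_simps [simp]: "orientation (Inl l) = 1" "orientation (Inr l) = - 1"
  by (simp_all add: orientation_def)

lemma frequency_simps [simp]: "frequency \<Lambda> (Inl l) = \<Lambda> $ l" "frequency \<Lambda> (Inr l) = - \<Lambda> $ l"
  by (simp_all add: frequency_def)

lemma symp_form_eq:
  "symp_form (vec_left v, vec_right v, \<eta>, t) (vec_left v', vec_right v', \<eta>', t') =
    (\<Sum>i\<in>UNIV. orientation i * (v $ i * v' $ conjugate i)) + (of_real t * \<eta>' - \<eta> * of_real t')"
  by (simp add: symp_form_def UNIV_sum_split sum_subtractf sum_negf)

lemma interior_Qdom:
  fixes x y :: "complex ^ 'n::finite"
  assumes "max_norm x < R" "max_norm y < R"
  shows "(x, y) \<in> interior (Qdom R)"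
proof -
  define U where "U = (\<Inter>l\<in>UNIV. {p :: (complex ^ 'n) \<times> (complex ^ 'n). norm (fst p $ l) < R \<and> norm (snd p $ l) < R})"
  have "open U"
    unfolding U_def by (intro open_INT ballI open_Collect_conj open_Collect_less continuous_intros) auto
  moreover have "U \<subseteq> Qdom R"
    by (auto simp: U_def Qdom_def max_norm_le_iff less_imp_le)
  moreover have "(x, y) \<in> U" using assms by (auto simp: U_def max_norm_less_iff)
  ultimately show ?thesis using interior_maximal by blast
qed

text \<open>Values at the real points \<open>R * w k\<close>, normalised for
  \<open>coefficient_tendsto_zero\<close>: the factor \<open>R ^ mdeg m\<close> turns Cauchy bounds
  at radius \<open>R\<close> into uniform ones.\<close>

lemma ev_scaled:
  fixes c :: "('k::finite \<Rightarrow> nat) \<Rightarrow> complex"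
  shows "(\<Sum>\<^sub>\<infinity>m. (c m * of_real (R ^ mdeg m)) * of_real (\<Prod>k\<in>UNIV. w k ^ m k)) = ev (Mps c) (\<chi> k. of_real (R * w k))"
  unfolding ev_def by (rule infsum_cong) (simp add: mpow_def mdeg_def power_sum power_mult_distrib prod.distrib)

section \<open>The perturbation as a time-dependent power series\<close>

locale perturbation =
  fixes f :: "complex ^ 'n::finite \<Rightarrow> complex ^ 'n \<Rightarrow> real \<Rightarrow> complex"
    and fc :: "('n \<Rightarrow> nat) \<Rightarrow> ('n \<Rightarrow> nat) \<Rightarrow> real \<Rightarrow> complex"
    and R Mf a :: real
  assumes R: "0 < R" "R \<le> 1 / 2"
    and taylor: "t \<ge> 0 \<Longrightarrow> has_taylor_coeffs R (\<lambda>x y. f x y t) (\<lambda>\<alpha> \<beta>. fc \<alpha> \<beta> t)"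
    and C1: "C1_in_time R f"
    and QxLy: "QxLy fc"
    and Mf: "1 \<le> Mf" and a: "0 \<le> a"
    and norm_le: "t \<ge> 0 \<Longrightarrow> taylor_norm R (\<lambda>\<alpha> \<beta>. fc \<alpha> \<beta> t) \<le> ennreal (Mf * exp (- a * t))"
begin

definition ser :: "real \<Rightarrow> ('n + 'n, complex) mps" where
  "ser t = Mps (\<lambda>m. fc (m \<circ> Inl) (m \<circ> Inr) t)"

lemma mcoeff_ser: "mcoeff (ser t) m = fc (m \<circ> Inl) (m \<circ> Inr) t"
  by (simp add: ser_def)

lemma ser_has_sum:
  assumes "t \<ge> 0" "max_norm z < R"
  shows "((\<lambda>m. mcoeff (ser t) m * mpow z m) has_sum f (vec_left z) (vec_right z) t) UNIV"
proof -
  have z: "max_norm (vec_left z) < R" "max_norm (vec_right z) < R"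
    using assms(2) max_norm_vec_join_less[of "vec_left z" "vec_right z" R] by simp_all
  define X where "X = (\<lambda>(\<alpha>, \<beta>). fc \<alpha> \<beta> t * mpow (vec_left z) \<alpha> * mpow (vec_right z) \<beta>)"
  have "(X has_sum f (vec_left z) (vec_right z) t) UNIV"
    using taylor[OF assms(1)] interior_Qdom[OF z] unfolding has_taylor_coeffs_def X_def by fast
  then have "((\<lambda>m. X (index_split m)) has_sum f (vec_left z) (vec_right z) t) UNIV"
    using has_sum_reindex_bij_betw[of index_split UNIV UNIV X] bij_index_split by blast
  moreover have "X (index_split m) = mcoeff (ser t) m * mpow z m" for m
    using mpow_vec_join[of "vec_left z" "vec_right z" m] by (simp add: X_def index_split_def mcoeff_ser)
  ultimately show ?thesis by simp
qed

lemma ev_ser: "t \<ge> 0 \<Longrightarrow> max_norm z < R \<Longrightarrow> ev (ser t) z = f (vec_left z) (vec_right z) t"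
  unfolding ev_def by (rule infsumI) (rule ser_has_sum)

lemma ser_bound:
  assumes t: "t \<ge> 0"
  shows "norm (mcoeff (ser t) m) \<le> Mf * exp (- a * t) / R ^ mdeg m"
proof -
  define X where "X = (\<lambda>(\<alpha>, \<beta>). ennreal (norm (fc \<alpha> \<beta> t) * R ^ (mdeg \<alpha> + mdeg \<beta>)))"
  have "sum X {index_split m} \<le> infsum X UNIV"
    by (subst nonneg_infsum_complete) (auto intro!: SUP_upper2[of "{index_split m}"])
  also have "\<dots> \<le> ennreal (Mf * exp (- a * t))"
    using norm_le[OF t] by (simp add: taylor_norm_def X_def)
  finally have "ennreal (norm (mcoeff (ser t) m) * R ^ mdeg m) \<le> ennreal (Mf * exp (- a * t))"
    by (simp add: X_def index_split_def mcoeff_ser mdeg_sum_type)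
  then have "norm (mcoeff (ser t) m) * R ^ mdeg m \<le> Mf * exp (- a * t)"
    using Mf by (subst (asm) ennreal_le_iff) auto
  then show ?thesis using R by (simp add: le_divide_eq)
qed

lemma ser_bound': "t \<ge> 0 \<Longrightarrow> norm (mcoeff (ser t) m) \<le> Mf / R ^ mdeg m"
proof -
  assume t: "t \<ge> 0"
  have "Mf * exp (- a * t) \<le> Mf * 1" using Mf a t by (intro mult_left_mono) auto
  then have "Mf * exp (- a * t) / R ^ mdeg m \<le> Mf / R ^ mdeg m" using R by (intro divide_right_mono) auto
  then show ?thesis using ser_bound[OF t, of m] by linarith
qed

lemma ser_support: "t \<ge> 0 \<Longrightarrow> mcoeff (ser t) m \<noteq> 0 \<Longrightarrow> 2 \<le> mdeg (m \<circ> Inl) \<and> 1 \<le> mdeg (m \<circ> Inr)"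
  using QxLy unfolding QxLy_def mcoeff_ser by blast

lemma ser_support_mdeg: "t \<ge> 0 \<Longrightarrow> mcoeff (ser t) m \<noteq> 0 \<Longrightarrow> 3 \<le> mdeg m"
  using ser_support[of t m] unfolding mdeg_sum_type[of m] by linarith

lemma ser_diff:
  assumes "t \<ge> 0" "max_norm z < R"
  shows "\<exists>f'. ((\<lambda>t. ev (ser t) z) has_vector_derivative f') (at t within {0..})"
proof -
  have z: "max_norm (vec_left z) < R" "max_norm (vec_right z) < R"
    using assms(2) max_norm_vec_join_less[of "vec_left z" "vec_right z" R] by simp_all
  obtain f' where "((\<lambda>s. f (vec_left z) (vec_right z) s) has_vector_derivative f') (at t within {0..})"
    using C1 interior_Qdom[OF z] assms(1) unfolding C1_in_time_def by blast
  then have "((\<lambda>t. ev (ser t) z) has_vector_derivative f') (at t within {0..})"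
    by (rule has_vector_derivative_transform[rotated -1]) (use assms in \<open>auto simp: ev_ser\<close>)
  then show ?thesis ..
qed

text \<open>Only pointwise differentiability in \<open>t\<close> is assumed of \<open>f\<close>; the uniform bound on the coefficients
  turns it into continuity of each coefficient.\<close>

lemma ser_cont: "continuous_on {0..} (\<lambda>t. mcoeff (ser t) m)"
  unfolding continuous_on_def
proof
  fix t0 :: real assume "t0 \<in> {0..}"
  then have t0: "t0 \<ge> 0" by simp
  \<comment> \<open>Zero at negative times, where nothing is known, so that the coefficient bound
    holds for every value of the parameter.\<close>
  define c where "c t m = (if t \<ge> 0 then mcoeff (ser t) m - mcoeff (ser t0) m else 0)" for t m
  define d where "d t m = c t m * of_real (R ^ mdeg m)" for t and m :: "'n + 'n \<Rightarrow> nat"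
  have "((\<lambda>t. d t m) \<longlongrightarrow> 0) (at t0 within {0..})"
  proof (rule coefficient_tendsto_zero)
    fix t m
    show "norm (d t m) \<le> 2 * Mf"
    proof (cases "t \<ge> 0")
      case True
      have "norm (c t m) \<le> norm (mcoeff (ser t) m) + norm (mcoeff (ser t0) m)"
        using True norm_triangle_ineq4 by (auto simp: c_def)
      then have "norm (c t m) \<le> Mf / R ^ mdeg m + Mf / R ^ mdeg m"
        using ser_bound'[OF True, of m] ser_bound'[OF t0, of m] by linarith
      then show ?thesis using R by (simp add: d_def norm_mult norm_power le_divide_eq flip: add_divide_distrib)
    next
      case False
      then show ?thesis using Mf by (simp add: d_def c_def)
    qed
  next
    fix w :: "'n + 'n \<Rightarrow> real"
    assume w: "\<And>k. 0 < w k \<and> w k < 1 / 2"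
    define z where "z = (\<chi> k. complex_of_real (R * w k))"
    have z: "max_norm z < R"
      unfolding max_norm_less_iff
    proof
      fix k
      have "R * w k < R * 1" using R w[of k] by (intro mult_strict_left_mono) auto
      moreover have "norm (z $ k) = R * w k" using R w[of k] by (simp add: z_def norm_mult)
      ultimately show "norm (z $ k) < R" by simp
    qed
    obtain f' where "((\<lambda>t. ev (ser t) z) has_vector_derivative f') (at t0 within {0..})"
      using ser_diff[OF t0 z] by blast
    then have "((\<lambda>t. ev (ser t) z) \<longlongrightarrow> ev (ser t0) z) (at t0 within {0..})"
      using has_vector_derivative_continuous continuous_within by blast
    then have lim: "((\<lambda>t. ev (ser t) z - ev (ser t0) z) \<longlongrightarrow> 0) (at t0 within {0..})"
      by (rule LIM_zero)
    have "(\<Sum>\<^sub>\<infinity>m. d t m * of_real (\<Prod>k\<in>UNIV. w k ^ m k)) = ev (ser t) z - ev (ser t0) z" if "t \<ge> 0" for t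
    proof -
      have "(\<Sum>\<^sub>\<infinity>m. d t m * of_real (\<Prod>k\<in>UNIV. w k ^ m k)) = ev (Mps (c t)) z"
        unfolding d_def z_def by (rule ev_scaled)
      also have "Mps (c t) = ser t - ser t0" using that by (intro mps_eqI) (simp add: c_def)
      also have "((\<lambda>m. mcoeff (ser t) m * mpow z m + - (mcoeff (ser t0) m * mpow z m)) has_sum
          f (vec_left z) (vec_right z) t + - f (vec_left z) (vec_right z) t0) UNIV"
        by (intro has_sum_add ser_has_sum that z) (simp add: has_sum_uminus ser_has_sum[OF t0 z])
      then have "ev (ser t - ser t0) z = ev (ser t) z - ev (ser t0) z"
        unfolding ev_ser[OF that z] ev_ser[OF t0 z] unfolding ev_def by (intro infsumI) (simp add: algebra_simps)
      finally show ?thesis .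
    qed
    then show "((\<lambda>t. \<Sum>\<^sub>\<infinity>m. d t m * of_real (\<Prod>k\<in>UNIV. w k ^ m k)) \<longlongrightarrow> 0) (at t0 within {0..})"
      by (intro tendsto_cong[THEN iffD2, OF _ lim]) (auto simp: eventually_at_filter)
  qed
  then have "((\<lambda>t. d t m / of_real (R ^ mdeg m) + mcoeff (ser t0) m) \<longlongrightarrow> 0 / of_real (R ^ mdeg m) + mcoeff (ser t0) m) (at t0 within {0..})"
    using R by (intro tendsto_intros) auto
  then have lim: "((\<lambda>t. d t m / of_real (R ^ mdeg m) + mcoeff (ser t0) m) \<longlongrightarrow> mcoeff (ser t0) m) (at t0 within {0..})" by simp
  show "((\<lambda>t. mcoeff (ser t) m) \<longlongrightarrow> mcoeff (ser t0) m) (at t0 within {0..})"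
    by (intro tendsto_cong[THEN iffD1, OF _ lim]) (use R in \<open>auto simp: eventually_at_filter d_def c_def\<close>)
qed

text \<open>Halving \<open>y\<close> halves \<open>f\<close>, so the coefficients times
  \<open>h m\<close> are those of the zero function. They vanish by uniqueness, obtained from the
  limit statement applied to a constant sequence.\<close>

lemma linear_in_y_support:
  assumes lin: "linear_in_y R f" and t: "t \<ge> 0" and nz: "mcoeff (ser t) m \<noteq> 0"
  shows "mdeg (m \<circ> Inr) = 1"
proof -
  define h where "h m = (1 / 2) ^ mdeg (m \<circ> Inr) - (1 / 2 :: complex)" for m :: "'n + 'n \<Rightarrow> nat"
  have h: "norm (h m) \<le> 2" for m
  proof -
    have "norm (h m) \<le> norm ((1 / 2 :: complex) ^ mdeg (m \<circ> Inr)) + norm (1 / 2 :: complex)"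
      unfolding h_def by (rule norm_triangle_ineq4)
    also have "norm ((1 / 2 :: complex) ^ mdeg (m \<circ> Inr)) \<le> 1"
      unfolding norm_power by (intro power_le_one) auto
    finally show ?thesis by simp
  qed
  define c where "c m = mcoeff (ser t) m * h m" for m
  define d where "d (n :: nat) m = c m * of_real (R ^ mdeg m)" for n and m :: "'n + 'n \<Rightarrow> nat"
  have "(\<lambda>n. d n m) \<longlonglongrightarrow> 0"
  proof (rule coefficient_tendsto_zero)
    fix n m
    have "norm (d n m) = (norm (mcoeff (ser t) m) * R ^ mdeg m) * norm (h m)"
      using R by (simp add: d_def c_def norm_mult norm_power)
    also have "\<dots> \<le> Mf * 2"
      using ser_bound'[OF t, of m] R Mf by (intro mult_mono h) (auto simp: le_divide_eq)
    finally show "norm (d n m) \<le> Mf * 2" .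
  next
    fix w :: "'n + 'n \<Rightarrow> real"
    assume w: "\<And>k. 0 < w k \<and> w k < 1 / 2"
    define z where "z = (\<chi> k. complex_of_real (R * w k))"
    define z' where "z' = vec_join (vec_left z) (\<chi> l. vec_right z $ l / 2)"
    have zk: "norm (z $ k) < R" for k
    proof -
      have "R * w k < R * 1" using R w[of k] by (intro mult_strict_left_mono) auto
      moreover have "norm (z $ k) = R * w k" using R w[of k] by (simp add: z_def norm_mult)
      ultimately show "norm (z $ k) < R" by simp
    qed
    have z: "max_norm z < R" using zk by (simp add: max_norm_less_iff)
    have "norm (z $ k) / 2 < R" for k using zk[of k] norm_ge_zero[of "z $ k"] by linarith
    then have z': "max_norm z' < R" using zk by (simp add: max_norm_less_iff all_sum_iff z'_def norm_divide)
    obtain g where g: "\<And>x y. (x, y) \<in> Qdom R \<Longrightarrow> f x y t = (\<Sum>l\<in>UNIV. y $ l * g x t $ l)"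
      using lin t unfolding linear_in_y_def by blast
    have "(vec_left z, vec_right z) \<in> Qdom R" "(vec_left z', vec_right z') \<in> Qdom R"
      using z z' max_norm_vec_join_less[of "vec_left z" "vec_right z" R] max_norm_vec_join_less[of "vec_left z'" "vec_right z'" R]
      by (simp_all add: Qdom_def)
    then have f: "f (vec_left z') (vec_right z') t = f (vec_left z) (vec_right z) t / 2"
      using g by (simp add: z'_def sum_divide_distrib)
    have mpow: "mpow z' m = mpow z m * (1 / 2) ^ mdeg (m \<circ> Inr)" for m
    proof -
      have "mpow (\<chi> l. vec_right z $ l / 2) p = mpow (vec_right z) p * (1 / 2) ^ mdeg p" for p
        by (simp add: mpow_def mdeg_def power_divide prod_dividef power_sum prod.distrib)
      then show ?thesis using mpow_vec_join[of "vec_left z" "vec_right z" m]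
        by (simp add: z'_def mpow_vec_join mult.assoc)
    qed
    have "((\<lambda>m. mcoeff (ser t) m * mpow z' m + (- 1 / 2) * (mcoeff (ser t) m * mpow z m)) has_sum
        (f (vec_left z') (vec_right z') t + (- 1 / 2) * f (vec_left z) (vec_right z) t)) UNIV"
      by (intro has_sum_add has_sum_cmult_right ser_has_sum t z z')
    then have "((\<lambda>m. mcoeff (Mps c) m * mpow z m) has_sum 0) UNIV"
      by (simp add: f mpow c_def h_def algebra_simps)
    then have "ev (Mps c) z = 0" unfolding ev_def by (rule infsumI)
    then have "(\<Sum>\<^sub>\<infinity>m. d n m * of_real (\<Prod>k\<in>UNIV. w k ^ m k)) = 0" for n
      unfolding d_def z_def by (subst ev_scaled)
    then show "(\<lambda>n. \<Sum>\<^sub>\<infinity>m. d n m * of_real (\<Prod>k\<in>UNIV. w k ^ m k)) \<longlonglongrightarrow> 0" by simp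
  qed
  then have "c m = 0" using R by (simp add: d_def LIMSEQ_const_iff)
  then have "(1 / 2 :: complex) ^ mdeg (m \<circ> Inr) = (1 / 2) ^ 1" using nz by (simp add: c_def h_def)
  then have "norm ((1 / 2 :: complex) ^ mdeg (m \<circ> Inr)) = norm ((1 / 2 :: complex) ^ 1)" by (rule arg_cong)
  then have "(1 / 2 :: real) ^ mdeg (m \<circ> Inr) = (1 / 2) ^ 1" unfolding norm_power by simp
  then show ?thesis by (rule power_inject_exp'[THEN iffD1, rotated -1]) auto
qed

definition gradient :: "'n + 'n \<Rightarrow> real \<Rightarrow> ('n + 'n, complex) mps" where
  "gradient i t = mconst (orientation i) * mderiv (conjugate i) (ser t)"

lemma mcoeff_gradient:
  "mcoeff (gradient i t) m = orientation i * (of_nat (m (conjugate i) + 1) * mcoeff (ser t) (m + unit_index (conjugate i)))"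
  by (simp add: gradient_def mcoeff_mderiv)

text \<open>The factor from differentiation is at most \<open>2 ^ mdeg m\<close>, which halving the
  radius absorbs.\<close>

lemma gradient_bound:
  assumes t: "t \<ge> 0"
  shows "norm (mcoeff (gradient i t) m) \<le> (Mf / R) * exp (- a * t) / (R / 2) ^ mdeg m"
proof -
  have "norm (orientation i) = 1" by (cases i) auto
  have "m (conjugate i) + 1 \<le> 2 ^ mdeg m"
    using index_le_mdeg[of m "conjugate i"] less_exp[of "mdeg m"] by linarith
  then have le: "real (m (conjugate i) + 1) \<le> 2 ^ mdeg m"
    by (metis of_nat_le_iff of_nat_numeral of_nat_power)
  have "norm (mcoeff (gradient i t) m) = real (m (conjugate i) + 1) * norm (mcoeff (ser t) (m + unit_index (conjugate i)))"
    unfolding mcoeff_gradient norm_mult norm_of_nat \<open>norm (orientation i) = 1\<close> by simp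
  also have "\<dots> \<le> 2 ^ mdeg m * (Mf * exp (- a * t) / R ^ mdeg (m + unit_index (conjugate i)))"
    using le by (intro mult_mono ser_bound t) auto
  also have "\<dots> = (Mf / R) * exp (- a * t) / (R / 2) ^ mdeg m"
    unfolding mdeg_add mdeg_unit by (simp add: power_divide)
  finally show ?thesis .
qed

text \<open>As the Hamiltonian has weight \<open>\<kappa>\<close>, its derivative in direction
  \<open>conjugate i\<close> has weight \<open>\<kappa> - wt (conjugate i) = wt i\<close>: the
  grading passes to the vector field.\<close>

lemma hamiltonian_flow:
  assumes "small_divisors wt D N T"
    and wt: "\<And>i. wt i + wt (conjugate i) = \<kappa>"
    and supp: "\<And>t m. t \<ge> 0 \<Longrightarrow> mcoeff (ser t) m \<noteq> 0 \<Longrightarrow> idot wt m = \<kappa>"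
    and nonres: "\<And>i p. a = 0 \<Longrightarrow> good_mode wt i p \<Longrightarrow> 2 \<le> mdeg p \<Longrightarrow> Re (idot (frequency \<Lambda>) p - frequency \<Lambda> i) \<noteq> 0"
    and D: "\<And>i p. D i p = (if a > 0 then 1 / a else 1 / \<bar>Re (idot (frequency \<Lambda>) p - frequency \<Lambda> i)\<bar>)"
  shows "hamiltonian_flow wt D N T (frequency \<Lambda>) gradient a (Mf / R) (R / 2) conjugate orientation ser \<kappa> Mf"
proof -
  interpret small_divisors wt D N T by fact
  show ?thesis
  proof unfold_locales
    show "continuous_on {0..} (\<lambda>t. mcoeff (gradient i t) m)" for i m
      unfolding mcoeff_gradient by (intro continuous_intros ser_cont)
    show "norm (mcoeff (gradient i t) m) \<le> Mf / R * exp (- a * t) / (R / 2) ^ mdeg m" if "t \<ge> 0" for t i m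
      by (rule gradient_bound[OF that])
    show "2 \<le> mdeg m \<and> good_mode wt i m" if t: "t \<ge> 0" and nz: "mcoeff (gradient i t) m \<noteq> 0" for t i m
    proof -
      have nz': "mcoeff (ser t) (m + unit_index (conjugate i)) \<noteq> 0" using nz by (auto simp: mcoeff_gradient)
      have "3 \<le> mdeg m + 1" using ser_support_mdeg[OF t nz'] by simp
      moreover have "idot wt m + wt (conjugate i) = \<kappa>" using supp[OF t nz'] by (simp add: idot_add)
      ultimately show ?thesis using wt[of i] by (simp add: good_mode_def)
    qed
    show "norm (mcoeff (ser t) m) \<le> Mf / (R / 2) ^ mdeg m" if "t \<ge> 0" for t m
    proof -
      have "(R / 2) ^ mdeg m \<le> R ^ mdeg m" using R by (intro power_mono) auto
      then have "Mf / R ^ mdeg m \<le> Mf / (R / 2) ^ mdeg m" using R Mf by (intro divide_left_mono) auto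
      then show ?thesis using ser_bound'[OF that, of m] by linarith
    qed
    show "mcoeff (ser t) 0 = 0" if "t \<ge> 0" for t
      using ser_support_mdeg[OF that, of 0] by fastforce
    show "\<exists>f'. ((\<lambda>t. ev (ser t) z) has_vector_derivative f') (at t within {0..})"
      if "t \<ge> 0" "max_norm z < R / 2" for t z
      using that R by (intro ser_diff) auto
    show "conjugate (conjugate i) = i" "orientation i * orientation i = 1" "orientation (conjugate i) = - orientation i"
      "frequency \<Lambda> (conjugate i) = - frequency \<Lambda> i" for i by (cases i; simp)+
    show "gradient i t = mconst (orientation i) * mderiv (conjugate i) (ser t)" for i t
      by (simp add: gradient_def)
  qed (use R Mf a wt nonres D ser_cont in auto)
qed

end

lemma vec_left_linear_simps:
  "vec_left (v + w) = vec_left v + vec_left w" "vec_left (r *\<^sub>R v) = r *\<^sub>R vec_left v"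
  "vec_right (v + w) = vec_right v + vec_right w" "vec_right (r *\<^sub>R v) = r *\<^sub>R vec_right v"
  "vec_join (x + x') (y + y') = vec_join x y + vec_join x' y'" "vec_join (r *\<^sub>R x) (r *\<^sub>R y) = r *\<^sub>R vec_join x y"
  by (simp_all add: vec_eq_iff all_sum_iff)

text \<open>The pairings of \<open>c\<close> with \<open>L v\<close> and \<open>L v'\<close> cancel
  against the terms with \<open>d\<close>; the products of both time increments, including those
  with \<open>K\<close>, cancel by skew symmetry.\<close>

lemma symp_form_extended:
  fixes L :: "complex ^ ('n::finite + 'n) \<Rightarrow> complex ^ ('n + 'n)"
  defines "\<omega> v w \<equiv> \<Sum>i\<in>UNIV. orientation i * (v $ i * w $ conjugate i)"
  assumes L: "\<And>v w. \<omega> (L v) (L w) = \<omega> v w" and c: "\<And>w. \<omega> c (L w) = - d w"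
  shows "symp_form (vec_left (L v + of_real t *s c), vec_right (L v + of_real t *s c), \<eta> + (d v + of_real t * K), t)
      (vec_left (L v' + of_real t' *s c), vec_right (L v' + of_real t' *s c), \<eta>' + (d v' + of_real t' * K), t') =
    symp_form (vec_left v, vec_right v, \<eta>, t) (vec_left v', vec_right v', \<eta>', t')"
proof -
  have add: "\<omega> (v + x *s w) (v' + x' *s w') = \<omega> v v' + x * \<omega> w v' + x' * \<omega> v w' + x * x' * \<omega> w w'"
    for v w v' w' x x'
    unfolding \<omega>_def sum_distrib_left sum.distrib[symmetric]
    by (rule sum.cong) (simp_all add: algebra_simps)
  have skew: "\<omega> v w = - \<omega> w v" for v w
    by (simp add: \<omega>_def UNIV_sum_split sum_negf mult.commute)
  have "\<omega> c c = 0" using skew[of c c] by (simp add: eq_neg_iff_add_eq_0)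
  then show ?thesis
    unfolding symp_form_eq \<omega>_def[symmetric] add L c skew[of "L v" c] by (simp add: algebra_simps)
qed

context perturbation
begin

theorem strong_normal_form:
  assumes "small_divisors wt D N T"
    and wt: "\<And>i. wt i + wt (conjugate i) = \<kappa>"
    and supp: "\<And>t m. t \<ge> 0 \<Longrightarrow> mcoeff (ser t) m \<noteq> 0 \<Longrightarrow> idot wt m = \<kappa>"
    and nonres: "\<And>i p. a = 0 \<Longrightarrow> good_mode wt i p \<Longrightarrow> 2 \<le> mdeg p \<Longrightarrow> Re (idot (frequency \<Lambda>) p - frequency \<Lambda> i) \<noteq> 0"
    and D: "\<And>i p. D i p = (if a > 0 then 1 / a else 1 / \<bar>Re (idot (frequency \<Lambda>) p - frequency \<Lambda> i)\<bar>)"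
  shows "\<exists>Rs R0. 0 < Rs \<and> Rs < R0 \<and> R0 \<le> R ^ 16 \<and>
           (\<exists>M. (\<forall>t\<ge>0. M t ` Ddom Rs \<subseteq> Ddom R0) \<and>
                (\<forall>t\<ge>0. analytic_map_on_D (Ddom Rs) (M t)) \<and>
                canonical_family_on (Ddom Rs) M \<and>
                (\<forall>t\<ge>0. \<forall>p\<in>Ddom Rs. ham_H \<Lambda> f (M t p) t = ham_h \<Lambda> p))"
proof -
  interpret S: hamiltonian_flow wt D N T "frequency \<Lambda>" gradient a "Mf / R" "R / 2" conjugate orientation ser \<kappa> Mf
    by (rule hamiltonian_flow) fact+
  obtain u B s where u: "S.normalizing u B s" using S.normalizing_exists by blast
  \<comment> \<open>The constant of \<open>norm_energy_shift_le\<close> for the present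
    data.\<close>
  define Q where "Q = 5 * (\<Sum>j\<in>UNIV. norm (frequency \<Lambda> j)) + 4 * \<bar>Mf\<bar> / (R / 2) * 2 ^ CARD('n + 'n)"
  have "Q \<ge> 0" unfolding Q_def using R by (intro add_nonneg_nonneg mult_nonneg_nonneg divide_nonneg_nonneg sum_nonneg) auto
  then obtain \<sigma> where \<sigma>: "0 < \<sigma>" "\<sigma> \<le> s / 8" "8 * (4 * 2 ^ CARD('n + 'n) * B / s ^ 2 * \<sigma>) \<le> 1" "4 * \<sigma> \<le> R / 2" "\<sigma> \<le> 1"
    and \<sigma>R: "2 * \<sigma> \<le> R ^ 16" "Q * \<sigma> + \<sigma> \<le> R ^ 16"
    using S.radius_exists[of "R ^ 16" s B Q] R S.s_pos[OF u] S.B_nonneg[OF u] by auto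
  define \<phi> where "\<phi> = S.\<phi> u"
  define K where "K = S.energy_shift u"
  define M where "M t = (\<lambda>(x, y, \<eta>). (vec_left (\<phi> (vec_join x y) t), vec_right (\<phi> (vec_join x y) t), \<eta> + K (vec_join x y) t))"
    for t and \<eta> :: complex
  \<comment> \<open>The domain has radius \<open>\<sigma> / 2\<close>, so its points lie strictly
    inside radius \<open>\<sigma>\<close>, as the derivative statements require.\<close>
  have Rs: "max_norm (vec_join x y) < \<sigma>" if "(x, y, \<eta>) \<in> Ddom (\<sigma> / 2)" for x y \<eta>
    using that \<sigma>(1) unfolding max_norm_vec_join_less Ddom_def Qdom_def by auto
  have \<phi>_small: "max_norm (\<phi> z t) \<le> 2 * \<sigma>" if "t \<ge> 0" "max_norm z \<le> \<sigma>" for z t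
    unfolding \<phi>_def by (rule S.max_norm_\<phi>[OF u \<sigma> that])
  have K_small: "norm (K z t) \<le> Q * \<sigma>" if "t \<ge> 0" "max_norm z \<le> \<sigma>" for z t
    unfolding K_def Q_def by (rule S.norm_energy_shift_le[OF u \<sigma> that])
  have image: "M t p \<in> Ddom (R ^ 16)" if t: "t \<ge> 0" and p: "p \<in> Ddom (\<sigma> / 2)" for t p
  proof (cases p)
    case (fields x y \<eta>)
    define z where "z = vec_join x y"
    have z: "max_norm z \<le> \<sigma>" using Rs[of x y \<eta>] p fields by (simp add: z_def)
    have "max_norm (vec_join (vec_left (\<phi> z t)) (vec_right (\<phi> z t))) \<le> R ^ 16"
      using \<phi>_small[OF t z] \<sigma>R(1) by simp
    moreover have "\<bar>Im (\<eta> + K z t)\<bar> \<le> R ^ 16"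
    proof -
      have "\<bar>Im \<eta>\<bar> \<le> \<sigma> / 2" using p by (simp add: fields Ddom_def Sdom_def)
      moreover have "\<bar>Im (K z t)\<bar> \<le> Q * \<sigma>" using abs_Im_le_cmod K_small[OF t z] by (rule order_trans)
      ultimately show ?thesis using \<sigma>(1) \<sigma>R(2) by simp
    qed
    ultimately show ?thesis
      by (simp add: M_def fields Ddom_def Qdom_def Sdom_def max_norm_vec_join_le z_def del: vec_join_simps(3))
  qed
  have analytic: "analytic_map_on_D (Ddom (\<sigma> / 2)) (M t)" if t: "t \<ge> 0" for t
    unfolding analytic_map_on_D_def
  proof (intro ballI)
    fix p :: "(complex ^ 'n) \<times> (complex ^ 'n) \<times> complex" assume p: "p \<in> Ddom (\<sigma> / 2)"
    obtain x y \<eta> where p_eq: "p = (x, y, \<eta>)" by (cases p)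
    have z: "max_norm (vec_join x y) < \<sigma>" using Rs p p_eq by blast
    have \<Psi>: "asum \<sigma> (near_identity (\<lambda>k q. u k q t) i)" for i
      using \<sigma> S.s_pos[OF u] by (intro S.asum_\<Psi>[OF u \<sigma> t]) auto
    have "analytic_at_D (\<lambda>q. fst (M t q) $ l) p" for l
      unfolding p_eq by (rule analytic_at_D_ev[where \<kappa> = 0, OF \<Psi>[of "Inl l"] z]) (simp add: M_def \<phi>_def S.\<phi>_def[OF u])
    moreover have "analytic_at_D (\<lambda>q. fst (snd (M t q)) $ l) p" for l
      unfolding p_eq by (rule analytic_at_D_ev[where \<kappa> = 0, OF \<Psi>[of "Inr l"] z]) (simp add: M_def \<phi>_def S.\<phi>_def[OF u])
    moreover have "analytic_at_D (\<lambda>q. snd (snd (M t q))) p"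
      unfolding p_eq by (rule analytic_at_D_ev[where \<kappa> = 1, OF S.energy_series(1)[OF u \<sigma> t] z])
        (simp add: M_def K_def S.energy_series(2)[OF u \<sigma> t])
    ultimately show "(\<forall>l. analytic_at_D (\<lambda>q. fst (M t q) $ l) p) \<and> (\<forall>l. analytic_at_D (\<lambda>q. fst (snd (M t q)) $ l) p) \<and>
        analytic_at_D (\<lambda>q. snd (snd (M t q))) p" by blast
  qed
  have inj: "inj_on (M t) (Ddom (\<sigma> / 2))" if t: "t \<ge> 0" for t
  proof (rule inj_onI)
    fix p p' :: "(complex ^ 'n) \<times> (complex ^ 'n) \<times> complex"
    assume p: "p \<in> Ddom (\<sigma> / 2)" "p' \<in> Ddom (\<sigma> / 2)" and eq: "M t p = M t p'"
    obtain x y \<eta> x' y' \<eta>' where p_eq: "p = (x, y, \<eta>)" "p' = (x', y', \<eta>')" by (metis prod.exhaust)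
    have z: "max_norm (vec_join x y) \<le> \<sigma>" "max_norm (vec_join x' y') \<le> \<sigma>"
      using Rs[of x y \<eta>] Rs[of x' y' \<eta>'] p p_eq by simp_all
    have "\<phi> (vec_join x y) t = \<phi> (vec_join x' y') t"
      unfolding vec_sum_eq_iff[of "\<phi> (vec_join x y) t"] using eq by (simp add: M_def p_eq)
    then have "vec_join x y = vec_join x' y'" unfolding \<phi>_def by (rule S.\<phi>_inj[OF u \<sigma> t z])
    then show "p = p'" using eq unfolding vec_sum_eq_iff[of "vec_join x y"] by (simp add: M_def p_eq)
  qed
  have canonical: "\<exists>L. (extended_map M has_derivative L) (at p within E) \<and> (\<forall>u v. symp_form (L u) (L v) = symp_form u v)"
    if E: "E = {(x, y, \<eta>, t). (x, y, \<eta>) \<in> Ddom (\<sigma> / 2) \<and> t \<ge> 0}" and p: "p \<in> E" for E p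
  proof -
    obtain x y \<eta> t where p_eq: "p = (x, y, \<eta>, t)" by (cases p)
    have t: "t \<ge> 0" and z: "max_norm (vec_join x y) < \<sigma>" using p Rs by (auto simp: E p_eq)
    obtain L c d K' where
      1: "((\<lambda>(z, t). \<phi> z t) has_derivative (\<lambda>(w, s). L w + of_real s *s c)) (at (vec_join x y, t) within UNIV \<times> {0..})" and
      2: "((\<lambda>(z, t). K z t) has_derivative (\<lambda>(w, s). d w + of_real s * K')) (at (vec_join x y, t) within UNIV \<times> {0..})" and
      L: "\<And>v w. (\<Sum>i\<in>UNIV. orientation i * (L v $ i * L w $ conjugate i)) = (\<Sum>i\<in>UNIV. orientation i * (v $ i * w $ conjugate i))" and
      c: "\<And>w. (\<Sum>i\<in>UNIV. orientation i * (c $ i * L w $ conjugate i)) = - d w"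
      using S.extended_derivative[OF u \<sigma> t z] unfolding \<phi>_def K_def by blast
    \<comment> \<open>The linear projection that forgets \<open>\<eta>\<close>. Phase image and
      energy shift depend only on what it keeps, so their derivatives are pulled back along
      it.\<close>
    define J where "J = (\<lambda>(x, y, \<eta> :: complex, t :: real). (vec_join x y :: complex ^ ('n + 'n), t))"
    have "linear J" by (rule linearI) (auto simp: J_def vec_left_linear_simps)
    then have J: "(J has_derivative J) (at p within E)"
      by (intro bounded_linear_imp_has_derivative) (simp add: linear_conv_bounded_linear)
    have sub: "J ` E \<subseteq> UNIV \<times> {0..}" by (auto simp: J_def E)
    have Jp: "J p = (vec_join x y, t)" by (simp add: J_def p_eq)
    have \<phi>J: "((\<lambda>q. case J q of (z, t) \<Rightarrow> \<phi> z t) has_derivative (\<lambda>h. case J h of (w, s) \<Rightarrow> L w + of_real s *s c)) (at p within E)"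
      by (rule has_derivative_in_compose[OF J]) (rule has_derivative_subset[OF 1[folded Jp] sub])
    have KJ: "((\<lambda>q. case J q of (z, t) \<Rightarrow> K z t) has_derivative (\<lambda>h. case J h of (w, s) \<Rightarrow> d w + of_real s * K')) (at p within E)"
      by (rule has_derivative_in_compose[OF J]) (rule has_derivative_subset[OF 2[folded Jp] sub])
    have lr: "bounded_linear (vec_left :: complex ^ ('n + 'n) \<Rightarrow> _)" "bounded_linear (vec_right :: complex ^ ('n + 'n) \<Rightarrow> _)"
      unfolding linear_conv_bounded_linear[symmetric] by (auto intro!: linearI simp: vec_left_linear_simps)
    have snd3: "((\<lambda>q. fst (snd (snd q))) has_derivative (\<lambda>h. fst (snd (snd h)))) (at p within E)"
      "((\<lambda>q. snd (snd (snd q))) has_derivative (\<lambda>h. snd (snd (snd h)))) (at p within E)"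
      by (auto intro!: derivative_eq_intros)
    define DM where "DM = (\<lambda>h. (vec_left (case J h of (w, s) \<Rightarrow> L w + of_real s *s c), vec_right (case J h of (w, s) \<Rightarrow> L w + of_real s *s c),
        fst (snd (snd h)) + (case J h of (w, s) \<Rightarrow> d w + of_real s * K'), snd (snd (snd h))))"
    have "((\<lambda>q. (vec_left (case J q of (z, t) \<Rightarrow> \<phi> z t), vec_right (case J q of (z, t) \<Rightarrow> \<phi> z t),
        fst (snd (snd q)) + (case J q of (z, t) \<Rightarrow> K z t), snd (snd (snd q)))) has_derivative DM) (at p within E)"
      unfolding DM_def
      by (intro has_derivative_Pair has_derivative_add bounded_linear.has_derivative[OF lr(1)]
          bounded_linear.has_derivative[OF lr(2)] \<phi>J KJ snd3)
    also have "(\<lambda>q. (vec_left (case J q of (z, t) \<Rightarrow> \<phi> z t), vec_right (case J q of (z, t) \<Rightarrow> \<phi> z t),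
        fst (snd (snd q)) + (case J q of (z, t) \<Rightarrow> K z t), snd (snd (snd q)))) = extended_map M"
      by (auto simp: extended_map_def M_def J_def fun_eq_iff)
    finally have "(extended_map M has_derivative DM) (at p within E)" .
    moreover have "symp_form (DM h) (DM h') = symp_form h h'" for h h'
    proof -
      obtain x1 y1 \<eta>1 t1 x2 y2 \<eta>2 t2 where h: "h = (x1, y1, \<eta>1, t1)" "h' = (x2, y2, \<eta>2, t2)" by (metis prod.exhaust)
      show ?thesis
        using symp_form_extended[of L c d "vec_join x1 y1" t1 \<eta>1 K' "vec_join x2 y2" t2 \<eta>2, OF L c] by (simp add: h DM_def J_def)
    qed
    ultimately show ?thesis by blast
  qed
  have normal: "ham_H \<Lambda> f (M t p) t = ham_h \<Lambda> p" if t: "t \<ge> 0" and p: "p \<in> Ddom (\<sigma> / 2)" for t p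
  proof (cases p)
    case (fields x y \<eta>)
    define z where "z = vec_join x y"
    have z: "max_norm z \<le> \<sigma>" using Rs[of x y \<eta>] p fields by (simp add: z_def)
    have hq: "S.hquad v = (\<Sum>l\<in>UNIV. \<Lambda> $ l * vec_left v $ l * vec_right v $ l)" for v
      by (simp add: S.hquad_def UNIV_sum_split mult_ac)
    have "max_norm (\<phi> z t) < R" using \<phi>_small[OF t z] \<sigma>(1,4) R by linarith
    then have "ev (ser t) (\<phi> z t) = f (vec_left (\<phi> z t)) (vec_right (\<phi> z t)) t" by (rule ev_ser[OF t])
    moreover have "K z t = S.hquad z - S.hquad (\<phi> z t) - ev (ser t) (\<phi> z t)"
      unfolding K_def \<phi>_def by (rule S.energy_shift_def[OF u])
    ultimately show ?thesis by (simp add: fields M_def ham_H_def ham_h_def hq z_def)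
  qed
  show ?thesis
    using \<sigma>(1) \<sigma>R(1) image analytic inj canonical normal
    by (intro exI[of _ "\<sigma> / 2"] exI[of _ "R ^ 16"] exI[of _ M] conjI) (auto simp: canonical_family_on_def Let_def)
qed

end

section \<open>The two cases\<close>

text \<open>For this weight the good modes are terms free of \<open>y\<close> in the components of
  \<open>x\<close> and terms linear in \<open>y\<close> in those of \<open>y\<close>, the shape of
  the field of a Hamiltonian linear in \<open>y\<close>.\<close>

definition y_degree :: "'n + 'n \<Rightarrow> nat" where
  "y_degree k = (case k of Inl l \<Rightarrow> 0 | Inr l \<Rightarrow> 1)"

lemma idot_y_degree: "idot y_degree m = mdeg (m \<circ> Inr)"
  by (simp add: idot_def UNIV_sum_split y_degree_def mdeg_def)

lemma nonresonant_sum: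
  fixes \<Lambda> :: "complex ^ 'n::finite" and \<alpha> :: "'n \<Rightarrow> nat"
  assumes "nonresonant \<Lambda> \<gamma> \<tau>" "mdeg \<alpha> \<ge> 2" "d = Re (idot (\<lambda>k. \<Lambda> $ k) \<alpha> - \<Lambda> $ l)"
  shows "d \<noteq> 0" "1 / \<bar>d\<bar> \<le> \<gamma> * real (mdeg \<alpha>) powr \<tau>"
proof -
  have "(\<Sum>k\<in>UNIV. axis l 1 $ k * \<Lambda> $ k) = (\<Sum>k\<in>UNIV. if k = l then \<Lambda> $ k else 0)"
    by (rule sum.cong) (auto simp: axis_def)
  then have "(\<Sum>k\<in>UNIV. (of_nat (\<alpha> k) - axis l 1 $ k) * \<Lambda> $ k) = idot (\<lambda>k. \<Lambda> $ k) \<alpha> - \<Lambda> $ l"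
    by (simp add: idot_def algebra_simps sum_subtractf)
  then show "d \<noteq> 0" "1 / \<bar>d\<bar> \<le> \<gamma> * real (mdeg \<alpha>) powr \<tau>"
    using assms(1,2) unfolding assms(3) nonresonant_def Let_def inverse_eq_divide by metis+
qed

lemma idot_frequency: "idot (frequency \<Lambda>) p = idot (\<lambda>k. \<Lambda> $ k) (p \<circ> Inl) - idot (\<lambda>k. \<Lambda> $ k) (p \<circ> Inr)"
  by (simp add: idot_def UNIV_sum_split sum_negf)

text \<open>For a component of \<open>x\<close> the divisor is literally one from the condition. For
  component \<open>l\<close> of \<open>y\<close> and index (\<alpha>, e_k) it is (\<alpha> + e_l -
  e_k) paired with \<Lambda>, again of that form, and \<alpha> + e_l has the same total degree as
  the mode.\<close>

lemma nonresonant_mode: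
  fixes \<Lambda> :: "complex ^ 'n::finite"
  assumes nr: "nonresonant \<Lambda> \<gamma> \<tau>" and p: "good_mode y_degree i p" "2 \<le> mdeg p"
  shows "Re (idot (frequency \<Lambda>) p - frequency \<Lambda> i) \<noteq> 0"
    and "1 / \<bar>Re (idot (frequency \<Lambda>) p - frequency \<Lambda> i)\<bar> \<le> \<gamma> * real (mdeg p) powr \<tau>"
proof -
  obtain \<alpha> l where "mdeg \<alpha> = mdeg p" "idot (frequency \<Lambda>) p - frequency \<Lambda> i = idot (\<lambda>k. \<Lambda> $ k) \<alpha> - \<Lambda> $ l"
  proof (cases i)
    case (Inl l)
    then have "mdeg (p \<circ> Inr) = 0" using p(1) unfolding good_mode_def idot_y_degree by (simp add: y_degree_def)
    then have "mdeg (p \<circ> Inl) = mdeg p" "p \<circ> Inr = 0" using mdeg_sum_type[of p] by simp_all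
    then show ?thesis using that[of "p \<circ> Inl" l] unfolding idot_frequency by (simp add: Inl)
  next
    case (Inr l)
    then have 1: "mdeg (p \<circ> Inr) = 1" using p(1) unfolding good_mode_def idot_y_degree by (simp add: y_degree_def)
    then obtain k where "p \<circ> Inr = unit_index k" using mdeg_eq_1_iff by blast
    moreover have "mdeg ((p \<circ> Inl) + unit_index l) = mdeg p" unfolding mdeg_add mdeg_unit using mdeg_sum_type[of p] 1 by simp
    ultimately show ?thesis using that[of "(p \<circ> Inl) + unit_index l" k] unfolding idot_frequency by (simp add: Inr idot_add)
  qed
  then show "Re (idot (frequency \<Lambda>) p - frequency \<Lambda> i) \<noteq> 0"
    "1 / \<bar>Re (idot (frequency \<Lambda>) p - frequency \<Lambda> i)\<bar> \<le> \<gamma> * real (mdeg p) powr \<tau>"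
    using nonresonant_sum[OF nr, of \<alpha> _ l] p(2) by metis+
qed

text \<open>The smaller inverse belongs to the number of larger modulus, which is at least half the
  distance of the two.\<close>

lemma min_inverse_abs_le:
  fixes u v :: real
  assumes "u \<noteq> 0" "v \<noteq> 0" "u \<noteq> v"
  shows "min (1 / \<bar>u\<bar>) (1 / \<bar>v\<bar>) \<le> 2 * (1 / \<bar>u - v\<bar>)"
proof -
  have "\<bar>u - v\<bar> \<le> 2 * max \<bar>u\<bar> \<bar>v\<bar>" by auto
  then have "1 / (2 * max \<bar>u\<bar> \<bar>v\<bar>) \<le> 1 / \<bar>u - v\<bar>" using assms by (intro divide_left_mono) auto
  then have "1 / max \<bar>u\<bar> \<bar>v\<bar> \<le> 2 * (1 / \<bar>u - v\<bar>)" by simp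
  moreover have "min (1 / \<bar>u\<bar>) (1 / \<bar>v\<bar>) \<le> 1 / max \<bar>u\<bar> \<bar>v\<bar>" by (auto simp: max_def)
  ultimately show ?thesis by (rule order_trans[rotated])
qed

lemma idot_split: "q \<le> p \<Longrightarrow> idot \<nu> p = idot \<nu> (p - q) + idot \<nu> q"
  by (subst idot_add[symmetric]) (simp add: index_diff_add)

text \<open>The difference of the divisors of \<open>(i, p)\<close> and \<open>(j, q)\<close> is the
  divisor of the good mode \<open>(i, p - q + unit_index j)\<close>, of degree
  \<open>n + 1 \<ge> 2\<close> for a gap \<open>n\<close>. Replacing \<open>n + 1\<close> by
  \<open>2 * n\<close> costs \<open>2 ^ T\<close>, and passing from the minimum of the inverses to
  the inverse of the difference costs 2.\<close>

lemma small_divisors_nonresonant: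
  fixes \<Lambda> :: "complex ^ 'n::finite"
  assumes nr: "nonresonant \<Lambda> \<gamma> \<tau>" and \<gamma>: "\<gamma> > 0"
  shows "small_divisors y_degree (\<lambda>i p. 1 / \<bar>Re (idot (frequency \<Lambda>) p - frequency \<Lambda> i)\<bar>)
    (max 1 (2 * 2 ^ nat \<lceil>\<tau>\<rceil> * \<gamma>)) (nat \<lceil>\<tau>\<rceil>)"
proof -
  define \<mu> where "\<mu> i p = Re (idot (frequency \<Lambda>) p - frequency \<Lambda> i)" for i :: "'n + 'n" and p
  define T where "T = nat \<lceil>\<tau>\<rceil>"
  define N where "N = max 1 (2 * 2 ^ T * \<gamma>)"
  have N: "2 * 2 ^ T * \<gamma> \<le> N" by (simp add: N_def)
  have bound: "\<mu> i p \<noteq> 0" "1 / \<bar>\<mu> i p\<bar> \<le> \<gamma> * real (mdeg p) ^ T"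
    if "good_mode y_degree i p" "2 \<le> mdeg p" for i p
  proof -
    show "\<mu> i p \<noteq> 0" unfolding \<mu>_def by (rule nonresonant_mode(1)[OF nr that])
    have "1 / \<bar>\<mu> i p\<bar> \<le> \<gamma> * real (mdeg p) powr \<tau>" unfolding \<mu>_def by (rule nonresonant_mode(2)[OF nr that])
    also have "\<dots> \<le> \<gamma> * real (mdeg p) powr real T"
      using that \<gamma> by (intro mult_left_mono powr_mono) (auto simp: T_def real_nat_ceiling_ge)
    also have "real (mdeg p) powr real T = real (mdeg p) ^ T" using that by (intro powr_realpow) auto
    finally show "1 / \<bar>\<mu> i p\<bar> \<le> \<gamma> * real (mdeg p) ^ T" .
  qed
  show ?thesis
    unfolding \<mu>_def[symmetric] T_def[symmetric] N_def[symmetric]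
  proof unfold_locales
    fix i :: "'n + 'n" and p assume p: "good_mode y_degree i p" "2 \<le> mdeg p"
    have "1 \<le> 2 * (2::real) ^ T" using one_le_power[of "2::real" T] by linarith
    then have "1 * \<gamma> \<le> 2 * 2 ^ T * \<gamma>" using \<gamma> by (intro mult_right_mono) auto
    then have "\<gamma> * real (mdeg p) ^ T \<le> N * real (mdeg p) ^ T" using N by (intro mult_right_mono) auto
    then show "1 / \<bar>\<mu> i p\<bar> \<le> N * real (mdeg p) ^ T" using bound(2)[OF p] by linarith
  next
    fix i j :: "'n + 'n" and p q assume p: "good_mode y_degree i p" and q: "good_mode y_degree j q" "q \<le> p" "q \<noteq> p" "2 \<le> mdeg q"
    have "mdeg (p - q) \<noteq> 0" using q index_diff_add(1)[OF q(2)] by (metis add_0_right mdeg_eq_0_iff)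
    define n where "n = mdeg p - mdeg q"
    have n: "n \<ge> 1" "mdeg (p - q) = n" using mdeg_diff[OF q(2)] \<open>mdeg (p - q) \<noteq> 0\<close> by (simp_all add: n_def)
    define m where "m = p - q + unit_index j"
    have m_deg: "mdeg m = n + 1" unfolding m_def mdeg_add mdeg_unit n(2) ..
    have "good_mode y_degree i m"
      using p q(1) idot_split[OF q(2), of y_degree] by (simp add: good_mode_def m_def idot_add)
    moreover have "2 \<le> mdeg m" using m_deg n by simp
    ultimately have m: "\<mu> i m \<noteq> 0" "1 / \<bar>\<mu> i m\<bar> \<le> \<gamma> * real (mdeg m) ^ T" by (rule bound)+
    have "\<mu> i m = \<mu> i p - \<mu> j q" by (simp add: \<mu>_def m_def idot_add idot_split[OF q(2), of "frequency \<Lambda>"])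
    moreover have "\<mu> i p \<noteq> 0" "\<mu> j q \<noteq> 0" using mdeg_mono[OF q(2)] q(4) by (intro bound p q; simp)+
    ultimately have "min (1 / \<bar>\<mu> i p\<bar>) (1 / \<bar>\<mu> j q\<bar>) \<le> 2 * (1 / \<bar>\<mu> i m\<bar>)"
      using min_inverse_abs_le[of "\<mu> i p" "\<mu> j q"] m(1) by simp
    also have "\<dots> \<le> 2 * (\<gamma> * (2 * real n) ^ T)"
    proof -
      have "real (mdeg m) ^ T \<le> (2 * real n) ^ T" using m_deg n by (intro power_mono) auto
      then have "\<gamma> * real (mdeg m) ^ T \<le> \<gamma> * (2 * real n) ^ T" using \<gamma> by (intro mult_left_mono) auto
      then show ?thesis using m(2) by linarith
    qed
    also have "\<dots> = (2 * 2 ^ T * \<gamma>) * real n ^ T" by (simp add: power_mult_distrib)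
    also have "\<dots> \<le> N * real n ^ T" using N by (intro mult_right_mono) auto
    finally show "min (1 / \<bar>\<mu> i p\<bar>) (1 / \<bar>\<mu> j q\<bar>) \<le> N * real (mdeg p - mdeg q) ^ T" by (simp add: n_def)
  qed (auto simp: N_def)
qed

theorem theorem1p1:
  fixes \<Lambda> :: "complex ^ 'n::finite"
    and f :: "complex ^ 'n \<Rightarrow> complex ^ 'n \<Rightarrow> real \<Rightarrow> complex"
    and fc :: "('n \<Rightarrow> nat) \<Rightarrow> ('n \<Rightarrow> nat) \<Rightarrow> real \<Rightarrow> complex"
    and R Mf a :: real
  assumes "0 < R" and "R \<le> 1 / 2"
    and "\<And>t. t \<ge> 0 \<Longrightarrow> (\<lambda>x y. f x y t) \<in> C_space R"
    and "\<And>t. t \<ge> 0 \<Longrightarrow> has_taylor_coeffs R (\<lambda>x y. f x y t) (\<lambda>\<alpha> \<beta>. fc \<alpha> \<beta> t)"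
    and "C1_in_time R f"
    and "QxLy fc"
    and "1 \<le> Mf" and "0 \<le> a" and "a < 1"
    and "\<And>t. t \<ge> 0 \<Longrightarrow> taylor_norm R (\<lambda>\<alpha> \<beta>. fc \<alpha> \<beta> t) \<le> ennreal (Mf * exp (- a * t))"
    and "a > 0 \<or>
         (a = 0 \<and> linear_in_y R f \<and>
          (\<exists>\<gamma> \<tau>. \<gamma> > 0 \<and> \<tau> \<ge> real CARD('n) \<and> nonresonant \<Lambda> \<gamma> \<tau>))"
  shows "\<exists>Rs R0. 0 < Rs \<and> Rs < R0 \<and> R0 \<le> R ^ 16 \<and>
           (\<exists>M. (\<forall>t\<ge>0. M t ` Ddom Rs \<subseteq> Ddom R0) \<and>
                (\<forall>t\<ge>0. analytic_map_on_D (Ddom Rs) (M t)) \<and>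
                canonical_family_on (Ddom Rs) M \<and>
                (\<forall>t\<ge>0. \<forall>p\<in>Ddom Rs. ham_H \<Lambda> f (M t p) t = ham_h \<Lambda> p))"
proof -
  interpret perturbation f fc R Mf a
    by unfold_locales (use assms in auto)
  show ?thesis
    using assms(11)
  proof (elim disjE conjE exE)
    assume a: "a > 0"
    show ?thesis
    proof (rule strong_normal_form)
      \<comment> \<open>Zero weights make every mode good, and a constant loss satisfies all bounds
        with exponent 0.\<close>
      show "small_divisors (\<lambda>_. 0) (\<lambda>_ _. 1 / a) (max 1 (1 / a)) 0"
        by unfold_locales (use a in auto)
      show "idot (\<lambda>_. 0) m = (0 :: nat)" for m :: "'n + 'n \<Rightarrow> nat" by (simp add: idot_def)
    qed (use a in auto)
  next
    fix \<gamma> \<tau> assume a: "a = 0" and lin: "linear_in_y R f" and \<gamma>: "\<gamma> > 0" and nr: "nonresonant \<Lambda> \<gamma> \<tau>"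
    show ?thesis
    proof (rule strong_normal_form[OF small_divisors_nonresonant[OF nr \<gamma>]])
      show "y_degree i + y_degree (conjugate i) = 1" for i :: "'n + 'n"
        by (cases i) (simp_all add: y_degree_def)
      \<comment> \<open>Linearity in \<open>y\<close> is the statement that the Hamiltonian has
        weight 1, the sum of the weights of a conjugate pair.\<close>
      show "idot y_degree m = 1" if "t \<ge> 0" "mcoeff (ser t) m \<noteq> 0" for t m
        unfolding idot_y_degree by (rule linear_in_y_support[OF lin that])
    qed (use nonresonant_mode(1)[OF nr] a in auto)
  qed
qed

end
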